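(* Let $E$ be a complex Banach space and let $A\in\mathcal{Q}(c^{2})$ be an operator in $E$ for some $c>0$. Let $p\in(1,\infty)$ and let $T>0$ be finite. Then for every \[ g\in L^{p}(0,T;\mathcal{D}(A^{\frac{3}{2}}))\cap W_{0}^{2,p}(0,T;\mathcal{D}(\sqrt{A})) \] the Cauchy problem \[ f''(t)+Af(t)=g(t),\qquad f(0)=f'(0)=0,\qquad\text{in } L^{p}(0,T;E), \] i.e. $(B^{2}+A)f=g$, has, in the sense of (I) and (II) below, a unique solution $f\in W^{1,p}(0,T;E)$, given by \[ f(t)=\frac{1}{2\pi i}\int_{i\mathbb{R}-c}\int_{0}^{t}(A+z^{2})^{-1}e^{z(x-t)}g(x)\,dx\,dz,\qquad t\in[0,T]. \] The sense in which $f$ is the solution is the following. Let $c'>c$ and, for $\lambda\in i\mathbb{R}-c$, $z\in i\mathbb{R}-c'$ and $h\in L^{p}(0,T;E)$, put \[ y_{\lambda,z}(h)=(i\sqrt{A}-z)^{-1}(-i\sqrt{A}-\lambda)^{-1}(B+z)^{-1}(B+\lambda)^{-1}h . \] (I) For every $g\in L^{p}(0,T;\mathcal{D}(A^{\frac{3}{2}}))\cap W_{0}^{2,p}(0,T;\mathcal{D}(\sqrt{A}))$, \[ \frac{1}{(2\pi i)^{2}}\int_{i\mathbb{R}-c'}\int_{i\mathbb{R}-c}y_{\lambda,z}\big((B^{2}+A)g\big)\,d\lambda\, dz=g . \] (II) For every $w\in W_{0}^{1,p}(0,T;\mathcal{D}(\sqrt{A}))$, \[ \frac{1}{2\pi i}\int_{i\mathbb{R}-c}(A+z^{2})^{-1}(B+z)^{-1}w\,dz=\frac{1}{(2\pi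 i)^{2}}\int_{i\mathbb{R}-c'}\int_{i\mathbb{R}-c}y_{\lambda,z}(w)\,d\lambda\, dz . \] That is, the map $h\mapsto\frac{1}{(2\pi i)^{2}}\int_{i\mathbb{R}-c'}\int_{i\mathbb{R}-c}y_{\lambda,z}(h)\,d\lambda\,dz$ inverts $B^{2}+A$ from the left in the sense of (I), and $f$ is the image of $g$ under this map, written by means of (II) as $f=\frac{1}{2\pi i}\int_{i\mathbb{R}-c}(A+z^{2})^{-1}(B+z)^{-1}g\,dz$.
   Context: The class $\mathcal{P}(0)$ consists of the closed linear operators $A$ in $E$ for which there is $K\geq1$ with $[0,\infty)\subset\rho(-A)$ (resolvent set) and $(1+z)\|(A+z)^{-1}\|\leq K$ for all $z\in[0,\infty)$. For such $A$ the fractional powers $A^{\alpha}$, $\alpha\in\mathbb{R}$, are defined in the usual way for sectorial operators; $\sqrt{A}=A^{1/2}$. For $c>0$, $\mathcal{Q}(c)$ is the class of closed linear operators $A$ in $E$ such that $A\in\mathcal{P}(0)$, \[ \Pi_{c}=\Big\{z\in\mathbb{C}\ \Big|\ \mathrm{Re}(z)\geq c-\frac{(\mathrm{Im}(z))^{2}}{4c}\Big\}\subset\rho(-A), \] and \[ \|(A+z)^{-1}\|=o(1),\qquad |z|^{\frac{1}{2}}\,\|(A+z)^{-1}A^{-\frac{1}{2}}\|=o(1)\qquad\text{in }\Pi_{c} \] (as $|z|\to\infty$, $z\in\Pi_c$). $B=\partial_{t}$ in $L^{p}(0,T;E)$ with $\mathcal{D}(B)=\{f\in W^{1,p}(0,T;E)\mid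 f(0)=0\}$; its spectrum is empty and $\big((B+\lambda)^{-1}g\big)(t)=\int_{0}^{t}e^{\lambda(x-t)}g(x)\,dx$ for all $\lambda\in\mathbb{C}$. $A$ and its fractional powers act on $E$-valued functions pointwise in $t$: $(Af)(t)=Af(t)$. For $k\in\mathbb{N}$ and $\alpha\geq0$, $W_{0}^{k,p}(0,T;\mathcal{D}(A^{\alpha}))=B^{-k}A^{-\alpha}L^{p}(0,T;E)$. The lines $i\mathbb{R}-c$ and $i\mathbb{R}-c'$ (the vertical lines $\mathrm{Re}\,z=-c$, $\mathrm{Re}\,z=-c'$) are oriented in the direction of increasing imaginary part. For $A\in\mathcal{Q}(c^{2})$ the operators $\pm i\sqrt{A}+z$ are invertible for $\mathrm{Re}(z)\leq -c$, with $(\pm i\sqrt{A}+z)^{-1}=z(A+z^{2})^{-1}\mp i\sqrt{A}(A+z^{2})^{-1}$. *)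

theory Defs
  imports "HOL-Analysis.Analysis" "HOL-Library.Function_Algebras"
begin

section \<open>Complex Banach spaces\<close>

class complex_vector = real_vector +
  fixes scaleC :: "complex \<Rightarrow> 'a \<Rightarrow> 'a"  (infixr "*\<^sub>C" 75)
  assumes scaleC_add_right: "a *\<^sub>C (x + y) = a *\<^sub>C x + a *\<^sub>C y"
    and scaleC_add_left: "(a + b) *\<^sub>C x = a *\<^sub>C x + b *\<^sub>C x"
    and scaleC_scaleC: "a *\<^sub>C b *\<^sub>C x = (a * b) *\<^sub>C x"
    and scaleC_of_real: "complex_of_real r *\<^sub>C x = r *\<^sub>R x"

class complex_banach = complex_vector + banach +
  assumes norm_scaleC: "norm (a *\<^sub>C x) = cmod a * norm x"

text \<open>Representatives of elements of \<open>L\<^sup>p(0,T;E)\<close> are functions on the real line, with the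
  pointwise vector space structure.\<close>

instantiation "fun" :: (type, real_vector) real_vector
begin
definition scaleR_fun :: "real \<Rightarrow> ('a \<Rightarrow> 'b) \<Rightarrow> 'a \<Rightarrow> 'b"
  where "scaleR_fun r f = (\<lambda>x. r *\<^sub>R f x)"
instance
  by standard (simp_all add: scaleR_fun_def fun_eq_iff scaleR_add_right scaleR_add_left)
end

instantiation "fun" :: (type, complex_vector) complex_vector
begin
definition scaleC_fun :: "complex \<Rightarrow> ('a \<Rightarrow> 'b) \<Rightarrow> 'a \<Rightarrow> 'b"
  where "scaleC_fun a f = (\<lambda>x. a *\<^sub>C f x)"
instance
  by standard (simp_all add: scaleC_fun_def scaleR_fun_def fun_eq_iff
      scaleC_add_right scaleC_add_left scaleC_scaleC scaleC_of_real)
end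


section \<open>Bochner integrals\<close>

text \<open>The Bochner integral of the library is restricted to second countable spaces. The following
  is the same definition, for functions with values in a linear subspace \<open>V\<close> with a seminorm \<open>N\<close>.
  It is used for \<open>E\<close> itself, which need not be separable, and for \<open>L\<^sup>p(0,T;E)\<close>, where \<open>V\<close> is the
  set of representatives. The value \<open>I\<close> is unique up to elements of seminorm zero. Measurability of
  the error terms is required explicitly because the nonnegative integral of the library is a lower
  integral on functions that are not measurable.\<close>

definition has_bochner_in ::
    "'v::real_vector set \<Rightarrow> ('v \<Rightarrow> real) \<Rightarrow> 'a measure \<Rightarrow> ('a \<Rightarrow> 'v) \<Rightarrow> 'v \<Rightarrow> bool" where
  "has_bochner_in V N M f I \<longleftrightarrow>
     f ` space M \<subseteq> V \<and> I \<in> V \<and>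
     (\<exists>s. (\<forall>n::nat. Bochner_Integration.simple_bochner_integrable M (s n) \<and> s n ` space M \<subseteq> V \<and>
              (\<lambda>x. N (f x - s n x)) \<in> borel_measurable M) \<and>
          (\<lambda>n. \<integral>\<^sup>+x. ennreal (N (f x - s n x)) \<partial>M) \<longlonglongrightarrow> 0 \<and>
          (\<lambda>n. N (Bochner_Integration.simple_bochner_integral M (s n) - I)) \<longlonglongrightarrow> 0)"

abbreviation has_bochner ::
    "'a measure \<Rightarrow> ('a \<Rightarrow> 'e::real_normed_vector) \<Rightarrow> 'e \<Rightarrow> bool" where
  "has_bochner \<equiv> has_bochner_in UNIV norm"

definition bochner :: "'a measure \<Rightarrow> ('a \<Rightarrow> 'e::real_normed_vector) \<Rightarrow> 'e" where
  "bochner M f = (THE I. has_bochner M f I)"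

text \<open>The integral of \<open>F\<close> along \<open>\<i>\<real> + a\<close>, upwards: the parametrization is \<open>s \<mapsto> a + \<i>s\<close>.\<close>

definition has_line_integral ::
    "'v::complex_vector set \<Rightarrow> ('v \<Rightarrow> real) \<Rightarrow> real \<Rightarrow> (complex \<Rightarrow> 'v) \<Rightarrow> 'v \<Rightarrow> bool" where
  "has_line_integral V N a F I \<longleftrightarrow>
     has_bochner_in V N lebesgue (\<lambda>s. \<i> *\<^sub>C F (Complex a s)) I"

text \<open>The iterated integral of \<open>F \<lambda> z\<close>, inner variable \<open>\<lambda>\<close> on \<open>\<i>\<real> + a\<close>, outer variable \<open>z\<close> on
  \<open>\<i>\<real> + b\<close>.\<close>

definition has_iterated_line_integral ::
    "'v::complex_vector set \<Rightarrow> ('v \<Rightarrow> real) \<Rightarrow> real \<Rightarrow> real \<Rightarrow> (complex \<Rightarrow> complex \<Rightarrow> 'v) \<Rightarrow> 'v \<Rightarrow> bool"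
  where
  "has_iterated_line_integral V N a b F I \<longleftrightarrow>
     (\<exists>G. (\<forall>z. Re z = b \<longrightarrow> has_line_integral V N a (\<lambda>l. F l z) (G z)) \<and>
          has_line_integral V N b G I)"


section \<open>Linear operators\<close>

text \<open>A linear operator is represented by its graph; its domain is \<open>Domain A\<close>, its inverse is the
  converse \<open>A\<inverse>\<close> and \<open>A O A\<close> is its square. Operators on \<open>L\<^sup>p(0,T;E)\<close> are relations
  between representatives, hence single-valued only up to null sets; therefore application uses
  \<open>SOME\<close>.\<close>

definition app :: "('a \<times> 'b) set \<Rightarrow> 'a \<Rightarrow> 'b" where
  "app G x = (SOME y. (x, y) \<in> G)"

definition graph :: "('a \<Rightarrow> 'b) \<Rightarrow> ('a \<times> 'b) set" where
  "graph R = {(x, R x) |x. True}"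

definition op_scale :: "complex \<Rightarrow> ('v::complex_vector \<times> 'v) set \<Rightarrow> ('v \<times> 'v) set" where
  "op_scale a A = {(x, a *\<^sub>C y) |x y. (x, y) \<in> A}"

definition op_shift :: "('v::complex_vector \<times> 'v) set \<Rightarrow> complex \<Rightarrow> ('v \<times> 'v) set" where
  "op_shift A z = {(x, y + z *\<^sub>C x) |x y. (x, y) \<in> A}"

definition op_plus :: "('v::complex_vector \<times> 'v) set \<Rightarrow> ('v \<times> 'v) set \<Rightarrow> ('v \<times> 'v) set" where
  "op_plus A B = {(x, y + z) |x y z. (x, y) \<in> A \<and> (x, z) \<in> B}"

definition closed_linear_operator :: "('e::complex_banach \<times> 'e) set \<Rightarrow> bool" where
  "closed_linear_operator A \<longleftrightarrow>
     (0, 0) \<in> A \<and>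
     (\<forall>x y x' y'. (x, y) \<in> A \<and> (x', y') \<in> A \<longrightarrow> (x + x', y + y') \<in> A) \<and>
     (\<forall>a x y. (x, y) \<in> A \<longrightarrow> (a *\<^sub>C x, a *\<^sub>C y) \<in> A) \<and>
     single_valued A \<and> closed A"

definition bounded_complex_linear :: "('e::complex_banach \<Rightarrow> 'e) \<Rightarrow> bool" where
  "bounded_complex_linear R \<longleftrightarrow> bounded_linear R \<and> (\<forall>a x. R (a *\<^sub>C x) = a *\<^sub>C R x)"

definition resolvent_set :: "('e::complex_banach \<times> 'e) set \<Rightarrow> complex set" where
  "resolvent_set A =
     {l. \<exists>R. bounded_complex_linear R \<and> (op_shift (op_scale (-1) A) l)\<inverse> = graph R}"

definition resolvent :: "('e::complex_banach \<times> 'e) set \<Rightarrow> complex \<Rightarrow> 'e \<Rightarrow> 'e"  \<comment> \<open>\<open>(A + z)\<^sup>-\<^sup>1\<close>\<close>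
  where "resolvent A z = app ((op_shift A z)\<inverse>)"

definition class_P0 :: "('e::complex_banach \<times> 'e) set set" where
  "class_P0 = {A. closed_linear_operator A \<and>
     (\<exists>K\<ge>1. \<forall>z\<ge>0. complex_of_real z \<in> resolvent_set (op_scale (-1) A) \<and>
        (1 + z) * onorm (resolvent A (complex_of_real z)) \<le> K)}"


section \<open>Fractional powers\<close>

text \<open>For \<open>a \<ge> 0\<close> with integer part \<open>n\<close> and fractional part \<open>b\<close>, the bounded operator \<open>A\<^sup>-\<^sup>a\<close> is
  \<open>(A\<^sup>-\<^sup>1)\<^sup>n A\<^sup>-\<^sup>b\<close>, where for \<open>0 < b < 1\<close> (Balakrishnan)
  \<open>A\<^sup>-\<^sup>b = sin (\<pi> b) / \<pi> * \<integral>\<^sub>0\<^sup>\<infinity> s\<^sup>-\<^sup>b (A + s)\<^sup>-\<^sup>1 ds\<close>. Then \<open>A\<^sup>a\<close> is the inverse of \<open>A\<^sup>-\<^sup>a\<close>.\<close>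

definition neg_power :: "('e::complex_banach \<times> 'e) set \<Rightarrow> real \<Rightarrow> 'e \<Rightarrow> 'e" where
  "neg_power A a x =
     (resolvent A 0 ^^ nat \<lfloor>a\<rfloor>)
       (if frac a = 0 then x
        else (sin (pi * frac a) / pi) *\<^sub>R
          bochner (lebesgue_on {0<..}) (\<lambda>s. s powr (- frac a) *\<^sub>R resolvent A (complex_of_real s) x))"

definition op_power :: "('e::complex_banach \<times> 'e) set \<Rightarrow> real \<Rightarrow> ('e \<times> 'e) set" where
  "op_power A a = (if a \<le> 0 then graph (neg_power A (- a)) else (graph (neg_power A a))\<inverse>)"

abbreviation op_sqrt :: "('e::complex_banach \<times> 'e) set \<Rightarrow> ('e \<times> 'e) set" where
  "op_sqrt A \<equiv> op_power A (1/2)"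

definition Pi_region :: "real \<Rightarrow> complex set" where
  "Pi_region c = {z. Re z \<ge> c - (Im z)\<^sup>2 / (4 * c)}"

definition class_Q :: "real \<Rightarrow> ('e::complex_banach \<times> 'e) set set" where
  "class_Q c = {A. A \<in> class_P0 \<and> Pi_region c \<subseteq> resolvent_set (op_scale (-1) A) \<and>
     ((\<lambda>z. onorm (resolvent A z)) \<longlongrightarrow> 0) (inf at_infinity (principal (Pi_region c))) \<and>
     ((\<lambda>z. cmod z powr (1/2) * onorm (\<lambda>x. resolvent A z (app (op_power A (-1/2)) x))) \<longlongrightarrow> 0)
       (inf at_infinity (principal (Pi_region c)))}"


section \<open>Lebesgue and Sobolev spaces of vector-valued functions on \<open>(0,T)\<close>\<close>

definition strongly_measurable :: "'a measure \<Rightarrow> ('a \<Rightarrow> 'e::real_normed_vector) \<Rightarrow> bool" where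
  "strongly_measurable M f \<longleftrightarrow>
     (\<exists>s. (\<forall>n::nat. simple_function M (s n)) \<and> (AE x in M. (\<lambda>n. s n x) \<longlonglongrightarrow> f x))"

abbreviation interval :: "real \<Rightarrow> real measure" where
  "interval T \<equiv> lebesgue_on {0<..<T}"

definition Lp :: "real \<Rightarrow> real \<Rightarrow> (real \<Rightarrow> 'e::complex_banach) set" where
  "Lp p T = {f. strongly_measurable (interval T) f \<and>
     integrable (interval T) (\<lambda>t. norm (f t) powr p)}"

definition Lp_norm :: "real \<Rightarrow> real \<Rightarrow> (real \<Rightarrow> 'e::complex_banach) \<Rightarrow> real" where
  "Lp_norm p T f = (LINT t|interval T. norm (f t) powr p) powr (1/p)"

text \<open>The operator in \<open>L\<^sup>p(0,T;E)\<close> that acts as \<open>G\<close> pointwise in \<open>t\<close>, with maximal domain.\<close>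

definition pointwise ::
    "real \<Rightarrow> real \<Rightarrow> ('e::complex_banach \<times> 'e) set \<Rightarrow> ((real \<Rightarrow> 'e) \<times> (real \<Rightarrow> 'e)) set" where
  "pointwise p T G = {(f, h). f \<in> Lp p T \<and> h \<in> Lp p T \<and> (AE t in interval T. (f t, h t) \<in> G)}"

text \<open>\<open>L\<^sup>p(0,T;\<D>(A\<^sup>a))\<close>: a function is in it iff it and its image under \<open>A\<^sup>a\<close> are in
  \<open>L\<^sup>p(0,T;E)\<close>, since \<open>\<D>(A\<^sup>a)\<close> carries the graph norm.\<close>

definition Lp_dom :: "real \<Rightarrow> real \<Rightarrow> ('e::complex_banach \<times> 'e) set \<Rightarrow> real \<Rightarrow> (real \<Rightarrow> 'e) set" where
  "Lp_dom p T A a = Domain (pointwise p T (op_power A a))"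

text \<open>Weak derivatives, with continuously differentiable test functions of compact support.\<close>

definition has_weak_derivative ::
    "real \<Rightarrow> (real \<Rightarrow> 'e::complex_banach) \<Rightarrow> (real \<Rightarrow> 'e) \<Rightarrow> bool" where
  "has_weak_derivative T f f' \<longleftrightarrow>
     (\<forall>\<phi> \<phi>' K. (\<forall>t. (\<phi> has_real_derivative \<phi>' t) (at t)) \<and> continuous_on UNIV \<phi>' \<and>
        compact K \<and> K \<subseteq> {0<..<T} \<and> (\<forall>t. t \<notin> K \<longrightarrow> \<phi> t = 0) \<longrightarrow>
        bochner (interval T) (\<lambda>t. \<phi>' t *\<^sub>R f t) = - bochner (interval T) (\<lambda>t. \<phi> t *\<^sub>R f' t))"

definition W1p :: "real \<Rightarrow> real \<Rightarrow> (real \<Rightarrow> 'e::complex_banach) set" where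
  "W1p p T = {f \<in> Lp p T. \<exists>f'\<in>Lp p T. has_weak_derivative T f f'}"

text \<open>The operator \<open>B = \<partial>\<^sub>t\<close>. The condition \<open>f(0) = 0\<close> refers to the continuous representative \<open>u\<close>.\<close>

definition B_op :: "real \<Rightarrow> real \<Rightarrow> ((real \<Rightarrow> 'e::complex_banach) \<times> (real \<Rightarrow> 'e)) set" where
  "B_op p T = {(f, f'). f \<in> Lp p T \<and> f' \<in> Lp p T \<and> has_weak_derivative T f f' \<and>
     (\<exists>u. continuous_on {0..T} u \<and> u 0 = 0 \<and> (AE t in interval T. f t = u t))}"

text \<open>\<open>W\<^sub>0\<^sup>k\<^sup>,\<^sup>p(0,T;\<D>(A\<^sup>a)) = B\<^sup>-\<^sup>k A\<^sup>-\<^sup>a L\<^sup>p(0,T;E)\<close>\<close>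

definition W0 :: "nat \<Rightarrow> real \<Rightarrow> real \<Rightarrow> ('e::complex_banach \<times> 'e) set \<Rightarrow> real \<Rightarrow> (real \<Rightarrow> 'e) set" where
  "W0 k p T A a = ((B_op p T)\<inverse> ^^ k) `` (pointwise p T (op_power A (- a)) `` Lp p T)"

abbreviation Lp_line_integral where
  "Lp_line_integral p T \<equiv> has_line_integral (Lp p T) (Lp_norm p T)"

abbreviation Lp_iterated_line_integral where
  "Lp_iterated_line_integral p T \<equiv> has_iterated_line_integral (Lp p T) (Lp_norm p T)"


section \<open>The Cauchy problem\<close>

definition B2_plus_A ::
    "real \<Rightarrow> real \<Rightarrow> ('e::complex_banach \<times> 'e) set \<Rightarrow> ((real \<Rightarrow> 'e) \<times> (real \<Rightarrow> 'e)) set" where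
  "B2_plus_A p T A = op_plus (B_op p T O B_op p T) (pointwise p T A)"

definition y_op ::
    "real \<Rightarrow> real \<Rightarrow> ('e::complex_banach \<times> 'e) set \<Rightarrow> (real \<Rightarrow> 'e) \<Rightarrow> complex \<Rightarrow> complex \<Rightarrow> real \<Rightarrow> 'e" where
  "y_op p T A h l z =
     app (pointwise p T ((op_shift (op_scale \<i> (op_sqrt A)) (- z))\<inverse>))
      (app (pointwise p T ((op_shift (op_scale (- \<i>) (op_sqrt A)) (- l))\<inverse>))
       (app ((op_shift (B_op p T) z)\<inverse>)
        (app ((op_shift (B_op p T) l)\<inverse>) h)))"

text \<open>The integrand \<open>(A + z\<^sup>2)\<^sup>-\<^sup>1 (B + z)\<^sup>-\<^sup>1 w\<close> in \<open>L\<^sup>p(0,T;E)\<close>.\<close>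

definition x_op ::
    "real \<Rightarrow> real \<Rightarrow> ('e::complex_banach \<times> 'e) set \<Rightarrow> (real \<Rightarrow> 'e) \<Rightarrow> complex \<Rightarrow> real \<Rightarrow> 'e" where
  "x_op p T A w z =
     app (pointwise p T ((op_shift A (z\<^sup>2))\<inverse>)) (app ((op_shift (B_op p T) z)\<inverse>) w)"

text \<open>\<open>f(t)\<close> is given, for all \<open>t \<in> [0,T]\<close>, by the integral formula; the inner integral is \<open>H t z\<close>,
  the outer one \<open>J\<close>, and both converge as Bochner integrals in \<open>E\<close>.\<close>

definition given_by_formula ::
    "real \<Rightarrow> real \<Rightarrow> ('e::complex_banach \<times> 'e) set \<Rightarrow> (real \<Rightarrow> 'e) \<Rightarrow> (real \<Rightarrow> 'e) \<Rightarrow> bool" where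
  "given_by_formula c T A g f \<longleftrightarrow>
     (\<forall>t\<in>{0..T}. \<exists>H J.
        (\<forall>z. Re z = - c \<longrightarrow>
           has_bochner (lebesgue_on {0..t})
             (\<lambda>x. resolvent A (z\<^sup>2) (exp (z * complex_of_real (x - t)) *\<^sub>C g x)) (H z)) \<and>
        has_line_integral UNIV norm (- c) H J \<and>
        f t = (1 / (2 * pi * \<i>)) *\<^sub>C J)"

end

theory Submission
  imports Defs "HOL-Real_Asymp.Real_Asymp"
begin

text \<open>Factor \<open>B\<^sup>2 + A = (B + \<i>\<surd>A)(B - \<i>\<surd>A)\<close>. The functional calculus of Dore and Venni type inverts each factor
  by \<open>h \<mapsto> (1 / 2\<pi>\<i>) \<integral> (\<sigma>\<i>\<surd>A - l)\<^sup>-\<^sup>1 (B + l)\<^sup>-\<^sup>1 h dl\<close>. The resolvents of \<open>\<plusminus>\<i>\<surd>A\<close> are only \<open>O(1 + |l|)\<close> on the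
  half plane \<open>Re l \<le> - c\<close>, hence the extra regularity of the data. For (I), the identity
  \<open>(\<sigma>\<i>\<surd>A - l)\<^sup>-\<^sup>1 (B + l)\<^sup>-\<^sup>1 (B + \<sigma>\<i>\<surd>A) u = (\<sigma>\<i>\<surd>A - l)\<^sup>-\<^sup>1 u + (B + l)\<^sup>-\<^sup>1 u\<close> leaves two terms whose sum
  is integrable on the line: up to \<open>u / l\<close>, the first has no singularity on the left of it and the
  second none on the right, so the integral is \<open>2\<pi>\<i> u\<close>. For (II), the resolvent identities turn \<open>y\<^sub>l\<^sub>,\<^sub>z\<close> into
  sums of functions of one operator with the kernel \<open>1 / (z\<^sup>2 - l\<^sup>2)\<close>. Those with \<open>(B + l)\<^sup>-\<^sup>1\<close> vanish on
  integrating in \<open>z\<close> first, the others are evaluated by integrating in \<open>l\<close>.\<close>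

section \<open>Integrals of dominated functions\<close>

text \<open>Two choices shape the proof. E need not be separable, so the Bochner integrals of the
  statement are traded for Henstock-Kurzweil integrals, whose values are unique; Bochner
  integrability returns only where the statement asks for it. And computations use bounded
  operators: sqrt A enters through its inverse \<open>U\<close>, and B through the continuous
  solution \<open>vol z g\<close> of a Volterra equation, so that identities hold at every t and
  null sets matter only at both ends of the proof. Data in the domain read g = A^(-1/2) B^(-2) v =
  A^(-3/2) k with v and k in L^p. The obstacle in (I) is that k in L^p gives no bound at a fixed t.
  Uniqueness comes from (I): its iterated integral depends on (B^2 + A) u only, hence two solutions
  in the domain coincide, and (II) identifies their common value with f.\<close>

lemma scaleC_one: "1 *\<^sub>C (x::'a::complex_vector) = x"
  using scaleC_of_real[of 1 x] by simp

lemma bounded_bilinear_scaleC: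
  "bounded_bilinear (scaleC :: complex \<Rightarrow> 'e \<Rightarrow> 'e::complex_banach)"
proof
  fix a b :: complex and x y :: 'e and r :: real
  show "(a + b) *\<^sub>C x = a *\<^sub>C x + b *\<^sub>C x" by (rule scaleC_add_left)
  show "a *\<^sub>C (x + y) = a *\<^sub>C x + a *\<^sub>C y" by (rule scaleC_add_right)
  show "(r *\<^sub>R a) *\<^sub>C x = r *\<^sub>R (a *\<^sub>C x)"
    by (simp add: scaleR_conv_of_real scaleC_scaleC scaleC_of_real[symmetric])
  show "a *\<^sub>C (r *\<^sub>R x) = r *\<^sub>R (a *\<^sub>C x)"
    by (simp add: scaleC_scaleC scaleC_of_real[symmetric] mult.commute)
  show "\<exists>K. \<forall>(a::complex) (x::'e). norm (a *\<^sub>C x) \<le> norm a * norm x * K"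
    by (rule exI[of _ 1]) (simp add: norm_scaleC)
qed

interpretation scaleC: bounded_bilinear "scaleC :: complex \<Rightarrow> 'e \<Rightarrow> 'e::complex_banach"
  by (rule bounded_bilinear_scaleC)

declare scaleC.zero_left [simp] scaleC.zero_right [simp]

lemmas continuous_on_scaleC [continuous_intros] = scaleC.continuous_on

lemma continuous_on_section1:
  assumes "continuous_on (A \<times> B) (\<lambda>(x, y). f x y)" "y \<in> B" shows "continuous_on A (\<lambda>x. f x y)"
proof -
  have "continuous_on A (\<lambda>x. (\<lambda>(x, y). f x y) (x, y))"
    by (rule continuous_on_compose2[OF assms(1)]) (use assms(2) in \<open>auto intro!: continuous_intros\<close>)
  thus ?thesis by simp
qed

lemma continuous_on_swap_pair:
  assumes "continuous_on (A \<times> B) (\<lambda>(x, y). f x y)" shows "continuous_on (B \<times> A) (\<lambda>(y, x). f x y)"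
proof -
  have "continuous_on (B \<times> A) (\<lambda>z. (\<lambda>(x, y). f x y) (snd z, fst z))"
    by (rule continuous_on_compose2[OF assms]) (auto intro!: continuous_intros)
  thus ?thesis by (simp add: split_def)
qed

lemmas continuous_on_section2 = continuous_on_section1[OF continuous_on_swap_pair]

lemma continuous_dominated_integrable:
  fixes f :: "real \<Rightarrow> 'b::banach"
  assumes "continuous_on UNIV f" "\<And>x. norm (f x) \<le> h x" "h integrable_on UNIV"
  shows "f integrable_on UNIV"
proof (rule integrable_on_all_intervals_integrable_bound[OF _ _ assms(3)])
  show "(\<lambda>x. if x \<in> UNIV then f x else 0) integrable_on cbox a b" for a b
    using integrable_continuous_real[OF continuous_on_subset[OF assms(1)], of a b] by simp
qed (rule assms(2))

text \<open>Reduced to the scalar theorem: the real functions \<open>norm (f n x - g x)\<close> are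
  dominated by \<open>2 * h\<close> and tend to 0, and their integrals bound the difference of the
  vector integrals.\<close>

lemma dominated_convergence_continuous:
  fixes f :: "nat \<Rightarrow> real \<Rightarrow> 'b::banach"
  assumes cf: "\<And>n. continuous_on UNIV (f n)" and cg: "continuous_on UNIV g"
    and h: "h integrable_on UNIV" and le: "\<And>n x. norm (f n x) \<le> h x"
    and conv: "\<And>x. (\<lambda>n. f n x) \<longlonglongrightarrow> g x"
  shows "(\<lambda>n. integral UNIV (f n)) \<longlonglongrightarrow> integral UNIV g"
proof -
  have leg: "norm (g x) \<le> h x" for x
    using tendsto_norm[OF conv] by (rule LIMSEQ_le_const2) (use le in blast)
  have fi: "f n integrable_on UNIV" for n
    by (rule continuous_dominated_integrable[OF cf le h])
  have gi: "g integrable_on UNIV"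
    by (rule continuous_dominated_integrable[OF cg leg h])
  have h2: "(\<lambda>x. 2 * h x) integrable_on UNIV"
    using integrable_on_cmult_left[OF h, of 2] by simp
  have le2: "norm (norm (f n x - g x)) \<le> 2 * h x" for n x
    using norm_triangle_ineq4[of "f n x" "g x"] le[of n x] leg[of x] by simp
  have di: "(\<lambda>x. norm (f n x - g x)) integrable_on UNIV" for n
    by (rule continuous_dominated_integrable[OF _ le2 h2]) (intro continuous_intros cf cg)
  have c0: "(\<lambda>n. norm (f n x - g x)) \<longlonglongrightarrow> (\<lambda>x. 0) x" for x
    using conv[of x] by (simp add: LIM_zero tendsto_norm_zero)
  have "(\<lambda>n. integral UNIV (\<lambda>x. norm (f n x - g x))) \<longlonglongrightarrow> integral UNIV (\<lambda>x::real. 0::real)"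
    by (rule dominated_convergence(2)[OF di h2]) (use le2 c0 in auto)
  hence l0: "(\<lambda>n. integral UNIV (\<lambda>x. norm (f n x - g x))) \<longlonglongrightarrow> 0" by simp
  have bd: "norm (integral UNIV (f n) - integral UNIV g) \<le> integral UNIV (\<lambda>x. norm (f n x - g x))" for n
  proof -
    have "integral UNIV (f n) - integral UNIV g = integral UNIV (\<lambda>x. f n x - g x)"
      by (rule integral_diff[symmetric]) (rule fi gi)+
    thus ?thesis
      by (auto intro!: integral_norm_bound_integral integrable_diff fi gi di)
  qed
  have "(\<lambda>n. integral UNIV (f n) - integral UNIV g) \<longlonglongrightarrow> 0"
    by (rule Lim_null_comparison[OF always_eventually[OF allI[OF bd]] l0])
  thus ?thesis by (simp add: LIM_zero_iff)
qed

text \<open>Replaces an integral over the line by a sequential limit over \<open>{- n..n}\<close>,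
  where the fundamental theorem, substitutions and Fubini on compact rectangles are at hand. Limits
  computed in this way identify values only; integrability is always shown separately.\<close>

lemma integral_symmetric_limit:
  fixes f :: "real \<Rightarrow> 'b::banach"
  assumes "f integrable_on UNIV"
  shows "(\<lambda>n. integral {- real n..real n} f) \<longlonglongrightarrow> integral UNIV f"
proof (rule LIMSEQ_I)
  fix e :: real assume "e > 0"
  have "(f has_integral integral UNIV f) UNIV" using assms by blast
  then obtain B where "B > 0" and B: "\<And>a b. ball 0 B \<subseteq> cbox a b \<Longrightarrow> norm (integral (cbox a b) f - integral UNIV f) < e"
    unfolding has_integral_alt'[of f _ UNIV] using \<open>e > 0\<close> by auto
  obtain N :: nat where N: "B \<le> real N" using real_arch_simple by blast
  show "\<exists>no. \<forall>n\<ge>no. norm (integral {- real n..real n} f - integral UNIV f) < e"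
  proof (intro exI allI impI)
    fix n assume "n \<ge> N"
    have "ball 0 B \<subseteq> cbox (- real n) (real n)"
    proof
      fix x :: real assume "x \<in> ball 0 B"
      hence "\<bar>x\<bar> < B" by (simp add: dist_real_def)
      moreover have "B \<le> real n" using N \<open>n \<ge> N\<close> by linarith
      ultimately show "x \<in> cbox (- real n) (real n)" by auto
    qed
    from B[OF this] show "norm (integral {- real n..real n} f - integral UNIV f) < e" by simp
  qed
qed

lemma integral_tail_bound:
  fixes f :: "real \<Rightarrow> 'b::banach"
  assumes f: "continuous_on UNIV f" and le: "\<And>x. norm (f x) \<le> h x" and h: "h integrable_on UNIV"
  shows "norm (integral UNIV f - integral {a..b} f) \<le> integral UNIV h - integral {a..b} h"
proof -
  have fi: "f integrable_on UNIV" by (rule continuous_dominated_integrable[OF f le h])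
  have "f integrable_on {a..b}" "h integrable_on {a..b}"
    using fi h integrable_on_subinterval by blast+
  hence f1: "((\<lambda>x. if x \<in> {a..b} then f x else 0) has_integral integral {a..b} f) UNIV"
    and h1: "((\<lambda>x. if x \<in> {a..b} then h x else 0) has_integral integral {a..b} h) UNIV"
    by (simp_all only: has_integral_restrict_UNIV integrable_integral)
  have A: "((\<lambda>x. f x - (if x \<in> {a..b} then f x else 0)) has_integral (integral UNIV f - integral {a..b} f)) UNIV"
    by (rule has_integral_diff[OF integrable_integral[OF fi] f1])
  have B: "((\<lambda>x. h x - (if x \<in> {a..b} then h x else 0)) has_integral (integral UNIV h - integral {a..b} h)) UNIV"
    by (rule has_integral_diff[OF integrable_integral[OF h] h1])
  have "norm (integral UNIV (\<lambda>x. f x - (if x \<in> {a..b} then f x else 0)))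
     \<le> integral UNIV (\<lambda>x. h x - (if x \<in> {a..b} then h x else 0))"
    by (rule integral_norm_bound_integral) (use A B le in \<open>auto simp: integrable_on_def\<close>)
  thus ?thesis using A B by (simp only: integral_unique)
qed

text \<open>The majorant is asked for only near each parameter, because the peaks of
  \<open>kap3 r\<close>, used later, move with \<open>r\<close>.\<close>

lemma continuous_on_integral_dominated:
  fixes f :: "'p::metric_space \<Rightarrow> real \<Rightarrow> 'b::banach"
  assumes cont: "continuous_on (P \<times> UNIV) (\<lambda>(p, s). f p s)"
    and loc: "\<And>p. p \<in> P \<Longrightarrow> \<exists>h e. e > 0 \<and> h integrable_on UNIV \<and> (\<forall>q\<in>P. dist q p < e \<longrightarrow> (\<forall>s. norm (f q s) \<le> h s))"
  shows "continuous_on P (\<lambda>p. integral UNIV (f p))"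
proof (rule continuous_on_sequentiallyI)
  fix u a assume u: "\<forall>n. u n \<in> P" and a: "a \<in> P" and ua: "u \<longlonglongrightarrow> a"
  obtain h e where e: "e > 0" and h: "h integrable_on UNIV" and
    le: "\<And>q s. q \<in> P \<Longrightarrow> dist q a < e \<Longrightarrow> norm (f q s) \<le> h s"
    using loc[OF a] by blast
  obtain N where N: "\<And>n. n \<ge> N \<Longrightarrow> dist (u n) a < e"
    using ua e unfolding lim_sequentially by blast
  have c: "continuous_on UNIV (f p)" if "p \<in> P" for p
  by (rule continuous_on_section2[OF cont that])
  have "(\<lambda>n. integral UNIV (f (u (n + N)))) \<longlonglongrightarrow> integral UNIV (f a)"
  proof (rule dominated_convergence_continuous[OF _ _ h])
    show "continuous_on UNIV (f (u (n + N)))" for n using c u by blast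
    show "continuous_on UNIV (f a)" using c a by blast
    show "norm (f (u (n + N)) x) \<le> h x" for n x using le u N by simp
    fix x
    have "(\<lambda>n. f (u n) x) \<longlonglongrightarrow> f a x"
      using continuous_on_tendsto_compose[OF cont tendsto_Pair[OF ua tendsto_const[of x]]] u a
      by auto
    thus "(\<lambda>n. f (u (n + N)) x) \<longlonglongrightarrow> f a x" by (rule LIMSEQ_ignore_initial_segment)
  qed
  thus "(\<lambda>n. integral UNIV (f (u n))) \<longlonglongrightarrow> integral UNIV (f a)" by (rule LIMSEQ_offset)
qed

text \<open>Fubini on \<open>{a..b} \<times> {- n..n}\<close> for continuous functions, then n to
  infinity. The tail of \<open>h\<close> bounds the error uniformly in \<open>x\<close>.\<close>

lemma integral_swap_dominated:
  fixes f :: "real \<Rightarrow> real \<Rightarrow> 'b::banach"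
  assumes cont: "continuous_on ({a..b} \<times> UNIV) (\<lambda>(x, s). f x s)"
    and le: "\<And>x s. x \<in> {a..b} \<Longrightarrow> norm (f x s) \<le> h s" and h: "h integrable_on UNIV"
    and s: "(\<lambda>s. integral {a..b} (\<lambda>x. f x s)) integrable_on UNIV"
  shows "integral {a..b} (\<lambda>x. integral UNIV (f x)) = integral UNIV (\<lambda>s. integral {a..b} (\<lambda>x. f x s))"
proof -
  have c: "continuous_on UNIV (f x)" if "x \<in> {a..b}" for x
  by (rule continuous_on_section2[OF cont that])
  have cU: "continuous_on {a..b} (\<lambda>x. integral UNIV (f x))"
  proof (rule continuous_on_integral_dominated[OF cont], intro exI conjI ballI impI allI)
    show "(1::real) > 0" by simp
    show "h integrable_on UNIV" by (rule h)
    show "norm (f q s) \<le> h s" if "q \<in> {a..b}" for q s using le that .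
  qed
  have cn: "continuous_on {a..b} (\<lambda>x. integral {- real n..real n} (f x))" for n
  proof -
    have "continuous_on {a..b} (\<lambda>x. integral (cbox (- real n) (real n)) (f x))"
      by (rule integral_continuous_on_param) (auto intro: continuous_on_subset[OF cont])
    thus ?thesis by simp
  qed
  have sw: "integral {a..b} (\<lambda>x. integral {- real n..real n} (f x)) = integral {- real n..real n} (\<lambda>s. integral {a..b} (\<lambda>x. f x s))" for n
    using integral_swap_continuous[of a "- real n" b "real n" f]
    by (auto intro: continuous_on_subset[OF cont] simp: cbox_Pair_eq)
  let ?\<tau> = "\<lambda>n. integral UNIV h - integral {- real n..real n} h"
  have bd: "norm (integral {a..b} (\<lambda>x. integral UNIV (f x)) - integral {a..b} (\<lambda>x. integral {- real n..real n} (f x)))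
      \<le> integral {a..b} (\<lambda>x. ?\<tau> n)" for n
  proof -
    have "integral {a..b} (\<lambda>x. integral UNIV (f x)) - integral {a..b} (\<lambda>x. integral {- real n..real n} (f x))
       = integral {a..b} (\<lambda>x. integral UNIV (f x) - integral {- real n..real n} (f x))"
      by (rule integral_diff[symmetric]) (auto intro!: integrable_continuous_real cU cn)
    also have "norm \<dots> \<le> integral {a..b} (\<lambda>x. ?\<tau> n)"
      by (rule integral_norm_bound_integral)
         (auto intro!: integrable_continuous_real cU cn continuous_intros integral_tail_bound c le h)
    finally show ?thesis .
  qed
  have l0: "(\<lambda>n. integral {a..b} (\<lambda>x. ?\<tau> n)) \<longlonglongrightarrow> 0"
  proof -
    have "?\<tau> \<longlonglongrightarrow> 0" using tendsto_diff[OF tendsto_const integral_symmetric_limit[OF h], of "integral UNIV h"] by simp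
    from tendsto_mult_right_zero[OF this, of "measure lborel {a..b}"] show ?thesis by (simp add: mult.commute)
  qed
  have "(\<lambda>n. integral {a..b} (\<lambda>x. integral UNIV (f x)) - integral {a..b} (\<lambda>x. integral {- real n..real n} (f x))) \<longlonglongrightarrow> 0"
    by (rule Lim_null_comparison[OF always_eventually[OF allI[OF bd]] l0])
  from tendsto_diff[OF tendsto_const this, of "integral {a..b} (\<lambda>x. integral UNIV (f x))"]
  have "(\<lambda>n. integral {- real n..real n} (\<lambda>s. integral {a..b} (\<lambda>x. f x s))) \<longlonglongrightarrow> integral {a..b} (\<lambda>x. integral UNIV (f x))"
    by (simp add: sw)
  from LIMSEQ_unique[OF this integral_symmetric_limit[OF s]] show ?thesis .
qed

text \<open>The standard majorant on a vertical line. The exponent is written so that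
  \<open>e\<close> is the surplus over the borderline of integrability.\<close>

definition kap :: "real \<Rightarrow> real \<Rightarrow> real" where "kap e s = (1 + \<bar>s\<bar>) powr (- e - 1)"

lemma kap_continuous [continuous_intros]: "continuous_on S (kap e)"
proof -
  have "continuous_on S (\<lambda>s. (1 + \<bar>s\<bar>) powr (- e - 1))"
    by (rule continuous_on_powr) (auto intro!: continuous_on_add continuous_on_rabs continuous_on_const continuous_on_id)
  thus ?thesis by (simp add: kap_def[abs_def])
qed

lemma kap_nonneg [simp]: "0 \<le> kap e s" by (simp add: kap_def)

lemma kap_integrable:
  assumes "e > 0" shows "kap e integrable_on UNIV"
proof -
  have R: "(kap e has_integral (1 - (1 + real n) powr (- e)) / e) {0..real n}" for n
  proof -
    have "((\<lambda>s. (1 + s) powr (- e - 1)) has_integral (- ((1 + real n) powr (- e) / e) - - ((1 + 0) powr (- e) / e))) {0..real n}"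
      by (rule fundamental_theorem_of_calculus)
         (use assms in \<open>auto intro!: derivative_eq_intros simp flip: has_real_derivative_iff_has_vector_derivative
          simp: field_simps\<close>)
    hence "(kap e has_integral (- ((1 + real n) powr (- e) / e) - - ((1 + 0) powr (- e) / e))) {0..real n}"
      by (rule has_integral_eq[rotated]) (simp add: kap_def)
    thus ?thesis by (simp add: diff_divide_distrib add.commute)
  qed
  have L: "(kap e has_integral (1 - (1 + real n) powr (- e)) / e) {- real n..0}" for n
    using has_integral_reflect_real[where f="kap e" and a=0 and b="real n"] R[of n] by (simp add: kap_def[abs_def])
  have I: "(kap e has_integral 2 * (1 - (1 + real n) powr (- e)) / e) {- real n..real n}" for n
    using has_integral_combine[OF _ _ L R, of n n] by (simp add: add_divide_distrib)
  let ?f = "\<lambda>n x. if x \<in> {- real n..real n} then kap e x else 0"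
  have If: "(?f n has_integral 2 * (1 - (1 + real n) powr (- e)) / e) UNIV" for n
    using I[of n] by (simp only: has_integral_restrict_UNIV)
  have "kap e integrable_on UNIV \<and> (\<lambda>k. integral UNIV (?f k)) \<longlonglongrightarrow> integral UNIV (kap e)"
  proof (rule monotone_convergence_increasing)
    show "?f n integrable_on UNIV" for n using If by blast
    show "?f n x \<le> ?f (Suc n) x" for n x by (simp add: kap_nonneg)
    show "(\<lambda>k. ?f k x) \<longlonglongrightarrow> kap e x" for x
    proof (rule tendsto_eventually)
      obtain N :: nat where "\<bar>x\<bar> \<le> real N" using real_arch_simple by blast
      hence "\<forall>k\<ge>N. ?f k x = kap e x" by (smt (verit) atLeastAtMost_iff of_nat_mono)
      thus "\<forall>\<^sub>F k in sequentially. ?f k x = kap e x" unfolding eventually_sequentially by blast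
    qed
    show "bounded (range (\<lambda>k. integral UNIV (?f k)))"
    proof (rule boundedI[of _ "2 / e"])
      fix y assume "y \<in> range (\<lambda>k. integral UNIV (?f k))"
      then obtain k where y: "y = 2 * (1 - (1 + real k) powr (- e)) / e" using integral_unique[OF If] by auto
      have "(1 + real k) powr (- e) \<le> 1" using assms by (simp add: powr_minus inverse_le_1_iff ge_one_powr_ge_zero)
      moreover have "(1 + real k) powr (- e) \<ge> 0" by simp
      ultimately show "norm y \<le> 2 / e" unfolding y using assms by (simp add: divide_right_mono abs_of_nonneg)
    qed
  qed
  thus ?thesis by blast
qed

lemma integrable_on_shift_UNIV:
  fixes f :: "real \<Rightarrow> 'b::banach"
  assumes "(f has_integral I) UNIV"
  shows "((\<lambda>x. f (x + c)) has_integral I) UNIV"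
proof (subst has_integral_alt', intro conjI allI impI)
  have sh: "integral {a..b} (\<lambda>x. f (x + c)) = integral {a+c..b+c} f" for a b :: real
    using integral_shift_cbox_plus[of a b f c] by (simp add: o_def add.commute)
  have int: "f integrable_on {a..b}" for a b :: real
    using assms by (meson has_integral_integrable integrable_on_subinterval subset_UNIV)
  show "(\<lambda>x. if x \<in> UNIV then f (x + c) else 0) integrable_on cbox a b" for a b :: real
    using int[of "a+c" "b+c"] integrable_on_shift_cbox[of f c a b] by (simp add: o_def add.commute)
  fix e :: real assume "e > 0"
  then obtain B where "B > 0" and B: "\<And>a b. ball 0 B \<subseteq> cbox a b \<Longrightarrow> norm (integral (cbox a b) f - I) < e"
    using assms unfolding has_integral_alt'[of f _ UNIV] by auto
  show "\<exists>B>0. \<forall>a b. ball 0 B \<subseteq> cbox a b \<longrightarrow>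
      norm (integral (cbox a b) (\<lambda>x. if x \<in> UNIV then f (x + c) else 0) - I) < e"
  proof (intro exI[of _ "B + \<bar>c\<bar>"] conjI allI impI)
    show "B + \<bar>c\<bar> > 0" using \<open>B > 0\<close> by simp
    fix a b :: real assume sub: "ball 0 (B + \<bar>c\<bar>) \<subseteq> cbox a b"
    have "ball 0 B \<subseteq> cbox (a + c) (b + c)"
    proof
      fix x :: real assume "x \<in> ball 0 B"
      hence "x - c \<in> ball 0 (B + \<bar>c\<bar>)" by (auto simp: dist_real_def)
      hence "x - c \<in> cbox a b" using sub by blast
      thus "x \<in> cbox (a + c) (b + c)" by auto
    qed
    from B[OF this] show "norm (integral (cbox a b) (\<lambda>x. if x \<in> UNIV then f (x + c) else 0) - I) < e"
      by (simp add: sh)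
  qed
qed

section \<open>Bochner and Henstock-Kurzweil integrals\<close>

lemma simple_bochner_has_integral:
  fixes s :: "real \<Rightarrow> 'b::banach"
  assumes S: "S \<in> sets lebesgue" and s: "Bochner_Integration.simple_bochner_integrable (lebesgue_on S) s"
  shows "(s has_integral Bochner_Integration.simple_bochner_integral (lebesgue_on S) s) S"
proof -
  let ?M = "lebesgue_on S"
  define Z where "Z y = {x \<in> S. s x = y}" for y
  from s have sf: "simple_function ?M s" and fin: "emeasure ?M {y \<in> space ?M. s y \<noteq> 0} \<noteq> \<infinity>"
    by (simp_all add: simple_bochner_integrable.simps)
  have fint: "finite (s ` S)" using simple_functionD(1)[OF sf] by simp
  have Zeq: "Z y = s -` {y} \<inter> space ?M" for y by (auto simp: Z_def)
  have Zm: "Z y \<in> sets ?M" for y unfolding Zeq by (rule simple_functionD(2)[OF sf])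
  have nz: "{y \<in> space ?M. s y \<noteq> 0} \<in> sets ?M"
  proof -
    have "{y \<in> space ?M. s y \<noteq> 0} = s -` (- {0}) \<inter> space ?M" by auto
    thus ?thesis using simple_functionD(2)[OF sf] by metis
  qed
  have mZ: "measure ?M (Z y) = measure lebesgue (Z y)" for y
    by (rule measure_restrict_space) (use S in \<open>auto simp: Z_def\<close>)
  have Zl: "Z y \<in> lmeasurable" if "y \<noteq> 0" for y
  proof (rule fmeasurableI)
    show "Z y \<in> sets lebesgue" using Zm[of y] S by (auto simp: sets_restrict_space_iff)
    have "emeasure lebesgue (Z y) = emeasure ?M (Z y)"
      by (rule emeasure_restrict_space[symmetric]) (use S in \<open>auto simp: Z_def\<close>)
    also have "\<dots> \<le> emeasure ?M {y \<in> space ?M. s y \<noteq> 0}"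
      by (rule emeasure_mono[OF _ nz]) (use that in \<open>auto simp: Z_def\<close>)
    finally show "emeasure lebesgue (Z y) < \<infinity>" using fin
      by (metis infinity_ennreal_def less_top neq_top_trans)
  qed
  have "((\<lambda>x. \<Sum>y\<in>s ` S. indicator (Z y) x *\<^sub>R y) has_integral (\<Sum>y\<in>s ` S. measure ?M (Z y) *\<^sub>R y)) UNIV"
  proof (rule has_integral_sum[OF fint])
    fix y assume "y \<in> s ` S"
    show "((\<lambda>x. indicator (Z y) x *\<^sub>R y) has_integral measure ?M (Z y) *\<^sub>R y) UNIV"
    proof (cases "y = 0")
      case False
      from Zl[OF this] have "(indicator (Z y) has_integral measure lebesgue (Z y)) UNIV"
        by (simp add: lmeasurable_iff_has_integral)
      from has_integral_scaleR_left[OF this, of y] show ?thesis by (simp add: mZ)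
    qed simp
  qed
  moreover have "(\<Sum>y\<in>s ` S. indicator (Z y) x *\<^sub>R y) = (if x \<in> S then s x else 0)" for x
  proof (cases "x \<in> S")
    case True
    have "(\<Sum>y\<in>s ` S. indicator (Z y) x *\<^sub>R y) = (\<Sum>y\<in>s ` S. if y = s x then y else 0)"
      by (rule sum.cong) (auto simp: Z_def True indicator_def)
    thus ?thesis using fint True by simp
  qed (simp add: Z_def)
  moreover have "(\<Sum>y\<in>s ` S. measure ?M (Z y) *\<^sub>R y) = Bochner_Integration.simple_bochner_integral ?M s"
    by (simp add: simple_bochner_integral_def Z_def)
  ultimately show ?thesis by (simp add: has_integral_restrict_UNIV)
qed

text \<open>Cauchy criterion with the common refinement of the gauges of \<open>g\<close> and
  \<open>\<phi>\<close>: a Riemann sum of f - g is bounded by the corresponding Riemann sum of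
  \<open>\<phi>\<close>, which is close to the small number \<open>P\<close>.\<close>

lemma integrable_approx_cbox:
  fixes f :: "real \<Rightarrow> 'b::banach"
  assumes "\<And>e. e > 0 \<Longrightarrow> \<exists>g \<phi> P. g integrable_on cbox a b \<and>
     (\<phi> has_integral P) (cbox a b) \<and> P < e \<and> (\<forall>x\<in>cbox a b. norm (f x - g x) \<le> \<phi> x)"
  shows "f integrable_on cbox a b"
  unfolding integrable_Cauchy
proof (intro allI impI)
  fix e :: real assume "e > 0"
  \<comment> \<open>The sums of f and g differ by at most the sum for \<open>\<phi>\<close>, less
    than e/6 + e/6; those of g are within e/6 of \<open>J\<close>. So all sums of f lie within e/2
    of \<open>J\<close>, and any two of them within e of each other.\<close>
  hence e6: "e/6 > 0" by simp
  obtain g J \<phi> P where g: "(g has_integral J) (cbox a b)" and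
    \<phi>: "(\<phi> has_integral P) (cbox a b)" and P: "P < e/6" and le: "\<And>x. x \<in> cbox a b \<Longrightarrow> norm (f x - g x) \<le> \<phi> x"
    using assms[OF e6] by (auto simp: integrable_on_def)
  obtain \<gamma>1 where \<gamma>1: "gauge \<gamma>1" "\<And>D. D tagged_division_of cbox a b \<Longrightarrow> \<gamma>1 fine D \<Longrightarrow>
     norm ((\<Sum>(x,k)\<in>D. measure lborel k *\<^sub>R g x) - J) < e/6"
    using g e6 unfolding has_integral by meson
  obtain \<gamma>2 where \<gamma>2: "gauge \<gamma>2" "\<And>D. D tagged_division_of cbox a b \<Longrightarrow> \<gamma>2 fine D \<Longrightarrow>
     norm ((\<Sum>(x,k)\<in>D. measure lborel k *\<^sub>R \<phi> x) - P) < e/6"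
    using \<phi> e6 unfolding has_integral by meson
  have near: "norm ((\<Sum>(x,k)\<in>D. measure lborel k *\<^sub>R f x) - J) < e/2"
    if D: "D tagged_division_of cbox a b" and "(\<lambda>x. \<gamma>1 x \<inter> \<gamma>2 x) fine D" for D
  proof -
    have f1: "\<gamma>1 fine D" and f2: "\<gamma>2 fine D" using that(2) by (auto simp: fine_Int)
    have "(\<Sum>(x,k)\<in>D. measure lborel k *\<^sub>R f x) - (\<Sum>(x,k)\<in>D. measure lborel k *\<^sub>R g x)
       = (\<Sum>(x,k)\<in>D. measure lborel k *\<^sub>R (f x - g x))"
      by (simp add: sum_subtractf[symmetric] scaleR_diff_right split_def)
    also have "norm \<dots> \<le> (\<Sum>(x,k)\<in>D. measure lborel k *\<^sub>R \<phi> x)"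
    proof (rule sum_norm_le, clarify)
      fix x k assume "(x, k) \<in> D"
      hence "x \<in> cbox a b" using tag_in_interval[OF D] by blast
      from le[OF this] show "norm (measure lborel k *\<^sub>R (f x - g x)) \<le> measure lborel k *\<^sub>R \<phi> x"
        by (simp add: mult_left_mono)
    qed
    also have "\<dots> < e/3" using \<gamma>2(2)[OF D f2] P unfolding real_norm_def by linarith
    finally show ?thesis using norm_triangle_lt[OF add_strict_mono[OF _ \<gamma>1(2)[OF D f1]]] by fastforce
  qed
  show "\<exists>\<gamma>. gauge \<gamma> \<and> (\<forall>D1 D2. D1 tagged_division_of cbox a b \<and> \<gamma> fine D1 \<and> D2 tagged_division_of cbox a b \<and> \<gamma> fine D2 \<longrightarrow>
     norm ((\<Sum>(x,k)\<in>D1. measure lborel k *\<^sub>R f x) - (\<Sum>(x,k)\<in>D2. measure lborel k *\<^sub>R f x)) < e)"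
    using gauge_Int[OF \<gamma>1(1) \<gamma>2(1)] norm_diff_triangle_less[OF near near[unfolded norm_minus_commute]] by (force simp: field_simps)
qed

text \<open>The Henstock-Kurzweil integral is closed under L^1 approximation as soon as the error
  has an integrable scalar majorant. The local part is \<open>integrable_approx_cbox\<close>; at
  infinity the radius found for the approximant \<open>g\<close> also serves for \<open>f\<close>,
  since the error is at most \<open>P\<close> on every box.\<close>

lemma has_integral_approx:
  fixes f :: "real \<Rightarrow> 'b::banach"
  assumes appr: "\<And>e. e > 0 \<Longrightarrow> \<exists>g J \<phi> P. (g has_integral J) S \<and> norm (J - I) < e \<and>
     (\<phi> has_integral P) S \<and> P < e \<and> (\<forall>x\<in>S. norm (f x - g x) \<le> \<phi> x)"
  shows "(f has_integral I) S"
proof -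
  let ?r = "\<lambda>f x. if x \<in> S then f x else 0"
  have sub: "integral (cbox a b) (?r \<phi>) \<le> P"
    if "(\<phi> has_integral P) S" "\<forall>x\<in>S. norm (f x - g x) \<le> \<phi> x" for \<phi> P a b and g :: "real \<Rightarrow> 'b"
  proof -
    have U: "(?r \<phi> has_integral P) UNIV" using that by (simp only: has_integral_restrict_UNIV)
    have "integral (cbox a b) (?r \<phi>) \<le> integral UNIV (?r \<phi>)"
    proof (rule integral_subset_le)
      show "?r \<phi> integrable_on UNIV" using U by blast
      thus "?r \<phi> integrable_on cbox a b" by (rule integrable_on_subcbox) simp
      show "\<forall>x\<in>UNIV. 0 \<le> ?r \<phi> x" using that(2) by (auto intro: order_trans[OF norm_ge_zero])
    qed simp
    thus ?thesis using U by (simp add: integral_unique)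
  qed
  have loc: "h integrable_on S \<Longrightarrow> ?r h integrable_on cbox a b" for h :: "real \<Rightarrow> 'c::banach" and a b
    by (rule integrable_altD(1))
  have fi: "?r f integrable_on cbox a b" for a b
  proof (rule integrable_approx_cbox)
    fix e :: real assume "e > 0"
    then obtain g J \<phi> P where g: "(g has_integral J) S" and \<phi>: "(\<phi> has_integral P) S" and P: "P < e"
      and le: "\<forall>x\<in>S. norm (f x - g x) \<le> \<phi> x" using appr by blast
    have "?r g integrable_on cbox a b" "?r \<phi> integrable_on cbox a b" using loc g \<phi> by blast+
    moreover have "integral (cbox a b) (?r \<phi>) < e" by (rule le_less_trans[OF sub[OF \<phi> le] P])
    moreover have "\<forall>x\<in>cbox a b. norm (?r f x - ?r g x) \<le> ?r \<phi> x" using le by simp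
    ultimately show "\<exists>g \<phi> P. g integrable_on cbox a b \<and> (\<phi> has_integral P) (cbox a b) \<and> P < e \<and>
        (\<forall>x\<in>cbox a b. norm (?r f x - g x) \<le> \<phi> x)"
      using integrable_integral by blast
  qed
  show ?thesis
  proof (subst has_integral_alt', intro conjI allI impI)
    show "?r f integrable_on cbox a b" for a b by (rule fi)
    fix e :: real assume "e > 0"
    hence e3: "e/3 > 0" by simp
    obtain g J \<phi> P where g: "(g has_integral J) S" and J: "norm (J - I) < e/3" and
      \<phi>: "(\<phi> has_integral P) S" and P: "P < e/3" and le: "\<forall>x\<in>S. norm (f x - g x) \<le> \<phi> x"
      using appr[OF e3] by blast
    obtain B where "B > 0" and B: "\<And>a b. ball 0 B \<subseteq> cbox a b \<Longrightarrow> norm (integral (cbox a b) (?r g) - J) < e/3"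
      using g e3 unfolding has_integral_alt'[of g] by meson
    show "\<exists>B>0. \<forall>a b. ball 0 B \<subseteq> cbox a b \<longrightarrow> norm (integral (cbox a b) (?r f) - I) < e"
    proof (intro exI[of _ B] conjI allI impI)
      fix a b :: real assume ab: "ball 0 B \<subseteq> cbox a b"
      have gi: "?r g integrable_on cbox a b" and \<phi>i: "?r \<phi> integrable_on cbox a b"
        using loc g \<phi> by blast+
      have "integral (cbox a b) (?r f) - integral (cbox a b) (?r g) = integral (cbox a b) (\<lambda>x. ?r f x - ?r g x)"
        by (rule integral_diff[symmetric]) (rule fi gi)+
      also have "norm \<dots> \<le> integral (cbox a b) (?r \<phi>)"
      proof (rule integral_norm_bound_integral)
        show "(\<lambda>x. ?r f x - ?r g x) integrable_on cbox a b" by (rule integrable_diff[OF fi gi])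
        show "norm (?r f x - ?r g x) \<le> ?r \<phi> x" for x using le by auto
      qed (rule \<phi>i)
      also have "\<dots> < e/3" using P by (intro le_less_trans[OF sub[OF \<phi> le]]) linarith
      finally have 1: "norm (integral (cbox a b) (?r f) - integral (cbox a b) (?r g)) < e/3" .
      note 2 = B[OF ab]
      have "integral (cbox a b) (?r f) - I = (integral (cbox a b) (?r f) - integral (cbox a b) (?r g))
         + ((integral (cbox a b) (?r g) - J) + (J - I))" by simp
      also have "norm \<dots> \<le> norm (integral (cbox a b) (?r f) - integral (cbox a b) (?r g))
         + (norm (integral (cbox a b) (?r g) - J) + norm (J - I))"
        by (intro norm_triangle_le add_mono order.refl norm_triangle_ineq)
      also have "\<dots> < e" using 1 2 J by simp
      finally show "norm (integral (cbox a b) (?r f) - I) < e" .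
    qed (rule \<open>B > 0\<close>)
  qed
qed

lemma L1_limit_has_integral:
  fixes f :: "real \<Rightarrow> 'b::banach"
  assumes S: "S \<in> sets lebesgue" and s: "\<And>n. Bochner_Integration.simple_bochner_integrable (lebesgue_on S) (s n)"
    and m: "\<And>n. (\<lambda>x. norm (f x - s n x)) \<in> borel_measurable (lebesgue_on S)"
    and lim: "(\<lambda>n. \<integral>\<^sup>+x. ennreal (norm (f x - s n x)) \<partial>lebesgue_on S) \<longlonglongrightarrow> 0"
    and I: "(\<lambda>n. Bochner_Integration.simple_bochner_integral (lebesgue_on S) (s n)) \<longlonglongrightarrow> I"
  shows "(f has_integral I) S"
proof (rule has_integral_approx)
  fix e :: real assume "e > 0"
  have "\<forall>\<^sub>F n in sequentially. (\<integral>\<^sup>+x. ennreal (norm (f x - s n x)) \<partial>lebesgue_on S) < ennreal e"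
    by (rule order_tendstoD(2)[OF lim]) (use \<open>e > 0\<close> in simp)
  moreover have "\<forall>\<^sub>F n in sequentially. dist (Bochner_Integration.simple_bochner_integral (lebesgue_on S) (s n)) I < e"
    using I \<open>e > 0\<close> by (rule tendstoD)
  ultimately obtain n where n: "(\<integral>\<^sup>+x. ennreal (norm (f x - s n x)) \<partial>lebesgue_on S) < ennreal e"
    "dist (Bochner_Integration.simple_bochner_integral (lebesgue_on S) (s n)) I < e"
    by (metis (mono_tags, lifting) eventually_conj eventually_happens' sequentially_bot)
  have int: "integrable (lebesgue_on S) (\<lambda>x. norm (f x - s n x))"
    by (rule integrableI_bounded[OF m]) (use n(1) order_less_trans in \<open>fastforce simp: ennreal_less_top\<close>)
  have "ennreal (LINT x|lebesgue_on S. norm (f x - s n x)) < ennreal e"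
    using n(1) nn_integral_eq_integral[OF int] by simp
  hence P: "(LINT x|lebesgue_on S. norm (f x - s n x)) < e"
    using \<open>e > 0\<close> ennreal_less_iff integral_nonneg_AE by (simp add: ennreal_less_iff)
  show "\<exists>g J \<phi> P. (g has_integral J) S \<and> norm (J - I) < e \<and>
     (\<phi> has_integral P) S \<and> P < e \<and> (\<forall>x\<in>S. norm (f x - g x) \<le> \<phi> x)"
    by (rule exI[of _ "s n"], rule exI[of _ "Bochner_Integration.simple_bochner_integral (lebesgue_on S) (s n)"],
        rule exI[of _ "\<lambda>x. norm (f x - s n x)"], rule exI[of _ "LINT x|lebesgue_on S. norm (f x - s n x)"])
       (use simple_bochner_has_integral[OF S s] n(2) P has_integral_integral_lebesgue_on[OF int S]
        in \<open>simp add: dist_norm\<close>)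
qed

text \<open>Gives uniqueness of the Bochner value, and with it the meaning of the description
  operator in \<open>bochner\<close>, without any separability.\<close>

lemma has_bochner_has_integral:
  fixes f :: "real \<Rightarrow> 'b::banach"
  assumes "S \<in> sets lebesgue" "has_bochner (lebesgue_on S) f I"
  shows "(f has_integral I) S"
proof -
  obtain s where s: "\<And>n. Bochner_Integration.simple_bochner_integrable (lebesgue_on S) (s n)"
    "\<And>n. (\<lambda>x. norm (f x - s n x)) \<in> borel_measurable (lebesgue_on S)"
    "(\<lambda>n. \<integral>\<^sup>+x. ennreal (norm (f x - s n x)) \<partial>lebesgue_on S) \<longlonglongrightarrow> 0"
    "(\<lambda>n. norm (Bochner_Integration.simple_bochner_integral (lebesgue_on S) (s n) - I)) \<longlonglongrightarrow> 0"
    using assms(2) unfolding has_bochner_in_def by blast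
  show ?thesis
    by (rule L1_limit_has_integral[OF assms(1) s(1-3)])
       (use s(4) in \<open>simp add: tendsto_norm_zero_iff LIM_zero_iff\<close>)
qed

lemma bochner_eqI:
  fixes f :: "real \<Rightarrow> 'b::banach"
  assumes "S \<in> sets lebesgue" "has_bochner (lebesgue_on S) f I"
  shows "bochner (lebesgue_on S) f = I"
  unfolding bochner_def
proof (rule the_equality)
  fix J assume "has_bochner (lebesgue_on S) f J"
  from has_integral_unique[OF has_bochner_has_integral[OF assms(1) this] has_bochner_has_integral[OF assms]]
  show "J = I" .
qed (rule assms(2))

lemma has_bochner_in_cong:
  assumes eq: "\<And>x. x \<in> space M \<Longrightarrow> f x = g x"
  shows "has_bochner_in V N M f I \<longleftrightarrow> has_bochner_in V N M g I"
proof -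
  have 1: "(\<lambda>x. N (f x - s x)) \<in> borel_measurable M \<longleftrightarrow> (\<lambda>x. N (g x - s x)) \<in> borel_measurable M" for s
    by (rule measurable_cong) (simp add: eq)
  have 2: "(\<integral>\<^sup>+x. ennreal (N (f x - s x)) \<partial>M) = (\<integral>\<^sup>+x. ennreal (N (g x - s x)) \<partial>M)" for s
    by (rule nn_integral_cong) (simp add: eq)
  have 3: "f ` space M = g ` space M" by (rule image_cong[OF refl eq])
  show ?thesis unfolding has_bochner_in_def by (simp only: 1 2 3)
qed

text \<open>At points without convergence \<open>lim\<close> is arbitrary. They form a null set,
  which does no harm because Lebesgue measure is complete.\<close>

lemma borel_measurable_AE_LIMSEQ:
  fixes u :: "nat \<Rightarrow> real \<Rightarrow> real"
  assumes S: "S \<in> sets lebesgue" and u: "\<And>m. u m \<in> borel_measurable (lebesgue_on S)"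
    and lim: "AE x in lebesgue_on S. (\<lambda>m. u m x) \<longlonglongrightarrow> v x"
  shows "v \<in> borel_measurable (lebesgue_on S)"
proof -
  let ?r = "\<lambda>f x. if x \<in> S then f x else (0::real)"
  have m: "?r (u m) \<in> borel_measurable lebesgue" for m using u S by (simp add: borel_measurable_if)
  have "(\<lambda>x. lim (\<lambda>m. ?r (u m) x)) \<in> borel_measurable lebesgue"
    by (rule borel_measurable_lim_metric[OF m])
  moreover have "AE x in lebesgue. lim (\<lambda>m. ?r (u m) x) = ?r v x"
  proof -
    have "AE x in lebesgue. x \<in> S \<longrightarrow> (\<lambda>m. u m x) \<longlonglongrightarrow> v x"
      using lim S by (simp add: AE_restrict_space_iff)
    thus ?thesis by eventually_elim (auto simp: limI)
  qed
  ultimately have "?r v \<in> borel_measurable lebesgue" by (rule borel_measurable_AE)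
  thus ?thesis by (rule borel_measurable_if_D)
qed

text \<open>A general continuous \<open>\<rho>\<close> is kept because later it is a seminorm
  composed with a linear map, and not only the norm.\<close>

lemma strongly_measurable_diff_measurable:
  fixes f :: "real \<Rightarrow> 'b::real_normed_vector" and \<rho> :: "'b \<Rightarrow> real"
  assumes S: "S \<in> sets lebesgue" and f: "strongly_measurable (lebesgue_on S) f"
    and s: "simple_function (lebesgue_on S) s" and \<rho>: "continuous_on UNIV \<rho>"
  shows "(\<lambda>x. \<rho> (f x - s x)) \<in> borel_measurable (lebesgue_on S)"
proof -
  obtain s0 where s0: "\<And>n. simple_function (lebesgue_on S) (s0 n)"
    "AE x in lebesgue_on S. (\<lambda>n. s0 n x) \<longlonglongrightarrow> f x"
    using f unfolding strongly_measurable_def by blast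
  show ?thesis
  proof (rule borel_measurable_AE_LIMSEQ[OF S])
    show "(\<lambda>x. \<rho> (s0 m x - s x)) \<in> borel_measurable (lebesgue_on S)" for m
      by (rule borel_measurable_simple_function, rule simple_function_compose2[OF s0(1) s])
    show "AE x in lebesgue_on S. (\<lambda>m. \<rho> (s0 m x - s x)) \<longlonglongrightarrow> \<rho> (f x - s x)"
      using s0(2)
      by eventually_elim
         (rule continuous_on_tendsto_compose[OF \<rho>], auto intro!: tendsto_diff tendsto_const)
  qed
qed

lemma bochner_approx:
  fixes f :: "real \<Rightarrow> 'b::real_normed_vector"
  assumes S: "S \<in> sets lebesgue" and f: "strongly_measurable (lebesgue_on S) f"
    and int: "integrable (lebesgue_on S) (\<lambda>x. norm (f x))"
  obtains s where "\<And>n. Bochner_Integration.simple_bochner_integrable (lebesgue_on S) (s n)"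
    "(\<lambda>n. \<integral>\<^sup>+x. ennreal (norm (f x - s n x)) \<partial>lebesgue_on S) \<longlonglongrightarrow> 0"
proof -
  let ?M = "lebesgue_on S"
  obtain s0 where s0: "\<And>n. simple_function ?M (s0 n)" "AE x in ?M. (\<lambda>n. s0 n x) \<longlonglongrightarrow> f x"
    using f unfolding strongly_measurable_def by blast
  \<comment> \<open>Truncation at twice the norm of f gives the integrable majorant 3 |f| for the
    errors. Convergence survives: where f x is not 0 the truncation is eventually inactive, and
    where f x = 0 it produces the value 0 itself.\<close>
  define s where "s n x = (if norm (s0 n x) \<le> 2 * norm (f x) then s0 n x else 0)" for n x
  have fm[measurable]: "(\<lambda>x. norm (f x)) \<in> borel_measurable ?M" using int by (rule borel_measurable_integrable)
  have nm[measurable]: "(\<lambda>x. norm (s0 n x)) \<in> borel_measurable ?M" for n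
    by (rule borel_measurable_simple_function, rule simple_function_compose1[OF s0(1)])
  have sf: "simple_function ?M (s n)" for n
    unfolding s_def
  proof (rule simple_function_If)
    show "{x \<in> space ?M. norm (s0 n x) \<le> 2 * norm (f x)} \<in> sets ?M" by measurable
  qed (simp_all add: s0)
  have le: "norm (s n x) \<le> 2 * norm (f x)" for n x by (simp add: s_def)
  have sm[measurable]: "(\<lambda>x. norm (s n x)) \<in> borel_measurable ?M" for n
    by (rule borel_measurable_simple_function, rule simple_function_compose1[OF sf])
  have fin2: "(\<integral>\<^sup>+x. ennreal (3 * norm (f x)) \<partial>?M) < \<infinity>"
  proof -
    have "integrable ?M (\<lambda>x. 3 * norm (f x))" using int by simp
    hence "(\<integral>\<^sup>+x. ennreal (3 * norm (f x)) \<partial>?M) = ennreal (LINT x|?M. 3 * norm (f x))"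
      by (rule nn_integral_eq_integral) simp
    thus ?thesis by simp
  qed
  have sbi: "Bochner_Integration.simple_bochner_integrable ?M (s n)" for n
  proof (rule simple_bochner_integrableI_bounded[OF sf])
    have "(\<integral>\<^sup>+x. ennreal (norm (s n x)) \<partial>?M) \<le> (\<integral>\<^sup>+x. ennreal (3 * norm (f x)) \<partial>?M)"
      by (intro nn_integral_mono ennreal_leI) (use le in \<open>smt (verit) norm_ge_zero\<close>)
    thus "(\<integral>\<^sup>+x. ennreal (norm (s n x)) \<partial>?M) < \<infinity>" using fin2 by (rule le_less_trans)
  qed
  have dm: "(\<lambda>x. norm (f x - s n x)) \<in> borel_measurable ?M" for n
    by (rule strongly_measurable_diff_measurable[OF S f sf]) (rule continuous_on_norm_id)
  have "(\<lambda>n. \<integral>\<^sup>+x. ennreal (norm (f x - s n x)) \<partial>?M) \<longlonglongrightarrow> (\<integral>\<^sup>+x. 0 \<partial>?M)"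
  proof (rule nn_integral_dominated_convergence[where w="\<lambda>x. ennreal (3 * norm (f x))"])
    show "(\<lambda>x. ennreal (norm (f x - s n x))) \<in> borel_measurable ?M" for n using dm by measurable
    show "(\<lambda>x. ennreal (3 * norm (f x))) \<in> borel_measurable ?M" by measurable
    show "AE x in ?M. ennreal (norm (f x - s n x)) \<le> ennreal (3 * norm (f x))" for n
    proof (rule AE_I2, rule ennreal_leI)
      fix x show "norm (f x - s n x) \<le> 3 * norm (f x)"
        using norm_triangle_ineq4[of "f x" "s n x"] le[of n x] by simp
    qed
    show "AE x in ?M. (\<lambda>n. ennreal (norm (f x - s n x))) \<longlonglongrightarrow> 0"
      using s0(2)
    proof eventually_elim
      fix x assume lim: "(\<lambda>n. s0 n x) \<longlonglongrightarrow> f x"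
      have "(\<lambda>n. s n x) \<longlonglongrightarrow> f x"
      proof (cases "f x = 0")
        case True
        hence "s n x = f x" for n by (simp add: s_def)
        thus ?thesis by simp
      next
        case False
        have "\<forall>\<^sub>F n in sequentially. norm (s0 n x) < 2 * norm (f x)"
          by (rule order_tendstoD(2)[OF tendsto_norm[OF lim]]) (use False in simp)
        hence "\<forall>\<^sub>F n in sequentially. s0 n x = s n x" by eventually_elim (simp add: s_def)
        from tendsto_cong[OF this] lim show ?thesis by simp
      qed
      from tendsto_norm_zero[OF tendsto_diff[OF tendsto_const this, of "f x", simplified]]
      have "(\<lambda>n. norm (f x - s n x)) \<longlonglongrightarrow> 0" by simp
      from tendsto_ennrealI[OF this] show "(\<lambda>n. ennreal (norm (f x - s n x))) \<longlonglongrightarrow> 0" by simp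
    qed
  qed (use fin2 in simp_all)
  thus ?thesis using that[OF sbi] by simp
qed

text \<open>Representatives of L^p functions carry only a seminorm. The integral is therefore formed
  in a Banach space \<open>'y\<close>, where the integrals of the simple approximations are Cauchy
  and hence converge, and then carried over by the linear map \<open>L\<close>. The last hypothesis
  says that, for almost every x, \<open>N\<close> cannot tell \<open>f x\<close> from
  \<open>L (F x)\<close>.\<close>

lemma has_bochner_in_linear_image:
  fixes F :: "real \<Rightarrow> 'y::banach" and L :: "'y \<Rightarrow> 'v::real_vector"
  assumes S: "S \<in> sets lebesgue" and F: "strongly_measurable (lebesgue_on S) F"
    and int: "integrable (lebesgue_on S) (\<lambda>x. norm (F x))"
    and L: "linear L" "\<And>y. L y \<in> V"
    and N: "continuous_on UNIV (\<lambda>y. N (L y))" "\<And>y. N (L y) \<le> C * norm y" "\<And>y. 0 \<le> N (L y)"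
    and f: "\<And>x. x \<in> S \<Longrightarrow> f x \<in> V" "AE x in lebesgue_on S. \<forall>y. N (f x - L y) = N (L (F x - y))"
  shows "F integrable_on S" "has_bochner_in V N (lebesgue_on S) f (L (integral S F))"
proof -
  let ?M = "lebesgue_on S"
  obtain s where s: "\<And>n. Bochner_Integration.simple_bochner_integrable ?M (s n)"
    and lim: "(\<lambda>n. \<integral>\<^sup>+x. ennreal (norm (F x - s n x)) \<partial>?M) \<longlonglongrightarrow> 0"
    using bochner_approx[OF S F int] by metis
  have sf: "simple_function ?M (s n)" for n using s by (simp add: simple_bochner_integrable.simps)
  let ?K = "\<lambda>n. Bochner_Integration.simple_bochner_integral ?M (s n)"
  have dm[measurable]: "(\<lambda>x. norm (F x - s n x)) \<in> borel_measurable ?M" for n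
    by (rule strongly_measurable_diff_measurable[OF S F sf]) (rule continuous_on_norm_id)
  have Kd: "ennreal (norm (?K m - ?K n)) \<le> (\<integral>\<^sup>+x. ennreal (norm (F x - s m x)) \<partial>?M) + (\<integral>\<^sup>+x. ennreal (norm (F x - s n x)) \<partial>?M)" for m n
  proof -
    have d: "Bochner_Integration.simple_bochner_integrable ?M (\<lambda>x. s m x - s n x)"
      by (rule simple_bochner_integrable_compose2[OF _ s s]) simp
    have nd: "Bochner_Integration.simple_bochner_integrable ?M (\<lambda>x. norm (s m x - s n x))"
      using simple_bochner_integrable_compose2[of "\<lambda>x y. norm x", OF _ d d] by simp
    have "norm (?K m - ?K n) \<le> Bochner_Integration.simple_bochner_integral ?M (\<lambda>x. norm (s m x - s n x))"
      using simple_bochner_integral_norm_bound[OF d] by (simp add: simple_bochner_integral_diff[OF s s])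
    from ennreal_leI[OF this]
    have "ennreal (norm (?K m - ?K n)) \<le> (\<integral>\<^sup>+x. ennreal (norm (s m x - s n x)) \<partial>?M)"
      by (simp add: simple_bochner_integral_eq_nn_integral[OF nd])
    also have "\<dots> \<le> (\<integral>\<^sup>+x. ennreal (norm (F x - s m x)) + ennreal (norm (F x - s n x)) \<partial>?M)"
    proof (rule nn_integral_mono)
      fix x
      have "norm (s m x - s n x) = norm ((F x - s n x) - (F x - s m x))" by simp
      also have "\<dots> \<le> norm (F x - s n x) + norm (F x - s m x)" by (rule norm_triangle_ineq4)
      finally show "ennreal (norm (s m x - s n x)) \<le> ennreal (norm (F x - s m x)) + ennreal (norm (F x - s n x))"
        by (simp add: ennreal_plus[symmetric] add.commute del: ennreal_plus)
    qed
    also have "\<dots> = (\<integral>\<^sup>+x. ennreal (norm (F x - s m x)) \<partial>?M) + (\<integral>\<^sup>+x. ennreal (norm (F x - s n x)) \<partial>?M)"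
      by (rule nn_integral_add) measurable
    finally show ?thesis .
  qed
  have "Cauchy ?K"
  proof (rule metric_CauchyI)
    fix e :: real assume "e > 0"
    have "\<forall>\<^sub>F n in sequentially. (\<integral>\<^sup>+x. ennreal (norm (F x - s n x)) \<partial>?M) < ennreal (e/2)"
      by (rule order_tendstoD(2)[OF lim]) (use \<open>e > 0\<close> in simp)
    then obtain N where N: "\<And>n. n \<ge> N \<Longrightarrow> (\<integral>\<^sup>+x. ennreal (norm (F x - s n x)) \<partial>?M) < ennreal (e/2)"
      unfolding eventually_sequentially by blast
    show "\<exists>M. \<forall>m\<ge>M. \<forall>n\<ge>M. dist (?K m) (?K n) < e"
    proof (intro exI[of _ N] allI impI)
      fix m n assume "N \<le> m" "N \<le> n"
      have "ennreal (norm (?K m - ?K n)) < ennreal (e/2) + ennreal (e/2)"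
        by (rule le_less_trans[OF Kd]) (intro add_strict_mono N \<open>N \<le> m\<close> \<open>N \<le> n\<close>)
      also have "\<dots> = ennreal e" using \<open>e > 0\<close> by (simp add: ennreal_plus[symmetric] del: ennreal_plus)
      finally show "dist (?K m) (?K n) < e" by (simp add: dist_norm ennreal_less_iff)
    qed
  qed
  then obtain I where I: "?K \<longlonglongrightarrow> I" using convergent_eq_Cauchy by blast
  have FI: "(F has_integral I) S" by (rule L1_limit_has_integral[OF S s dm lim I])
  thus "F integrable_on S" by blast
  have IF: "integral S F = I" using FI by (rule integral_unique)
  have sfL: "simple_function ?M (\<lambda>x. L (s n x))" for n by (rule simple_function_compose1[OF sf])
  have L0: "L 0 = 0" using L(1) by (rule linear_0)
  have ae: "AE x in ?M. N (L (F x - s n x)) = N (f x - L (s n x))" for n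
    using f(2) by eventually_elim simp
  have Lm: "(\<lambda>x. N (L (F x - s n x))) \<in> borel_measurable ?M" for n
    by (rule strongly_measurable_diff_measurable[OF S F sf N(1)])
  have m: "(\<lambda>x. N (f x - L (s n x))) \<in> borel_measurable ?M" for n
  proof (rule borel_measurable_AE_LIMSEQ[OF S Lm[of n]])
    show "AE x in ?M. (\<lambda>m. N (L (F x - s n x))) \<longlonglongrightarrow> N (f x - L (s n x))"
      using ae[of n] by eventually_elim simp
  qed
  have C: "N (L y) \<le> \<bar>C\<bar> * norm y" for y
    using N(2)[of y] by (meson abs_ge_self mult_right_mono norm_ge_zero order_trans)
  show "has_bochner_in V N ?M f (L (integral S F))"
    unfolding has_bochner_in_def IF
  proof (intro conjI exI[of _ "\<lambda>n x. L (s n x)"] allI)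
    show "f ` space ?M \<subseteq> V" using f(1) by auto
    show "L I \<in> V" by (rule L(2))
    show "Bochner_Integration.simple_bochner_integrable ?M (\<lambda>x. L (s n x))" for n
      using simple_bochner_integrable_compose2[of "\<lambda>x y. L x", OF _ s s] L0 by simp
    show "(\<lambda>x. L (s n x)) ` space ?M \<subseteq> V" for n using L(2) by auto
    show "(\<lambda>x. N (f x - L (s n x))) \<in> borel_measurable ?M" for n by (rule m)
    show "(\<lambda>n. \<integral>\<^sup>+x. ennreal (N (f x - L (s n x))) \<partial>?M) \<longlonglongrightarrow> 0"
    proof (rule tendsto_sandwich[OF _ _ tendsto_const])
      show "\<forall>\<^sub>F n in sequentially. (\<integral>\<^sup>+x. ennreal (N (f x - L (s n x))) \<partial>?M) \<le> ennreal \<bar>C\<bar> * (\<integral>\<^sup>+x. ennreal (norm (F x - s n x)) \<partial>?M)"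
      proof (rule always_eventually, rule allI)
        fix n
        have "(\<integral>\<^sup>+x. ennreal (N (f x - L (s n x))) \<partial>?M) = (\<integral>\<^sup>+x. ennreal (N (L (F x - s n x))) \<partial>?M)"
          by (rule nn_integral_cong_AE) (use ae[of n] in \<open>eventually_elim, simp\<close>)
        also have "\<dots> \<le> (\<integral>\<^sup>+x. ennreal \<bar>C\<bar> * ennreal (norm (F x - s n x)) \<partial>?M)"
          by (rule nn_integral_mono) (use C in \<open>simp add: ennreal_mult[symmetric] ennreal_leI\<close>)
        also have "\<dots> = ennreal \<bar>C\<bar> * (\<integral>\<^sup>+x. ennreal (norm (F x - s n x)) \<partial>?M)"
          by (rule nn_integral_cmult) measurable
        finally show "(\<integral>\<^sup>+x. ennreal (N (f x - L (s n x))) \<partial>?M) \<le> ennreal \<bar>C\<bar> * (\<integral>\<^sup>+x. ennreal (norm (F x - s n x)) \<partial>?M)" .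
      qed
      show "(\<lambda>n. ennreal \<bar>C\<bar> * (\<integral>\<^sup>+x. ennreal (norm (F x - s n x)) \<partial>?M)) \<longlonglongrightarrow> 0"
        using ennreal_tendsto_cmult[OF _ lim, of "ennreal \<bar>C\<bar>"] by simp
    qed simp
    show "(\<lambda>n. N (Bochner_Integration.simple_bochner_integral ?M (\<lambda>x. L (s n x)) - L I)) \<longlonglongrightarrow> 0"
    proof (rule Lim_null_comparison)
      have "Bochner_Integration.simple_bochner_integral ?M (\<lambda>x. L (s n x)) - L I = L (?K n - I)" for n
        using simple_bochner_integral_linear[OF L(1) s, of n] L(1) by (simp add: linear_diff)
      thus "\<forall>\<^sub>F n in sequentially. norm (N (Bochner_Integration.simple_bochner_integral ?M (\<lambda>x. L (s n x)) - L I)) \<le> \<bar>C\<bar> * norm (?K n - I)"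
        using C N(3) by simp
      show "(\<lambda>n. \<bar>C\<bar> * norm (?K n - I)) \<longlonglongrightarrow> 0"
        using tendsto_mult_right_zero[OF tendsto_norm_zero[OF LIM_zero[OF I]]] .
    qed
  qed
qed

lemma has_bochner_strong:
  fixes f :: "real \<Rightarrow> 'b::banach"
  assumes S: "S \<in> sets lebesgue" and f: "strongly_measurable (lebesgue_on S) f"
    and int: "integrable (lebesgue_on S) (\<lambda>x. norm (f x))"
  shows "f integrable_on S" "has_bochner (lebesgue_on S) f (integral S f)"
  using has_bochner_in_linear_image[OF S f int, of "\<lambda>x. x" UNIV norm 1 f]
  by (auto intro: continuous_on_norm_id linear_ident)

lemma has_bochner_strong_AE:
  fixes f :: "real \<Rightarrow> 'b::banach"
  assumes S: "S \<in> sets lebesgue" and f: "strongly_measurable (lebesgue_on S) f"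
    and int: "integrable (lebesgue_on S) (\<lambda>x. norm (f x))" and g: "AE x in lebesgue_on S. g x = f x"
  shows "has_bochner (lebesgue_on S) g (integral S f)"
proof -
  have "AE x in lebesgue_on S. \<forall>y. norm (g x - y) = norm (f x - y)" using g by eventually_elim simp
  from has_bochner_in_linear_image(2)[OF S f int, of "\<lambda>x. x" UNIV norm 1 g, OF _ _ _ _ _ _ this]
  show ?thesis by (auto intro: continuous_on_norm_id linear_ident)
qed

lemma bochner_eq_integral:
  fixes f :: "real \<Rightarrow> 'b::banach"
  assumes S: "S \<in> sets lebesgue" and f: "strongly_measurable (lebesgue_on S) f"
    and int: "integrable (lebesgue_on S) (\<lambda>x. norm (f x))"
  shows "bochner (lebesgue_on S) f = integral S f"
  by (rule bochner_eqI[OF S has_bochner_strong(2)[OF assms]])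

lemma strongly_measurable_continuous_on:
  fixes f :: "real \<Rightarrow> 'b::real_normed_vector"
  assumes S: "S \<in> sets lebesgue" and f: "continuous_on S f"
  shows "strongly_measurable (lebesgue_on S) f"
proof -
  \<comment> \<open>\<open>k n x\<close> is the number of the cell of length 1/n that contains x,
    cut off at n^2 so that only finitely many values occur. \<open>pt n j\<close> is a point of S in
    cell j, so that f is evaluated inside S only.\<close>
  define k where "k n x = max (- int (n*n)) (min (int (n*n)) \<lfloor>real n * x\<rfloor>)" for n :: nat and x :: real
  define pt where "pt n j = (SOME y. y \<in> S \<and> k n y = j)" for n j
  have pt: "pt n (k n x) \<in> S \<and> k n (pt n (k n x)) = k n x" if "x \<in> S" for n x
    unfolding pt_def by (rule someI[of _ x]) (use that in simp)
  have km: "{x. k n x = j} \<in> sets lebesgue" for n j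
  proof -
    have "Measurable.pred borel (\<lambda>x. k n x = j)" unfolding k_def by measurable
    hence "{x. k n x = j} \<in> sets borel" by (simp add: pred_def)
    thus ?thesis by simp
  qed
  have ks: "simple_function (lebesgue_on S) (k n)" for n
    unfolding simple_function_def
  proof (intro conjI ballI)
    have "k n ` space (lebesgue_on S) \<subseteq> {- int (n*n)..int (n*n)}" by (auto simp: k_def)
    thus "finite (k n ` space (lebesgue_on S))" by (rule finite_subset) simp
    fix j
    have "k n -` {j} \<inter> space (lebesgue_on S) = {x. k n x = j} \<inter> S" by auto
    thus "k n -` {j} \<inter> space (lebesgue_on S) \<in> sets (lebesgue_on S)"
      using S km by (auto simp: sets_restrict_space_iff)
  qed
  have lim: "(\<lambda>n. pt n (k n x)) \<longlonglongrightarrow> x" if x: "x \<in> S" for x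
  proof (rule Lim_transform_bound[where g="\<lambda>n. 1 / real n", THEN LIM_zero_cancel, rotated])
    show "(\<lambda>n. 1 / real n) \<longlonglongrightarrow> 0" by (rule lim_1_over_n)
    \<comment> \<open>The two extra units keep n x strictly between the cut-offs. Hence a point with
      the same cell number is not cut off either and lies within 1/n of x.\<close>
    obtain N :: nat where N: "\<bar>x\<bar> + 2 \<le> real N" using real_arch_simple by blast
    show "\<forall>\<^sub>F n in sequentially. norm (pt n (k n x) - x) \<le> norm (1 / real n)"
      unfolding eventually_sequentially
    proof (intro exI[of _ N] allI impI)
      fix n assume "N \<le> n"
      hence n: "\<bar>x\<bar> + 2 \<le> real n" using N by linarith
      hence n2: "real n \<ge> 2" by linarith
      have "real n * \<bar>x\<bar> \<le> real n * (real n - 2)" by (rule mult_left_mono) (use n in auto)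
      hence b: "\<bar>real n * x\<bar> \<le> real (n*n) - 4" using n2 by (simp add: abs_mult algebra_simps)
      hence kx: "k n x = \<lfloor>real n * x\<rfloor>" unfolding k_def by (smt (verit) le_floor_iff floor_le_iff of_int_of_nat_eq of_int_minus)
      let ?y = "pt n (k n x)"
      have "k n ?y = \<lfloor>real n * x\<rfloor>" using pt[OF x, of n] kx by simp
      moreover have "\<lfloor>real n * x\<rfloor> < int (n*n)" "- int (n*n) < \<lfloor>real n * x\<rfloor>" using b by linarith+
      ultimately have "\<lfloor>real n * ?y\<rfloor> = \<lfloor>real n * x\<rfloor>" unfolding k_def by linarith
      hence "\<bar>real n * ?y - real n * x\<bar> < 1" by linarith
      hence "real n * \<bar>?y - x\<bar> < 1" by (simp add: abs_mult right_diff_distrib[symmetric])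
      thus "norm (?y - x) \<le> norm (1 / real n)" using n2 by (simp add: field_simps)
    qed
  qed
  have "AE x in lebesgue_on S. (\<lambda>n. f (pt n (k n x))) \<longlonglongrightarrow> f x"
  proof (rule AE_I2)
    fix x assume "x \<in> space (lebesgue_on S)"
    hence x: "x \<in> S" by simp
    show "(\<lambda>n. f (pt n (k n x))) \<longlonglongrightarrow> f x"
      by (rule continuous_on_tendsto_compose[OF f lim[OF x] x]) (use pt[OF x] in simp)
  qed
  moreover have "simple_function (lebesgue_on S) (\<lambda>x. f (pt n (k n x)))" for n
    by (rule simple_function_compose1[OF ks])
  ultimately show ?thesis unfolding strongly_measurable_def
    by (intro exI[of _ "\<lambda>n x. f (pt n (k n x))"]) simp
qed

lemma strongly_measurable_compose2:
  assumes "strongly_measurable M f" "strongly_measurable M g" and p: "continuous_on UNIV (\<lambda>(x, y). p x y)"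
  shows "strongly_measurable M (\<lambda>x. p (f x) (g x))"
proof -
  obtain s where s: "\<And>n. simple_function M (s n)" "AE x in M. (\<lambda>n. s n x) \<longlonglongrightarrow> f x"
    using assms(1) unfolding strongly_measurable_def by blast
  obtain r where r: "\<And>n. simple_function M (r n)" "AE x in M. (\<lambda>n. r n x) \<longlonglongrightarrow> g x"
    using assms(2) unfolding strongly_measurable_def by blast
  have "AE x in M. (\<lambda>n. p (s n x) (r n x)) \<longlonglongrightarrow> p (f x) (g x)"
    using s(2) r(2)
  proof eventually_elim
    fix x assume "(\<lambda>n. s n x) \<longlonglongrightarrow> f x" "(\<lambda>n. r n x) \<longlonglongrightarrow> g x"
    from continuous_on_tendsto_compose[OF p tendsto_Pair[OF this]]
    show "(\<lambda>n. p (s n x) (r n x)) \<longlonglongrightarrow> p (f x) (g x)" by simp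
  qed
  moreover have "simple_function M (\<lambda>x. p (s n x) (r n x))" for n
    by (rule simple_function_compose2[OF s(1) r(1)])
  ultimately show ?thesis unfolding strongly_measurable_def
    by (intro exI[of _ "\<lambda>n x. p (s n x) (r n x)"]) simp
qed

lemma strongly_measurable_compose:
  fixes f :: "'x \<Rightarrow> 'a::real_normed_vector" and p :: "'a \<Rightarrow> 'b::real_normed_vector"
  assumes f: "strongly_measurable M f" and p: "continuous_on UNIV p"
  shows "strongly_measurable M (\<lambda>x. p (f x))"
proof (rule strongly_measurable_compose2[OF f f, of "\<lambda>x y. p x"])
  show "continuous_on UNIV (\<lambda>(x, y::'a). p x)"
    unfolding split_def by (rule continuous_on_compose2[OF p continuous_on_fst[OF continuous_on_id]]) simp
qed

lemma strongly_measurable_cong_AE: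
  assumes f: "strongly_measurable M f" and g: "AE x in M. g x = f x"
  shows "strongly_measurable M g"
proof -
  obtain s where s: "\<And>n. simple_function M (s n)" "AE x in M. (\<lambda>n. s n x) \<longlonglongrightarrow> f x"
    using f unfolding strongly_measurable_def by blast
  have "AE x in M. (\<lambda>n. s n x) \<longlonglongrightarrow> g x" using s(2) g by eventually_elim simp
  thus ?thesis using s(1) unfolding strongly_measurable_def by blast
qed

section \<open>Functions on a compact interval\<close>

text \<open>Telescope over n equal pieces. This replaces the theorem on vanishing derivatives where
  \<open>G\<close> need not be differentiable: its increments only have to be small relative to
  those of a scalar function \<open>h\<close>, for instance a primitive of the norm of an integrable
  function.\<close>

lemma eq_of_small_increments:
  fixes G :: "real \<Rightarrow> 'b::real_normed_vector" and h :: "real \<Rightarrow> real"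
  assumes ab: "a \<le> b"
    and inc: "\<And>e. e > 0 \<Longrightarrow> \<exists>d>0. \<forall>s t. a \<le> s \<longrightarrow> s \<le> t \<longrightarrow> t \<le> b \<longrightarrow> t - s < d \<longrightarrow>
      norm (G t - G s) \<le> e * (h t - h s)"
  shows "G b = G a"
proof -
  have bound: "norm (G b - G a) \<le> e * (h b - h a)" if e: "e > 0" for e
  proof -
    obtain d where d: "d > 0" and D: "\<And>s t. a \<le> s \<Longrightarrow> s \<le> t \<Longrightarrow> t \<le> b \<Longrightarrow> t - s < d \<Longrightarrow> norm (G t - G s) \<le> e * (h t - h s)"
      using inc[OF e] by blast
    obtain n :: nat where n: "(b - a) / d < real n" using reals_Archimedean2 by blast
    have n0: "n > 0" using n ab d by (metis divide_nonneg_pos diff_ge_0_iff_ge gr0I not_less of_nat_0)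
    have step: "(b - a) / real n < d" using n d n0 by (simp add: field_simps)
    define q where "q = (b - a) / real n"
    define x where "x i = a + real i * q" for i
    have x0: "x 0 = a" and xn: "x n = b" using n0 by (simp_all add: x_def q_def)
    have xs: "x (Suc i) - x i = (b - a) / real n" for i by (simp add: x_def distrib_right q_def[symmetric])
    have xa: "a \<le> x i" for i using ab by (simp add: x_def q_def)
    have xb: "x i \<le> b" if "i \<le> n" for i
    proof -
      have "real i * ((b - a) / real n) \<le> real n * ((b - a) / real n)"
        by (rule mult_right_mono) (use that ab in auto)
      thus ?thesis using n0 by (simp add: x_def q_def)
    qed
    have le: "norm (G (x (Suc i)) - G (x i)) \<le> e * (h (x (Suc i)) - h (x i))" if "i < n" for i
    proof (rule D[OF xa])
      have "0 \<le> (b - a) / real n" using ab by simp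
      thus "x i \<le> x (Suc i)" using xs[of i] by linarith
      show "x (Suc i) \<le> b" using xb that by simp
      show "x (Suc i) - x i < d" using xs step by simp
    qed
    have "G b - G a = (\<Sum>i<n. G (x (Suc i)) - G (x i))"
      by (simp add: sum_lessThan_telescope[of "\<lambda>i. G (x i)"] x0 xn)
    also have "norm \<dots> \<le> (\<Sum>i<n. e * (h (x (Suc i)) - h (x i)))"
      by (rule sum_norm_le) (use le in simp)
    also have "\<dots> = e * (h b - h a)"
      by (simp add: sum_distrib_left[symmetric] sum_lessThan_telescope[of "\<lambda>i. h (x i)"] x0 xn)
    finally show ?thesis .
  qed
  have "norm (G b - G a) \<le> 0"
  proof (rule field_le_epsilon)
    fix e :: real assume "e > 0"
    define C where "C = \<bar>h b - h a\<bar> + 1"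
    have C: "C > 0" "h b - h a \<le> C" by (auto simp: C_def)
    have "norm (G b - G a) \<le> (e / C) * (h b - h a)" by (rule bound) (use \<open>e > 0\<close> C in simp)
    also have "\<dots> \<le> (e / C) * C" by (rule mult_left_mono) (use C \<open>e > 0\<close> in auto)
    also have "\<dots> = e" using C by simp
    finally show "norm (G b - G a) \<le> 0 + e" by simp
  qed
  thus ?thesis by simp
qed

lemma integral_diff_Icc:
  fixes f :: "real \<Rightarrow> 'b::banach"
  assumes "f integrable_on {a..b}" "a \<le> s" "s \<le> t" "t \<le> b"
  shows "integral {a..t} f - integral {a..s} f = integral {s..t} f"
proof -
  have "f integrable_on {a..t}" by (rule integrable_on_subinterval[OF assms(1)]) (use assms in auto)
  from Henstock_Kurzweil_Integration.integral_combine[OF assms(2,3) this] show ?thesis by (simp add: algebra_simps)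
qed

lemma continuous_bounded_Icc:
  fixes f :: "real \<Rightarrow> 'b::real_normed_vector"
  assumes "continuous_on {a..b} f"
  obtains M where "M > 0" "\<And>t. t \<in> {a..b} \<Longrightarrow> norm (f t) \<le> M"
proof -
  have "bounded (f ` {a..b})" by (rule compact_imp_bounded[OF compact_continuous_image[OF assms compact_Icc]])
  then obtain M where "M > 0" "\<forall>y\<in>f ` {a..b}. norm y \<le> M" unfolding bounded_pos by blast
  thus ?thesis using that by blast
qed

text \<open>Since \<open>f\<close> is merely integrable, \<open>u\<close> need not be
  differentiable. On a short interval [s,t] replace \<open>\<phi>\<close> by its value at t and
  \<open>u\<close> by its value at s: the defect then cancels exactly up to errors which uniform
  continuity bounds by e times the integral of |f| and by e (t - s). This is the choice of
  \<open>h\<close> in \<open>eq_of_small_increments\<close>.\<close>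

lemma integration_by_parts_scaleC:
  fixes f u :: "real \<Rightarrow> 'e::complex_banach" and \<phi> \<phi>' :: "real \<Rightarrow> complex"
  assumes ab: "a \<le> b"
    and f: "f integrable_on {a..b}" and nf: "(\<lambda>x. norm (f x)) integrable_on {a..b}"
    and \<phi>f: "(\<lambda>x. \<phi> x *\<^sub>C f x) integrable_on {a..b}"
    and d: "\<And>x. x \<in> {a..b} \<Longrightarrow> (\<phi> has_vector_derivative \<phi>' x) (at x within {a..b})"
    and c: "continuous_on {a..b} \<phi>'"
    and u: "\<And>x. x \<in> {a..b} \<Longrightarrow> u x = u a + integral {a..x} f"
  shows "\<phi> b *\<^sub>C u b - \<phi> a *\<^sub>C u a = integral {a..b} (\<lambda>x. \<phi> x *\<^sub>C f x) + integral {a..b} (\<lambda>x. \<phi>' x *\<^sub>C u x)"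
proof -
  have uc: "continuous_on {a..b} u"
  proof -
    have "continuous_on {a..b} (\<lambda>x. u a + integral {a..x} f)"
      by (intro continuous_intros indefinite_integral_continuous_1 f)
    thus ?thesis by (rule continuous_on_eq) (rule u[symmetric])
  qed
  have \<phi>c: "continuous_on {a..b} \<phi>" using d by (rule continuous_on_vector_derivative)
  have \<phi>'u: "(\<lambda>x. \<phi>' x *\<^sub>C u x) integrable_on {a..b}"
    by (intro integrable_continuous_real continuous_intros c uc)
  define G where "G t = \<phi> t *\<^sub>C u t - \<phi> a *\<^sub>C u a - integral {a..t} (\<lambda>x. \<phi> x *\<^sub>C f x) - integral {a..t} (\<lambda>x. \<phi>' x *\<^sub>C u x)" for t
  define h where "h t = integral {a..t} (\<lambda>x. norm (f x)) + t" for t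
  obtain M where M: "M > 0" "\<And>x. x \<in> {a..b} \<Longrightarrow> norm (\<phi>' x) \<le> M"
    using continuous_bounded_Icc[OF c] by blast
  have "G b = G a"
  proof (rule eq_of_small_increments[OF ab, where h=h])
    fix e :: real assume e: "e > 0"
    obtain d1 where d1: "d1 > 0" "\<And>x y. x \<in> {a..b} \<Longrightarrow> y \<in> {a..b} \<Longrightarrow> dist y x < d1 \<Longrightarrow> dist (\<phi> y) (\<phi> x) < e"
      using compact_uniformly_continuous[OF \<phi>c compact_Icc] e unfolding uniformly_continuous_on_def by metis
    have "e / M > 0" using e M by simp
    then obtain d2 where d2: "d2 > 0" "\<And>x y. x \<in> {a..b} \<Longrightarrow> y \<in> {a..b} \<Longrightarrow> dist y x < d2 \<Longrightarrow> dist (u y) (u x) < e / M"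
      using compact_uniformly_continuous[OF uc compact_Icc] unfolding uniformly_continuous_on_def by metis
    show "\<exists>d>0. \<forall>s t. a \<le> s \<longrightarrow> s \<le> t \<longrightarrow> t \<le> b \<longrightarrow> t - s < d \<longrightarrow> norm (G t - G s) \<le> e * (h t - h s)"
    proof (intro exI[of _ "min d1 d2"] conjI allI impI)
      show "min d1 d2 > 0" using d1 d2 by simp
      fix s t assume st: "a \<le> s" "s \<le> t" "t \<le> b" "t - s < min d1 d2"
      have sub: "{s..t} \<subseteq> {a..b}" using st by auto
      note S = integrable_on_subinterval[OF _ sub]
      have fs: "f integrable_on {s..t}" and nfs: "(\<lambda>x. norm (f x)) integrable_on {s..t}"
        and \<phi>fs: "(\<lambda>x. \<phi> x *\<^sub>C f x) integrable_on {s..t}" and \<phi>us: "(\<lambda>x. \<phi>' x *\<^sub>C u x) integrable_on {s..t}"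
        by (rule S, fact)+
      have \<phi>ts: "integral {s..t} \<phi>' = \<phi> t - \<phi> s"
        by (rule integral_unique, rule fundamental_theorem_of_calculus[OF st(2)])
           (use d sub in \<open>blast intro: has_vector_derivative_within_subset\<close>)
      have \<phi>'s: "\<phi>' integrable_on {s..t}" by (rule integrable_continuous_real, rule continuous_on_subset[OF c sub])
      have ut: "u t - u s = integral {s..t} f"
        using u[of t] u[of s] integral_diff_Icc[OF f st(1-3)] st by (simp add: algebra_simps)
      have A: "integral {s..t} (\<lambda>x. (\<phi> t - \<phi> x) *\<^sub>C f x) = \<phi> t *\<^sub>C (u t - u s) - integral {s..t} (\<lambda>x. \<phi> x *\<^sub>C f x)"
      proof -
        have "integral {s..t} (\<lambda>x. \<phi> t *\<^sub>C f x - \<phi> x *\<^sub>C f x) = integral {s..t} (\<lambda>x. \<phi> t *\<^sub>C f x) - integral {s..t} (\<lambda>x. \<phi> x *\<^sub>C f x)"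
          by (rule integral_diff[OF integrable_linear[OF fs scaleC.bounded_linear_right, unfolded o_def] \<phi>fs])
        moreover have "integral {s..t} (\<lambda>x. \<phi> t *\<^sub>C f x) = \<phi> t *\<^sub>C integral {s..t} f"
          using integral_linear[OF fs scaleC.bounded_linear_right, of "\<phi> t"] by (simp add: o_def)
        ultimately show ?thesis by (simp add: scaleC.diff_left ut)
      qed
      have B: "integral {s..t} (\<lambda>x. \<phi>' x *\<^sub>C (u s - u x)) = (\<phi> t - \<phi> s) *\<^sub>C u s - integral {s..t} (\<lambda>x. \<phi>' x *\<^sub>C u x)"
      proof -
        have "integral {s..t} (\<lambda>x. \<phi>' x *\<^sub>C u s - \<phi>' x *\<^sub>C u x) = integral {s..t} (\<lambda>x. \<phi>' x *\<^sub>C u s) - integral {s..t} (\<lambda>x. \<phi>' x *\<^sub>C u x)"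
          by (rule integral_diff[OF integrable_linear[OF \<phi>'s scaleC.bounded_linear_left, unfolded o_def] \<phi>us])
        moreover have "integral {s..t} (\<lambda>x. \<phi>' x *\<^sub>C u s) = (\<phi> t - \<phi> s) *\<^sub>C u s"
          using integral_linear[OF \<phi>'s scaleC.bounded_linear_left, of "u s"] by (simp add: o_def \<phi>ts)
        ultimately show ?thesis by (simp add: scaleC.diff_right)
      qed
      have Ai: "(\<lambda>x. (\<phi> t - \<phi> x) *\<^sub>C f x) integrable_on {s..t}"
        unfolding scaleC.diff_left
        by (rule integrable_diff[OF integrable_linear[OF fs scaleC.bounded_linear_right, unfolded o_def] \<phi>fs])
      have Bi: "(\<lambda>x. \<phi>' x *\<^sub>C (u s - u x)) integrable_on {s..t}"
        by (intro integrable_continuous_real continuous_intros continuous_on_subset[OF c sub] continuous_on_subset[OF uc sub])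
      have nA: "norm (integral {s..t} (\<lambda>x. (\<phi> t - \<phi> x) *\<^sub>C f x)) \<le> integral {s..t} (\<lambda>x. e * norm (f x))"
      proof (rule integral_norm_bound_integral[OF Ai])
        show "(\<lambda>x. e * norm (f x)) integrable_on {s..t}" using integrable_on_cmult_left[OF nfs, of e] by simp
        fix x assume x: "x \<in> {s..t}"
        have "dist (\<phi> t) (\<phi> x) < e" by (rule d1(2)) (use x st in \<open>auto simp: dist_real_def\<close>)
        thus "norm ((\<phi> t - \<phi> x) *\<^sub>C f x) \<le> e * norm (f x)"
          by (simp add: norm_scaleC dist_norm mult_right_mono)
      qed
      have nB: "norm (integral {s..t} (\<lambda>x. \<phi>' x *\<^sub>C (u s - u x))) \<le> integral {s..t} (\<lambda>x. e)"
      proof (rule integral_norm_bound_integral[OF Bi])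
        fix x assume x: "x \<in> {s..t}"
        have "dist (u s) (u x) < e / M" by (rule d2(2)) (use x st in \<open>auto simp: dist_real_def\<close>)
        hence "norm (\<phi>' x) * norm (u s - u x) \<le> M * (e / M)"
          by (intro mult_mono M(2)) (use x sub M in \<open>auto simp: dist_norm\<close>)
        thus "norm (\<phi>' x *\<^sub>C (u s - u x)) \<le> e" using M by (simp add: norm_scaleC)
      qed (rule integrable_const_ivl)
      have hd: "h t - h s = integral {s..t} (\<lambda>x. norm (f x)) + (t - s)"
        using integral_diff_Icc[OF nf st(1-3)] by (simp add: h_def)
      have "G t - G s = (\<phi> t *\<^sub>C u t - \<phi> s *\<^sub>C u s) - integral {s..t} (\<lambda>x. \<phi> x *\<^sub>C f x) - integral {s..t} (\<lambda>x. \<phi>' x *\<^sub>C u x)"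
        using integral_diff_Icc[OF \<phi>f st(1-3)] integral_diff_Icc[OF \<phi>'u st(1-3)] by (simp add: G_def algebra_simps)
      also have "\<dots> = integral {s..t} (\<lambda>x. (\<phi> t - \<phi> x) *\<^sub>C f x) + integral {s..t} (\<lambda>x. \<phi>' x *\<^sub>C (u s - u x))"
        unfolding A B by (simp add: scaleC.diff_left scaleC.diff_right)
      also have "norm \<dots> \<le> integral {s..t} (\<lambda>x. e * norm (f x)) + integral {s..t} (\<lambda>x. e)"
        by (rule norm_triangle_mono[OF nA nB])
      also have "\<dots> = e * (h t - h s)" using st by (simp add: hd algebra_simps)
      finally show "norm (G t - G s) \<le> e * (h t - h s)" .
    qed
  qed
  hence "G b = 0" by (simp add: G_def)
  thus ?thesis by (simp add: G_def algebra_simps)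
qed

section \<open>The spaces of integrable and p-integrable vector valued functions on (0,T)\<close>

definition L1 :: "real \<Rightarrow> (real \<Rightarrow> 'b::real_normed_vector) \<Rightarrow> bool" where
  "L1 T f \<longleftrightarrow> strongly_measurable (interval T) f \<and> integrable (interval T) (\<lambda>t. norm (f t))"

text \<open>The end points join the exceptional set, so that statements about the open interval can
  be used in integrals over closed ones.\<close>

lemma AE_interval_negligible:
  assumes "AE t in interval T. P t"
  obtains N where "negligible N" "\<And>t. t \<in> {0..T} - N \<Longrightarrow> P t"
proof -
  have "AE t in lebesgue. t \<in> {0<..<T} \<longrightarrow> P t" using assms by (simp add: AE_restrict_space_iff)
  then obtain N where "{t \<in> space lebesgue. \<not> (t \<in> {0<..<T} \<longrightarrow> P t)} \<subseteq> N" "emeasure lebesgue N = 0" "N \<in> sets lebesgue"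
    by (rule AE_E)
  hence N: "N \<in> null_sets lebesgue" "{t. \<not> (t \<in> {0<..<T} \<longrightarrow> P t)} \<subseteq> N"
    by (simp_all add: null_setsI)
  show ?thesis
  proof (rule that)
    have "negligible N" using N(1) by (simp only: negligible_iff_null_sets)
    moreover have "negligible {0, T}" by (rule negligible_finite) simp
    ultimately show "negligible (N \<union> {0, T})" by (rule negligible_Un)
    show "P t" if t: "t \<in> {0..T} - (N \<union> {0, T})" for t
    proof (rule ccontr)
      assume "\<not> P t"
      hence "t \<in> {t. \<not> (t \<in> {0<..<T} \<longrightarrow> P t)}" using t by (simp add: less_le)
      thus False using N(2) t by blast
    qed
  qed
qed

lemma integral_cong_AE_interval:
  assumes "AE t in interval T. f t = g t" and "{a..b} \<subseteq> {0..T}"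
  shows "integral {a..b} f = integral {a..b} g"
proof -
  obtain N where "negligible N" "\<And>t. t \<in> {0..T} - N \<Longrightarrow> f t = g t"
    using AE_interval_negligible[OF assms(1)] by blast
  thus ?thesis using assms(2) by (intro integral_spike[of N]) auto
qed

lemma integrable_on_Icc_from_interval:
  fixes f :: "real \<Rightarrow> 'b::banach"
  assumes "f integrable_on {0<..<T}" "{a..b} \<subseteq> {0..T}"
  shows "f integrable_on {a..b}"
proof -
  have "f integrable_on {0..T}"
  proof (rule integrable_spike_set[OF assms(1)])
    show "negligible {x \<in> {0<..<T} - {0..T}. f x \<noteq> 0}"
      by (rule negligible_subset[of "{}"]) auto
    show "negligible {x \<in> {0..T} - {0<..<T}. f x \<noteq> 0}"
      by (rule negligible_subset[of "{0, T}"]) auto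
  qed
  thus ?thesis using assms(2) by (rule integrable_on_subinterval)
qed

lemma L1_integrable:
  fixes f :: "real \<Rightarrow> 'b::banach"
  assumes "L1 T f" "{a..b} \<subseteq> {0..T}"
  shows "f integrable_on {a..b}" "(\<lambda>x. norm (f x)) integrable_on {a..b}"
proof -
  have "f integrable_on {0<..<T}" using assms(1) has_bochner_strong(1)[of "{0<..<T}" f] by (simp add: L1_def)
  thus "f integrable_on {a..b}" using assms(2) by (rule integrable_on_Icc_from_interval)
  have "(\<lambda>x. norm (f x)) integrable_on {0<..<T}"
    using assms(1) by (intro integrable_on_lebesgue_on) (auto simp: L1_def)
  thus "(\<lambda>x. norm (f x)) integrable_on {a..b}" using assms(2) by (rule integrable_on_Icc_from_interval)
qed

lemma strongly_measurable_norm: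
  assumes "strongly_measurable (interval T) f"
  shows "(\<lambda>x. norm (f x)) \<in> borel_measurable (interval T)"
  using strongly_measurable_diff_measurable[OF _ assms, of "\<lambda>x. 0" norm] by (auto intro: continuous_on_norm_id)

lemma L1_dominated:
  fixes f :: "real \<Rightarrow> 'b::real_normed_vector"
  assumes f: "strongly_measurable (interval T) f" and g: "integrable (interval T) g"
    and le: "\<And>t. t \<in> {0<..<T} \<Longrightarrow> norm (f t) \<le> g t"
  shows "L1 T f"
  unfolding L1_def
proof (rule conjI[OF f], rule Bochner_Integration.integrable_bound[OF g strongly_measurable_norm[OF f]])
  show "AE t in interval T. norm (norm (f t)) \<le> norm (g t)"
    by (rule AE_I2) (use le in \<open>force intro: order_trans[OF _ abs_ge_self]\<close>)
qed

lemma continuous_strongly_measurable: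
  fixes f :: "real \<Rightarrow> 'b::real_normed_vector"
  assumes "continuous_on {0..T} f" shows "strongly_measurable (interval T) f"
  by (rule strongly_measurable_continuous_on, simp, rule continuous_on_subset[OF assms]) auto

lemma integrable_const_interval: "integrable (interval T) (\<lambda>t. c :: real)"
proof -
  have "emeasure lebesgue {0<..<T} < \<infinity>" by (cases "T \<ge> 0") auto
  hence "finite_measure (interval T)" by (intro finite_measureI) (simp add: emeasure_restrict_space)
  thus ?thesis by (rule finite_measure.integrable_const)
qed

lemma L1_continuous:
  fixes f :: "real \<Rightarrow> 'b::real_normed_vector"
  assumes "continuous_on {0..T} f" shows "L1 T f"
proof -
  obtain M where M: "\<And>t. t \<in> {0..T} \<Longrightarrow> norm (f t) \<le> M" using continuous_bounded_Icc[OF assms] by blast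
  show ?thesis
    by (rule L1_dominated[OF continuous_strongly_measurable[OF assms] integrable_const_interval[of _ M]]) (use M in auto)
qed

lemma L1_cong_AE:
  assumes "L1 T f" "AE t in interval T. g t = f t" shows "L1 T g"
proof -
  have m: "strongly_measurable (interval T) g" using assms by (auto simp: L1_def intro: strongly_measurable_cong_AE)
  have "integrable (interval T) (\<lambda>t. norm (f t))" using assms by (simp add: L1_def)
  hence "integrable (interval T) (\<lambda>t. norm (g t))"
    by (rule Bochner_Integration.integrable_bound[OF _ strongly_measurable_norm[OF m]]) (use assms(2) in \<open>eventually_elim, simp\<close>)
  thus ?thesis using m by (simp add: L1_def)
qed

lemma L1_add:
  assumes "L1 T f" "L1 T g" shows "L1 T (\<lambda>t. f t + g t)"
proof (rule L1_dominated)
  show "strongly_measurable (interval T) (\<lambda>t. f t + g t)"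
    by (rule strongly_measurable_compose2) (use assms in \<open>auto simp: L1_def split_def intro!: continuous_intros\<close>)
  show "integrable (interval T) (\<lambda>t. norm (f t) + norm (g t))" using assms by (auto simp: L1_def)
qed (rule norm_triangle_ineq)

lemma L1_linear:
  assumes f: "L1 T f" and R: "bounded_linear R" shows "L1 T (\<lambda>t. R (f t))"
proof -
  obtain K where K: "\<And>x. norm (R x) \<le> norm x * K" using bounded_linear.bounded[OF R] by blast
  show ?thesis
  proof (rule L1_dominated)
    show "strongly_measurable (interval T) (\<lambda>t. R (f t))"
      by (rule strongly_measurable_compose) (use f in \<open>auto simp: L1_def intro: linear_continuous_on[OF R]\<close>)
    show "integrable (interval T) (\<lambda>t. norm (f t) * K)" using f by (auto simp: L1_def)
  qed (rule K)
qed

lemma L1_scaleC: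
  fixes f :: "real \<Rightarrow> 'e::complex_banach"
  assumes f: "L1 T f" and \<phi>: "continuous_on {0..T} \<phi>" shows "L1 T (\<lambda>t. \<phi> t *\<^sub>C f t)"
proof -
  obtain M where M: "\<And>t. t \<in> {0..T} \<Longrightarrow> norm (\<phi> t) \<le> M" using continuous_bounded_Icc[OF \<phi>] by blast
  show ?thesis
  proof (rule L1_dominated)
    show "strongly_measurable (interval T) (\<lambda>t. \<phi> t *\<^sub>C f t)"
      by (rule strongly_measurable_compose2[OF continuous_strongly_measurable[OF \<phi>]])
         (use f in \<open>auto simp: L1_def split_def intro!: continuous_intros\<close>)
    show "integrable (interval T) (\<lambda>t. M * norm (f t))" using f by (auto simp: L1_def)
    show "norm (\<phi> t *\<^sub>C f t) \<le> M * norm (f t)" if "t \<in> {0<..<T}" for t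
      using M[of t] that by (simp add: norm_scaleC mult_right_mono)
  qed
qed

text \<open>Two dominating functions are allowed so that one estimate covers sums as well as images
  under bounded operators.\<close>

lemma Lp_dominated:
  fixes f :: "real \<Rightarrow> 'e::complex_banach"
  assumes p: "1 < p" and f: "strongly_measurable (interval T) f" and g: "g \<in> Lp p T" and h: "h \<in> Lp p T"
    and C: "C \<ge> 0" and le: "\<And>t. t \<in> {0<..<T} \<Longrightarrow> norm (f t) \<le> C * (norm (g t) + norm (h t))"
  shows "f \<in> Lp p T"
proof -
  have m: "(\<lambda>t. norm (f t) powr p) \<in> borel_measurable (interval T)"
    using strongly_measurable_norm[OF f] by measurable
  have int: "integrable (interval T) (\<lambda>t. (2*C) powr p * (norm (g t) powr p + norm (h t) powr p))"
    using g h by (auto simp: Lp_def)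
  have "integrable (interval T) (\<lambda>t. norm (f t) powr p)"
  proof (rule Bochner_Integration.integrable_bound[OF int m], rule AE_I2)
    fix t assume "t \<in> space (interval T)"
    hence t: "t \<in> {0<..<T}" by simp
    define a where "a = max (norm (g t)) (norm (h t))"
    have a: "a \<ge> 0" "norm (g t) + norm (h t) \<le> 2 * a" by (auto simp: a_def max_def)
    have "norm (f t) \<le> 2 * C * a" using le[OF t] mult_left_mono[OF a(2) C] by simp
    hence "norm (f t) powr p \<le> (2 * C * a) powr p" by (rule powr_mono2[rotated 2]) (use p in auto)
    also have "\<dots> = (2 * C) powr p * a powr p" using C a by (simp add: powr_mult)
    also have "a powr p \<le> norm (g t) powr p + norm (h t) powr p" by (auto simp: a_def max_def)
    finally have "norm (f t) powr p \<le> (2*C) powr p * (norm (g t) powr p + norm (h t) powr p)"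
      by (simp add: mult_left_mono)
    thus "norm (norm (f t) powr p) \<le> norm ((2*C) powr p * (norm (g t) powr p + norm (h t) powr p))" by simp
  qed
  thus ?thesis using f by (simp add: Lp_def)
qed

lemma Lp_continuous:
  fixes f :: "real \<Rightarrow> 'e::complex_banach"
  assumes p: "1 < p" and f: "continuous_on {0..T} f" shows "f \<in> Lp p T"
proof -
  obtain M where M: "M > 0" "\<And>t. t \<in> {0..T} \<Longrightarrow> norm (f t) \<le> M" using continuous_bounded_Icc[OF f] by blast
  note m = continuous_strongly_measurable[OF f]
  have m2: "(\<lambda>t. norm (f t) powr p) \<in> borel_measurable (interval T)"
    using strongly_measurable_norm[OF m] by measurable
  have "integrable (interval T) (\<lambda>t. norm (f t) powr p)"
    by (rule Bochner_Integration.integrable_bound[OF integrable_const_interval[of _ "M powr p"] m2], rule AE_I2)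
       (use M p in \<open>auto intro!: powr_mono2\<close>)
  thus ?thesis using m by (simp add: Lp_def)
qed

lemma Lp_imp_L1:
  fixes f :: "real \<Rightarrow> 'e::complex_banach"
  assumes p: "1 < p" and f: "f \<in> Lp p T" shows "L1 T f"
proof (rule L1_dominated)
  show "strongly_measurable (interval T) f" using f by (simp add: Lp_def)
  show "integrable (interval T) (\<lambda>t. 1 + norm (f t) powr p)"
    using f integrable_const_interval[of T 1] by (auto simp: Lp_def)
  fix t
  show "norm (f t) \<le> 1 + norm (f t) powr p"
  proof (cases "norm (f t) \<le> 1")
    case False
    hence "norm (f t) powr 1 \<le> norm (f t) powr p" by (intro powr_mono) (use p in auto)
    thus ?thesis using False by simp
  qed (simp add: add_increasing2)
qed

lemma Lp_cong_AE:
  fixes f :: "real \<Rightarrow> 'e::complex_banach"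
  assumes f: "f \<in> Lp p T" and ae: "AE t in interval T. g t = f t" shows "g \<in> Lp p T"
proof -
  have m: "strongly_measurable (interval T) g" using assms by (auto simp: Lp_def intro: strongly_measurable_cong_AE)
  have int: "integrable (interval T) (\<lambda>t. norm (f t) powr p)" using f by (simp add: Lp_def)
  have m2: "(\<lambda>t. norm (g t) powr p) \<in> borel_measurable (interval T)"
    using strongly_measurable_norm[OF m] by measurable
  have "integrable (interval T) (\<lambda>t. norm (g t) powr p)"
    by (rule Bochner_Integration.integrable_bound[OF int m2]) (use ae in \<open>eventually_elim, simp\<close>)
  thus ?thesis using m by (simp add: Lp_def)
qed

lemma Lp_linear:
  assumes p: "1 < p" and f: "f \<in> Lp p T" and R: "bounded_linear R" shows "(\<lambda>t. R (f t)) \<in> Lp p T"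
proof -
  obtain K where K: "K \<ge> 0" "\<And>x. norm (R x) \<le> norm x * K" using bounded_linear.nonneg_bounded[OF R] by blast
  show ?thesis
  proof (rule Lp_dominated[OF p _ f f K(1)])
    show "strongly_measurable (interval T) (\<lambda>t. R (f t))"
      by (rule strongly_measurable_compose) (use f in \<open>auto simp: Lp_def intro: linear_continuous_on[OF R]\<close>)
    show "norm (R (f t)) \<le> K * (norm (f t) + norm (f t))" for t
    proof -
      have "0 \<le> K * norm (f t)" using K(1) by simp
      thus ?thesis using K(2)[of "f t"] unfolding distrib_left mult.commute[of "norm (f t)"] by linarith
    qed
  qed
qed

lemma Lp_add:
  assumes p: "1 < p" and f: "f \<in> Lp p T" and g: "g \<in> Lp p T" shows "(\<lambda>t. f t + g t) \<in> Lp p T"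
proof (rule Lp_dominated[OF p _ f g])
  show "strongly_measurable (interval T) (\<lambda>t. f t + g t)"
    by (rule strongly_measurable_compose2) (use assms in \<open>auto simp: Lp_def split_def intro!: continuous_intros\<close>)
  show "norm (f t + g t) \<le> 1 * (norm (f t) + norm (g t))" for t by (simp add: norm_triangle_ineq)
qed simp

section \<open>The operator of differentiation\<close>

lemma has_vector_derivative_exp_scaled:
  "((\<lambda>x. exp (z * complex_of_real x)) has_vector_derivative z * exp (z * complex_of_real x)) (at x within S)"
  by (rule has_vector_derivative_real_field) (auto intro!: derivative_eq_intros)

text \<open>The continuous representative of \<open>(B + z)^(-1) g\<close>. Fixing it makes the
  resolvent calculus of B hold at every t.\<close>

definition vol :: "complex \<Rightarrow> (real \<Rightarrow> 'e) \<Rightarrow> real \<Rightarrow> 'e::complex_banach" where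
  "vol z g t = integral {0..t} (\<lambda>x. exp (z * complex_of_real (x - t)) *\<^sub>C g x)"

lemma L1_exp:
  fixes g :: "real \<Rightarrow> 'e::complex_banach"
  assumes "L1 T g" shows "L1 T (\<lambda>x. exp (z * complex_of_real (x - t)) *\<^sub>C g x)"
  by (rule L1_scaleC[OF assms]) (intro continuous_intros)

lemma integral_scaleC_right:
  fixes g :: "real \<Rightarrow> 'e::complex_banach"
  assumes "g integrable_on S" shows "integral S (\<lambda>x. c *\<^sub>C g x) = c *\<^sub>C integral S g"
  using integral_linear[OF assms scaleC.bounded_linear_right, of c] by (simp add: o_def)

lemma vol_exp:
  fixes g :: "real \<Rightarrow> 'e::complex_banach"
  assumes g: "L1 T g" and t: "t \<in> {0..T}"
  shows "vol z g t = exp (- z * complex_of_real t) *\<^sub>C integral {0..t} (\<lambda>x. exp (z * complex_of_real x) *\<^sub>C g x)"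
proof -
  have "L1 T (\<lambda>x. exp (z * complex_of_real x) *\<^sub>C g x)" using L1_exp[OF g, of z 0] by simp
  hence i: "(\<lambda>x. exp (z * complex_of_real x) *\<^sub>C g x) integrable_on {0..t}" by (rule L1_integrable) (use t in auto)
  have "exp (z * complex_of_real (x - t)) = exp (- z * complex_of_real t) * exp (z * complex_of_real x)" for x
    by (simp add: exp_add[symmetric] algebra_simps)
  thus ?thesis unfolding vol_def
    by (simp add: scaleC_scaleC[symmetric] integral_scaleC_right[OF i])
qed

lemma L1_diff:
  fixes f g :: "real \<Rightarrow> 'b::real_normed_vector"
  assumes "L1 T f" "L1 T g" shows "L1 T (\<lambda>t. f t - g t)"
  using L1_add[OF assms(1) L1_linear[OF assms(2) bounded_linear_minus[OF bounded_linear_ident]]] by simp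

lemma L1_scaleC_const:
  fixes f :: "real \<Rightarrow> 'e::complex_banach"
  assumes "L1 T f" shows "L1 T (\<lambda>t. c *\<^sub>C f t)"
  by (rule L1_scaleC[OF assms]) (rule continuous_on_const)

lemma ibp_exp:
  fixes f u :: "real \<Rightarrow> 'e::complex_banach"
  assumes f: "L1 T f" and t: "t \<in> {0..T}" and u: "\<And>x. x \<in> {0..T} \<Longrightarrow> u x = integral {0..x} f"
  shows "exp (z * complex_of_real t) *\<^sub>C u t = integral {0..t} (\<lambda>x. exp (z * complex_of_real x) *\<^sub>C f x)
     + integral {0..t} (\<lambda>x. (z * exp (z * complex_of_real x)) *\<^sub>C u x)"
proof -
  have s: "{0..t} \<subseteq> {0..T}" using t by auto
  have u0: "u 0 = 0" using u[of 0] t by auto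
  have e: "L1 T (\<lambda>x. exp (z * complex_of_real x) *\<^sub>C f x)" using L1_exp[OF f, of z 0] by simp
  have "exp (z * complex_of_real t) *\<^sub>C u t - exp (z * complex_of_real 0) *\<^sub>C u 0
     = integral {0..t} (\<lambda>x. exp (z * complex_of_real x) *\<^sub>C f x)
     + integral {0..t} (\<lambda>x. (z * exp (z * complex_of_real x)) *\<^sub>C u x)"
    by (rule integration_by_parts_scaleC)
       (use t u u0 s L1_integrable[OF f s] L1_integrable[OF e s] has_vector_derivative_exp_scaled
        in \<open>auto intro!: continuous_intros\<close>)
  thus ?thesis by (simp add: u0)
qed

lemma integral_continuous_L1:
  fixes f :: "real \<Rightarrow> 'b::banach"
  assumes "L1 T f" shows "continuous_on {0..T} (\<lambda>t. integral {0..t} f)"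
  by (rule indefinite_integral_continuous_1, rule L1_integrable[OF assms]) simp

text \<open>Uniqueness for f' + z f = g, f(0) = 0 in integrated form. The integrating factor exp(z
  t) is applied through integration by parts, which also covers data \<open>g\<close> that are only
  integrable.\<close>

lemma vol_eqI:
  fixes f g :: "real \<Rightarrow> 'e::complex_banach"
  assumes g: "L1 T g" and fc: "continuous_on {0..T} f"
    and eq: "\<And>t. t \<in> {0..T} \<Longrightarrow> f t = integral {0..t} (\<lambda>x. g x - z *\<^sub>C f x)" and t: "t \<in> {0..T}"
  shows "f t = vol z g t"
proof -
  let ?e = "\<lambda>x. exp (z * complex_of_real x)"
  have s: "{0..t} \<subseteq> {0..T}" using t by auto
  have f1: "L1 T f" by (rule L1_continuous[OF fc])
  have d: "L1 T (\<lambda>x. g x - z *\<^sub>C f x)" by (intro L1_diff g L1_scaleC_const f1)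
  have eg: "L1 T (\<lambda>x. ?e x *\<^sub>C g x)" using L1_exp[OF g, of z 0] by simp
  have ef: "L1 T (\<lambda>x. (z * ?e x) *\<^sub>C f x)" by (rule L1_scaleC[OF f1]) (intro continuous_intros)
  have "?e t *\<^sub>C f t = integral {0..t} (\<lambda>x. ?e x *\<^sub>C (g x - z *\<^sub>C f x)) + integral {0..t} (\<lambda>x. (z * ?e x) *\<^sub>C f x)"
    by (rule ibp_exp[OF d t eq])
  also have "(\<lambda>x. ?e x *\<^sub>C (g x - z *\<^sub>C f x)) = (\<lambda>x. ?e x *\<^sub>C g x - (z * ?e x) *\<^sub>C f x)"
    by (simp add: scaleC.diff_right scaleC_scaleC mult.commute)
  also have "integral {0..t} \<dots> = integral {0..t} (\<lambda>x. ?e x *\<^sub>C g x) - integral {0..t} (\<lambda>x. (z * ?e x) *\<^sub>C f x)"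
    by (rule integral_diff[OF L1_integrable(1)[OF eg s] L1_integrable(1)[OF ef s]])
  finally have "exp (- z * complex_of_real t) *\<^sub>C (?e t *\<^sub>C f t) = vol z g t" by (simp add: vol_exp[OF g t])
  thus ?thesis by (simp add: scaleC_scaleC exp_minus_inverse exp_add[symmetric] scaleC_one)
qed

lemma vol_continuous:
  fixes g :: "real \<Rightarrow> 'e::complex_banach"
  assumes g: "L1 T g" shows "continuous_on {0..T} (vol z g)"
proof -
  have e: "L1 T (\<lambda>x. exp (z * complex_of_real x) *\<^sub>C g x)" using L1_exp[OF g, of z 0] by simp
  have "continuous_on {0..T} (\<lambda>t. exp (- z * complex_of_real t) *\<^sub>C integral {0..t} (\<lambda>x. exp (z * complex_of_real x) *\<^sub>C g x))"
    by (intro continuous_intros integral_continuous_L1[OF e])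
  thus ?thesis by (rule continuous_on_eq) (simp add: vol_exp[OF g])
qed

text \<open>The existence counterpart of \<open>vol_eqI\<close>: integrate exp(- z x) by parts
  against the primitive of exp(z x) g.\<close>

lemma vol_integral:
  fixes g :: "real \<Rightarrow> 'e::complex_banach"
  assumes g: "L1 T g" and t: "t \<in> {0..T}"
  shows "vol z g t = integral {0..t} (\<lambda>x. g x - z *\<^sub>C vol z g x)"
proof -
  let ?e = "\<lambda>x. exp (z * complex_of_real x)" and ?e' = "\<lambda>x. exp (- z * complex_of_real x)"
  have s: "{0..t} \<subseteq> {0..T}" using t by auto
  have e: "L1 T (\<lambda>x. ?e x *\<^sub>C g x)" using L1_exp[OF g, of z 0] by simp
  have v: "L1 T (\<lambda>x. z *\<^sub>C vol z g x)" by (intro L1_scaleC_const L1_continuous vol_continuous g)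
  let ?w = "\<lambda>t. integral {0..t} (\<lambda>x. ?e x *\<^sub>C g x)"
  have "vol z g t = ?e' t *\<^sub>C ?w t" by (rule vol_exp[OF g t])
  also have "\<dots> = integral {0..t} (\<lambda>x. ?e' x *\<^sub>C (?e x *\<^sub>C g x)) + integral {0..t} (\<lambda>x. (- z * ?e' x) *\<^sub>C ?w x)"
    by (rule ibp_exp[OF e t]) simp
  also have "(\<lambda>x. ?e' x *\<^sub>C (?e x *\<^sub>C g x)) = g"
    by (simp add: scaleC_scaleC exp_add[symmetric] scaleC_one)
  also have "integral {0..t} (\<lambda>x. (- z * ?e' x) *\<^sub>C ?w x) = integral {0..t} (\<lambda>x. - (z *\<^sub>C vol z g x))"
    by (rule integral_cong) (use s vol_exp[OF g] in \<open>auto simp: scaleC_scaleC[symmetric] scaleC.minus_left\<close>)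
  also have "\<dots> = - integral {0..t} (\<lambda>x. z *\<^sub>C vol z g x)" by simp
  also have "integral {0..t} g + - integral {0..t} (\<lambda>x. z *\<^sub>C vol z g x) = integral {0..t} (\<lambda>x. g x - z *\<^sub>C vol z g x)"
    using integral_diff[OF L1_integrable(1)[OF g s] L1_integrable(1)[OF v s]] by simp
  finally show ?thesis .
qed

lemma vol_cong_AE:
  fixes g h :: "real \<Rightarrow> 'e::complex_banach"
  assumes "AE t in interval T. g t = h t" "t \<in> {0..T}" shows "vol z g t = vol z h t"
  unfolding vol_def
  by (rule integral_cong_AE_interval) (use assms(1) in \<open>eventually_elim, simp\<close>, use assms(2) in auto)

lemma vol_cong:
  assumes "\<And>x. x \<in> {0..t} \<Longrightarrow> g x = h x" shows "vol z g t = vol z h t"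
  unfolding vol_def by (rule integral_cong) (simp add: assms)

lemma vol_linear:
  fixes g :: "real \<Rightarrow> 'e::complex_banach"
  assumes g: "L1 T g" and t: "t \<in> {0..T}" and R: "bounded_complex_linear R"
  shows "vol z (\<lambda>x. R (g x)) t = R (vol z g t)"
proof -
  have "(\<lambda>x. exp (z * complex_of_real (x - t)) *\<^sub>C g x) integrable_on {0..t}"
    by (rule L1_integrable(1)[OF L1_exp[OF g]]) (use t in auto)
  from integral_linear[OF this, of R] R show ?thesis
    unfolding vol_def bounded_complex_linear_def by (simp add: o_def)
qed

lemma vol_add:
  fixes g h :: "real \<Rightarrow> 'e::complex_banach"
  assumes g: "L1 T g" and h: "L1 T h" and t: "t \<in> {0..T}"
  shows "vol z (\<lambda>x. g x + h x) t = vol z g t + vol z h t"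
  unfolding vol_def scaleC.add_right
  by (rule integral_add; rule L1_integrable(1)[OF L1_exp]; use g h t in auto)

lemma vol_scaleC:
  fixes g :: "real \<Rightarrow> 'e::complex_banach"
  assumes g: "L1 T g" and t: "t \<in> {0..T}"
  shows "vol z (\<lambda>x. c *\<^sub>C g x) t = c *\<^sub>C vol z g t"
proof -
  have i: "(\<lambda>x. exp (z * complex_of_real (x - t)) *\<^sub>C g x) integrable_on {0..t}"
    by (rule L1_integrable(1)[OF L1_exp[OF g]]) (use t in auto)
  show ?thesis unfolding vol_def integral_scaleC_right[OF i, symmetric]
    by (simp add: scaleC_scaleC mult.commute)
qed

text \<open>The resolvent identity of B, by uniqueness: \<open>vol l g\<close> also solves the
  equation with parameter z, for the right hand side
  \<open>g x + (z - l) *\<^sub>C vol l g x\<close>.\<close>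

lemma vol_resolvent:
  fixes g :: "real \<Rightarrow> 'e::complex_banach"
  assumes g: "L1 T g" and t: "t \<in> {0..T}"
  shows "vol z g t - vol l g t = (l - z) *\<^sub>C vol z (vol l g) t"
proof -
  have vl: "L1 T (vol l g)" by (intro L1_continuous vol_continuous g)
  have h: "L1 T (\<lambda>x. (z - l) *\<^sub>C vol l g x)" by (rule L1_scaleC_const[OF vl])
  have "vol l g t = vol z (\<lambda>x. g x + (z - l) *\<^sub>C vol l g x) t"
  proof (rule vol_eqI[OF L1_add[OF g h] vol_continuous[OF g] _ t])
    fix s assume "s \<in> {0..T}"
    from vol_integral[OF g this, of l]
    show "vol l g s = integral {0..s} (\<lambda>x. g x + (z - l) *\<^sub>C vol l g x - z *\<^sub>C vol l g x)"
      by (simp add: scaleC.diff_left)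
  qed
  also have "\<dots> = vol z g t + (z - l) *\<^sub>C vol z (vol l g) t"
    by (simp add: vol_add[OF g h t] vol_scaleC[OF vl t])
  finally have "vol l g t = vol z g t + (z - l) *\<^sub>C vol z (vol l g) t" .
  thus ?thesis by (simp add: scaleC.diff_left)
qed

text \<open>(B + z)^(-1) B u = u - z (B + z)^(-1) u for u(0) = 0. Read from right to left, every
  derivative of u in time gains a factor 1/z in the decay of \<open>vol z u\<close>.\<close>

lemma vol_deriv:
  fixes u u' :: "real \<Rightarrow> 'e::complex_banach"
  assumes u': "L1 T u'" and u: "\<And>s. s \<in> {0..T} \<Longrightarrow> u s = integral {0..s} u'" and t: "t \<in> {0..T}"
  shows "vol z u' t = u t - z *\<^sub>C vol z u t"
proof -
  have uc: "continuous_on {0..T} u" by (rule continuous_on_eq[OF integral_continuous_L1[OF u']]) (simp add: u)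
  note u1 = L1_continuous[OF uc]
  note vc = vol_continuous[OF u1, of z]
  have "u t - z *\<^sub>C vol z u t = vol z u' t"
  proof (rule vol_eqI[OF u' _ _ t])
    show "continuous_on {0..T} (\<lambda>t. u t - z *\<^sub>C vol z u t)" by (intro continuous_intros uc vc)
    fix s assume s: "s \<in> {0..T}"
    hence sub: "{0..s} \<subseteq> {0..T}" by auto
    have d: "L1 T (\<lambda>x. u x - z *\<^sub>C vol z u x)" by (intro L1_continuous continuous_intros uc vc)
    have "u s - z *\<^sub>C vol z u s = integral {0..s} u' - z *\<^sub>C integral {0..s} (\<lambda>x. u x - z *\<^sub>C vol z u x)"
      using u[OF s] vol_integral[OF u1 s, of z] by simp
    also have "\<dots> = integral {0..s} u' - integral {0..s} (\<lambda>x. z *\<^sub>C (u x - z *\<^sub>C vol z u x))"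
      by (simp add: integral_scaleC_right[OF L1_integrable(1)[OF d sub]])
    also have "\<dots> = integral {0..s} (\<lambda>x. u' x - z *\<^sub>C (u x - z *\<^sub>C vol z u x))"
      by (rule integral_diff[symmetric]; rule L1_integrable(1)[OF _ sub]; intro u' L1_scaleC_const d)
    finally show "u s - z *\<^sub>C vol z u s = integral {0..s} (\<lambda>x. u' x - z *\<^sub>C (u x - z *\<^sub>C vol z u x))" .
  qed
  thus ?thesis by simp
qed

lemma vol_norm_le:
  fixes g :: "real \<Rightarrow> 'e::complex_banach"
  assumes g: "L1 T g" and t: "t \<in> {0..T}" and a: "- a \<le> Re z" "a \<ge> 0"
  shows "norm (vol z g t) \<le> exp (a * T) * integral {0..T} (\<lambda>x. norm (g x))"
proof -
  have s: "{0..t} \<subseteq> {0..T}" using t by auto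
  have n: "(\<lambda>x. norm (g x)) integrable_on {0..t}" "(\<lambda>x. norm (g x)) integrable_on {0..T}"
    using L1_integrable(2)[OF g] s by auto
  have "norm (vol z g t) \<le> integral {0..t} (\<lambda>x. exp (a * T) * norm (g x))"
    unfolding vol_def
  proof (rule integral_norm_bound_integral)
    show "(\<lambda>x. exp (z * complex_of_real (x - t)) *\<^sub>C g x) integrable_on {0..t}"
      by (rule L1_integrable(1)[OF L1_exp[OF g] s])
    show "(\<lambda>x. exp (a * T) * norm (g x)) integrable_on {0..t}"
      using integrable_on_cmult_left[OF n(1), of "exp (a * T)"] by simp
    fix x assume x: "x \<in> {0..t}"
    have "Re z * (x - t) \<le> a * T"
    proof -
      have "Re z * (x - t) = - Re z * (t - x)" by (simp add: algebra_simps)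
      also have "\<dots> \<le> a * (t - x)" by (rule mult_right_mono) (use a x in auto)
      also have "\<dots> \<le> a * T" by (rule mult_left_mono) (use a x t in auto)
      finally show ?thesis .
    qed
    hence "cmod (exp (z * complex_of_real (x - t))) \<le> exp (a * T)" by (simp add: norm_exp_eq_Re)
    thus "norm (exp (z * complex_of_real (x - t)) *\<^sub>C g x) \<le> exp (a * T) * norm (g x)"
      by (simp add: norm_scaleC mult_right_mono)
  qed
  also have "\<dots> = exp (a * T) * integral {0..t} (\<lambda>x. norm (g x))" by simp
  also have "\<dots> \<le> exp (a * T) * integral {0..T} (\<lambda>x. norm (g x))"
    by (intro mult_left_mono integral_subset_le s n) auto
  finally show ?thesis .
qed

text \<open>By the resolvent identity \<open>vol z g\<close> is Lipschitz in z near each point,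
  uniformly in t; joint continuity then follows from continuity in t alone.\<close>

lemma vol_continuous2:
  fixes g :: "real \<Rightarrow> 'e::complex_banach"
  assumes g: "L1 T g"
  shows "continuous_on (UNIV \<times> {0..T}) (\<lambda>(z, t). vol z g t)"
proof (rule continuous_on_sequentiallyI, clarify)
  fix u :: "nat \<Rightarrow> complex \<times> real" and l t0
  assume u: "\<forall>n. u n \<in> UNIV \<times> {0..T}" and t0: "t0 \<in> {0..T}" and lim: "u \<longlonglongrightarrow> (l, t0)"
  have z: "(\<lambda>n. fst (u n)) \<longlonglongrightarrow> l" and t: "(\<lambda>n. snd (u n)) \<longlonglongrightarrow> t0"
    using tendsto_fst[OF lim] tendsto_snd[OF lim] by simp_all
  have tT: "snd (u n) \<in> {0..T}" for n using u by (metis mem_Times_iff)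
  define a where "a = cmod l + 1"
  define C where "C = exp (a * T) * integral {0..T} (\<lambda>x. norm (vol l g x))"
  have vl: "L1 T (vol l g)" by (intro L1_continuous vol_continuous g)
  have "(\<lambda>n. vol (fst (u n)) g (snd (u n)) - vol l g (snd (u n))) \<longlonglongrightarrow> 0"
  proof (rule Lim_null_comparison)
    show "(\<lambda>n. cmod (l - fst (u n)) * C) \<longlonglongrightarrow> 0"
      by (rule tendsto_mult_left_zero, rule tendsto_norm_zero)
         (use tendsto_diff[OF tendsto_const z, of l] in simp)
    have "\<forall>\<^sub>F n in sequentially. dist (fst (u n)) l < 1" using z by (rule tendstoD) simp
    thus "\<forall>\<^sub>F n in sequentially. norm (vol (fst (u n)) g (snd (u n)) - vol l g (snd (u n))) \<le> cmod (l - fst (u n)) * C"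
    proof eventually_elim
      fix n assume d: "dist (fst (u n)) l < 1"
      have "\<bar>Re (fst (u n))\<bar> \<le> a" using d abs_Re_le_cmod[of "fst (u n)"] norm_triangle_sub[of "fst (u n)" l]
        by (simp add: a_def dist_norm)
      hence "norm (vol (fst (u n)) (vol l g) (snd (u n))) \<le> C"
        unfolding C_def by (intro vol_norm_le[OF vl tT]) (auto simp: a_def)
      thus "norm (vol (fst (u n)) g (snd (u n)) - vol l g (snd (u n))) \<le> cmod (l - fst (u n)) * C"
        by (simp add: vol_resolvent[OF g tT] norm_scaleC mult_left_mono)
    qed
  qed
  moreover have "(\<lambda>n. vol l g (snd (u n))) \<longlonglongrightarrow> vol l g t0"
    by (rule continuous_on_tendsto_compose[OF vol_continuous[OF g] t t0]) (rule always_eventually, use tT in blast)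
  ultimately have "(\<lambda>n. vol (fst (u n)) g (snd (u n))) \<longlonglongrightarrow> vol l g t0"
    using tendsto_add by fastforce
  thus "(\<lambda>n. (\<lambda>(z, t). vol z g t) (u n)) \<longlonglongrightarrow> vol l g t0" by (simp add: split_def)
qed

text \<open>Building block for piecewise quadratic test functions, which are continuously
  differentiable and no smoother than the definition of the weak derivative requires.\<close>

lemma has_real_derivative_times_abs:
  "((\<lambda>s. s * \<bar>s\<bar>) has_real_derivative 2 * \<bar>s\<bar>) (at (s::real))"
proof (cases "s = 0")
  case True
  have "(\<lambda>h. \<bar>h\<bar>) \<midarrow>0\<rightarrow> (0::real)" using tendsto_rabs[OF tendsto_ident_at, of 0 UNIV] by simp
  moreover have "\<forall>\<^sub>F h in at 0. \<bar>h\<bar> = (h * \<bar>h\<bar>) / (h::real)"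
    by (rule eventually_at_topological[THEN iffD2]) (auto intro: exI[of _ UNIV])
  ultimately have "(\<lambda>h::real. (h * \<bar>h\<bar>) / h) \<midarrow>0\<rightarrow> 0" by (rule Lim_transform_eventually)
  thus ?thesis using True by (simp add: DERIV_def)
next
  case False
  show ?thesis
  proof (cases "s > 0")
    case True
    have "((\<lambda>s::real. s * s) has_real_derivative 2 * \<bar>s\<bar>) (at s)" using True by (auto intro!: derivative_eq_intros)
    thus ?thesis by (rule has_field_derivative_transform_within_open[of _ _ _ "{0<..}"]) (use True in auto)
  next
    case F: False
    hence "s < 0" using False by simp
    have "((\<lambda>s::real. - s * s) has_real_derivative 2 * \<bar>s\<bar>) (at s)" using \<open>s < 0\<close> by (auto intro!: derivative_eq_intros)
    thus ?thesis by (rule has_field_derivative_transform_within_open[of _ _ _ "{..<0}"]) (use \<open>s < 0\<close> in auto)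
  qed
qed

lemma L1_scaleR:
  fixes f :: "real \<Rightarrow> 'e::complex_banach"
  assumes f: "L1 T f" and \<phi>: "continuous_on {0..T} \<phi>" shows "L1 T (\<lambda>t. \<phi> t *\<^sub>R f t)"
proof -
  have "continuous_on {0..T} (\<lambda>t. complex_of_real (\<phi> t))" by (intro continuous_intros \<phi>)
  from L1_scaleC[OF f this] show ?thesis by (simp add: scaleC_of_real)
qed

lemma bochner_interval:
  fixes f :: "real \<Rightarrow> 'b::banach"
  assumes "L1 T f" shows "bochner (interval T) f = integral {0..T} f"
proof -
  have "bochner (interval T) f = integral {0<..<T} f" by (rule bochner_eq_integral) (use assms in \<open>auto simp: L1_def\<close>)
  also have "\<dots> = integral {0..T} f"
  proof (rule integral_spike_set)
    show "negligible {x \<in> {0<..<T} - {0..T}. f x \<noteq> 0}" by (rule negligible_subset[of "{}"]) auto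
    show "negligible {x \<in> {0..T} - {0<..<T}. f x \<noteq> 0}" by (rule negligible_subset[of "{0, T}"]) auto
  qed
  finally show ?thesis .
qed

lemma has_weak_derivative_integral:
  fixes f' :: "real \<Rightarrow> 'e::complex_banach"
  assumes T: "T > 0" and f': "L1 T f'" and f: "AE t in interval T. f t = integral {0..t} f'"
  shows "has_weak_derivative T f f'"
  unfolding has_weak_derivative_def
proof (intro allI impI, elim conjE)
  fix \<phi> \<phi>' :: "real \<Rightarrow> real" and K
  assume d: "\<forall>t. (\<phi> has_real_derivative \<phi>' t) (at t)" and c: "continuous_on UNIV \<phi>'"
    and K: "compact K" "K \<subseteq> {0<..<T}" "\<forall>t. t \<notin> K \<longrightarrow> \<phi> t = 0"
  let ?u = "\<lambda>t. integral {0..t} f'"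
  have uc: "continuous_on {0..T} ?u" by (rule integral_continuous_L1[OF f'])
  have \<phi>'c: "continuous_on {0..T} \<phi>'" by (rule continuous_on_subset[OF c]) simp
  have \<phi>c: "continuous_on {0..T} \<phi>" by (meson DERIV_isCont continuous_at_imp_continuous_on d)
  have fu: "L1 T (\<lambda>t. \<phi>' t *\<^sub>R f t)"
    by (rule L1_cong_AE[OF L1_scaleR[OF L1_continuous[OF uc] \<phi>'c]]) (use f in \<open>eventually_elim, simp\<close>)
  have ff: "L1 T (\<lambda>t. \<phi> t *\<^sub>R f' t)" by (rule L1_scaleR[OF f' \<phi>c])
  have e: "complex_of_real (\<phi> T) *\<^sub>C ?u T - complex_of_real (\<phi> 0) *\<^sub>C ?u 0 =
     integral {0..T} (\<lambda>x. complex_of_real (\<phi> x) *\<^sub>C f' x) + integral {0..T} (\<lambda>x. complex_of_real (\<phi>' x) *\<^sub>C ?u x)"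
  proof (rule integration_by_parts_scaleC)
    show "(\<lambda>x. complex_of_real (\<phi> x) *\<^sub>C f' x) integrable_on {0..T}"
      using L1_integrable(1)[OF ff, of 0 T] by (simp add: scaleC_of_real)
    show "((\<lambda>x. complex_of_real (\<phi> x)) has_vector_derivative complex_of_real (\<phi>' x)) (at x within {0..T})" for x
    proof -
      have "(\<phi> has_vector_derivative \<phi>' x) (at x within {0..T})"
        using d by (meson has_real_derivative_iff_has_vector_derivative has_vector_derivative_at_within)
      from bounded_linear.has_vector_derivative[OF bounded_linear_of_real this] show ?thesis .
    qed
  qed (use T L1_integrable[OF f', of 0 T] in \<open>auto intro!: continuous_intros \<phi>'c\<close>)
  have "\<phi> T = 0" "\<phi> 0 = 0" using K by auto
  hence "integral {0..T} (\<lambda>x. \<phi>' x *\<^sub>R ?u x) = - integral {0..T} (\<lambda>x. \<phi> x *\<^sub>R f' x)"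
    using e by (simp add: scaleC_of_real eq_neg_iff_add_eq_0 add.commute)
  moreover have "integral {0..T} (\<lambda>x. \<phi>' x *\<^sub>R f x) = integral {0..T} (\<lambda>x. \<phi>' x *\<^sub>R ?u x)"
    by (rule integral_cong_AE_interval) (use f in \<open>eventually_elim, simp\<close>, simp)
  ultimately show "bochner (interval T) (\<lambda>t. \<phi>' t *\<^sub>R f t) = - bochner (interval T) (\<lambda>t. \<phi> t *\<^sub>R f' t)"
    by (simp add: bochner_interval[OF fu] bochner_interval[OF ff])
qed

text \<open>The lemma of du Bois-Reymond for continuous functions. The derivative of the test
  function is the difference of two equal bumps at \<open>a\<close> and \<open>b\<close>, and each
  bump nearly reproduces the value of \<open>d\<close> at its centre.\<close>

lemma continuous_weak_derivative_zero:
  fixes d :: "real \<Rightarrow> 'e::complex_banach"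
  assumes T: "T > 0" and d: "continuous_on {0..T} d"
    and z: "\<And>\<phi> \<phi>' K. (\<forall>t. (\<phi> has_real_derivative \<phi>' t) (at t)) \<Longrightarrow> continuous_on UNIV \<phi>' \<Longrightarrow>
        compact K \<Longrightarrow> K \<subseteq> {0<..<T} \<Longrightarrow> (\<forall>t. t \<notin> K \<longrightarrow> \<phi> t = 0) \<Longrightarrow> integral {0..T} (\<lambda>t. \<phi>' t *\<^sub>R d t) = 0"
    and ab: "0 < a" "a < b" "b < T"
  shows "d a = d b"
proof -
  have est: "norm (d a - d b) \<le> 2 * e" if e: "e > 0" for e
  proof -
    obtain \<delta> where \<delta>: "\<delta> > 0" "\<And>x y. x \<in> {0..T} \<Longrightarrow> y \<in> {0..T} \<Longrightarrow> dist y x < \<delta> \<Longrightarrow> dist (d y) (d x) < e"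
      using compact_uniformly_continuous[OF d compact_Icc] e unfolding uniformly_continuous_on_def by metis
    define h where "h = min (\<delta>/2) (min a (T - b)) / 2"
    have h: "h > 0" "h < \<delta>" "h < a" "b + h < T" using \<delta>(1) ab by (auto simp: h_def min_def field_simps)
    \<comment> \<open>\<open>k\<close> is the hat function on [-h,h] of height 2h and mass 2h^2, and
      \<open>Q\<close> its odd primitive, which is constant, - h^2 or h^2, outside [-h,h]. So the
      difference of two translates of \<open>Q\<close> has compact support.\<close>
    define Q where "Q s = ((s + h) * \<bar>s + h\<bar> + (s - h) * \<bar>s - h\<bar> - 2 * (s * \<bar>s\<bar>)) / 2" for s
    define k where "k s = \<bar>s + h\<bar> + \<bar>s - h\<bar> - 2 * \<bar>s\<bar>" for s
    have Qd: "((\<lambda>t. Q (t - c)) has_real_derivative k (t - c)) (at t)" for t c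
    proof -
      note D = DERIV_chain2[OF has_real_derivative_times_abs]
      have 1: "((\<lambda>t. (t - c + h) * \<bar>t - c + h\<bar>) has_real_derivative 2 * \<bar>t - c + h\<bar> * 1) (at t)"
        by (rule D) (auto intro!: derivative_eq_intros)
      have 2: "((\<lambda>t. (t - c - h) * \<bar>t - c - h\<bar>) has_real_derivative 2 * \<bar>t - c - h\<bar> * 1) (at t)"
        by (rule D) (auto intro!: derivative_eq_intros)
      have 3: "((\<lambda>t. (t - c) * \<bar>t - c\<bar>) has_real_derivative 2 * \<bar>t - c\<bar> * 1) (at t)"
        by (rule D) (auto intro!: derivative_eq_intros)
      show ?thesis unfolding Q_def k_def
        by (rule DERIV_cong[OF DERIV_cdivide[OF DERIV_diff[OF DERIV_add[OF 1 2] DERIV_cmult[OF 3, of 2]], of 2]]) simp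
    qed
    have Q1: "Q s = h * h" if "s \<ge> h" for s using that h by (simp add: Q_def algebra_simps)
    have Q2: "Q s = - (h * h)" if "s \<le> - h" for s using that h by (simp add: Q_def algebra_simps)
    have k0: "k s = 0" if "\<bar>s\<bar> \<ge> h" for s using that h by (auto simp: k_def abs_if split: if_splits)
    have kn: "k s \<ge> 0" for s by (simp add: k_def abs_if)
    have kc: "continuous_on S (\<lambda>t. k (t - c))" for S c unfolding k_def by (intro continuous_intros)
    have int1: "((\<lambda>t. k (t - c)) has_integral 2 * (h * h)) {0..T}" if "h \<le> c" "c + h \<le> T" for c
    proof -
      have "((\<lambda>t. k (t - c)) has_integral Q (T - c) - Q (0 - c)) {0..T}"
        by (rule fundamental_theorem_of_calculus)
           (use T in simp, rule has_vector_derivative_at_within, rule Qd[unfolded has_real_derivative_iff_has_vector_derivative])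
      thus ?thesis using that by (simp add: Q1 Q2)
    qed
    have "integral {0..T} (\<lambda>t. (k (t - a) - k (t - b)) *\<^sub>R d t) = 0"
    proof (rule z[of "\<lambda>t. Q (t - a) - Q (t - b)" _ "{a - h..b + h}"])
      show "\<forall>t. ((\<lambda>t. Q (t - a) - Q (t - b)) has_real_derivative k (t - a) - k (t - b)) (at t)"
        by (intro allI DERIV_diff Qd)
      show "continuous_on UNIV (\<lambda>t. k (t - a) - k (t - b))" by (intro continuous_on_diff kc)
      show "{a - h..b + h} \<subseteq> {0<..<T}" using h by auto
      show "\<forall>t. t \<notin> {a - h..b + h} \<longrightarrow> Q (t - a) - Q (t - b) = 0"
      proof (intro allI impI)
        fix t assume "t \<notin> {a - h..b + h}"
        then consider "t < a - h" | "t > b + h" by force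
        thus "Q (t - a) - Q (t - b) = 0"
        proof cases
          case 1 thus ?thesis using ab by (simp add: Q2)
        next
          case 2 thus ?thesis using ab by (simp add: Q1)
        qed
      qed
    qed simp
    moreover have ki: "(\<lambda>t. k (t - c) *\<^sub>R d t) integrable_on {0..T}" for c
      by (intro integrable_continuous_real continuous_on_scaleR kc d)
    ultimately have eq: "integral {0..T} (\<lambda>t. k (t - a) *\<^sub>R d t) = integral {0..T} (\<lambda>t. k (t - b) *\<^sub>R d t)"
      by (simp add: scaleR_diff_left integral_diff[OF ki ki])
    have near: "norm (integral {0..T} (\<lambda>t. k (t - c) *\<^sub>R d t) - (2 * (h * h)) *\<^sub>R d c) \<le> 2 * (h * h) * e"
      if c: "h \<le> c" "c + h \<le> T" for c
    proof -
      note I = int1[OF c]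
      have "((\<lambda>t. k (t - c) *\<^sub>R d c) has_integral (2 * (h * h)) *\<^sub>R d c) {0..T}"
        by (rule has_integral_scaleR_left[OF I])
      from has_integral_diff[OF integrable_integral[OF ki[of c]] this]
      have J: "((\<lambda>t. k (t - c) *\<^sub>R (d t - d c)) has_integral (integral {0..T} (\<lambda>t. k (t - c) *\<^sub>R d t) - (2 * (h * h)) *\<^sub>R d c)) {0..T}"
        by (simp add: scaleR_diff_right)
      have K: "((\<lambda>t. k (t - c) * e) has_integral 2 * (h * h) * e) {0..T}" by (rule has_integral_mult_left[OF I])
      have "norm (integral {0..T} (\<lambda>t. k (t - c) *\<^sub>R (d t - d c))) \<le> integral {0..T} (\<lambda>t. k (t - c) * e)"
      proof (rule integral_norm_bound_integral)
        fix t assume t: "t \<in> {0..T}"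
        show "norm (k (t - c) *\<^sub>R (d t - d c)) \<le> k (t - c) * e"
        proof (cases "\<bar>t - c\<bar> \<ge> h")
          case False
          have "dist (d t) (d c) < e" by (rule \<delta>(2)) (use t c h False in \<open>auto simp: dist_real_def\<close>)
          thus ?thesis using kn[of "t - c"] by (simp add: dist_norm mult_left_mono)
        qed (simp add: k0)
      qed (use J K in \<open>auto simp: integrable_on_def\<close>)
      thus ?thesis unfolding integral_unique[OF J] integral_unique[OF K] .
    qed
    have N: "norm ((2 * (h * h)) *\<^sub>R (d a - d b)) \<le> 2 * (h * h) * e + 2 * (h * h) * e"
    proof -
      have "(2 * (h * h)) *\<^sub>R (d a - d b) = (integral {0..T} (\<lambda>t. k (t - b) *\<^sub>R d t) - (2 * (h * h)) *\<^sub>R d b)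
         - (integral {0..T} (\<lambda>t. k (t - a) *\<^sub>R d t) - (2 * (h * h)) *\<^sub>R d a)"
        by (simp add: eq scaleR_diff_right)
      also have "norm \<dots> \<le> 2 * (h * h) * e + 2 * (h * h) * e"
        by (rule order_trans[OF norm_triangle_ineq4]) (intro add_mono near; use h ab in simp)
      finally show ?thesis .
    qed
    have hh: "0 \<le> 2 * (h * h)" by simp
    have "(2 * (h * h)) * norm (d a - d b) \<le> 2 * (h * h) * e + 2 * (h * h) * e"
      using N by (simp only: norm_scaleR abs_of_nonneg[OF hh])
    hence "(2 * (h * h)) * norm (d a - d b) \<le> (2 * (h * h)) * (2 * e)" by (simp add: algebra_simps)
    thus ?thesis by (rule mult_left_le_imp_le) (use h in simp)
  qed
  have "norm (d a - d b) \<le> 0"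
  proof (rule field_le_epsilon)
    fix e :: real assume "e > 0" thus "norm (d a - d b) \<le> 0 + e" using est[of "e/2"] by simp
  qed
  thus ?thesis by simp
qed

text \<open>From here on B is used in this integrated form. For the direction from left to right,
  the continuous representative and the primitive of f' differ by a function with weak derivative 0,
  hence by a constant, which is 0 because both vanish at t = 0.\<close>

lemma B_op_iff:
  fixes f f' :: "real \<Rightarrow> 'e::complex_banach"
  assumes T: "T > 0" and p: "1 < p"
  shows "(f, f') \<in> B_op p T \<longleftrightarrow> f \<in> Lp p T \<and> f' \<in> Lp p T \<and> (AE t in interval T. f t = integral {0..t} f')"
proof
  assume R: "f \<in> Lp p T \<and> f' \<in> Lp p T \<and> (AE t in interval T. f t = integral {0..t} f')"
  hence f': "L1 T f'" using p Lp_imp_L1 by blast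
  have "has_weak_derivative T f f'" by (rule has_weak_derivative_integral[OF T f']) (use R in blast)
  moreover have "\<exists>u. continuous_on {0..T} u \<and> u 0 = 0 \<and> (AE t in interval T. f t = u t)"
    by (rule exI[of _ "\<lambda>t. integral {0..t} f'"]) (use R integral_continuous_L1[OF f'] in auto)
  ultimately show "(f, f') \<in> B_op p T" using R by (simp add: B_op_def)
next
  assume "(f, f') \<in> B_op p T"
  then obtain u where f: "f \<in> Lp p T" "f' \<in> Lp p T" and w: "has_weak_derivative T f f'"
    and u: "continuous_on {0..T} u" "u 0 = 0" "AE t in interval T. f t = u t"
    by (auto simp: B_op_def)
  have f': "L1 T f'" using f p Lp_imp_L1 by blast
  let ?U = "\<lambda>t. integral {0..t} f'"
  have Uc: "continuous_on {0..T} ?U" by (rule integral_continuous_L1[OF f'])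
  have wU: "has_weak_derivative T ?U f'" by (rule has_weak_derivative_integral[OF T f']) simp
  define d where "d t = u t - ?U t" for t
  have dc: "continuous_on {0..T} d" unfolding d_def by (intro continuous_intros u Uc)
  have dd: "d a = d b" if "0 < a" "a < b" "b < T" for a b
  proof (rule continuous_weak_derivative_zero[OF T dc _ that])
    fix \<phi> \<phi>' :: "real \<Rightarrow> real" and K
    assume h: "\<forall>t. (\<phi> has_real_derivative \<phi>' t) (at t)" "continuous_on UNIV \<phi>'" "compact K" "K \<subseteq> {0<..<T}" "\<forall>t. t \<notin> K \<longrightarrow> \<phi> t = 0"
    have \<phi>'c: "continuous_on {0..T} \<phi>'" by (rule continuous_on_subset[OF h(2)]) simp
    have uL: "L1 T (\<lambda>t. \<phi>' t *\<^sub>R u t)" by (rule L1_scaleR[OF L1_continuous[OF u(1)] \<phi>'c])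
    have UL: "L1 T (\<lambda>t. \<phi>' t *\<^sub>R ?U t)" by (rule L1_scaleR[OF L1_continuous[OF Uc] \<phi>'c])
    have fL: "L1 T (\<lambda>t. \<phi>' t *\<^sub>R f t)" by (rule L1_cong_AE[OF uL]) (use u(3) in \<open>eventually_elim, simp\<close>)
    have wd: "bochner (interval T) (\<lambda>t. \<phi>' t *\<^sub>R g t) = - bochner (interval T) (\<lambda>t. \<phi> t *\<^sub>R f' t)"
      if "has_weak_derivative T g f'" for g
      using that[unfolded has_weak_derivative_def, rule_format, of \<phi> \<phi>' K] h by blast
    have "bochner (interval T) (\<lambda>t. \<phi>' t *\<^sub>R f t) = bochner (interval T) (\<lambda>t. \<phi>' t *\<^sub>R ?U t)"
      by (simp only: wd[OF w] wd[OF wU])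
    moreover have "integral {0..T} (\<lambda>t. \<phi>' t *\<^sub>R f t) = integral {0..T} (\<lambda>t. \<phi>' t *\<^sub>R u t)"
      by (rule integral_cong_AE_interval) (use u(3) in \<open>eventually_elim, simp\<close>, simp)
    ultimately have "integral {0..T} (\<lambda>t. \<phi>' t *\<^sub>R u t) = integral {0..T} (\<lambda>t. \<phi>' t *\<^sub>R ?U t)"
      by (simp add: bochner_interval[OF fL] bochner_interval[OF UL])
    thus "integral {0..T} (\<lambda>t. \<phi>' t *\<^sub>R d t) = 0"
      unfolding d_def scaleR_diff_right
      by (simp add: integral_diff[OF L1_integrable(1)[OF uL] L1_integrable(1)[OF UL]])
  qed
  have const: "d t = d (T/2)" if "t \<in> {0<..<T}" for t
  proof (cases t "T/2" rule: linorder_cases)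
    case less thus ?thesis using that T dd[of t "T/2"] by simp
  next
    case greater thus ?thesis using that T dd[of "T/2" t] by simp
  next
    case equal thus ?thesis by (simp only:)
  qed
  have "d 0 = d (T/2)"
  proof (rule continuous_constant_on_closure[of "{0<..<T}" d "d (T/2)" 0])
    show "continuous_on (closure {0<..<T}) d" using dc T by simp
    show "0 \<in> closure {0<..<T}" using T by simp
  qed (rule const)
  moreover have "d 0 = 0" by (simp add: d_def u)
  ultimately have "d t = 0" if "t \<in> {0<..<T}" for t using const[OF that] by simp
  hence "AE t in interval T. u t = ?U t" by (intro AE_I2) (simp add: d_def)
  with u(3) have "AE t in interval T. f t = ?U t" by eventually_elim simp
  thus "f \<in> Lp p T \<and> f' \<in> Lp p T \<and> (AE t in interval T. f t = integral {0..t} f')" using f by blast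
qed

section \<open>Cauchy's theorem for integrals along vertical lines\<close>

text \<open>Holomorphy with a uniform quadratic remainder: it is preserved by bounded resolvent families, and
  Cauchy's theorem for rectangles follows from it by differentiating under the integral.\<close>

definition qd :: "complex set \<Rightarrow> (complex \<Rightarrow> 'e::complex_banach) \<Rightarrow> bool" where
  "qd S v \<longleftrightarrow> (\<exists>D C. \<forall>z\<in>S. norm (v z) \<le> C \<and> norm (D z) \<le> C \<and>
     (\<forall>w\<in>S. norm (v w - v z - (w - z) *\<^sub>C D z) \<le> C * (cmod (w - z))\<^sup>2))"

lemma qdI:
  assumes "\<And>z. z \<in> S \<Longrightarrow> norm (v z) \<le> C1" "\<And>z. z \<in> S \<Longrightarrow> norm (D z) \<le> C2"
    "\<And>z w. z \<in> S \<Longrightarrow> w \<in> S \<Longrightarrow> norm (v w - v z - (w - z) *\<^sub>C D z) \<le> C3 * (cmod (w - z))\<^sup>2"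
  shows "qd S v"
  unfolding qd_def
proof (intro exI[of _ D] exI[of _ "max C1 (max C2 C3)"] ballI conjI)
  fix z w assume z: "z \<in> S" and w: "w \<in> S"
  have "C3 * (cmod (w - z))\<^sup>2 \<le> max C1 (max C2 C3) * (cmod (w - z))\<^sup>2" by (rule mult_right_mono) auto
  with assms(3)[OF z w] show "norm (v w - v z - (w - z) *\<^sub>C D z) \<le> max C1 (max C2 C3) * (cmod (w - z))\<^sup>2" by linarith
qed (use assms(1,2) in \<open>fastforce simp: le_max_iff_disj\<close>)+

lemma qd_const: "qd S (\<lambda>z. x)"
  by (rule qdI[where D="\<lambda>z. 0" and ?C1.0="norm x" and ?C2.0=0 and ?C3.0=0]) auto

lemma qd_subset: "qd S v \<Longrightarrow> R \<subseteq> S \<Longrightarrow> qd R v"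
  unfolding qd_def by blast

lemma qd_cong:
  assumes "qd S v" "\<And>z. z \<in> S \<Longrightarrow> u z = v z" shows "qd S u"
  using assms unfolding qd_def by simp

lemma qd_add:
  assumes "qd S u" "qd S v" shows "qd S (\<lambda>z. u z + v z)"
proof -
  obtain D C where D: "\<And>z. z \<in> S \<Longrightarrow> norm (u z) \<le> C" "\<And>z. z \<in> S \<Longrightarrow> norm (D z) \<le> C"
    "\<And>z w. z \<in> S \<Longrightarrow> w \<in> S \<Longrightarrow> norm (u w - u z - (w - z) *\<^sub>C D z) \<le> C * (cmod (w - z))\<^sup>2"
    using assms(1) unfolding qd_def by blast
  obtain D' C' where D': "\<And>z. z \<in> S \<Longrightarrow> norm (v z) \<le> C'" "\<And>z. z \<in> S \<Longrightarrow> norm (D' z) \<le> C'"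
    "\<And>z w. z \<in> S \<Longrightarrow> w \<in> S \<Longrightarrow> norm (v w - v z - (w - z) *\<^sub>C D' z) \<le> C' * (cmod (w - z))\<^sup>2"
    using assms(2) unfolding qd_def by blast
  show ?thesis
  proof (rule qdI[where D="\<lambda>z. D z + D' z"])
    show "norm (u z + v z) \<le> C + C'" if "z \<in> S" for z using norm_triangle_mono[OF D(1) D'(1)] that by blast
    show "norm (D z + D' z) \<le> C + C'" if "z \<in> S" for z using norm_triangle_mono[OF D(2) D'(2)] that by blast
    fix z w assume zw: "z \<in> S" "w \<in> S"
    have eq: "u w + v w - (u z + v z) - (w - z) *\<^sub>C (D z + D' z) = (u w - u z - (w - z) *\<^sub>C D z) + (v w - v z - (w - z) *\<^sub>C D' z)"
      by (simp add: scaleC.add_right)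
    show "norm (u w + v w - (u z + v z) - (w - z) *\<^sub>C (D z + D' z)) \<le> (C + C') * (cmod (w - z))\<^sup>2"
      unfolding eq distrib_right by (rule norm_triangle_mono[OF D(3)[OF zw] D'(3)[OF zw]])
  qed
qed

text \<open>The derivative of R z (v z) is
  \<open>\<kappa> *\<^sub>C R z (R z (v z)) + R z (D z)\<close>. The remainder splits into R w
  applied to the remainder of v and two terms in which the resolvent identity yields a second factor
  w - z. The factor \<open>\<kappa>\<close> is 0 for constant operators, 1 for \<open>Rs\<close> and
  -1 for the scalars 1/(z - \<mu>).\<close>

lemma qd_resolvent_family:
  fixes R :: "complex \<Rightarrow> 'e \<Rightarrow> 'e::complex_banach"
  assumes v: "qd S v"
    and lin: "\<And>w. w \<in> S \<Longrightarrow> bounded_complex_linear (R w)"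
    and K: "\<And>w x. w \<in> S \<Longrightarrow> norm (R w x) \<le> K * norm x"
    and res: "\<And>w z x. w \<in> S \<Longrightarrow> z \<in> S \<Longrightarrow> R w x - R z x = (\<kappa> * (w - z)) *\<^sub>C R w (R z x)"
  shows "qd S (\<lambda>z. R z (v z))"
proof -
  obtain D C where D: "\<And>z. z \<in> S \<Longrightarrow> norm (v z) \<le> C" "\<And>z. z \<in> S \<Longrightarrow> norm (D z) \<le> C"
    "\<And>z w. z \<in> S \<Longrightarrow> w \<in> S \<Longrightarrow> norm (v w - v z - (w - z) *\<^sub>C D z) \<le> C * (cmod (w - z))\<^sup>2"
    using v unfolding qd_def by blast
  define k where "k = \<bar>K\<bar>"
  have k: "k \<ge> 0" by (simp add: k_def)
  have Rk: "norm (R w x) \<le> k * y" if "w \<in> S" "norm x \<le> y" for w x y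
  proof -
    have "norm (R w x) \<le> k * norm x" using K[OF that(1), of x] by (smt (verit) k_def mult_right_mono norm_ge_zero)
    also have "\<dots> \<le> k * y" using that k by (simp add: mult_left_mono)
    finally show ?thesis .
  qed
  have L: "R w (x + y) = R w x + R w y" "R w (x - y) = R w x - R w y" "R w (a *\<^sub>C x) = a *\<^sub>C R w x" if "w \<in> S" for w x y a
    using lin[OF that] unfolding bounded_complex_linear_def
    by (auto simp: linear_simps)
  show ?thesis
  proof (rule qdI[where D="\<lambda>z. \<kappa> *\<^sub>C R z (R z (v z)) + R z (D z)"])
    show "norm (R z (v z)) \<le> k * C" if "z \<in> S" for z using that by (intro Rk D)
    show "norm (\<kappa> *\<^sub>C R z (R z (v z)) + R z (D z)) \<le> cmod \<kappa> * (k * (k * C)) + k * C" if "z \<in> S" for z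
      by (rule norm_triangle_mono) (use that in \<open>auto simp: norm_scaleC intro!: mult_left_mono Rk D\<close>)
    fix z w assume z: "z \<in> S" and w: "w \<in> S"
    let ?d = "w - z"
    have 3: "R w (v z) - R z (v z) - (\<kappa> * ?d) *\<^sub>C R z (R z (v z)) = (\<kappa> * ?d * (\<kappa> * ?d)) *\<^sub>C R w (R z (R z (v z)))"
    proof -
      have "R w (v z) - R z (v z) - (\<kappa> * ?d) *\<^sub>C R z (R z (v z)) = (\<kappa> * ?d) *\<^sub>C (R w (R z (v z)) - R z (R z (v z)))"
        by (simp only: res[OF w z, of "v z"] scaleC.diff_right)
      also have "\<dots> = (\<kappa> * ?d * (\<kappa> * ?d)) *\<^sub>C R w (R z (R z (v z)))"
        by (simp only: res[OF w z, of "R z (v z)"] scaleC_scaleC)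
      finally show ?thesis .
    qed
    have 2: "?d *\<^sub>C (R w (D z) - R z (D z)) = (\<kappa> * ?d * ?d) *\<^sub>C R w (R z (D z))"
      by (simp add: res[OF w z] scaleC_scaleC mult_ac)
    have "R w (v w) - R z (v z) - ?d *\<^sub>C (\<kappa> *\<^sub>C R z (R z (v z)) + R z (D z))
      = R w (v w - v z - ?d *\<^sub>C D z) + ?d *\<^sub>C (R w (D z) - R z (D z))
        + (R w (v z) - R z (v z) - (\<kappa> * ?d) *\<^sub>C R z (R z (v z)))"
      by (simp add: L[OF w] scaleC.diff_right scaleC.add_right scaleC_scaleC mult.commute)
    also have "norm \<dots> \<le> k * (C * (cmod ?d)\<^sup>2) + (cmod \<kappa> * (cmod ?d)\<^sup>2) * (k * (k * C)) + ((cmod \<kappa>)\<^sup>2 * (cmod ?d)\<^sup>2) * (k * (k * (k * C)))"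
      unfolding 2 3
    proof (intro norm_triangle_mono)
      show "norm (R w (v w - v z - ?d *\<^sub>C D z)) \<le> k * (C * (cmod ?d)\<^sup>2)" by (intro Rk w D(3) z)
      show "norm ((\<kappa> * ?d * ?d) *\<^sub>C R w (R z (D z))) \<le> (cmod \<kappa> * (cmod ?d)\<^sup>2) * (k * (k * C))"
        by (simp only: norm_scaleC norm_mult power2_eq_square mult.assoc)
           (intro mult_left_mono Rk w z D norm_ge_zero)
      have "cmod (\<kappa> * ?d * (\<kappa> * ?d)) = (cmod \<kappa>)\<^sup>2 * (cmod ?d)\<^sup>2" by (simp add: norm_mult power2_eq_square)
      moreover have "norm (R w (R z (R z (v z)))) \<le> k * (k * (k * C))" by (intro Rk w z D)
      ultimately show "norm ((\<kappa> * ?d * (\<kappa> * ?d)) *\<^sub>C R w (R z (R z (v z)))) \<le> ((cmod \<kappa>)\<^sup>2 * (cmod ?d)\<^sup>2) * (k * (k * (k * C)))"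
        by (simp add: norm_scaleC mult_left_mono)
    qed
    also have "\<dots> = (k * C + cmod \<kappa> * (k * (k * C)) + (cmod \<kappa>)\<^sup>2 * (k * (k * (k * C)))) * (cmod ?d)\<^sup>2"
      by (simp add: algebra_simps)
    finally show "norm (R w (v w) - R z (v z) - ?d *\<^sub>C (\<kappa> *\<^sub>C R z (R z (v z)) + R z (D z)))
      \<le> (k * C + cmod \<kappa> * (k * (k * C)) + (cmod \<kappa>)\<^sup>2 * (k * (k * (k * C)))) * (cmod ?d)\<^sup>2" .
  qed
qed

lemma bounded_complex_linear_scaleC: "bounded_complex_linear (\<lambda>x. c *\<^sub>C x)"
  unfolding bounded_complex_linear_def
  by (simp add: scaleC.bounded_linear_right scaleC_scaleC mult.commute)

lemma qd_scaleC_const: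
  assumes "qd S v" shows "qd S (\<lambda>z. c *\<^sub>C v z)"
  by (rule qd_resolvent_family[where R="\<lambda>z x. c *\<^sub>C x" and \<kappa>=0 and K="cmod c", OF assms bounded_complex_linear_scaleC])
     (simp_all add: norm_scaleC)

lemma qd_diff:
  assumes "qd S u" "qd S v" shows "qd S (\<lambda>z. u z - v z)"
  using qd_add[OF assms(1) qd_scaleC_const[OF assms(2), of "-1"]] by (simp add: scaleC.minus_left scaleC_one)

lemma qd_scalar_resolvent:
  fixes v :: "complex \<Rightarrow> 'e::complex_banach"
  assumes v: "qd S v" and d: "d > 0" "\<And>z. z \<in> S \<Longrightarrow> cmod (z - \<mu>) \<ge> d"
  shows "qd S (\<lambda>z. (1 / (z - \<mu>)) *\<^sub>C v z)"
proof (rule qd_resolvent_family[where R="\<lambda>z x. (1 / (z - \<mu>)) *\<^sub>C x" and \<kappa>="-1" and K="1/d", OF v bounded_complex_linear_scaleC])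
  fix w z and x :: 'e assume w: "w \<in> S" and z: "z \<in> S"
  have "w - \<mu> \<noteq> 0" "z - \<mu> \<noteq> 0" using d w z by fastforce+
  hence eq: "1 / (w - \<mu>) - 1 / (z - \<mu>) = - 1 * (w - z) * (1 / (w - \<mu>) * (1 / (z - \<mu>)))" by (simp add: field_simps)
  have "(1 / (w - \<mu>)) *\<^sub>C x - (1 / (z - \<mu>)) *\<^sub>C x = (1 / (w - \<mu>) - 1 / (z - \<mu>)) *\<^sub>C x"
    by (rule scaleC.diff_left[symmetric])
  thus "(1 / (w - \<mu>)) *\<^sub>C x - (1 / (z - \<mu>)) *\<^sub>C x = (- 1 * (w - z)) *\<^sub>C (1 / (w - \<mu>)) *\<^sub>C (1 / (z - \<mu>)) *\<^sub>C x"
    unfolding eq by (simp only: scaleC_scaleC mult.assoc)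
next
  fix w and x :: 'e assume "w \<in> S"
  hence "norm (1 / (w - \<mu>)) \<le> 1 / d" using d by (simp add: norm_divide frac_le)
  thus "norm ((1 / (w - \<mu>)) *\<^sub>C x) \<le> 1 / d * norm x" 
    unfolding norm_scaleC by (rule mult_right_mono) simp
qed

lemma qd_continuous:
  assumes "qd S v" shows "continuous_on S v"
proof -
  obtain D C where D: "\<And>z. z \<in> S \<Longrightarrow> norm (D z) \<le> C"
    "\<And>z w. z \<in> S \<Longrightarrow> w \<in> S \<Longrightarrow> norm (v w - v z - (w - z) *\<^sub>C D z) \<le> C * (cmod (w - z))\<^sup>2"
    using assms unfolding qd_def by blast
  show ?thesis unfolding continuous_on_def
  proof
    fix z assume z: "z \<in> S"
    have "((\<lambda>w. v w - v z) \<longlongrightarrow> 0) (at z within S)"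
    proof (rule Lim_null_comparison)
      show "\<forall>\<^sub>F w in at z within S. norm (v w - v z) \<le> C * (cmod (w - z))\<^sup>2 + cmod (w - z) * C"
        unfolding eventually_at_filter
      proof (rule always_eventually, intro allI impI)
        fix w assume "w \<noteq> z" and w: "w \<in> S"
        have "norm (v w - v z) = norm ((v w - v z - (w - z) *\<^sub>C D z) + (w - z) *\<^sub>C D z)" by simp
        also have "\<dots> \<le> C * (cmod (w - z))\<^sup>2 + cmod (w - z) * C"
          by (rule norm_triangle_mono[OF D(2)[OF z w]]) (simp add: norm_scaleC mult_left_mono D(1)[OF z])
        finally show "norm (v w - v z) \<le> C * (cmod (w - z))\<^sup>2 + cmod (w - z) * C" .
      qed
      have c: "((\<lambda>w. cmod (w - z)) \<longlongrightarrow> 0) (at z within S)"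
        using tendsto_norm_zero[OF LIM_zero[OF tendsto_ident_at]] .
      have "((\<lambda>w. C * (cmod (w - z))\<^sup>2 + cmod (w - z) * C) \<longlongrightarrow> C * 0\<^sup>2 + 0 * C) (at z within S)"
        by (intro tendsto_add tendsto_mult tendsto_power tendsto_const c)
      thus "((\<lambda>w. C * (cmod (w - z))\<^sup>2 + cmod (w - z) * C) \<longlongrightarrow> 0) (at z within S)" by simp
    qed
    thus "(v \<longlongrightarrow> v z) (at z within S)" by (rule LIM_zero_cancel)
  qed
qed

lemma has_vector_derivative_quadratic:
  fixes f :: "real \<Rightarrow> 'b::real_normed_vector"
  assumes "\<And>y. y \<in> S \<Longrightarrow> norm (f y - f x - (y - x) *\<^sub>R D) \<le> C * (y - x)\<^sup>2"
  shows "(f has_vector_derivative D) (at x within S)"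
  unfolding has_vector_derivative_def
proof (rule has_derivativeI_sandwich[of 1])
  show "bounded_linear (\<lambda>h. h *\<^sub>R D)" by (rule bounded_linear_scaleR_left)
  show "norm (f y - f x - (y - x) *\<^sub>R D) / norm (y - x) \<le> C * norm (y - x)" if "y \<in> S" "y \<noteq> x" for y
  proof -
    have "norm (f y - f x - (y - x) *\<^sub>R D) \<le> C * norm (y - x) * norm (y - x)"
      using assms[OF that(1)] by (simp add: power2_eq_square mult.assoc)
    thus ?thesis using that(2) by (simp add: divide_le_eq)
  qed
  show "((\<lambda>y. C * norm (y - x)) \<longlongrightarrow> 0) (at x within S)"
    by (intro tendsto_mult_right_zero tendsto_norm_zero LIM_zero tendsto_ident_at)
qed simp

lemma continuous_on_Complex [continuous_intros]:
  assumes "continuous_on S f" "continuous_on S g" shows "continuous_on S (\<lambda>x. Complex (f x) (g x))"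
  unfolding Complex_eq by (intro continuous_intros assms)

text \<open>Move the right edge of the rectangle: the derivative in x of the vertical integral is
  the integral of \<i> D over the edge, up to the factor in front, and the fundamental theorem in y
  turns this into the difference of F at the two ends, which is the derivative of the horizontal
  integrals. The quadratic remainder makes all errors of second order in the step.\<close>

lemma qd_rectangle:
  fixes F :: "complex \<Rightarrow> 'e::complex_banach"
  assumes ab: "a \<le> b" and n: "n \<ge> 0" and q: "qd {z. a \<le> Re z \<and> Re z \<le> b \<and> - n \<le> Im z \<and> Im z \<le> n} F"
  shows "\<i> *\<^sub>C (integral {-n..n} (\<lambda>y. F (Complex b y)) - integral {-n..n} (\<lambda>y. F (Complex a y)))
    = integral {a..b} (\<lambda>x. F (Complex x n)) - integral {a..b} (\<lambda>x. F (Complex x (-n)))"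
proof -
  let ?S = "{z. a \<le> Re z \<and> Re z \<le> b \<and> - n \<le> Im z \<and> Im z \<le> n}"
  obtain D C where D: "\<And>z. z \<in> ?S \<Longrightarrow> norm (D z) \<le> C"
    "\<And>z w. z \<in> ?S \<Longrightarrow> w \<in> ?S \<Longrightarrow> norm (F w - F z - (w - z) *\<^sub>C D z) \<le> C * (cmod (w - z))\<^sup>2"
    using q unfolding qd_def by blast
  have C: "C \<ge> 0" using order_trans[OF norm_ge_zero D(1)[of "Complex a n"]] ab n by simp
  have Fc: "continuous_on ?S F" by (rule qd_continuous[OF q])
  have Fv: "continuous_on {-n..n} (\<lambda>y. F (Complex x y))" if "x \<in> {a..b}" for x
    by (rule continuous_on_compose2[OF Fc]) (use that in \<open>auto intro!: continuous_intros\<close>)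
  have Fh: "continuous_on {a..b} (\<lambda>x. F (Complex x y))" if "y \<in> {-n..n}" for y
    by (rule continuous_on_compose2[OF Fc]) (use that in \<open>auto intro!: continuous_intros\<close>)
  have Fhi: "(\<lambda>x. F (Complex x y)) integrable_on {a..b}" if "y \<in> {-n..n}" for y
    by (rule integrable_continuous_real[OF Fh[OF that]])
  have nn: "n \<in> {-n..n}" "-n \<in> {-n..n}" using n by auto
  have lip: "norm (F (Complex x y) - F (Complex s y)) \<le> C * (x - s) + C * (x - s)\<^sup>2"
    if "s \<le> x" "s \<in> {a..b}" "x \<in> {a..b}" "y \<in> {-n..n}" for s x y
  proof -
    have "Complex x y - Complex s y = complex_of_real (x - s)" by (simp add: complex_eq_iff)
    hence c: "cmod (Complex x y - Complex s y) = x - s" using that by (simp only: norm_of_real)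
    have "norm (F (Complex x y) - F (Complex s y)) = norm ((F (Complex x y) - F (Complex s y) - (Complex x y - Complex s y) *\<^sub>C D (Complex s y))
       + (Complex x y - Complex s y) *\<^sub>C D (Complex s y))" by simp
    also have "\<dots> \<le> C * (x - s)\<^sup>2 + (x - s) * C"
    proof (rule norm_triangle_mono)
      show "norm (F (Complex x y) - F (Complex s y) - (Complex x y - Complex s y) *\<^sub>C D (Complex s y)) \<le> C * (x - s)\<^sup>2"
        using D(2)[of "Complex s y" "Complex x y"] c that by simp
      show "norm ((Complex x y - Complex s y) *\<^sub>C D (Complex s y)) \<le> (x - s) * C"
        using that D(1)[of "Complex s y"] by (simp only: norm_scaleC c) (simp add: mult_left_mono)
    qed
    finally show ?thesis by (simp add: algebra_simps)
  qed
  define G where "G x = \<i> *\<^sub>C integral {-n..n} (\<lambda>y. F (Complex x y))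
     - (integral {a..x} (\<lambda>x. F (Complex x n)) - integral {a..x} (\<lambda>x. F (Complex x (-n))))" for x
  have "G b = G a"
  proof (rule eq_of_small_increments[OF ab, where h="\<lambda>x. x"])
    fix e :: real assume e: "e > 0"
    \<comment> \<open>2 n C comes from the vertical edge of length 2 n and 4 C from the two
      horizontal pieces, where \<delta> \<le> 1 absorbs the quadratic term. The summand 1 keeps
      \<open>B\<close> positive.\<close>
    define B where "B = 2 * n * C + 4 * C + 1"
    have B: "B > 0" using n C by (simp add: B_def add_nonneg_pos)
    show "\<exists>d>0. \<forall>s t. a \<le> s \<longrightarrow> s \<le> t \<longrightarrow> t \<le> b \<longrightarrow> t - s < d \<longrightarrow> norm (G t - G s) \<le> e * (t - s)"
    proof (intro exI[of _ "min 1 (e / B)"] conjI allI impI)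
      show "min 1 (e / B) > 0" using e B by simp
      fix s t assume st: "a \<le> s" "s \<le> t" "t \<le> b" "t - s < min 1 (e / B)"
      define \<delta> where "\<delta> = t - s"
      have \<delta>: "0 \<le> \<delta>" "\<delta> \<le> 1" "\<delta> * B \<le> e" using st B by (simp_all add: \<delta>_def field_simps)
      have sI: "s \<in> {a..b}" and tI: "t \<in> {a..b}" using st by auto
      have FTC: "((\<lambda>y. \<i> *\<^sub>C D (Complex s y)) has_integral F (Complex s n) - F (Complex s (-n))) {-n..n}"
      proof (rule fundamental_theorem_of_calculus)
        show "- n \<le> n" using n by simp
        fix y assume y: "y \<in> {-n..n}"
        show "((\<lambda>y. F (Complex s y)) has_vector_derivative \<i> *\<^sub>C D (Complex s y)) (at y within {-n..n})"
        proof (rule has_vector_derivative_quadratic)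
          fix w assume w: "w \<in> {-n..n}"
          have e1: "Complex s w - Complex s y = \<i> * complex_of_real (w - y)" by (simp add: complex_eq_iff)
          have "cmod (Complex s w - Complex s y) = \<bar>w - y\<bar>" unfolding e1 by (simp add: norm_mult del: of_real_diff)
          moreover have "(Complex s w - Complex s y) *\<^sub>C D (Complex s y) = (w - y) *\<^sub>R \<i> *\<^sub>C D (Complex s y)"
            unfolding e1 by (simp add: scaleC_of_real[symmetric] scaleC_scaleC mult.commute del: of_real_diff)
          ultimately show "norm (F (Complex s w) - F (Complex s y) - (w - y) *\<^sub>R \<i> *\<^sub>C D (Complex s y)) \<le> C * (w - y)\<^sup>2"
            using D(2)[of "Complex s y" "Complex s w"] sI y w by simp
        qed
      qed
      let ?A = "F (Complex s n) - F (Complex s (-n))"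
      let ?f = "\<lambda>y. \<i> *\<^sub>C F (Complex t y) - \<i> *\<^sub>C F (Complex s y) - \<delta> *\<^sub>R (\<i> *\<^sub>C D (Complex s y))"
      have Iv: "((\<lambda>y. \<i> *\<^sub>C F (Complex x y)) has_integral \<i> *\<^sub>C integral {-n..n} (\<lambda>y. F (Complex x y))) {-n..n}" if "x \<in> {a..b}" for x
        using has_integral_linear[OF integrable_integral[OF integrable_continuous_real[OF Fv[OF that]]] scaleC.bounded_linear_right, of \<i>]
        by (simp add: o_def)
      have E1: "(?f has_integral (\<i> *\<^sub>C integral {-n..n} (\<lambda>y. F (Complex t y)) - \<i> *\<^sub>C integral {-n..n} (\<lambda>y. F (Complex s y)) - \<delta> *\<^sub>R ?A)) {-n..n}"
        by (intro has_integral_diff Iv tI sI has_integral_cmul FTC)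
      have nE1: "norm (\<i> *\<^sub>C integral {-n..n} (\<lambda>y. F (Complex t y)) - \<i> *\<^sub>C integral {-n..n} (\<lambda>y. F (Complex s y)) - \<delta> *\<^sub>R ?A) \<le> C * \<delta>\<^sup>2 * (2 * n)"
      proof -
        have "norm (integral {-n..n} ?f) \<le> integral {-n..n} (\<lambda>y. C * \<delta>\<^sup>2)"
        proof (rule integral_norm_bound_integral)
          fix y assume y: "y \<in> {-n..n}"
          have e1: "Complex t y - Complex s y = complex_of_real \<delta>" by (simp add: complex_eq_iff \<delta>_def)
          have "?f y = \<i> *\<^sub>C (F (Complex t y) - F (Complex s y) - (Complex t y - Complex s y) *\<^sub>C D (Complex s y))"
            unfolding e1 by (simp add: scaleC.diff_right scaleC_of_real[symmetric] scaleC_scaleC mult.commute)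
          moreover have "cmod (Complex t y - Complex s y) = \<delta>" unfolding e1 using \<delta> by simp
          ultimately show "norm (?f y) \<le> C * \<delta>\<^sup>2"
            using D(2)[of "Complex s y" "Complex t y"] sI tI y by (simp add: norm_scaleC)
        qed (use E1 in \<open>auto simp: integrable_on_def\<close>)
        thus ?thesis using E1 n by (simp add: integral_unique mult_ac)
      qed
      have E2: "norm (integral {s..t} (\<lambda>x. F (Complex x y)) - \<delta> *\<^sub>R F (Complex s y)) \<le> \<delta> * (C * \<delta> + C * \<delta>\<^sup>2)"
        if y: "y \<in> {-n..n}" for y
      proof -
        have i: "(\<lambda>x. F (Complex x y)) integrable_on {s..t}"
          by (rule integrable_on_subinterval[OF Fhi[OF y]]) (use st in auto)
        have "integral {s..t} (\<lambda>x. F (Complex x y)) - \<delta> *\<^sub>R F (Complex s y) = integral {s..t} (\<lambda>x. F (Complex x y) - F (Complex s y))"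
          using integral_diff[OF i integrable_const_ivl, of "F (Complex s y)"] st by (simp add: \<delta>_def)
        also have "norm \<dots> \<le> integral {s..t} (\<lambda>x. C * \<delta> + C * \<delta>\<^sup>2)"
        proof (rule integral_norm_bound_integral)
          fix x assume x: "x \<in> {s..t}"
          have "norm (F (Complex x y) - F (Complex s y)) \<le> C * (x - s) + C * (x - s)\<^sup>2"
            by (rule lip) (use x st y in auto)
          also have "\<dots> \<le> C * \<delta> + C * \<delta>\<^sup>2"
            by (intro add_mono mult_left_mono power_mono) (use x C in \<open>auto simp: \<delta>_def\<close>)
          finally show "norm (F (Complex x y) - F (Complex s y)) \<le> C * \<delta> + C * \<delta>\<^sup>2" .
        qed (auto intro!: integrable_diff i)
        also have "\<dots> = \<delta> * (C * \<delta> + C * \<delta>\<^sup>2)" using st by (simp add: \<delta>_def)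
        finally show ?thesis .
      qed
      have "G t - G s = (\<i> *\<^sub>C integral {-n..n} (\<lambda>y. F (Complex t y)) - \<i> *\<^sub>C integral {-n..n} (\<lambda>y. F (Complex s y)) - \<delta> *\<^sub>R ?A)
         - (integral {s..t} (\<lambda>x. F (Complex x n)) - \<delta> *\<^sub>R F (Complex s n))
         + (integral {s..t} (\<lambda>x. F (Complex x (-n))) - \<delta> *\<^sub>R F (Complex s (-n)))"
        using integral_diff_Icc[OF Fhi[OF nn(1)] st(1-3)] integral_diff_Icc[OF Fhi[OF nn(2)] st(1-3)]
        by (simp add: G_def scaleR_diff_right algebra_simps)
      also have "norm \<dots> \<le> C * \<delta>\<^sup>2 * (2 * n) + \<delta> * (C * \<delta> + C * \<delta>\<^sup>2) + \<delta> * (C * \<delta> + C * \<delta>\<^sup>2)"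
        by (intro norm_triangle_mono order_trans[OF norm_triangle_ineq4] add_mono nE1 E2 nn)
      also have "\<dots> \<le> e * \<delta>"
      proof -
        have "C * \<delta>\<^sup>2 \<le> C * \<delta>" using \<delta> C by (simp add: power2_eq_square mult_left_mono mult_left_le)
        hence "\<delta> * (C * \<delta> + C * \<delta>\<^sup>2) \<le> \<delta> * (2 * (C * \<delta>))" using \<delta> by (intro mult_left_mono) auto
        hence "C * \<delta>\<^sup>2 * (2 * n) + \<delta> * (C * \<delta> + C * \<delta>\<^sup>2) + \<delta> * (C * \<delta> + C * \<delta>\<^sup>2) \<le> \<delta> * (\<delta> * (2 * n * C + 4 * C))"
          by (simp add: power2_eq_square algebra_simps)
        also have "\<dots> \<le> \<delta> * (\<delta> * B)" using \<delta> by (intro mult_left_mono) (auto simp: B_def)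
        also have "\<dots> \<le> \<delta> * e" using \<delta> by (intro mult_left_mono)
        finally show ?thesis by (simp add: mult.commute)
      qed
      finally show "norm (G t - G s) \<le> e * (t - s)" by (simp add: \<delta>_def)
    qed
  qed
  thus ?thesis by (simp add: G_def scaleC.diff_right algebra_simps)
qed

section \<open>Shifting vertical lines and closing them at infinity\<close>

lemma one_plus_cmod_powr_le_kap:
  assumes "e > 0" shows "(1 + cmod z) powr (- e - 1) \<le> kap e (Im z)"
  unfolding kap_def by (rule powr_mono2') (use assms abs_Im_le_cmod in auto)

text \<open>Decay has to be checked only far out. On the remaining bounded part F is bounded, and
  the weight is bounded below.\<close>

lemma decay_on_bounded_part:
  assumes q: "qd {z \<in> S. cmod z \<le> \<rho>} F" and e: "e > 0"
    and dec: "\<And>z. z \<in> S \<Longrightarrow> \<rho> \<le> cmod z \<Longrightarrow> norm (F z) \<le> C * (1 + cmod z) powr (- e - 1)"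
  obtains C' where "C' \<ge> 0" "\<And>z. z \<in> S \<Longrightarrow> norm (F z) \<le> C' * (1 + cmod z) powr (- e - 1)"
proof -
  obtain C0 where C0: "\<And>z. z \<in> S \<Longrightarrow> cmod z \<le> \<rho> \<Longrightarrow> norm (F z) \<le> C0"
    using q unfolding qd_def by blast
  define C' where "C' = \<bar>C\<bar> + \<bar>C0\<bar> * (1 + \<bar>\<rho>\<bar>) powr (e + 1)"
  show ?thesis
  proof (rule that)
    show "C' \<ge> 0" by (simp add: C'_def)
    fix z assume z: "z \<in> S"
    let ?p = "(1 + cmod z) powr (- e - 1)"
    have p: "?p \<ge> 0" by simp
    show "norm (F z) \<le> C' * ?p"
    proof (cases "\<rho> \<le> cmod z")
      case True
      have "norm (F z) \<le> C * ?p" by (rule dec[OF z True])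
      also have "\<dots> \<le> C' * ?p" by (rule mult_right_mono[OF _ p]) (simp add: C'_def add_increasing2)
      finally show ?thesis .
    next
      case False
      have "1 + cmod z \<le> 1 + \<bar>\<rho>\<bar>" using False by simp
      hence "(1 + cmod z) powr (e + 1) \<le> (1 + \<bar>\<rho>\<bar>) powr (e + 1)" by (rule powr_mono2[rotated 2]) (use e in \<open>auto\<close>)
      moreover have "(1 + cmod z) powr (e + 1) * ?p = 1"
        by (simp add: powr_add[symmetric] add_nonneg_eq_0_iff)
      ultimately have "1 \<le> (1 + \<bar>\<rho>\<bar>) powr (e + 1) * ?p" using mult_right_mono[OF _ p] by metis
      hence "\<bar>C0\<bar> * 1 \<le> \<bar>C0\<bar> * ((1 + \<bar>\<rho>\<bar>) powr (e + 1) * ?p)" by (intro mult_left_mono) auto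
      moreover have "norm (F z) \<le> \<bar>C0\<bar>" using C0[OF z] False by force
      moreover have "0 \<le> \<bar>C\<bar> * ?p" by simp
      ultimately show ?thesis unfolding C'_def distrib_right mult.assoc by linarith
    qed
  qed
qed

lemma line_integrable:
  fixes F :: "complex \<Rightarrow> 'e::complex_banach"
  assumes c: "continuous_on UNIV (\<lambda>s. F (Complex a s))" and e: "e > 0"
    and C: "\<And>s. norm (F (Complex a s)) \<le> C * kap e s"
  shows "(\<lambda>s. F (Complex a s)) integrable_on UNIV"
  by (rule continuous_dominated_integrable[OF c C]) (use integrable_on_cmult_left[OF kap_integrable[OF e], of C] in simp)

lemma qd_line_continuous:
  fixes F :: "complex \<Rightarrow> 'e::complex_banach"
  assumes q: "\<And>r. qd {z \<in> S. cmod z \<le> r} F" and a: "\<And>s. Complex a s \<in> S"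
  shows "continuous_on UNIV (\<lambda>s. F (Complex a s))"
proof (rule continuous_at_imp_continuous_on, rule ballI)
  fix s :: real
  have "continuous_on {s - 1<..<s + 1} (\<lambda>s. F (Complex a s))"
  proof (rule continuous_on_compose2[OF qd_continuous[OF q[of "\<bar>a\<bar> + \<bar>s\<bar> + 1"]]])
    show "(\<lambda>s. Complex a s) ` {s - 1<..<s + 1} \<subseteq> {z \<in> S. cmod z \<le> \<bar>a\<bar> + \<bar>s\<bar> + 1}"
    proof (clarsimp simp: a)
      fix x assume "s - 1 < x" "x < s + 1"
      hence "\<bar>x\<bar> \<le> \<bar>s\<bar> + 1" by linarith
      thus "cmod (Complex a x) \<le> \<bar>a\<bar> + \<bar>s\<bar> + 1" using cmod_le[of "Complex a x"] by simp
    qed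
  qed (intro continuous_intros)
  thus "isCont (\<lambda>s. F (Complex a s)) s" by (simp add: continuous_on_eq_continuous_at)
qed

text \<open>Cauchy's theorem on rectangles of height 2 n: the horizontal edges have fixed length and
  integrands of size \<open>kap e n\<close>, so they vanish in the limit.\<close>

lemma strip_shift:
  fixes F :: "complex \<Rightarrow> 'e::complex_banach"
  assumes ab: "a \<le> b" and q: "\<And>r. qd {z \<in> {z. a \<le> Re z \<and> Re z \<le> b}. cmod z \<le> r} F" and e: "e > 0"
    and dec: "\<And>z. a \<le> Re z \<Longrightarrow> Re z \<le> b \<Longrightarrow> \<rho> \<le> cmod z \<Longrightarrow> norm (F z) \<le> C * (1 + cmod z) powr (- e - 1)"
  shows "integral UNIV (\<lambda>s. F (Complex a s)) = integral UNIV (\<lambda>s. F (Complex b s))"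
proof -
  let ?S = "{z. a \<le> Re z \<and> Re z \<le> b}"
  obtain C' where C': "C' \<ge> 0" "\<And>z. z \<in> ?S \<Longrightarrow> norm (F z) \<le> C' * (1 + cmod z) powr (- e - 1)"
    using decay_on_bounded_part[OF q e, of \<rho> C] dec by auto
  have bd: "norm (F (Complex x s)) \<le> C' * kap e s" if "x \<in> {a..b}" for x s
    using C'(2)[of "Complex x s"] that mult_left_mono[OF one_plus_cmod_powr_le_kap[OF e, of "Complex x s"] C'(1)] by simp
  have cont: "continuous_on UNIV (\<lambda>s. F (Complex x s))" if "x \<in> {a..b}" for x
    by (rule qd_line_continuous[OF q]) (use that in auto)
  have int: "(\<lambda>s. F (Complex x s)) integrable_on UNIV" if "x \<in> {a..b}" for x
    by (rule line_integrable[OF cont[OF that] e bd[OF that]])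
  have aI: "a \<in> {a..b}" and bI: "b \<in> {a..b}" using ab by auto
  let ?d = "\<lambda>n. integral {- real n..real n} (\<lambda>y. F (Complex b y)) - integral {- real n..real n} (\<lambda>y. F (Complex a y))"
  have lim: "?d \<longlonglongrightarrow> integral UNIV (\<lambda>s. F (Complex b s)) - integral UNIV (\<lambda>s. F (Complex a s))"
    by (intro tendsto_diff integral_symmetric_limit int aI bI)
  have "?d \<longlonglongrightarrow> 0"
  proof (rule Lim_null_comparison)
    show "\<forall>\<^sub>F n in sequentially. norm (?d n) \<le> 2 * (C' * (b - a)) * kap e (real n)"
    proof (rule always_eventually, rule allI)
      fix n
      have S: "{z. a \<le> Re z \<and> Re z \<le> b \<and> - real n \<le> Im z \<and> Im z \<le> real n} \<subseteq> {z \<in> ?S. cmod z \<le> \<bar>a\<bar> + \<bar>b\<bar> + real n}"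
      proof clarsimp
        fix z assume "a \<le> Re z" "Re z \<le> b" "- real n \<le> Im z" "Im z \<le> real n"
        hence "\<bar>Re z\<bar> \<le> \<bar>a\<bar> + \<bar>b\<bar>" "\<bar>Im z\<bar> \<le> real n" by linarith+
        thus "cmod z \<le> \<bar>a\<bar> + \<bar>b\<bar> + real n" using cmod_le[of z] by linarith
      qed
      have S': "continuous_on {z. a \<le> Re z \<and> Re z \<le> b \<and> - real n \<le> Im z \<and> Im z \<le> real n} F"
        by (rule qd_continuous[OF qd_subset[OF q S]])
      have R: "\<i> *\<^sub>C ?d n = integral {a..b} (\<lambda>x. F (Complex x (real n))) - integral {a..b} (\<lambda>x. F (Complex x (- real n)))"
        by (rule qd_rectangle[OF ab _ qd_subset[OF q S]]) simp
      have N: "norm (integral {a..b} (\<lambda>x. F (Complex x y))) \<le> C' * (b - a) * kap e (real n)" if "y = real n \<or> y = - real n" for y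
      proof -
        have "norm (integral {a..b} (\<lambda>x. F (Complex x y))) \<le> integral {a..b} (\<lambda>x. C' * kap e (real n))"
        proof (rule integral_norm_bound_integral)
          show "(\<lambda>x. F (Complex x y)) integrable_on {a..b}"
            by (rule integrable_continuous_real, rule continuous_on_compose2[OF S'])
               (use that in \<open>auto intro!: continuous_intros\<close>)
          show "norm (F (Complex x y)) \<le> C' * kap e (real n)" if "x \<in> {a..b}" for x
            using bd[OF that, of y] \<open>y = real n \<or> y = - real n\<close> by (auto simp: kap_def)
        qed (rule integrable_const_ivl)
        thus ?thesis using ab by (simp add: mult_ac)
      qed
      have "norm (?d n) = norm (\<i> *\<^sub>C ?d n)" by (simp add: norm_scaleC)
      also have "\<dots> \<le> C' * (b - a) * kap e (real n) + C' * (b - a) * kap e (real n)"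
        unfolding R by (intro order_trans[OF norm_triangle_ineq4] add_mono N) auto
      finally show "norm (?d n) \<le> 2 * (C' * (b - a)) * kap e (real n)" by simp
    qed
    have "(\<lambda>n. kap e (real n)) \<longlonglongrightarrow> 0"
    proof -
      have "filterlim (\<lambda>n. 1 + real n) at_top sequentially"
        by (rule filterlim_tendsto_add_at_top[OF tendsto_const filterlim_real_sequentially])
      from tendsto_neg_powr[OF _ this, of "- e - 1"] e show ?thesis by (simp add: kap_def)
    qed
    from tendsto_mult_right_zero[OF this] show "(\<lambda>n. 2 * (C' * (b - a)) * kap e (real n)) \<longlonglongrightarrow> 0" .
  qed
  from LIMSEQ_unique[OF lim this] show ?thesis by simp
qed

text \<open>The integral is the same on every line further to the left. Half of the surplus
  \<open>e\<close> keeps the integrand integrable along the line, the other half makes the integral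
  tend to 0 as the line moves to the left.\<close>

lemma left_half_plane_integral_zero:
  fixes F :: "complex \<Rightarrow> 'e::complex_banach"
  assumes q: "\<And>r. qd {z \<in> {z. Re z \<le> a}. cmod z \<le> r} F" and e: "e > 0"
    and dec: "\<And>z. Re z \<le> a \<Longrightarrow> \<rho> \<le> cmod z \<Longrightarrow> norm (F z) \<le> C * (1 + cmod z) powr (- e - 1)"
  shows "(\<lambda>s. F (Complex a s)) integrable_on UNIV" "integral UNIV (\<lambda>s. F (Complex a s)) = 0"
proof -
  let ?S = "{z. Re z \<le> a}"
  obtain C' where C': "C' \<ge> 0" "\<And>z. z \<in> ?S \<Longrightarrow> norm (F z) \<le> C' * (1 + cmod z) powr (- e - 1)"
    using decay_on_bounded_part[OF q e, of \<rho> C] dec by auto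
  have bd: "norm (F (Complex x s)) \<le> C' * kap e s" if "x \<le> a" for x s
    using C'(2)[of "Complex x s"] that mult_left_mono[OF one_plus_cmod_powr_le_kap[OF e, of "Complex x s"] C'(1)] by simp
  have cont: "continuous_on UNIV (\<lambda>s. F (Complex x s))" if "x \<le> a" for x
    by (rule qd_line_continuous[OF q]) (use that in auto)
  have int: "(\<lambda>s. F (Complex x s)) integrable_on UNIV" if "x \<le> a" for x
    by (rule line_integrable[OF cont[OF that] e bd[OF that]])
  show "(\<lambda>s. F (Complex a s)) integrable_on UNIV" by (rule int) simp
  have eq: "integral UNIV (\<lambda>s. F (Complex x s)) = integral UNIV (\<lambda>s. F (Complex a s))" if "x \<le> a" for x
  proof (rule strip_shift[OF that _ e])
    show "qd {z \<in> {z. x \<le> Re z \<and> Re z \<le> a}. cmod z \<le> r} F" for r by (rule qd_subset[OF q]) auto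
  qed (use dec in auto)
  have e2: "e / 2 > 0" using e by simp
  note k2 = kap_integrable[OF e2]
  have sm: "norm (integral UNIV (\<lambda>s. F (Complex x s))) \<le> (C' * integral UNIV (kap (e/2))) * (1 + \<bar>x\<bar>) powr (- (e/2))" if x: "x \<le> a" for x
  proof -
    have "norm (integral UNIV (\<lambda>s. F (Complex x s))) \<le> integral UNIV (\<lambda>s. (C' * (1 + \<bar>x\<bar>) powr (- (e/2))) * kap (e/2) s)"
    proof (rule integral_norm_bound_integral[OF int[OF x]])
      show "(\<lambda>s. (C' * (1 + \<bar>x\<bar>) powr (- (e/2))) * kap (e/2) s) integrable_on UNIV"
        using integrable_on_cmult_left[OF k2, of "C' * (1 + \<bar>x\<bar>) powr (- (e/2))"] by simp
      fix s
      let ?m = "cmod (Complex x s)"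
      have "norm (F (Complex x s)) \<le> C' * (1 + ?m) powr (- e - 1)" using C'(2)[of "Complex x s"] x by simp
      also have "(1 + ?m) powr (- e - 1) = (1 + ?m) powr (- (e/2)) * (1 + ?m) powr (- (e/2) - 1)"
        by (simp add: powr_add[symmetric])
      also have "\<dots> \<le> (1 + \<bar>x\<bar>) powr (- (e/2)) * kap (e/2) s"
      proof (rule mult_mono)
        show "(1 + ?m) powr (- (e/2)) \<le> (1 + \<bar>x\<bar>) powr (- (e/2))"
          by (rule powr_mono2') (use e abs_Re_le_cmod[of "Complex x s"] in auto)
        show "(1 + ?m) powr (- (e/2) - 1) \<le> kap (e/2) s" using one_plus_cmod_powr_le_kap[OF e2, of "Complex x s"] by simp
      qed auto
      finally show "norm (F (Complex x s)) \<le> (C' * (1 + \<bar>x\<bar>) powr (- (e/2))) * kap (e/2) s"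
        using C'(1) by (simp add: mult_left_mono mult.assoc)
    qed
    thus ?thesis by (simp add: mult_ac)
  qed
  have "(\<lambda>n. (C' * integral UNIV (kap (e/2))) * (1 + \<bar>a - real n\<bar>) powr (- (e/2))) \<longlonglongrightarrow> 0"
  proof (rule tendsto_mult_right_zero, rule tendsto_neg_powr)
    show "filterlim (\<lambda>n. 1 + \<bar>a - real n\<bar>) at_top sequentially"
    proof (rule filterlim_at_top_mono)
      show "filterlim (\<lambda>n. - a + real n) at_top sequentially"
        by (rule filterlim_tendsto_add_at_top[OF tendsto_const filterlim_real_sequentially])
    qed (auto intro!: always_eventually)
  qed (use e in simp)
  moreover have "norm (integral UNIV (\<lambda>s. F (Complex a s))) \<le> (C' * integral UNIV (kap (e/2))) * (1 + \<bar>a - real n\<bar>) powr (- (e/2))" for n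
    using sm[of "a - real n"] eq[of "a - real n"] by simp
  ultimately have "norm (integral UNIV (\<lambda>s. F (Complex a s))) \<le> 0"
    by (intro LIMSEQ_le_const) auto
  thus "integral UNIV (\<lambda>s. F (Complex a s)) = 0" by simp
qed

section \<open>The square root of the inverse operator\<close>

lemma inverse_quadratic_le_kap:
  assumes "m > 0" shows "1 / (m + s\<^sup>2) \<le> 2 * (1 + 1 / m) * kap 1 s"
proof -
  have k: "kap 1 s = 1 / (1 + \<bar>s\<bar>)\<^sup>2"
    by (simp add: kap_def powr_minus inverse_eq_divide powr_numeral)
  have "(1 + \<bar>s\<bar>)\<^sup>2 \<le> 2 * (1 + s\<^sup>2)"
    using sum_squares_bound[of 1 "\<bar>s\<bar>"] by (simp add: power2_eq_square algebra_simps)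
  also have "\<dots> \<le> 2 * ((1 + 1 / m) * (m + s\<^sup>2))"
    using assms by (simp add: field_simps)
  finally have "(1 + \<bar>s\<bar>)\<^sup>2 \<le> 2 * (1 + 1 / m) * (m + s\<^sup>2)" by (simp only: mult.assoc)
  moreover have "m + s\<^sup>2 > 0" "(1 + \<bar>s\<bar>)\<^sup>2 > 0" using assms by (simp_all add: add_pos_nonneg)
  ultimately show ?thesis unfolding k by (simp add: divide_simps mult_ac)
qed

lemma continuous_on_inverse_quadratic:
  assumes "m > 0" shows "continuous_on S (\<lambda>s. 1 / (m + s\<^sup>2) :: real)"
proof (intro continuous_intros ballI)
  fix s :: real show "m + s\<^sup>2 \<noteq> 0" using assms by (metis add_pos_nonneg less_irrefl zero_le_power2)
qed

lemma inverse_quadratic_has_integral: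
  assumes m: "m > 0" shows "((\<lambda>s. 1 / (m + s\<^sup>2)) has_integral pi / sqrt m) UNIV"
proof -
  have i: "(\<lambda>s. 1 / (m + s\<^sup>2)) integrable_on UNIV"
  proof (rule continuous_dominated_integrable[OF continuous_on_inverse_quadratic[OF m]])
    show "norm (1 / (m + s\<^sup>2)) \<le> 2 * (1 + 1 / m) * kap 1 s" for s
      using inverse_quadratic_le_kap[OF m, of s] m by (simp add: abs_of_nonneg)
    show "(\<lambda>s. 2 * (1 + 1 / m) * kap 1 s) integrable_on UNIV"
      using integrable_on_cmult_left[OF kap_integrable[of 1], of "2 * (1 + 1 / m)"] by simp
  qed
  have I: "integral {- real n..real n} (\<lambda>s. 1 / (m + s\<^sup>2)) = arctan (real n / sqrt m) / sqrt m - arctan (- real n / sqrt m) / sqrt m" for n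
  proof (rule integral_unique, rule fundamental_theorem_of_calculus)
    fix s :: real
    have "((\<lambda>s. arctan (s / sqrt m) / sqrt m) has_real_derivative 1 / (m + s\<^sup>2)) (at s within {- real n..real n})"
    proof -
      have "((\<lambda>s. arctan (s / sqrt m) / sqrt m) has_real_derivative (inverse (1 + (s / sqrt m)\<^sup>2) * (1 / sqrt m)) / sqrt m) (at s within {- real n..real n})"
        by (rule DERIV_cdivide, rule DERIV_chain2[OF DERIV_arctan], rule DERIV_cdivide[OF DERIV_ident])
      also have "(inverse (1 + (s / sqrt m)\<^sup>2) * (1 / sqrt m)) / sqrt m = inverse (1 + s\<^sup>2 / m) * (1 / (sqrt m * sqrt m))"
        using m by (simp add: power_divide)
      also have "\<dots> = 1 / ((1 + s\<^sup>2 / m) * m)" using m by (simp add: divide_inverse)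
      also have "(1 + s\<^sup>2 / m) * m = m + s\<^sup>2" using m by (simp add: field_simps)
      finally show ?thesis .
    qed
    thus "((\<lambda>s. arctan (s / sqrt m) / sqrt m) has_vector_derivative 1 / (m + s\<^sup>2)) (at s within {- real n..real n})"
      by (simp add: has_real_derivative_iff_has_vector_derivative)
  qed simp
  have "filterlim (\<lambda>n. real n * (1 / sqrt m)) at_top sequentially"
    by (rule filterlim_at_top_mult_tendsto_pos[OF tendsto_const _ filterlim_real_sequentially]) (use m in simp)
  hence "(\<lambda>n. arctan (real n / sqrt m)) \<longlonglongrightarrow> pi / 2"
    using filterlim_compose[OF tendsto_arctan_at_top] by simp
  hence "(\<lambda>n. 2 * arctan (real n / sqrt m) / sqrt m) \<longlonglongrightarrow> 2 * (pi / 2) / sqrt m"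
    by (intro tendsto_intros) (use m in auto)
  hence "(\<lambda>n. integral {- real n..real n} (\<lambda>s. 1 / (m + s\<^sup>2))) \<longlonglongrightarrow> pi / sqrt m"
    by (simp add: I arctan_minus)
  from LIMSEQ_unique[OF integral_symmetric_limit[OF i] this] i show ?thesis
    using integrable_integral by fastforce
qed

text \<open>\<open>rb s\<close> stands for (A + s)^(-1), and the aim is that the square of A^(-1/2)
  is A^(-1). Working in the Banach algebra of bounded operators makes the integrals converge in norm
  and allows differentiating products of them in an additional shift l.\<close>

locale resolvent_half_line =
  fixes rb :: "real \<Rightarrow> 'e::banach \<Rightarrow>\<^sub>L 'e" and K :: real
  assumes K: "K \<ge> 1" and nb: "\<And>s. s \<ge> 0 \<Longrightarrow> norm (rb s) \<le> K / (1 + s)"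
    and res: "\<And>s t. s \<ge> 0 \<Longrightarrow> t \<ge> 0 \<Longrightarrow> rb s - rb t = (t - s) *\<^sub>R (rb s o\<^sub>L rb t)"
begin

interpretation comp: bounded_bilinear "blinfun_compose :: ('e \<Rightarrow>\<^sub>L 'e) \<Rightarrow> ('e \<Rightarrow>\<^sub>L 'e) \<Rightarrow> ('e \<Rightarrow>\<^sub>L 'e)"
  by (rule bounded_bilinear_blinfun_compose)

lemma comp_assoc: "(a o\<^sub>L b) o\<^sub>L d = a o\<^sub>L (b o\<^sub>L (d :: 'e \<Rightarrow>\<^sub>L 'e))" for a b :: "'e \<Rightarrow>\<^sub>L 'e"
  by (rule blinfun_eqI) simp

lemma norm_comp_le: "norm a \<le> x \<Longrightarrow> norm b \<le> y \<Longrightarrow> norm (a o\<^sub>L b) \<le> x * y" for a b :: "'e \<Rightarrow>\<^sub>L 'e"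
  by (rule order_trans[OF norm_blinfun_compose]) (intro mult_mono, auto intro: order_trans[OF norm_ge_zero])

lemma nbK: "s \<ge> 0 \<Longrightarrow> norm (rb s) \<le> K"
  using nb[of s] K by (smt (verit) divide_le_eq_1 frac_le div_by_1)

lemma commute: "s \<ge> 0 \<Longrightarrow> t \<ge> 0 \<Longrightarrow> rb s o\<^sub>L rb t = rb t o\<^sub>L rb s"
proof (cases "s = t")
  case False
  assume st: "s \<ge> 0" "t \<ge> 0"
  have "(t - s) *\<^sub>R (rb s o\<^sub>L rb t) = (t - s) *\<^sub>R (rb t o\<^sub>L rb s)"
    using res[OF st] res[OF st(2,1)] by (metis (no_types) minus_diff_eq scaleR_left.minus)
  thus ?thesis using False by simp
qed simp

lemma rb_quadratic:
  assumes "s \<ge> 0" "t \<ge> 0"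
  shows "rb t - rb s - (t - s) *\<^sub>R (- (rb s o\<^sub>L rb s)) = ((t - s)\<^sup>2) *\<^sub>R (rb t o\<^sub>L (rb s o\<^sub>L rb s))"
proof -
  have "(t - s) *\<^sub>R (- (rb s o\<^sub>L rb s)) = (s - t) *\<^sub>R (rb s o\<^sub>L rb s)"
    by (metis minus_diff_eq scaleR_minus_left scaleR_minus_right)
  hence "rb t - rb s - (t - s) *\<^sub>R (- (rb s o\<^sub>L rb s)) = (s - t) *\<^sub>R (rb t o\<^sub>L rb s) - (s - t) *\<^sub>R (rb s o\<^sub>L rb s)"
    by (simp only: res[OF assms(2,1)])
  also have "\<dots> = (s - t) *\<^sub>R ((rb t - rb s) o\<^sub>L rb s)"
    by (simp only: comp.diff_left scaleR_diff_right)
  also have "\<dots> = (s - t) *\<^sub>R (((s - t) *\<^sub>R (rb t o\<^sub>L rb s)) o\<^sub>L rb s)"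
    by (simp only: res[OF assms(2,1)])
  also have "\<dots> = ((t - s)\<^sup>2) *\<^sub>R (rb t o\<^sub>L (rb s o\<^sub>L rb s))"
    by (simp only: comp.scaleR_left comp_assoc scaleR_scaleR power2_commute[of t s] power2_eq_square[of "s - t"])
  finally show ?thesis .
qed

lemma rb_vector_derivative:
  assumes s: "s \<ge> 0"
  shows "(rb has_vector_derivative - (rb s o\<^sub>L rb s)) (at s within {0..})"
proof (rule has_vector_derivative_quadratic)
  fix t :: real assume t: "t \<in> {0..}"
  have b: "norm (rb t o\<^sub>L (rb s o\<^sub>L rb s)) \<le> K * (K * K)"
    by (intro norm_comp_le nbK s) (use t in auto)
  show "norm (rb t - rb s - (t - s) *\<^sub>R (- (rb s o\<^sub>L rb s))) \<le> (K * (K * K)) * (t - s)\<^sup>2"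
    unfolding rb_quadratic[OF s t[unfolded atLeast_iff]]
    using mult_right_mono[OF b, of "(t - s)\<^sup>2"] by (simp add: mult.commute)
qed

lemma rb_continuous: "continuous_on {0..} rb"
  by (rule continuous_on_vector_derivative[OF rb_vector_derivative]) auto

abbreviation "rq l s \<equiv> rb (l + s\<^sup>2)"
abbreviation "rq2 l s \<equiv> rq l s o\<^sub>L rq l s"

lemma rb_sq_continuous: assumes "l \<ge> 0" shows "continuous_on S (\<lambda>s. rq l s)"
  by (rule continuous_on_compose2[OF rb_continuous]) (use assms in \<open>auto intro!: continuous_intros\<close>)

lemma rb_sq_bound: assumes "l \<ge> 0" shows "norm (rq l s) \<le> K * (1 / (1 + s\<^sup>2))"
proof -
  have p: "l + s\<^sup>2 \<ge> 0" using assms by simp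
  have "norm (rq l s) \<le> K / (1 + (l + s\<^sup>2))" by (rule nb[OF p])
  also have "\<dots> \<le> K / (1 + s\<^sup>2)" using K assms by (intro divide_left_mono mult_pos_pos) (auto simp: add_pos_nonneg)
  finally show ?thesis by simp
qed

lemma quad_integrable: "(\<lambda>s. C * (1 / (1 + s\<^sup>2)) :: real) integrable_on UNIV"
proof -
  have "(\<lambda>s. 1 / (1 + s\<^sup>2) :: real) integrable_on UNIV" using inverse_quadratic_has_integral[of 1] by auto
  from integrable_on_cmult_left[OF this, of C] show ?thesis by simp
qed

lemma rb_sq_integrable: assumes "l \<ge> 0" shows "(\<lambda>s. rq l s) integrable_on UNIV"
  by (rule continuous_dominated_integrable[OF rb_sq_continuous[OF assms] rb_sq_bound[OF assms] quad_integrable])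

text \<open>(A + l)^(-1/2), by Balakrishnan's integral after the substitution of s^2 for the
  variable, which removes the singularity at 0. \<open>V l\<close> below is minus its derivative in
  l, formally (1/2) (A + l)^(-3/2).\<close>

definition U where "U l = (1 / pi) *\<^sub>R integral UNIV (\<lambda>s. rq l s)"
definition V where "V l = (1 / pi) *\<^sub>R integral UNIV (\<lambda>s. rq2 l s)"

lemma rb2_continuous: assumes "l \<ge> 0" shows "continuous_on S (\<lambda>s. rq2 l s)"
  by (intro comp.continuous_on rb_sq_continuous assms)

lemma rb2_bound: assumes "l \<ge> 0" shows "norm (rq2 l s) \<le> (K * K) * (1 / (1 + s\<^sup>2))"
proof -
  have "norm (rq2 l s) \<le> K * (K * (1 / (1 + s\<^sup>2)))"
    by (intro norm_comp_le rb_sq_bound nbK assms) (use assms in simp)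
  thus ?thesis by simp
qed

lemma rb2_integrable: assumes "l \<ge> 0" shows "(\<lambda>s. rq2 l s) integrable_on UNIV"
  by (rule continuous_dominated_integrable[OF rb2_continuous[OF assms] rb2_bound[OF assms] quad_integrable])

lemma rb3_bound: assumes "l \<ge> 0" "m \<ge> 0"
  shows "norm (rq m s o\<^sub>L (rq2 l s)) \<le> (K * (K * K)) * (1 / (1 + s\<^sup>2))"
proof -
  have "norm (rq m s o\<^sub>L (rq2 l s)) \<le> K * ((K * K) * (1 / (1 + s\<^sup>2)))"
    by (intro norm_comp_le rb2_bound nbK assms) (use assms in simp)
  thus ?thesis by simp
qed

lemma U_vector_derivative:
  assumes l: "l \<ge> 0" shows "(U has_vector_derivative - V l) (at l within {0..})"
proof (rule has_vector_derivative_quadratic)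
  fix m :: real assume "m \<in> {0..}"
  hence m: "m \<ge> 0" by simp
  let ?g = "\<lambda>s. rq m s o\<^sub>L (rq2 l s)"
  have gc: "continuous_on UNIV ?g" by (intro comp.continuous_on rb_sq_continuous l m)
  have gi: "?g integrable_on UNIV"
    by (rule continuous_dominated_integrable[OF gc rb3_bound[OF l m] quad_integrable])
  have "integral UNIV (\<lambda>s. rq m s) - integral UNIV (\<lambda>s. rq l s) - (m - l) *\<^sub>R (- integral UNIV (\<lambda>s. rq2 l s))
    = integral UNIV (\<lambda>s. rq m s - rq l s - (m - l) *\<^sub>R (- (rq2 l s)))"
  proof (rule integral_unique[symmetric], intro has_integral_diff has_integral_cmul has_integral_neg integrable_integral)
  qed (intro rb_sq_integrable rb2_integrable l m)+
  also have "\<dots> = integral UNIV (\<lambda>s. ((m - l)\<^sup>2) *\<^sub>R ?g s)"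
  proof (rule integral_cong)
    fix s :: real
    have "0 \<le> l + s\<^sup>2" "0 \<le> m + s\<^sup>2" using l m by auto
    from rb_quadratic[OF this]
    show "rq m s - rq l s - (m - l) *\<^sub>R (- (rq2 l s)) = ((m - l)\<^sup>2) *\<^sub>R ?g s" by simp
  qed
  also have "\<dots> = ((m - l)\<^sup>2) *\<^sub>R integral UNIV ?g" by (rule integral_cmul)
  finally have h: "integral UNIV (\<lambda>s. rq m s) - integral UNIV (\<lambda>s. rq l s) - (m - l) *\<^sub>R (- integral UNIV (\<lambda>s. rq2 l s))
    = ((m - l)\<^sup>2) *\<^sub>R integral UNIV ?g" .
  have "U m - U l - (m - l) *\<^sub>R (- V l) = (1 / pi) *\<^sub>R (integral UNIV (\<lambda>s. rq m s) - integral UNIV (\<lambda>s. rq l s) - (m - l) *\<^sub>R (- integral UNIV (\<lambda>s. rq2 l s)))"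
    unfolding U_def V_def by (simp add: scaleR_diff_right scaleR_add_right mult.commute)
  hence eq: "U m - U l - (m - l) *\<^sub>R (- V l) = (1 / pi) *\<^sub>R (((m - l)\<^sup>2) *\<^sub>R integral UNIV ?g)"
    by (simp only: h)
  have ib: "norm (integral UNIV ?g) \<le> integral UNIV (\<lambda>s. (K * (K * K)) * (1 / (1 + s\<^sup>2)))"
    by (rule integral_norm_bound_integral[OF gi quad_integrable rb3_bound[OF l m]])
  have "norm (U m - U l - (m - l) *\<^sub>R (- V l)) = (1 / pi) * ((m - l)\<^sup>2 * norm (integral UNIV ?g))"
    unfolding eq by simp
  also have "\<dots> \<le> (1 / pi) * ((m - l)\<^sup>2 * integral UNIV (\<lambda>s. (K * (K * K)) * (1 / (1 + s\<^sup>2))))"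
    by (intro mult_left_mono ib) auto
  finally show "norm (U m - U l - (m - l) *\<^sub>R (- V l)) \<le> ((1 / pi) * integral UNIV (\<lambda>s. (K * (K * K)) * (1 / (1 + s\<^sup>2)))) * (m - l)\<^sup>2"
    by (simp add: mult_ac)
qed

text \<open>The derivative of s (A + l + s^2)^(-1) in s has integral 0 over the line, since the
  function itself is O(1/s).\<close>

lemma integral_by_parts:
  assumes l: "l \<ge> 0"
  shows "(\<lambda>s. s\<^sup>2 *\<^sub>R (rq2 l s)) integrable_on UNIV"
    "integral UNIV (\<lambda>s. rq l s) = 2 *\<^sub>R integral UNIV (\<lambda>s. s\<^sup>2 *\<^sub>R (rq2 l s))"
proof -
  let ?g = "\<lambda>s. s\<^sup>2 *\<^sub>R (rq2 l s)"
  have gc: "continuous_on UNIV ?g" by (intro continuous_intros rb2_continuous l)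
  have gb: "norm (?g s) \<le> (K * K) * (1 / (1 + s\<^sup>2))" for s
  proof -
    have "norm (rq2 l s) \<le> (K * (1 / (1 + s\<^sup>2))) * (K * (1 / (1 + s\<^sup>2)))"
      by (intro norm_comp_le rb_sq_bound l)
    hence "s\<^sup>2 * norm (rq2 l s) \<le> s\<^sup>2 * ((K * (1 / (1 + s\<^sup>2))) * (K * (1 / (1 + s\<^sup>2))))"
      by (rule mult_left_mono) simp
    hence "norm (?g s) \<le> s\<^sup>2 * ((K * (1 / (1 + s\<^sup>2))) * (K * (1 / (1 + s\<^sup>2))))"
      by (simp only: norm_scaleR abs_power2)
    also have "\<dots> = (s\<^sup>2 * (1 / (1 + s\<^sup>2))) * ((K * K) * (1 / (1 + s\<^sup>2)))" by (simp add: mult_ac)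
    also have "\<dots> \<le> 1 * ((K * K) * (1 / (1 + s\<^sup>2)))"
      by (rule mult_right_mono) (auto simp: divide_le_eq add_pos_nonneg)
    finally show ?thesis by simp
  qed
  show gi: "?g integrable_on UNIV"
    by (rule continuous_dominated_integrable[OF gc gb quad_integrable])
  have I: "integral {- real n..real n} (\<lambda>s. rq l s - 2 *\<^sub>R ?g s) = (2 * real n) *\<^sub>R rb (l + (real n)\<^sup>2)" for n
  proof -
    have "((\<lambda>s. rq l s - 2 *\<^sub>R ?g s) has_integral real n *\<^sub>R rb (l + (real n)\<^sup>2) - (- real n) *\<^sub>R rb (l + (- real n)\<^sup>2)) {- real n..real n}"
    proof (rule fundamental_theorem_of_calculus)
      fix s :: real
      have 1: "((\<lambda>s. l + s\<^sup>2) has_vector_derivative 2 * s) (at s within {- real n..real n})"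
        by (auto intro!: derivative_eq_intros simp: has_real_derivative_iff_has_vector_derivative[symmetric])
      have 2: "(rb has_vector_derivative - (rq2 l s)) (at (l + s\<^sup>2) within (\<lambda>s. l + s\<^sup>2) ` {- real n..real n})"
        by (rule has_vector_derivative_within_subset[OF rb_vector_derivative]) (use l in auto)
      from vector_diff_chain_within[OF 1 2]
      have 3: "((\<lambda>s. rq l s) has_vector_derivative (2 * s) *\<^sub>R (- (rq2 l s))) (at s within {- real n..real n})"
        by (simp add: o_def)
      have alg: "s *\<^sub>R ((2 * s) *\<^sub>R (- X)) + 1 *\<^sub>R Y = Y - 2 *\<^sub>R (s\<^sup>2 *\<^sub>R X)" for X Y :: "'e \<Rightarrow>\<^sub>L 'e"
        by (simp add: power2_eq_square mult.left_commute)
      from has_vector_derivative_scaleR[OF DERIV_ident 3]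
      show "((\<lambda>s. s *\<^sub>R rq l s) has_vector_derivative rq l s - 2 *\<^sub>R ?g s) (at s within {- real n..real n})"
        by (simp only: alg)
    qed simp
    moreover have "real n *\<^sub>R Y - (- real n) *\<^sub>R Y = (2 * real n) *\<^sub>R Y" for Y :: "'e \<Rightarrow>\<^sub>L 'e"
      by (simp only: scaleR_diff_left[symmetric]) simp
    ultimately show ?thesis by (simp only: integral_unique power2_minus)
  qed
  have i: "(\<lambda>s. rq l s - 2 *\<^sub>R ?g s) integrable_on UNIV"
    by (intro integrable_diff rb_sq_integrable l integrable_cmul gi)
  have "(\<lambda>n. (2 * real n) *\<^sub>R rb (l + (real n)\<^sup>2)) \<longlonglongrightarrow> 0"
  proof (rule Lim_null_comparison)
    show "(\<lambda>n. (2 * K) * (1 / real n)) \<longlonglongrightarrow> 0" by (rule tendsto_mult_right_zero[OF lim_1_over_n])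
    show "\<forall>\<^sub>F n in sequentially. norm ((2 * real n) *\<^sub>R rb (l + (real n)\<^sup>2)) \<le> (2 * K) * (1 / real n)"
    proof (rule eventually_sequentiallyI[of 1])
      fix n :: nat assume n: "1 \<le> n"
      have "norm ((2 * real n) *\<^sub>R rb (l + (real n)\<^sup>2)) \<le> (2 * real n) * (K * (1 / (1 + (real n)\<^sup>2)))"
        using mult_left_mono[OF rb_sq_bound[OF l, of "real n"], of "2 * real n"] by simp
      also have "\<dots> \<le> (2 * real n) * (K * (1 / (real n)\<^sup>2))"
        using K n by (intro mult_left_mono divide_left_mono mult_pos_pos) (auto simp: add_pos_nonneg)
      also have "\<dots> = (2 * K) * (1 / real n)" using n by (simp add: power2_eq_square)
      finally show "norm ((2 * real n) *\<^sub>R rb (l + (real n)\<^sup>2)) \<le> (2 * K) * (1 / real n)" .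
    qed
  qed
  from LIMSEQ_unique[OF integral_symmetric_limit[OF i, unfolded I] this]
  have "integral UNIV (\<lambda>s. rq l s - 2 *\<^sub>R ?g s) = 0" .
  moreover have "integral UNIV (\<lambda>s. rq l s - 2 *\<^sub>R ?g s) = integral UNIV (\<lambda>s. rq l s) - 2 *\<^sub>R integral UNIV ?g"
    by (intro integral_unique has_integral_diff has_integral_cmul integrable_integral rb_sq_integrable l gi)
  ultimately show "integral UNIV (\<lambda>s. rq l s) = 2 *\<^sub>R integral UNIV ?g" by simp
qed

lemma comp_integral_left: "f integrable_on UNIV \<Longrightarrow> B o\<^sub>L integral UNIV f = integral UNIV (\<lambda>s::real. B o\<^sub>L f s)" for B :: "'e \<Rightarrow>\<^sub>L 'e" and f :: "real \<Rightarrow> 'e \<Rightarrow>\<^sub>L 'e"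
  using integral_linear[OF _ comp.bounded_linear_right, of f UNIV B] by (simp add: o_def)

lemma comp_integral_right: "f integrable_on UNIV \<Longrightarrow> integral UNIV f o\<^sub>L B = integral UNIV (\<lambda>s::real. f s o\<^sub>L B)" for B :: "'e \<Rightarrow>\<^sub>L 'e" and f :: "real \<Rightarrow> 'e \<Rightarrow>\<^sub>L 'e"
  using integral_linear[OF _ comp.bounded_linear_left, of f UNIV B] by (simp add: o_def)

lemma J_rb: assumes "x \<ge> 0" shows "x *\<^sub>R (rb 0 o\<^sub>L rb x) = rb 0 - rb x"
  using res[of 0 x] assms by simp

lemma U_commute: assumes l: "l \<ge> 0" and x: "x \<ge> 0" shows "rb x o\<^sub>L U l = U l o\<^sub>L rb x"
proof -
  have "rb x o\<^sub>L integral UNIV (\<lambda>s. rq l s) = integral UNIV (\<lambda>s. rq l s) o\<^sub>L rb x"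
    unfolding comp_integral_left[OF rb_sq_integrable[OF l]] comp_integral_right[OF rb_sq_integrable[OF l]]
    by (rule integral_cong) (use commute[OF x] l in auto)
  thus ?thesis by (simp add: U_def comp.scaleR_left comp.scaleR_right)
qed

text \<open>The relation (A + l) V = U / 2, multiplied by A^(-1) = \<open>rb 0\<close> so that only
  bounded operators occur.\<close>

lemma V_eq: assumes l: "l \<ge> 0" shows "V l + l *\<^sub>R (rb 0 o\<^sub>L V l) = (1/2) *\<^sub>R (rb 0 o\<^sub>L U l)"
proof -
  let ?r = "\<lambda>s. rq l s"
  let ?r2 = "\<lambda>s. ?r s o\<^sub>L ?r s"
  have pt: "?r2 s + l *\<^sub>R (rb 0 o\<^sub>L ?r2 s) = (rb 0 o\<^sub>L ?r s) - (rb 0 o\<^sub>L (s\<^sup>2 *\<^sub>R ?r2 s))" for s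
  proof -
    have "(l + s\<^sup>2) *\<^sub>R (rb 0 o\<^sub>L ?r2 s) = ((l + s\<^sup>2) *\<^sub>R (rb 0 o\<^sub>L ?r s)) o\<^sub>L ?r s"
      by (simp add: comp.scaleR_left comp_assoc)
    also have "\<dots> = (rb 0 o\<^sub>L ?r s) - ?r2 s" using l by (simp add: J_rb comp.diff_left)
    finally show ?thesis by (simp add: comp.scaleR_right scaleR_add_left algebra_simps)
  qed
  note ii = rb2_integrable[OF l] rb_sq_integrable[OF l] integral_by_parts(1)[OF l]
  have L: "(\<lambda>s. B o\<^sub>L f s) integrable_on UNIV" if "f integrable_on UNIV" for f :: "real \<Rightarrow> 'e \<Rightarrow>\<^sub>L 'e" and B :: "'e \<Rightarrow>\<^sub>L 'e"
    using integrable_linear[OF that comp.bounded_linear_right, of B] by (simp add: o_def)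
  have "integral UNIV ?r2 + l *\<^sub>R (rb 0 o\<^sub>L integral UNIV ?r2) = integral UNIV (\<lambda>s. ?r2 s + l *\<^sub>R (rb 0 o\<^sub>L ?r2 s))"
    unfolding comp_integral_left[OF ii(1)]
    by (rule integral_unique[symmetric], intro has_integral_add has_integral_cmul integrable_integral L ii)
  also have "\<dots> = integral UNIV (\<lambda>s. (rb 0 o\<^sub>L ?r s) - (rb 0 o\<^sub>L (s\<^sup>2 *\<^sub>R ?r2 s)))" by (simp only: pt)
  also have "\<dots> = (rb 0 o\<^sub>L integral UNIV ?r) - (rb 0 o\<^sub>L integral UNIV (\<lambda>s. s\<^sup>2 *\<^sub>R ?r2 s))"
    unfolding comp_integral_left[OF ii(2)] comp_integral_left[OF ii(3)]
    by (intro integral_unique has_integral_diff integrable_integral L ii)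
  also have "\<dots> = (1/2) *\<^sub>R (rb 0 o\<^sub>L integral UNIV ?r)"
    unfolding integral_by_parts(2)[OF l]
    by (simp only: comp.scaleR_right scaleR_scaleR) (simp add: scaleR_2)
  finally have h: "integral UNIV ?r2 + l *\<^sub>R (rb 0 o\<^sub>L integral UNIV ?r2) = (1/2) *\<^sub>R (rb 0 o\<^sub>L integral UNIV ?r)" .
  show ?thesis using arg_cong[OF h, of "scaleR (1 / pi)"]
    unfolding V_def U_def comp.scaleR_right by (simp add: scaleR_add_right mult.commute)
qed

text \<open>D l is A^(-1) (A + l) U(l)^2. It should be A^(-1) for every l, which is shown without a
  double integral: by \<open>V_eq\<close> the derivative vanishes, for l to infinity the limit is
  A^(-1), and at l = 0 the value is U(0)^2.\<close>

definition D where "D l = (U l o\<^sub>L U l) + l *\<^sub>R (rb 0 o\<^sub>L (U l o\<^sub>L U l))"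

lemma D_const: assumes l: "l \<ge> 0" shows "D l = D 0"
proof -
  have d: "(D has_vector_derivative 0) (at l within {0..})" if l: "l \<ge> 0" for l
  proof -
    have Ud: "(U has_derivative (\<lambda>h. h *\<^sub>R (- V l))) (at l within {0..})"
      using U_vector_derivative[OF l] by (simp add: has_vector_derivative_def)
    note Q = comp.FDERIV[OF Ud Ud]
    have id: "((\<lambda>x. x) has_derivative (\<lambda>h. h)) (at l within {0..})" by (rule has_derivative_ident)
    note JQ = bounded_linear.has_derivative[OF comp.bounded_linear_right Q, of "rb 0"]
    note lJQ = has_derivative_scaleR[OF id JQ]
    from has_derivative_add[OF Q lJQ]
    have 1: "(D has_derivative (\<lambda>h. (U l o\<^sub>L h *\<^sub>R - V l) + (h *\<^sub>R - V l o\<^sub>L U l) + (l *\<^sub>R (rb 0 o\<^sub>L ((U l o\<^sub>L h *\<^sub>R - V l) + (h *\<^sub>R - V l o\<^sub>L U l))) + h *\<^sub>R (rb 0 o\<^sub>L (U l o\<^sub>L U l))))) (at l within {0..})"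
      unfolding D_def[abs_def] .
    have a: "(V l o\<^sub>L U l) + l *\<^sub>R (rb 0 o\<^sub>L (V l o\<^sub>L U l)) = (1/2) *\<^sub>R (rb 0 o\<^sub>L (U l o\<^sub>L U l))"
      using arg_cong[OF V_eq[OF l], of "\<lambda>x. x o\<^sub>L U l"] by (simp add: comp.add_left comp.scaleR_left comp_assoc)
    have b: "(U l o\<^sub>L V l) + l *\<^sub>R (rb 0 o\<^sub>L (U l o\<^sub>L V l)) = (1/2) *\<^sub>R (rb 0 o\<^sub>L (U l o\<^sub>L U l))"
    proof -
      have c: "U l o\<^sub>L (rb 0 o\<^sub>L y) = rb 0 o\<^sub>L (U l o\<^sub>L y)" for y :: "'e \<Rightarrow>\<^sub>L 'e"
        by (simp only: comp_assoc[symmetric] U_commute[OF l order_refl, symmetric])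
      show ?thesis
        using arg_cong[OF V_eq[OF l], of "\<lambda>x. U l o\<^sub>L x"] by (simp add: comp.add_right comp.scaleR_right c)
    qed
    have "(U l o\<^sub>L h *\<^sub>R - V l) + (h *\<^sub>R - V l o\<^sub>L U l) + (l *\<^sub>R (rb 0 o\<^sub>L ((U l o\<^sub>L h *\<^sub>R - V l) + (h *\<^sub>R - V l o\<^sub>L U l))) + h *\<^sub>R (rb 0 o\<^sub>L (U l o\<^sub>L U l)))
      = h *\<^sub>R (rb 0 o\<^sub>L (U l o\<^sub>L U l)) - h *\<^sub>R ((U l o\<^sub>L V l) + l *\<^sub>R (rb 0 o\<^sub>L (U l o\<^sub>L V l))) - h *\<^sub>R ((V l o\<^sub>L U l) + l *\<^sub>R (rb 0 o\<^sub>L (V l o\<^sub>L U l)))" for h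
      by (simp add: comp.scaleR_right comp.scaleR_left comp.minus_left comp.minus_right comp.add_right comp.diff_right scaleR_add_right scaleR_diff_right mult.commute)
    also have "\<dots> h = h *\<^sub>R 0" for h
      unfolding a b by (simp only: scaleR_scaleR scaleR_diff_left[symmetric]) simp
    finally show ?thesis using 1 by (simp add: has_vector_derivative_def)
  qed
  have "(D has_derivative (\<lambda>h. 0)) (at x within {0..})" if "x \<in> {0..}" for x
    using d[of x] that by (simp add: has_vector_derivative_def)
  hence "\<exists>c. \<forall>x\<in>{0..}. D x = c"
    by (intro has_derivative_zero_constant) auto
  thus ?thesis using l by fastforce
qed

lemma U_bound: assumes l: "l \<ge> 0" shows "norm (U l) \<le> K / sqrt (1 + l)"
proof -
  have p: "1 + l > 0" using l by simp
  note I = has_integral_mult_right[OF inverse_quadratic_has_integral[OF p], of K]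
  have "norm (integral UNIV (\<lambda>s. rq l s)) \<le> integral UNIV (\<lambda>s. K * (1 / (1 + l + s\<^sup>2)))"
  proof (rule integral_norm_bound_integral[OF rb_sq_integrable[OF l]])
    show "(\<lambda>s. K * (1 / (1 + l + s\<^sup>2))) integrable_on UNIV" using I by blast
    fix s :: real
    have "l + s\<^sup>2 \<ge> 0" using l by simp
    from nb[OF this] show "norm (rq l s) \<le> K * (1 / (1 + l + s\<^sup>2))" by (simp add: add.assoc)
  qed
  also have "\<dots> = K * (pi / sqrt (1 + l))" using I by (rule integral_unique)
  finally show ?thesis unfolding U_def by (simp add: field_simps)
qed

text \<open>Quantifies that sqrt l (A + l)^(-1/2) tends to the identity on the range of A^(-1).
  Under the integral, (A + l + s^2)^(-1) A^(-1) is the difference of A^(-1) and (A + l + s^2)^(-1),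
  divided by l + s^2, and the integral of 1/(l + s^2) is pi / sqrt l.\<close>

lemma sqrt_U_J:
  assumes l: "l > 0"
  shows "norm (rb 0 - sqrt l *\<^sub>R (U l o\<^sub>L rb 0)) \<le> K / l"
proof -
  have l0: "l \<ge> 0" using l by simp
  let ?r = "\<lambda>s. rq l s"
  let ?q = "\<lambda>s. 1 / (l + s\<^sup>2)"
  note Iq = inverse_quadratic_has_integral[OF l]
  have sl: "sqrt l > 0" using l by simp
  have pt: "?r s o\<^sub>L rb 0 = ?q s *\<^sub>R rb 0 - ?q s *\<^sub>R ?r s" for s
  proof -
    have p: "l + s\<^sup>2 > 0" using l by (simp add: add_pos_nonneg)
    have "(l + s\<^sup>2) *\<^sub>R (?r s o\<^sub>L rb 0) = rb 0 - ?r s"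
      using J_rb[of "l + s\<^sup>2"] commute[of 0 "l + s\<^sup>2"] p by simp
    hence "?q s *\<^sub>R ((l + s\<^sup>2) *\<^sub>R (?r s o\<^sub>L rb 0)) = ?q s *\<^sub>R (rb 0 - ?r s)" by simp
    thus ?thesis using p by (simp add: scaleR_diff_right)
  qed
  have bd: "norm (?q s *\<^sub>R ?r s) \<le> (K / l) * ?q s" for s
  proof -
    have p: "l + s\<^sup>2 > 0" using l by (simp add: add_pos_nonneg)
    have "norm (?r s) \<le> K / (1 + (l + s\<^sup>2))" by (rule nb) (use p in simp)
    also have "\<dots> \<le> K / l" using K l by (intro divide_left_mono mult_pos_pos) (auto simp: add_pos_nonneg)
    finally have "?q s * norm (?r s) \<le> ?q s * (K / l)" by (rule mult_left_mono) (use p in simp)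
    thus ?thesis using p by (simp add: mult.commute)
  qed
  have bi: "(\<lambda>s. (K / l) * ?q s) integrable_on UNIV" using has_integral_mult_right[OF Iq, of "K / l"] by blast
  have c: "continuous_on UNIV (\<lambda>s. ?q s *\<^sub>R ?r s)"
    by (intro continuous_on_scaleR continuous_on_inverse_quadratic l rb_sq_continuous l0)
  have ei: "(\<lambda>s. ?q s *\<^sub>R ?r s) integrable_on UNIV" by (rule continuous_dominated_integrable[OF c bd bi])
  have "integral UNIV ?r o\<^sub>L rb 0 = integral UNIV (\<lambda>s. ?q s *\<^sub>R rb 0 - ?q s *\<^sub>R ?r s)"
    unfolding comp_integral_right[OF rb_sq_integrable[OF l0]] pt ..
  also have "\<dots> = (pi / sqrt l) *\<^sub>R rb 0 - integral UNIV (\<lambda>s. ?q s *\<^sub>R ?r s)"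
    by (intro integral_unique has_integral_diff has_integral_scaleR_left[OF Iq] integrable_integral ei)
  finally have "sqrt l *\<^sub>R (U l o\<^sub>L rb 0) = rb 0 - (sqrt l / pi) *\<^sub>R integral UNIV (\<lambda>s. ?q s *\<^sub>R ?r s)"
    unfolding U_def using l by (simp add: comp.scaleR_left scaleR_diff_right)
  hence n1: "norm (rb 0 - sqrt l *\<^sub>R (U l o\<^sub>L rb 0)) = (sqrt l / pi) * norm (integral UNIV (\<lambda>s. ?q s *\<^sub>R ?r s))"
    using l by simp
  have "norm (integral UNIV (\<lambda>s. ?q s *\<^sub>R ?r s)) \<le> integral UNIV (\<lambda>s. (K / l) * ?q s)"
    by (rule integral_norm_bound_integral[OF ei bi bd])
  also have "integral UNIV (\<lambda>s. (K / l) * ?q s) = (K / l) * (pi / sqrt l)"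
    by (rule integral_unique[OF has_integral_mult_right[OF Iq]])
  finally have "(sqrt l / pi) * norm (integral UNIV (\<lambda>s. ?q s *\<^sub>R ?r s)) \<le> (sqrt l / pi) * ((K / l) * (pi / sqrt l))"
    by (rule mult_left_mono) (use l in simp)
  also have "(sqrt l / pi) * ((K / l) * (pi / sqrt l)) = K / l" using sl by simp
  finally show ?thesis by (simp only: n1)
qed

text \<open>Write l A^(-1) U(l)^2 as the product of sqrt l U(l), of norm at most K, and sqrt l U(l)
  A^(-1) = A^(-1) - E with |E| \<le> K/l. Then D l - A^(-1) is U(l)^2 - E - sqrt l U(l) E, and each
  term is O(1/l).\<close>

theorem U_square: "U 0 o\<^sub>L U 0 = rb 0"
proof -
  have est: "norm (D 0 - rb 0) \<le> (K * K + K + K * K) * (1 / real n)" if n: "n \<ge> 1" for n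
  proof -
    define l where "l = real n"
    have l: "l \<ge> 0" "l > 0" using n by (auto simp: l_def)
    define E where "E = rb 0 - sqrt l *\<^sub>R (U l o\<^sub>L rb 0)"
    have nE: "norm E \<le> K / l" unfolding E_def by (rule sqrt_U_J[OF l(2)])
    have sU: "norm (sqrt l *\<^sub>R U l) \<le> K"
    proof -
      have "norm (sqrt l *\<^sub>R U l) = sqrt l * norm (U l)" using l by simp
      also have "\<dots> \<le> sqrt l * (K / sqrt (1 + l))" by (rule mult_left_mono[OF U_bound]) (use l in auto)
      also have "\<dots> \<le> 1 * K"
        using l K by (simp add: field_simps)
      finally show ?thesis by simp
    qed
    have nQ: "norm (U l o\<^sub>L U l) \<le> (K / sqrt (1 + l)) * (K / sqrt (1 + l))" by (intro norm_comp_le U_bound l)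
    have q: "(K / sqrt (1 + l)) * (K / sqrt (1 + l)) \<le> K * K / l"
    proof -
      have "(K / sqrt (1 + l)) * (K / sqrt (1 + l)) = K * K / (1 + l)" using l by simp
      also have "\<dots> \<le> K * K / l" using l K by (intro divide_left_mono) auto
      finally show ?thesis .
    qed
    have sl: "sqrt l * sqrt l = l" using l by simp
    have UJ: "sqrt l *\<^sub>R (U l o\<^sub>L rb 0) = rb 0 - E" by (simp add: E_def)
    have "l *\<^sub>R (rb 0 o\<^sub>L (U l o\<^sub>L U l)) = (sqrt l *\<^sub>R U l) o\<^sub>L (sqrt l *\<^sub>R (U l o\<^sub>L rb 0))"
    proof -
      have "rb 0 o\<^sub>L (U l o\<^sub>L U l) = (U l o\<^sub>L rb 0) o\<^sub>L U l" using U_commute[OF l(1), of 0] by (simp add: comp_assoc[symmetric])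
      also have "\<dots> = U l o\<^sub>L (U l o\<^sub>L rb 0)" using U_commute[OF l(1), of 0] by (simp add: comp_assoc)
      finally show ?thesis by (simp only: comp.scaleR_left comp.scaleR_right scaleR_scaleR sl)
    qed
    also have "\<dots> = (sqrt l *\<^sub>R U l) o\<^sub>L (rb 0 - E)" by (simp only: UJ)
    also have "\<dots> = ((sqrt l *\<^sub>R U l) o\<^sub>L rb 0) - ((sqrt l *\<^sub>R U l) o\<^sub>L E)" by (rule comp.diff_right)
    also have "(sqrt l *\<^sub>R U l) o\<^sub>L rb 0 = rb 0 - E" by (simp only: comp.scaleR_left UJ)
    finally have "D l - rb 0 = (U l o\<^sub>L U l) - E - ((sqrt l *\<^sub>R U l) o\<^sub>L E)" by (simp add: D_def)
    hence "norm (D 0 - rb 0) = norm ((U l o\<^sub>L U l) - E - ((sqrt l *\<^sub>R U l) o\<^sub>L E))" using D_const[OF l(1)] by simp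
    also have "\<dots> \<le> K * K / l + K / l + K * (K / l)"
      by (intro order_trans[OF norm_triangle_ineq4] add_mono order_trans[OF nQ q] nE norm_comp_le sU)
    also have "K * K / l + K / l + K * (K / l) = (K * K + K + K * K) * (1 / real n)"
      by (simp add: l_def add_divide_distrib distrib_right)
    finally show ?thesis .
  qed
  have "(\<lambda>n. (K * K + K + K * K) * (1 / real n)) \<longlonglongrightarrow> 0" by (rule tendsto_mult_right_zero[OF lim_1_over_n])
  hence "norm (D 0 - rb 0) \<le> 0"
    by (rule LIMSEQ_le_const) (use est in blast)
  thus ?thesis by (simp add: D_def)
qed

lemma U_apply: "blinfun_apply (U 0) x = (1 / pi) *\<^sub>R integral UNIV (\<lambda>s. blinfun_apply (rb (s\<^sup>2)) x)"
  using integral_linear[OF rb_sq_integrable[OF order_refl] blinfun.bounded_linear_left, of x]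
  by (simp add: U_def o_def blinfun.scaleR_left)

lemma rb_apply_sq_integrable: "(\<lambda>s. blinfun_apply (rb (s\<^sup>2)) x) integrable_on UNIV"
  using integrable_linear[OF rb_sq_integrable[OF order_refl] blinfun.bounded_linear_left, of x] by (simp add: o_def)

text \<open>Connects the integral in \<open>neg_power\<close> with \<open>U 0\<close>. The
  substitution is made on [0,m^2], and evenness of the substituted integrand turns the half line
  into the full line.\<close>

lemma balakrishnan:
  "bochner (lebesgue_on {0<..}) (\<lambda>s. s powr (- (1/2)) *\<^sub>R blinfun_apply (rb s) x) = pi *\<^sub>R blinfun_apply (U 0) x"
proof -
  let ?f = "\<lambda>s. s powr (- (1/2)) *\<^sub>R blinfun_apply (rb s) x"
  have S: "{0::real<..} \<in> sets lebesgue" by simp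
  have rc: "continuous_on R (\<lambda>s. blinfun_apply (rb s) x)" if "R \<subseteq> {0..}" for R
    by (intro continuous_intros continuous_on_subset[OF rb_continuous that])
  have fc: "continuous_on {0<..} ?f"
    by (intro continuous_on_scaleR rc continuous_on_powr continuous_intros) auto
  note fm = strongly_measurable_continuous_on[OF S fc]
  \<comment> \<open>Near 0 the resolvent is only bounded, at infinity its decay 1/s is used: this
    gives the exponents -1/2 and -3/2.\<close>
  let ?g = "\<lambda>s::real. if s \<le> 1 then s powr (- (1/2)) else s powr (- (3/2))"
  have g1: "?g integrable_on {0..1}"
    by (rule integrable_eq[OF integrable_on_powr_from_0[of "- (1/2)" 1]]) auto
  have "(\<lambda>s::real. s powr (- (3/2))) integrable_on {1..}"
    using has_integral_powr_to_inf[of "- (3/2)" 1] by auto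
  hence g2: "?g integrable_on {1..}" by (rule integrable_eq) auto
  have "?g integrable_on {0..1} \<union> {1..}"
    by (rule integrable_Un[OF _ g1 g2]) (rule negligible_subset[of "{1}"], auto)
  hence "?g integrable_on {0<..}"
  proof (rule integrable_spike_set)
    show "negligible {s \<in> {0..1} \<union> {1..} - {0<..}. ?g s \<noteq> 0}" by (rule negligible_subset[of "{0}"]) auto
    show "negligible {s \<in> {0<..} - ({0..1} \<union> {1..}). ?g s \<noteq> 0}" by (rule negligible_subset[of "{}"]) auto
  qed
  hence "?g absolutely_integrable_on {0<..}" by (rule nonnegative_absolutely_integrable_1) simp
  hence gi: "integrable (lebesgue_on {0<..}) ?g" by (simp add: integrable_restrict_space set_integrable_def)
  have int: "integrable (lebesgue_on {0<..}) (\<lambda>s. norm (?f s))"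
  proof (rule Bochner_Integration.integrable_bound)
    show "integrable (lebesgue_on {0<..}) (\<lambda>s. (K * norm x) * ?g s)" using gi by (rule integrable_mult_right)
    show "(\<lambda>s. norm (?f s)) \<in> borel_measurable (lebesgue_on {0<..})"
      using strongly_measurable_diff_measurable[OF S fm, of "\<lambda>x. 0" norm] by (auto intro: continuous_on_norm_id)
    show "AE s in lebesgue_on {0<..}. norm (norm (?f s)) \<le> norm ((K * norm x) * ?g s)"
    proof (rule AE_I2)
      fix s :: real assume "s \<in> space (lebesgue_on {0<..})"
      hence s: "s > 0" by simp
      have "norm (blinfun_apply (rb s) x) \<le> (K / (1 + s)) * norm x"
        by (rule order_trans[OF norm_blinfun mult_right_mono[OF nb]]) (use s in auto)
      hence "s powr (- (1/2)) * norm (blinfun_apply (rb s) x) \<le> s powr (- (1/2)) * ((K / (1 + s)) * norm x)"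
        by (rule mult_left_mono) simp
      hence "norm (?f s) \<le> s powr (- (1/2)) * ((K / (1 + s)) * norm x)" by simp
      also have "\<dots> = (K * norm x) * (s powr (- (1/2)) / (1 + s))" by simp
      also have "\<dots> \<le> (K * norm x) * ?g s"
      proof (rule mult_left_mono)
        show "s powr (- (1/2)) / (1 + s) \<le> ?g s"
        proof (cases "s \<le> 1")
          case True
          have "s powr (- (1/2)) / (1 + s) \<le> s powr (- (1/2)) / 1" by (rule divide_left_mono) (use s in auto)
          thus ?thesis using True by simp
        next
          case False
          have "s powr (- (1/2)) / (1 + s) \<le> s powr (- (1/2)) / s" by (rule divide_left_mono) (use s in auto)
          also have "\<dots> = s powr (- (3/2))" using s powr_diff[of s "- (1/2)" 1] by simp
          finally show ?thesis using False by simp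
        qed
      qed (use K in simp)
      finally show "norm (norm (?f s)) \<le> norm ((K * norm x) * ?g s)" by simp
    qed
  qed
  have fi: "?f integrable_on {0<..}" by (rule has_bochner_strong(1)[OF S fm int])
  let ?fz = "\<lambda>s. if s \<in> {0<..} then ?f s else 0"
  have f0i: "?fz integrable_on UNIV" using fi by (simp only: integrable_restrict_UNIV)
  have f0e: "integral UNIV ?fz = integral {0<..} ?f" by (rule integral_restrict_UNIV)
  let ?h = "\<lambda>s. blinfun_apply (rb (s\<^sup>2)) x"
  have hc: "continuous_on R ?h" for R
    by (intro continuous_intros rb_sq_continuous[of 0, simplified])
  have seg: "integral {- real (m\<^sup>2)..real (m\<^sup>2)} ?fz = integral {- real m..real m} ?h" for m :: nat
  proof -
    let ?\<Phi> = "\<lambda>y. 2 *\<^sub>R integral {0..y} ?h"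
    have "(?f has_integral (?\<Phi> (sqrt (real (m\<^sup>2))) - ?\<Phi> (sqrt 0))) {0..real (m\<^sup>2)}"
    \<comment> \<open>The interior version is used because sqrt has no derivative at 0.\<close>
    proof (rule fundamental_theorem_of_calculus_interior)
      have \<Phi>c: "continuous_on {0..real m} ?\<Phi>"
        by (intro continuous_intros indefinite_integral_continuous_1 integrable_continuous_real hc)
      show "continuous_on {0..real (m\<^sup>2)} (\<lambda>s. ?\<Phi> (sqrt s))"
        by (rule continuous_on_compose2[OF \<Phi>c]) (auto intro!: continuous_intros real_le_lsqrt)
      fix s assume s: "s \<in> {0<..<real (m\<^sup>2)}"
      have 1: "(sqrt has_vector_derivative inverse (sqrt s) / 2) (at s)"
        using DERIV_real_sqrt[of s] s by (simp add: has_real_derivative_iff_has_vector_derivative)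
      have m: "sqrt s \<in> {0..real m}" using s by (auto intro!: real_le_lsqrt)
      have "((\<lambda>y. integral {0..y} ?h) has_vector_derivative ?h (sqrt s)) (at (sqrt s) within {0..real m})"
        by (rule integral_has_vector_derivative[OF hc m])
      moreover have "at (sqrt s) within {0..real m} = at (sqrt s)"
      proof (rule at_within_interior)
        have "sqrt s < real m" using s by (intro real_less_lsqrt) auto
        thus "sqrt s \<in> interior {0..real m}" using s by simp
      qed
      ultimately have "((\<lambda>y. integral {0..y} ?h) has_vector_derivative ?h (sqrt s)) (at (sqrt s))" by simp
      from bounded_linear.has_vector_derivative[OF bounded_linear_scaleR_right this, of 2]
      have 2: "(?\<Phi> has_vector_derivative 2 *\<^sub>R ?h (sqrt s)) (at (sqrt s))" .
      from vector_diff_chain_at[OF 1 2] have "((\<lambda>s. ?\<Phi> (sqrt s)) has_vector_derivative (inverse (sqrt s) / 2) *\<^sub>R 2 *\<^sub>R ?h (sqrt s)) (at s)"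
        by (simp add: o_def)
      moreover have "(inverse (sqrt s) / 2) *\<^sub>R 2 *\<^sub>R ?h (sqrt s) = ?f s"
        using s by (simp add: powr_minus powr_half_sqrt)
      ultimately show "((\<lambda>s. ?\<Phi> (sqrt s)) has_vector_derivative ?f s) (at s)" by simp
    qed simp
    hence A: "(?f has_integral 2 *\<^sub>R integral {0..real m} ?h) {0..real (m\<^sup>2)}" by simp
    have "((\<lambda>s. if s \<in> {0..real (m\<^sup>2)} then ?f s else 0) has_integral 2 *\<^sub>R integral {0..real m} ?h) {- real (m\<^sup>2)..real (m\<^sup>2)}"
      by (rule has_integral_on_superset[OF has_integral_eq[OF _ A]]) auto
    hence "(?fz has_integral 2 *\<^sub>R integral {0..real m} ?h) {- real (m\<^sup>2)..real (m\<^sup>2)}"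
      by (rule has_integral_spike_finite[of "{0}", rotated 2]) auto
    hence B: "integral {- real (m\<^sup>2)..real (m\<^sup>2)} ?fz = 2 *\<^sub>R integral {0..real m} ?h" by (rule integral_unique)
    have "integral {- real m..0} ?h + integral {0..real m} ?h = integral {- real m..real m} ?h"
      by (rule Henstock_Kurzweil_Integration.integral_combine) (auto intro!: integrable_continuous_real hc)
    moreover have "integral {- real m..0} ?h = integral {0..real m} ?h"
      using Henstock_Kurzweil_Integration.integral_reflect_real[where f="?h" and a=0 and b="real m"] by simp
    ultimately show ?thesis using B by (simp add: scaleR_2)
  qed
  have "(\<lambda>m. integral {- real (m\<^sup>2)..real (m\<^sup>2)} ?fz) \<longlonglongrightarrow> integral UNIV ?fz"
  proof -
    have "filterlim (\<lambda>m::nat. m\<^sup>2) at_top at_top"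
      by (rule filterlim_subseq) (auto simp: strict_mono_def power_strict_mono)
    from filterlim_compose[OF integral_symmetric_limit[OF f0i] this] show ?thesis .
  qed
  hence "(\<lambda>m. integral {- real m..real m} ?h) \<longlonglongrightarrow> integral UNIV ?fz" by (simp only: seg)
  from LIMSEQ_unique[OF this integral_symmetric_limit[OF rb_apply_sq_integrable]]
  have "integral {0<..} ?f = integral UNIV ?h" by (simp only: f0e)
  thus ?thesis unfolding bochner_eq_integral[OF S fm int] U_apply by simp
qed

end

section \<open>Resolvents of the operators in class Q\<close>

lemma bounded_complex_linearD:
  assumes "bounded_complex_linear R"
  shows "bounded_linear R" "R (a *\<^sub>C x) = a *\<^sub>C R x" "R (x + y) = R x + R y" "R (x - y) = R x - R y"
    "R (- x) = - R x" "R 0 = 0"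
  using assms unfolding bounded_complex_linear_def by (auto simp: linear_simps)

lemma bounded_complex_linear_compose:
  "bounded_complex_linear R \<Longrightarrow> bounded_complex_linear Q \<Longrightarrow> bounded_complex_linear (\<lambda>x. R (Q x))"
  unfolding bounded_complex_linear_def using bounded_linear_compose by auto

lemma bounded_complex_linear_diff:
  "bounded_complex_linear R \<Longrightarrow> bounded_complex_linear Q \<Longrightarrow> bounded_complex_linear (\<lambda>x. R x - Q x)"
  unfolding bounded_complex_linear_def by (simp add: bounded_linear_sub scaleC.diff_right)

lemma bounded_complex_linear_scale:
  "bounded_complex_linear R \<Longrightarrow> bounded_complex_linear (\<lambda>x. c *\<^sub>C R x)"
  using bounded_complex_linear_compose[OF bounded_complex_linear_scaleC] .

lemma bounded_complex_linear_ident: "bounded_complex_linear (\<lambda>x. x)"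
  unfolding bounded_complex_linear_def by (simp add: bounded_linear_ident)

lemma op_scale_minus_one_twice: "op_scale (-1) (op_scale (-1) A) = (A :: ('e::complex_banach \<times> 'e) set)"
proof -
  have "(-1::complex) *\<^sub>C (-1::complex) *\<^sub>C y = y" for y :: 'e by (simp add: scaleC_scaleC scaleC_one)
  thus ?thesis unfolding op_scale_def by auto metis+
qed

lemma app_graph: "app (graph R) = R"
  by (rule ext) (simp add: app_def graph_def)

lemma graph_eqD: "(x, y) \<in> graph R \<longleftrightarrow> y = R x"
  by (auto simp: graph_def)

abbreviation res_neg :: "('e::complex_banach \<times> 'e) set \<Rightarrow> complex set" where
  "res_neg A \<equiv> resolvent_set (op_scale (-1) A)"

lemma resolvent_setD:
  assumes "z \<in> res_neg A"
  shows "bounded_complex_linear (resolvent A z)" "(op_shift A z)\<inverse> = graph (resolvent A z)"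
proof -
  obtain R where R: "bounded_complex_linear R" "(op_shift A z)\<inverse> = graph R"
    using assms unfolding resolvent_set_def op_scale_minus_one_twice by blast
  have "resolvent A z = R" unfolding resolvent_def R(2) by (rule app_graph)
  thus "bounded_complex_linear (resolvent A z)" "(op_shift A z)\<inverse> = graph (resolvent A z)" using R by simp_all
qed

lemma resolvent_left:
  assumes "z \<in> res_neg A" "(x, y) \<in> A"
  shows "resolvent A z (y + z *\<^sub>C x) = x"
proof -
  have "(y + z *\<^sub>C x, x) \<in> (op_shift A z)\<inverse>" using assms(2) by (auto simp: op_shift_def)
  thus ?thesis unfolding resolvent_setD(2)[OF assms(1)] graph_eqD by simp
qed

lemma resolvent_right:
  assumes "z \<in> res_neg A"
  shows "(resolvent A z y, y - z *\<^sub>C resolvent A z y) \<in> A"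
proof -
  have "(y, resolvent A z y) \<in> (op_shift A z)\<inverse>" unfolding resolvent_setD(2)[OF assms] graph_eqD by simp
  then obtain y' where "(resolvent A z y, y') \<in> A" "y = y' + z *\<^sub>C resolvent A z y"
    by (auto simp: op_shift_def)
  moreover from this have "y - z *\<^sub>C resolvent A z y = y'" by (metis add_diff_cancel_right')
  ultimately show ?thesis by (simp only:)
qed

lemma resolvent_identity:
  assumes z: "z \<in> res_neg A" and w: "w \<in> res_neg A"
  shows "resolvent A z x - resolvent A w x = (w - z) *\<^sub>C resolvent A z (resolvent A w x)"
proof -
  note L = bounded_complex_linearD[OF resolvent_setD(1)[OF z]]
  let ?u = "resolvent A w x"
  have "?u = resolvent A z ((x - w *\<^sub>C ?u) + z *\<^sub>C ?u)"
    by (rule resolvent_left[OF z resolvent_right[OF w], symmetric])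
  also have "(x - w *\<^sub>C ?u) + z *\<^sub>C ?u = x - (w - z) *\<^sub>C ?u" by (simp add: scaleC.diff_left)
  also have "resolvent A z \<dots> = resolvent A z x - (w - z) *\<^sub>C resolvent A z ?u" by (simp add: L)
  finally show ?thesis by (simp add: algebra_simps)
qed

text \<open>The resolvent identity is antisymmetric in the two points, so its right hand side may be
  written with either order of the factors.\<close>

lemma resolvent_commute:
  assumes z: "z \<in> res_neg A" and w: "w \<in> res_neg A"
  shows "resolvent A z (resolvent A w x) = resolvent A w (resolvent A z x)"
proof (cases "z = w")
  case False
  have "(w - z) *\<^sub>C resolvent A z (resolvent A w x) = (w - z) *\<^sub>C resolvent A w (resolvent A z x)"
    using resolvent_identity[OF z w, of x] resolvent_identity[OF w z, of x]
    by (metis minus_diff_eq scaleC.minus_left)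
  hence "(1 / (w - z)) *\<^sub>C (w - z) *\<^sub>C resolvent A z (resolvent A w x) = (1 / (w - z)) *\<^sub>C (w - z) *\<^sub>C resolvent A w (resolvent A z x)"
    by simp
  thus ?thesis using False by (simp add: scaleC_scaleC scaleC_one)
qed simp

lemma class_P0_sqrt:
  fixes A :: "('e::complex_banach \<times> 'e) set"
  assumes A: "A \<in> class_P0"
  obtains U where "bounded_complex_linear U" "\<And>x. U (U x) = resolvent A 0 x"
    "\<And>x. neg_power A (1/2) x = U x"
    "\<And>z x. z \<in> res_neg A \<Longrightarrow> resolvent A z (U x) = U (resolvent A z x)"
proof -
  obtain K where K: "K \<ge> 1" and rs: "\<And>s. s \<ge> 0 \<Longrightarrow> complex_of_real s \<in> res_neg A"
    and nK: "\<And>s. s \<ge> 0 \<Longrightarrow> (1 + s) * onorm (resolvent A (complex_of_real s)) \<le> K"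
    using A unfolding class_P0_def by blast
  note bcl = resolvent_setD(1)[OF rs]
  note bl = bounded_complex_linearD(1)[OF bcl]
  define rb where "rb s = Blinfun (resolvent A (complex_of_real s))" for s
  have rb: "blinfun_apply (rb s) = resolvent A (complex_of_real s)" if "s \<ge> 0" for s
    unfolding rb_def by (rule bounded_linear_Blinfun_apply[OF bl[OF that]])
  interpret H: resolvent_half_line rb K
  proof
    show "K \<ge> 1" by (rule K)
    show "norm (rb s) \<le> K / (1 + s)" if "s \<ge> 0" for s
      using nK[OF that] that by (simp add: norm_blinfun.rep_eq rb field_simps)
    show "rb s - rb t = (t - s) *\<^sub>R (rb s o\<^sub>L rb t)" if "s \<ge> 0" "t \<ge> 0" for s t
    proof (rule blinfun_eqI)
      fix x
      have "resolvent A (complex_of_real s) x - resolvent A (complex_of_real t) x = complex_of_real (t - s) *\<^sub>C resolvent A (complex_of_real s) (resolvent A (complex_of_real t) x)"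
        using resolvent_identity[OF rs[OF that(1)] rs[OF that(2)], of x] by simp
      thus "blinfun_apply (rb s - rb t) x = blinfun_apply ((t - s) *\<^sub>R (rb s o\<^sub>L rb t)) x"
        by (simp only: scaleC_of_real blinfun.diff_left blinfun.scaleR_left blinfun_apply_blinfun_compose rb[OF that(1)] rb[OF that(2)])
    qed
  qed
  let ?U = "blinfun_apply (H.U 0)"
  have Ux: "?U x = (1 / pi) *\<^sub>R integral UNIV (\<lambda>s. resolvent A (complex_of_real (s\<^sup>2)) x)" for x
    unfolding H.U_apply by (simp add: rb)
  have Ui: "(\<lambda>s. resolvent A (complex_of_real (s\<^sup>2)) x) integrable_on UNIV" for x
    using H.rb_apply_sq_integrable[of x] by (simp add: rb)
  \<comment> \<open>One argument for complex scalars and for resolvents: a bounded operator that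
    commutes with (A + s)^(-1) for s \<ge> 0 passes through the integral that defines A^(-1/2).
    Complex homogeneity is an instance because \<open>bounded_linear\<close> knows real scalars
    only.\<close>
  have com: "R (?U x) = ?U (R x)" if R: "bounded_linear R" and c: "\<And>s x. s \<ge> 0 \<Longrightarrow> R (resolvent A (complex_of_real s) x) = resolvent A (complex_of_real s) (R x)" for R x
  proof -
    have "R (integral UNIV (\<lambda>s. resolvent A (complex_of_real (s\<^sup>2)) x)) = integral UNIV (\<lambda>s. R (resolvent A (complex_of_real (s\<^sup>2)) x))"
      using integral_linear[OF Ui R, of x] by (simp add: o_def)
    also have "\<dots> = integral UNIV (\<lambda>s. resolvent A (complex_of_real (s\<^sup>2)) (R x))"
      by (rule integral_cong) (simp only: c zero_le_power2)
    finally show ?thesis unfolding Ux using linear_simps(5)[OF R] by simp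
  qed
  show ?thesis
  proof (rule that[of ?U])
    show "bounded_complex_linear ?U" unfolding bounded_complex_linear_def
    proof (intro conjI allI)
      show "bounded_linear ?U" by (rule blinfun.bounded_linear_right)
      show "?U (a *\<^sub>C x) = a *\<^sub>C ?U x" for a x
        by (rule com[symmetric, OF scaleC.bounded_linear_right]) (simp add: bounded_complex_linearD(2)[OF bcl])
    qed
    show "?U (?U x) = resolvent A 0 x" for x
      using arg_cong[OF H.U_square, of "\<lambda>T. blinfun_apply T x"] by (simp add: rb)
    show "resolvent A z (?U x) = ?U (resolvent A z x)" if "z \<in> res_neg A" for z x
      by (rule com[OF bounded_complex_linearD(1)[OF resolvent_setD(1)[OF that]]]) (rule resolvent_commute[OF that rs])
    show "neg_power A (1/2) x = ?U x" for x
    proof -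
      have "bochner (lebesgue_on {0<..}) (\<lambda>s. s powr (- (1/2)) *\<^sub>R resolvent A (complex_of_real s) x)
          = bochner (lebesgue_on {0<..}) (\<lambda>s. s powr (- (1/2)) *\<^sub>R blinfun_apply (rb s) x)"
      proof -
        have eq: "s powr (- (1/2)) *\<^sub>R resolvent A (complex_of_real s) x = s powr (- (1/2)) *\<^sub>R blinfun_apply (rb s) x" if "s \<in> space (lebesgue_on {0<..})" for s
          using that by (simp add: rb)
        have hb: "has_bochner (lebesgue_on {0<..}) (\<lambda>s. s powr (- (1/2)) *\<^sub>R resolvent A (complex_of_real s) x) I
          \<longleftrightarrow> has_bochner (lebesgue_on {0<..}) (\<lambda>s. s powr (- (1/2)) *\<^sub>R blinfun_apply (rb s) x) I" for I
          by (rule has_bochner_in_cong) (rule eq)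
        show ?thesis unfolding bochner_def hb ..
      qed
      hence "bochner (lebesgue_on {0<..}) (\<lambda>s. s powr (- (1/2)) *\<^sub>R resolvent A (complex_of_real s) x) = pi *\<^sub>R ?U x"
        by (simp only: H.balakrishnan)
      moreover have "frac (1/2::real) = 1/2" by (simp add: frac_def)
      ultimately show ?thesis unfolding neg_power_def by simp
    qed
  qed
qed

locale Q_operator =
  fixes A :: "('e::complex_banach \<times> 'e) set" and c :: real
  assumes c: "c > 0" and A: "A \<in> class_Q (c\<^sup>2)"
begin

text \<open>A^(-1/2), the one bounded operator through which A and its powers are expressed from
  here on: A = U^(-2), and U x runs through the domain of sqrt A.\<close>

definition "U = neg_power A (1/2)"

lemma A_P0: "A \<in> class_P0" using A by (simp add: class_Q_def)

lemma U: "bounded_complex_linear U" "U (U x) = resolvent A 0 x"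
  "z \<in> res_neg A \<Longrightarrow> resolvent A z (U x) = U (resolvent A z x)"
proof -
  obtain U' where U': "bounded_complex_linear U'" "\<And>x. U' (U' x) = resolvent A 0 x"
    "\<And>x. neg_power A (1/2) x = U' x"
    "\<And>z x. z \<in> res_neg A \<Longrightarrow> resolvent A z (U' x) = U' (resolvent A z x)"
    using class_P0_sqrt[OF A_P0] by blast
  have "U = U'" unfolding U_def by (rule ext) (rule U'(3))
  thus "bounded_complex_linear U" "U (U x) = resolvent A 0 x"
    "z \<in> res_neg A \<Longrightarrow> resolvent A z (U x) = U (resolvent A z x)" using U' by simp_all
qed

lemma zero_in: "0 \<in> res_neg A"
proof -
  obtain K where "\<forall>z\<ge>0. complex_of_real z \<in> res_neg A \<and> (1 + z) * onorm (resolvent A (complex_of_real z)) \<le> K"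
    using A_P0 unfolding class_P0_def by blast
  from this[rule_format, of 0] show ?thesis by simp
qed

lemma A_iff: "(x, y) \<in> A \<longleftrightarrow> x = U (U y)"
proof
  assume "(x, y) \<in> A"
  from resolvent_left[OF zero_in this] show "x = U (U y)" by (simp add: U)
next
  assume "x = U (U y)"
  thus "(x, y) \<in> A" using resolvent_right[OF zero_in, of y] by (simp add: U)
qed

lemma U_inj: assumes "U x = U y" shows "x = y"
proof -
  have "(U (U x), x) \<in> A" "(U (U x), y) \<in> A" using assms A_iff by auto
  moreover have "single_valued A" using A_P0 by (simp add: class_P0_def closed_linear_operator_def)
  ultimately show ?thesis by (auto dest: single_valuedD)
qed

definition H :: "complex set" where "H = {l. Re l \<le> - c}"

text \<open>Squaring maps the line Re l = - c onto the parabola that bounds the region for c^2. With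
  l = x + \<i> y the claim is (c^2 - x^2) (c^2 + y^2) \<le> 0.\<close>

lemma sq_in: assumes "l \<in> H" shows "l\<^sup>2 \<in> Pi_region (c\<^sup>2)" "l\<^sup>2 \<in> res_neg A"
proof -
  have r: "c\<^sup>2 \<le> (Re l)\<^sup>2" using assms c unfolding H_def by (metis abs_le_square_iff abs_of_pos le_minus_iff mem_Collect_eq power2_minus abs_ge_minus_self order_trans)
  have c2: "c\<^sup>2 > 0" using c by simp
  have "(c\<^sup>2 - (Re l)\<^sup>2) * (c\<^sup>2 + (Im l)\<^sup>2) \<le> 0" using r c2 by (simp add: mult_nonpos_nonneg)
  hence "c\<^sup>2 * (c\<^sup>2 - (Re l)\<^sup>2 + (Im l)\<^sup>2) \<le> (Re l)\<^sup>2 * (Im l)\<^sup>2" by (simp add: algebra_simps)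
  hence "c\<^sup>2 - (Re l)\<^sup>2 + (Im l)\<^sup>2 \<le> ((Re l)\<^sup>2 * (Im l)\<^sup>2) / c\<^sup>2" using c2 by (simp add: pos_le_divide_eq mult.commute)
  hence "c\<^sup>2 - ((Re l)\<^sup>2 * (Im l)\<^sup>2) / c\<^sup>2 \<le> (Re l)\<^sup>2 - (Im l)\<^sup>2" by simp
  moreover have "(Im (l\<^sup>2))\<^sup>2 / (4 * c\<^sup>2) = ((Re l)\<^sup>2 * (Im l)\<^sup>2) / c\<^sup>2"
    by (simp add: power2_eq_square)
  moreover have "Re (l\<^sup>2) = (Re l)\<^sup>2 - (Im l)\<^sup>2" by (simp add: power2_eq_square)
  ultimately show "l\<^sup>2 \<in> Pi_region (c\<^sup>2)" unfolding Pi_region_def by simp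
  thus "l\<^sup>2 \<in> res_neg A" using A unfolding class_Q_def by blast
qed

abbreviation R2 :: "complex \<Rightarrow> 'e \<Rightarrow> 'e" where "R2 l \<equiv> resolvent A (l\<^sup>2)"

lemma R2_bcl: "l \<in> H \<Longrightarrow> bounded_complex_linear (R2 l)" by (rule resolvent_setD(1)[OF sq_in(2)])

text \<open>The norm of the resolvent is continuous on \<open>\<Pi>\<close>, hence bounded on bounded parts of it; with the
  decay at infinity it is bounded on all of \<open>\<Pi>\<close>.\<close>

lemma resolvent_locally_bounded:
  assumes z: "z \<in> res_neg A"
  obtains d M where "d > 0" "\<And>w x. w \<in> res_neg A \<Longrightarrow> dist w z < d \<Longrightarrow> norm (resolvent A w x) \<le> M * norm x"
proof -
  obtain N where N: "N > 0" "\<And>x. norm (resolvent A z x) \<le> norm x * N"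
    using bounded_linear.pos_bounded[OF bounded_complex_linearD(1)[OF resolvent_setD(1)[OF z]]] by blast
  show ?thesis
  proof (rule that[of "1 / (2 * N)" "2 * N"])
    show "1 / (2 * N) > 0" using N by simp
    fix w x assume w: "w \<in> res_neg A" and d: "dist w z < 1 / (2 * N)"
    have "norm (resolvent A w x - resolvent A z x) = cmod (z - w) * norm (resolvent A z (resolvent A w x))"
      by (simp add: resolvent_identity[OF w z] norm_scaleC resolvent_commute[OF w z])
    also have "\<dots> \<le> (1 / (2 * N)) * (norm (resolvent A w x) * N)"
      by (intro mult_mono N(2)) (use d N in \<open>auto simp: dist_norm norm_minus_commute\<close>)
    also have "\<dots> = norm (resolvent A w x) / 2" using N by simp
    finally have "norm (resolvent A w x) \<le> norm (resolvent A z x) + norm (resolvent A w x) / 2"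
      using norm_triangle_sub[of "resolvent A w x" "resolvent A z x"] by linarith
    thus "norm (resolvent A w x) \<le> 2 * N * norm x" using N(2)[of x] by (simp add: mult_ac)
  qed
qed

lemma onorm_bound:
  assumes "bounded_linear R" "onorm R \<le> M" shows "norm (R x) \<le> M * norm x"
  using onorm[OF assms(1), of x] assms(2) by (meson mult_right_mono norm_ge_zero order_trans)

text \<open>The second bound evaluates the second decay condition at the point l^2, where its
  weight, the square root of the modulus, is |l|.\<close>

lemma resolvent_bounds:
  obtains M where "M > 0" "\<And>l x. l \<in> H \<Longrightarrow> norm (R2 l x) \<le> M * norm x"
    "\<And>l x. l \<in> H \<Longrightarrow> cmod l * norm (R2 l (U x)) \<le> M * norm x"
proof -
  let ?F = "inf at_infinity (principal (Pi_region (c\<^sup>2)))"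
  have sub: "Pi_region (c\<^sup>2) \<subseteq> res_neg A" using A unfolding class_Q_def by blast
  have appU: "app (op_power A (-1/2)) = U" by (simp add: op_power_def app_graph U_def)
  have 1: "((\<lambda>z. onorm (resolvent A z)) \<longlongrightarrow> 0) ?F" using A unfolding class_Q_def by blast
  have 2: "((\<lambda>z. cmod z powr (1/2) * onorm (\<lambda>x. resolvent A z (U x))) \<longlongrightarrow> 0) ?F"
  proof -
    have "((\<lambda>z. cmod z powr (1/2) * onorm (\<lambda>x. resolvent A z (app (op_power A (-1/2)) x))) \<longlongrightarrow> 0) ?F"
      using A unfolding class_Q_def by blast
    thus ?thesis unfolding appU .
  qed
  have "\<forall>\<^sub>F z in ?F. onorm (resolvent A z) < 1 \<and> cmod z powr (1/2) * onorm (\<lambda>x. resolvent A z (U x)) < 1"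
    using order_tendstoD(2)[OF 1, of 1] order_tendstoD(2)[OF 2, of 1] by (simp add: eventually_conj)
  then obtain b where b: "\<And>z. b \<le> cmod z \<Longrightarrow> z \<in> Pi_region (c\<^sup>2) \<Longrightarrow> onorm (resolvent A z) < 1 \<and> cmod z powr (1/2) * onorm (\<lambda>x. resolvent A z (U x)) < 1"
    unfolding eventually_inf_principal eventually_at_infinity by blast
  have closed: "closed (Pi_region (c\<^sup>2))" unfolding Pi_region_def
    by (intro closed_Collect_le continuous_intros) (use c in auto)
  define C where "C = Pi_region (c\<^sup>2) \<inter> cball 0 b"
  have comp: "compact C" unfolding C_def by (rule closed_Int_compact[OF closed compact_cball])
  have "\<forall>z\<in>C. \<exists>d M. d > 0 \<and> (\<forall>w x. w \<in> Pi_region (c\<^sup>2) \<longrightarrow> dist w z < d \<longrightarrow> norm (resolvent A w x) \<le> M * norm x)"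
  proof
    fix z assume "z \<in> C"
    hence "z \<in> res_neg A" using sub by (auto simp: C_def)
    then obtain d M where "d > 0" "\<And>w x. w \<in> res_neg A \<Longrightarrow> dist w z < d \<Longrightarrow> norm (resolvent A w x) \<le> M * norm x"
      using resolvent_locally_bounded by blast
    thus "\<exists>d M. d > 0 \<and> (\<forall>w x. w \<in> Pi_region (c\<^sup>2) \<longrightarrow> dist w z < d \<longrightarrow> norm (resolvent A w x) \<le> M * norm x)"
      using sub by blast
  qed
  then obtain d M where d: "\<And>z. z \<in> C \<Longrightarrow> d z > 0"
    and M: "\<And>z w x. z \<in> C \<Longrightarrow> w \<in> Pi_region (c\<^sup>2) \<Longrightarrow> dist w z < d z \<Longrightarrow> norm (resolvent A w x) \<le> M z * norm x"
    by metis
  have "C \<subseteq> (\<Union>z\<in>C. ball z (d z))" using d by force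
  then obtain D where D: "D \<subseteq> C" "finite D" "C \<subseteq> (\<Union>z\<in>D. ball z (d z))"
    using compactE_image[OF comp, of C "\<lambda>z. ball z (d z)"] by (metis open_ball)
  define M0 where "M0 = (\<Sum>z\<in>D. \<bar>M z\<bar>)"
  have M0: "norm (resolvent A w x) \<le> M0 * norm x" if w: "w \<in> C" for w x
  proof -
    from D(3) w obtain z where z: "z \<in> D" "w \<in> ball z (d z)" by blast
    have "norm (resolvent A w x) \<le> M z * norm x"
      by (rule M) (use z D w in \<open>auto simp: C_def dist_commute\<close>)
    also have "\<dots> \<le> M0 * norm x"
    proof (rule mult_right_mono)
      have "\<bar>M z\<bar> \<le> M0" unfolding M0_def by (rule member_le_sum[OF z(1)]) (use D in auto)
      thus "M z \<le> M0" by simp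
    qed simp
    finally show ?thesis .
  qed
  obtain N where N: "N > 0" "\<And>x. norm (U x) \<le> norm x * N"
    using bounded_linear.pos_bounded[OF bounded_complex_linearD(1)[OF U(1)]] by blast
  have M0n: "M0 \<ge> 0" by (simp add: M0_def sum_nonneg)
  \<comment> \<open>Where |l|^2 < b this gives |l| \<le> B, because B^2 \<ge> |b|; so the weight |l|
    is harmless on the bounded part.\<close>
  define B where "B = \<bar>b\<bar> + 1"
  show ?thesis
  proof (rule that[of "1 + M0 + B * (M0 * N)"])
    have p: "B * (M0 * N) \<ge> 0" using M0n N by (simp add: B_def)
    show "1 + M0 + B * (M0 * N) > 0" using p M0n by linarith
    fix l x assume l: "l \<in> H"
    note lP = sq_in(1)[OF l]
    note bl = bounded_complex_linearD(1)[OF R2_bcl[OF l]]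
    note blU = bounded_linear_compose[OF bl bounded_complex_linearD(1)[OF U(1)]]
    show "norm (R2 l x) \<le> (1 + M0 + B * (M0 * N)) * norm x"
    proof (cases "b \<le> cmod (l\<^sup>2)")
      case True
      have "onorm (R2 l) \<le> 1" using b[OF True lP] by linarith
      hence "norm (R2 l x) \<le> 1 * norm x" by (rule onorm_bound[OF bl])
      also have "\<dots> \<le> (1 + M0 + B * (M0 * N)) * norm x" by (rule mult_right_mono) (use p M0n in auto)
      finally show ?thesis .
    next
      case False
      have "norm (R2 l x) \<le> M0 * norm x" by (rule M0) (use False lP in \<open>auto simp: C_def\<close>)
      also have "\<dots> \<le> (1 + M0 + B * (M0 * N)) * norm x" by (rule mult_right_mono) (use p M0n in auto)
      finally show ?thesis .
    qed
    show "cmod l * norm (R2 l (U x)) \<le> (1 + M0 + B * (M0 * N)) * norm x"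
    proof (cases "b \<le> cmod (l\<^sup>2)")
      case True
      have l0: "cmod l > 0" using l c by (auto simp: H_def)
      have "cmod (l\<^sup>2) powr (1/2) = cmod l" by (simp add: norm_power powr_half_sqrt)
      hence "cmod l * onorm (\<lambda>x. R2 l (U x)) \<le> 1" using b[OF True lP] by simp
      hence "onorm (\<lambda>x. R2 l (U x)) \<le> 1 / cmod l" using l0 by (simp add: pos_le_divide_eq mult.commute)
      hence "norm (R2 l (U x)) \<le> (1 / cmod l) * norm x" by (rule onorm_bound[OF blU])
      hence "cmod l * norm (R2 l (U x)) \<le> 1 * norm x" using l0 by (simp add: pos_le_divide_eq mult.commute)
      also have "\<dots> \<le> (1 + M0 + B * (M0 * N)) * norm x" by (rule mult_right_mono) (use p M0n in auto)
      finally show ?thesis .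
    next
      case False
      have "(cmod l)\<^sup>2 \<le> \<bar>b\<bar>" using False by (simp add: norm_power)
      also have "\<dots> \<le> B\<^sup>2" by (simp add: B_def power2_eq_square algebra_simps)
      finally have lB: "cmod l \<le> B" by (rule power2_le_imp_le) (simp add: B_def)
      have "norm (R2 l (U x)) \<le> M0 * norm (U x)" by (rule M0) (use False lP in \<open>auto simp: C_def\<close>)
      also have "\<dots> \<le> M0 * (norm x * N)" by (rule mult_left_mono[OF N(2) M0n])
      finally have "cmod l * norm (R2 l (U x)) \<le> B * (M0 * (norm x * N))"
        by (intro mult_mono lB) (auto simp: B_def)
      also have "\<dots> = B * (M0 * N) * norm x" by simp
      also have "\<dots> \<le> (1 + M0 + B * (M0 * N)) * norm x" by (rule mult_right_mono) (use p M0n in auto)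
      finally show ?thesis .
    qed
  qed
qed

definition Dl :: "complex \<Rightarrow> 'e \<Rightarrow> 'e" where "Dl l x = U (x - l\<^sup>2 *\<^sub>C R2 l x)"

text \<open>\<open>Rs \<sigma> l\<close> is \<open>(\<sigma> \<i> \<surd>A - l)\<^sup>-\<^sup>1\<close> for \<open>\<sigma> = \<plusminus>1\<close>; \<open>Dl l\<close> is \<open>\<surd>A (A + l\<^sup>2)\<^sup>-\<^sup>1\<close>.\<close>

definition Rs :: "complex \<Rightarrow> complex \<Rightarrow> 'e \<Rightarrow> 'e" where "Rs \<sigma> l x = - ((\<sigma> * \<i>) *\<^sub>C Dl l x) - l *\<^sub>C R2 l x"

lemmas U_simps = bounded_complex_linearD[OF U(1)]

lemma Dl_bcl: "l \<in> H \<Longrightarrow> bounded_complex_linear (Dl l)"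
  unfolding Dl_def[abs_def]
  by (intro bounded_complex_linear_compose[OF U(1)] bounded_complex_linear_diff bounded_complex_linear_ident bounded_complex_linear_scale R2_bcl)

lemma Rs_bcl: "l \<in> H \<Longrightarrow> bounded_complex_linear (Rs \<sigma> l)"
proof -
  assume l: "l \<in> H"
  have "Rs \<sigma> l = (\<lambda>x. (- (\<sigma> * \<i>)) *\<^sub>C Dl l x - l *\<^sub>C R2 l x)"
    by (simp add: fun_eq_iff Rs_def scaleC.minus_left)
  thus ?thesis by (simp only:) (intro bounded_complex_linear_diff bounded_complex_linear_scale Dl_bcl R2_bcl l)
qed

lemma R2_U: "l \<in> H \<Longrightarrow> R2 l (U x) = U (R2 l x)" by (rule U(3)[OF sq_in(2)])

lemma U_Dl: assumes l: "l \<in> H" shows "U (Dl l x) = R2 l x"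
proof -
  have "R2 l x = U (U (x - l\<^sup>2 *\<^sub>C R2 l x))" using resolvent_right[OF sq_in(2)[OF l], of x] by (simp add: A_iff)
  thus ?thesis by (simp add: Dl_def)
qed

lemma Dl_U: assumes l: "l \<in> H" shows "Dl l (U x) = R2 l x"
  using U_Dl[OF l, of x] by (simp add: Dl_def R2_U[OF l] U_simps)

lemma Rs_U: assumes l: "l \<in> H" shows "Rs \<sigma> l (U x) = U (Rs \<sigma> l x)"
  by (simp add: Rs_def Dl_U[OF l] U_Dl[OF l] R2_U[OF l] U_simps)

lemma sigma_sq: "\<sigma> * \<sigma> = 1 \<Longrightarrow> \<sigma> * \<i> * (\<sigma> * \<i>) = - 1"
  by (metis (no_types) mult.assoc mult.commute mult.left_commute mult_1 i_squared)

text \<open>U x is a general element of the domain of sqrt A, with sqrt A (U x) = x. Together with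
  \<open>Rs_right\<close> this says that \<open>Rs \<sigma> l\<close> inverts \<sigma> \<i> sqrt A -
  l from both sides.\<close>

lemma Rs_left:
  assumes l: "l \<in> H" and \<sigma>: "\<sigma> * \<sigma> = 1"
  shows "Rs \<sigma> l ((\<sigma> * \<i>) *\<^sub>C x - l *\<^sub>C U x) = U x"
proof -
  note L = bounded_complex_linearD[OF Dl_bcl[OF l]] bounded_complex_linearD[OF R2_bcl[OF l]]
  have "Rs \<sigma> l ((\<sigma> * \<i>) *\<^sub>C x - l *\<^sub>C U x)
     = - ((\<sigma> * \<i> * (\<sigma> * \<i>)) *\<^sub>C Dl l x) + (l * l) *\<^sub>C U (R2 l x)"
    unfolding Rs_def by (simp add: L Dl_U[OF l] R2_U[OF l] scaleC.diff_right scaleC_scaleC mult.commute)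
  also have "\<dots> = U x" unfolding sigma_sq[OF \<sigma>]
    by (simp add: Dl_def U_simps scaleC.minus_left scaleC_one power2_eq_square)
  finally show ?thesis .
qed

lemma Rs_right:
  assumes l: "l \<in> H" and \<sigma>: "\<sigma> * \<sigma> = 1"
  obtains x where "Rs \<sigma> l y = U x" "y = (\<sigma> * \<i>) *\<^sub>C x - l *\<^sub>C U x"
proof -
  define e where "e = y - l\<^sup>2 *\<^sub>C R2 l y"
  have Ue: "U e = Dl l y" by (simp only: e_def Dl_def)
  define x where "x = - ((\<sigma> * \<i>) *\<^sub>C e) - l *\<^sub>C Dl l y"
  have Ux: "U x = Rs \<sigma> l y"
    by (simp only: x_def Rs_def U_simps Ue U_Dl[OF l])
  have "(\<sigma> * \<i>) *\<^sub>C x - l *\<^sub>C U x = - ((\<sigma> * \<i> * (\<sigma> * \<i>)) *\<^sub>C e) + (l * l) *\<^sub>C R2 l y"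
    unfolding Ux unfolding x_def Rs_def
    by (simp add: scaleC.diff_right scaleC.minus_right scaleC_scaleC mult_ac)
  also have "\<dots> = e + l\<^sup>2 *\<^sub>C R2 l y" unfolding sigma_sq[OF \<sigma>]
    by (simp only: scaleC.minus_left scaleC_one minus_minus power2_eq_square[of l])
  also have "\<dots> = y" by (simp only: e_def diff_add_cancel)
  finally have eq: "y = (\<sigma> * \<i>) *\<^sub>C x - l *\<^sub>C U x" by (rule sym)
  show ?thesis by (rule that[OF Ux[symmetric] eq])
qed

lemma Rs_identity:
  assumes l: "l \<in> H" and m: "m \<in> H" and \<sigma>: "\<sigma> * \<sigma> = 1"
  shows "Rs \<sigma> l y - Rs \<sigma> m y = (l - m) *\<^sub>C Rs \<sigma> l (Rs \<sigma> m y)"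
proof -
  note L = bounded_complex_linearD[OF Rs_bcl[OF l]]
  obtain x where x: "Rs \<sigma> m y = U x" "y = (\<sigma> * \<i>) *\<^sub>C x - m *\<^sub>C U x" using Rs_right[OF m \<sigma>] by blast
  have "y = ((\<sigma> * \<i>) *\<^sub>C x - l *\<^sub>C U x) + (l - m) *\<^sub>C U x" by (simp add: x(2) scaleC.diff_left)
  hence "Rs \<sigma> l y = Rs \<sigma> l ((\<sigma> * \<i>) *\<^sub>C x - l *\<^sub>C U x) + (l - m) *\<^sub>C Rs \<sigma> l (U x)" by (simp only: L)
  thus ?thesis by (simp add: Rs_left[OF l \<sigma>] x(1))
qed

text \<open>The operators \<sigma> \<i> sqrt A - m and - \<sigma> \<i> sqrt A - l add up to the
  scalar - (m + l). This is the resolvent identity for resolvents of opposite sign.\<close>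

lemma Rs_product:
  assumes l: "l \<in> H" and m: "m \<in> H" and \<sigma>: "\<sigma> * \<sigma> = 1"
  shows "(m + l) *\<^sub>C Rs \<sigma> m (Rs (- \<sigma>) l y) = - (Rs \<sigma> m y + Rs (- \<sigma>) l y)"
proof -
  note L = bounded_complex_linearD[OF Rs_bcl[OF m]]
  have \<sigma>': "- \<sigma> * - \<sigma> = 1" using \<sigma> by simp
  obtain x where x: "Rs (- \<sigma>) l y = U x" "y = (- \<sigma> * \<i>) *\<^sub>C x - l *\<^sub>C U x" using Rs_right[OF l \<sigma>'] by blast
  have "(\<sigma> * \<i>) *\<^sub>C x - m *\<^sub>C U x = - y - (m + l) *\<^sub>C U x"
    by (simp add: x(2) scaleC.minus_left scaleC.add_left)
  hence "U x = Rs \<sigma> m (- y - (m + l) *\<^sub>C U x)" using Rs_left[OF m \<sigma>, of x] by simp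
  also have "\<dots> = - Rs \<sigma> m y - (m + l) *\<^sub>C Rs \<sigma> m (U x)" by (simp only: L)
  finally have h: "U x = - Rs \<sigma> m y - (m + l) *\<^sub>C Rs \<sigma> m (U x)" .
  have g: "v = - (b + a)" if "a = - b - v" for a b v :: 'e using that by simp
  show ?thesis unfolding x(1) by (rule g[OF h])
qed

text \<open>The case m = l, where the parts with \<surd>A cancel in the sum. It corresponds to the
  factorization of A + l^2.\<close>

lemma Rs_product_same:
  assumes l: "l \<in> H" and \<sigma>: "\<sigma> * \<sigma> = 1"
  shows "Rs \<sigma> l (Rs (- \<sigma>) l y) = R2 l y"
proof -
  have l0: "l + l \<noteq> 0" using l c by (auto simp: H_def complex_eq_iff)
  have "(l + l) *\<^sub>C Rs \<sigma> l (Rs (- \<sigma>) l y) = - (Rs \<sigma> l y + Rs (- \<sigma>) l y)" by (rule Rs_product[OF l l \<sigma>])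
  also have "\<dots> = l *\<^sub>C R2 l y + l *\<^sub>C R2 l y" by (simp add: Rs_def scaleC.minus_left)
  also have "\<dots> = (l + l) *\<^sub>C R2 l y" by (rule scaleC.add_left[symmetric])
  finally have "(l + l) *\<^sub>C Rs \<sigma> l (Rs (- \<sigma>) l y) = (l + l) *\<^sub>C R2 l y" .
  hence "(1 / (l + l)) *\<^sub>C (l + l) *\<^sub>C Rs \<sigma> l (Rs (- \<sigma>) l y) = (1 / (l + l)) *\<^sub>C (l + l) *\<^sub>C R2 l y" by simp
  thus ?thesis using l0 by (simp add: scaleC_scaleC scaleC_one del: mult_2)
qed

text \<open>Each factor \<open>U\<close> gains one power of |l|, from growth 1 + |l| to decay 1 / (1
  + |l|). The first gain comes from the second decay condition of the class Q, the other from
  solving the identity of \<open>Rs_left\<close> for the term with the factor l.\<close>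

lemma Rs_bounds:
  obtains M where "M > 0" "\<And>\<sigma> l x. \<sigma> * \<sigma> = 1 \<Longrightarrow> l \<in> H \<Longrightarrow> norm (Rs \<sigma> l x) \<le> M * (1 + cmod l) * norm x"
    "\<And>\<sigma> l x. \<sigma> * \<sigma> = 1 \<Longrightarrow> l \<in> H \<Longrightarrow> norm (Rs \<sigma> l (U x)) \<le> M * norm x"
    "\<And>\<sigma> l x. \<sigma> * \<sigma> = 1 \<Longrightarrow> l \<in> H \<Longrightarrow> norm (Rs \<sigma> l (U (U x))) \<le> M / (1 + cmod l) * norm x"
    "\<And>l x. l \<in> H \<Longrightarrow> norm (R2 l x) \<le> M * norm x" "\<And>x. norm (U x) \<le> M * norm x"
proof -
  obtain M where M: "M > 0" "\<And>l x. l \<in> H \<Longrightarrow> norm (R2 l x) \<le> M * norm x"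
    "\<And>l x. l \<in> H \<Longrightarrow> cmod l * norm (R2 l (U x)) \<le> M * norm x" using resolvent_bounds by blast
  obtain N where N: "N > 0" "\<And>x. norm (U x) \<le> norm x * N"
    using bounded_linear.pos_bounded[OF bounded_complex_linearD(1)[OF U(1)]] by blast
  have s1: "cmod (\<sigma> * \<i>) = 1" if "\<sigma> * \<sigma> = 1" for \<sigma>
    using arg_cong[OF that, of cmod] by (simp add: norm_mult) (metis abs_norm_cancel abs_square_eq_1 power2_eq_square)
  \<comment> \<open>|l| \<ge> c on the half plane, so 1 + |l| \<le> k |l|.\<close>
  define k where "k = 1 + 1 / c"
  have k: "k \<ge> 1" using c by (simp add: k_def)
  have lk: "1 + cmod l \<le> k * cmod l" if "l \<in> H" for l
  proof -
    have "c \<le> cmod l" using that abs_Re_le_cmod[of l] by (auto simp: H_def)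
    thus ?thesis using c by (simp add: k_def field_simps)
  qed
  have b1: "norm (Rs \<sigma> l x) \<le> (N + 2 * M) * (1 + cmod l) * norm x" if \<sigma>: "\<sigma> * \<sigma> = 1" and l: "l \<in> H" for \<sigma> l x
  proof -
    have "norm (Dl l x) \<le> norm x * N + cmod l * (M * norm x)"
    proof -
      have "Dl l x = U x - l\<^sup>2 *\<^sub>C R2 l (U x)" by (simp only: Dl_def U_simps(2,4) R2_U[OF l])
      also have "norm \<dots> \<le> norm (U x) + cmod l * (cmod l * norm (R2 l (U x)))"
        by (rule order_trans[OF norm_triangle_ineq4]) (simp only: norm_scaleC norm_power power2_eq_square[of "cmod l"] mult.assoc order_refl)
      also have "\<dots> \<le> norm x * N + cmod l * (M * norm x)"
        by (intro add_mono N mult_left_mono M(3) l) simp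
      finally show ?thesis .
    qed
    moreover have "norm (Rs \<sigma> l x) \<le> norm (Dl l x) + cmod l * norm (R2 l x)"
      unfolding Rs_def by (rule order_trans[OF norm_triangle_ineq4]) (simp only: norm_minus_cancel norm_scaleC s1[OF \<sigma>] mult_1 order_refl)
    moreover have "cmod l * norm (R2 l x) \<le> cmod l * (M * norm x)" by (intro mult_left_mono M(2) l) simp
    ultimately have "norm (Rs \<sigma> l x) \<le> norm x * N + cmod l * (M * norm x) + cmod l * (M * norm x)" by linarith
    also have "\<dots> = (N + 2 * M * cmod l) * norm x" by (simp add: algebra_simps)
    also have "\<dots> \<le> ((N + 2 * M) * (1 + cmod l)) * norm x"
      by (rule mult_right_mono) (use N(1) M(1) in \<open>auto simp: algebra_simps\<close>)
    finally show ?thesis by simp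
  qed
  have b2: "norm (Rs \<sigma> l (U x)) \<le> (2 * M) * norm x" if \<sigma>: "\<sigma> * \<sigma> = 1" and l: "l \<in> H" for \<sigma> l x
  proof -
    have "norm (Rs \<sigma> l (U x)) \<le> norm (R2 l x) + cmod l * norm (R2 l (U x))"
      unfolding Rs_def Dl_U[OF l] by (rule order_trans[OF norm_triangle_ineq4]) (simp only: norm_minus_cancel norm_scaleC s1[OF \<sigma>] mult_1 order_refl)
    thus ?thesis using M(2)[OF l, of x] M(3)[OF l, of x] by simp
  qed
  have b3: "norm (Rs \<sigma> l (U (U x))) \<le> (k * (2 * M + N * N)) / (1 + cmod l) * norm x" if \<sigma>: "\<sigma> * \<sigma> = 1" and l: "l \<in> H" for \<sigma> l x
  proof -
    note L = bounded_complex_linearD[OF Rs_bcl[OF l]]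
    have "(\<sigma> * \<i>) *\<^sub>C Rs \<sigma> l (U x) - l *\<^sub>C Rs \<sigma> l (U (U x)) = U (U x)"
      using Rs_left[OF l \<sigma>, of "U x"] by (simp only: L)
    hence "l *\<^sub>C Rs \<sigma> l (U (U x)) = (\<sigma> * \<i>) *\<^sub>C Rs \<sigma> l (U x) - U (U x)" by (simp add: algebra_simps)
    hence "cmod l * norm (Rs \<sigma> l (U (U x))) = norm ((\<sigma> * \<i>) *\<^sub>C Rs \<sigma> l (U x) - U (U x))" by (metis norm_scaleC)
    also have "\<dots> \<le> norm (Rs \<sigma> l (U x)) + norm (U (U x))"
      by (rule order_trans[OF norm_triangle_ineq4]) (simp only: norm_scaleC s1[OF \<sigma>] mult_1 order_refl)
    also have "\<dots> \<le> 2 * M * norm x + (norm x * N) * N"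
      by (intro add_mono b2 \<sigma> l order_trans[OF N(2)] mult_right_mono N(2)) (use N in simp)
    also have "\<dots> = (2 * M + N * N) * norm x" by (simp add: algebra_simps)
    finally have "k * (cmod l * norm (Rs \<sigma> l (U (U x)))) \<le> k * ((2 * M + N * N) * norm x)"
      using k by (intro mult_left_mono) auto
    moreover have "(1 + cmod l) * norm (Rs \<sigma> l (U (U x))) \<le> k * cmod l * norm (Rs \<sigma> l (U (U x)))"
      by (rule mult_right_mono[OF lk[OF l]]) simp
    ultimately have "(1 + cmod l) * norm (Rs \<sigma> l (U (U x))) \<le> k * (2 * M + N * N) * norm x" by simp
    moreover have "1 + cmod l > 0" by (simp add: add_pos_nonneg)
    ultimately show ?thesis by (simp add: pos_le_divide_eq mult.commute)
  qed
  define M' where "M' = N + 2 * M + k * (2 * M + N * N)"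
  have kp: "k * (2 * M + N * N) \<ge> 0" using k M N by simp
  show ?thesis
  proof (rule that[of M'])
    show "M' > 0" using kp M N by (simp add: M'_def)
    fix \<sigma> l x assume \<sigma>: "\<sigma> * \<sigma> = (1::complex)" and l: "l \<in> H"
    show "norm (Rs \<sigma> l x) \<le> M' * (1 + cmod l) * norm x"
      by (rule order_trans[OF b1[OF \<sigma> l]]) (intro mult_right_mono, use kp in \<open>auto simp: M'_def\<close>)
    show "norm (Rs \<sigma> l (U x)) \<le> M' * norm x"
      by (rule order_trans[OF b2[OF \<sigma> l]]) (intro mult_right_mono, use kp N in \<open>auto simp: M'_def\<close>)
    show "norm (Rs \<sigma> l (U (U x))) \<le> M' / (1 + cmod l) * norm x"
      by (rule order_trans[OF b3[OF \<sigma> l]]) (intro mult_right_mono divide_right_mono, use kp N M in \<open>auto simp: M'_def\<close>)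
  next
    fix l x assume l: "l \<in> H"
    show "norm (R2 l x) \<le> M' * norm x"
      by (rule order_trans[OF M(2)[OF l]]) (intro mult_right_mono, use kp N M in \<open>auto simp: M'_def\<close>)
  next
    fix x
    have "norm (U x) \<le> N * norm x" using N(2)[of x] by (simp add: mult.commute)
    also have "\<dots> \<le> M' * norm x" by (intro mult_right_mono, use kp N M in \<open>auto simp: M'_def\<close>)
    finally show "norm (U x) \<le> M' * norm x" .
  qed
qed

lemma op_power_neg_half: "op_power A (- (1/2)) = graph U"
  by (simp add: op_power_def U_def)

lemma op_sqrt_eq: "op_sqrt A = (graph U)\<inverse>"
  by (simp add: op_power_def U_def)

lemma op_power_three_halves: "op_power A (3/2) = (graph (\<lambda>x. U (U (U x))))\<inverse>"
proof -
  have f: "frac (3/2::real) = 1/2" "frac (1/2::real) = 1/2" and n: "nat \<lfloor>3/2::real\<rfloor> = 1" "nat \<lfloor>1/2::real\<rfloor> = 0"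
    by (simp_all add: frac_def)
  have "neg_power A (3/2) x = U (U (U x))" for x
  proof -
    have "neg_power A (3/2) x = resolvent A 0 (neg_power A (1/2) x)"
      unfolding neg_power_def f n by simp
    also have "\<dots> = U (U (U x))" unfolding U_def[symmetric] by (rule U(2)[symmetric])
    finally show ?thesis .
  qed
  hence "neg_power A (3/2) = (\<lambda>x. U (U (U x)))" by (rule ext)
  thus ?thesis by (simp add: op_power_def)
qed

lemma shift_sqrt_eq_graph:
  assumes l: "l \<in> H" and \<sigma>: "\<sigma> * \<sigma> = 1"
  shows "(op_shift (op_scale (\<sigma> * \<i>) (op_sqrt A)) (- l))\<inverse> = graph (Rs \<sigma> l)"
proof -
  have "(y, u) \<in> (op_shift (op_scale (\<sigma> * \<i>) (op_sqrt A)) (- l))\<inverse> \<longleftrightarrow> (\<exists>x. u = U x \<and> y = (\<sigma> * \<i>) *\<^sub>C x - l *\<^sub>C U x)" for y u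
    unfolding op_sqrt_eq op_shift_def op_scale_def graph_def by (auto simp: scaleC.minus_left)
  moreover have "(\<exists>x. u = U x \<and> y = (\<sigma> * \<i>) *\<^sub>C x - l *\<^sub>C U x) \<longleftrightarrow> u = Rs \<sigma> l y" for y u
    using Rs_left[OF l \<sigma>] Rs_right[OF l \<sigma>, of y] by metis
  ultimately show ?thesis by (auto simp: graph_eqD)
qed

lemma shift_A_eq_graph: "l \<in> H \<Longrightarrow> (op_shift A (l\<^sup>2))\<inverse> = graph (R2 l)"
  by (rule resolvent_setD(2)[OF sq_in(2)])

end

section \<open>Line integrals of functions with values in the Lebesgue space\<close>

lemma nonneg_integrable_lebesgue:
  fixes h :: "real \<Rightarrow> real"
  assumes "h integrable_on UNIV" "\<And>x. 0 \<le> h x" shows "integrable lebesgue h"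
proof -
  have "h absolutely_integrable_on UNIV" using assms by (intro nonnegative_absolutely_integrable_1) auto
  thus ?thesis by (simp add: set_integrable_def)
qed

lemma continuous_dominated_norm_integrable:
  fixes F :: "real \<Rightarrow> 'b::banach"
  assumes F: "continuous_on UNIV F" and h: "h integrable_on UNIV" and le: "\<And>s. norm (F s) \<le> h s"
  shows "strongly_measurable (lebesgue_on UNIV) F" "integrable (lebesgue_on UNIV) (\<lambda>s. norm (F s))"
proof -
  show m: "strongly_measurable (lebesgue_on UNIV) F" by (rule strongly_measurable_continuous_on[OF _ F]) simp
  have h0: "0 \<le> h s" for s using le[of s] norm_ge_zero order_trans by blast
  have "integrable (lebesgue_on UNIV) h" using nonneg_integrable_lebesgue[OF h h0] by (simp add: lebesgue_on_UNIV_eq)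
  thus "integrable (lebesgue_on UNIV) (\<lambda>s. norm (F s))"
  proof (rule Bochner_Integration.integrable_bound)
    show "(\<lambda>s. norm (F s)) \<in> borel_measurable (lebesgue_on UNIV)"
      using strongly_measurable_diff_measurable[OF _ m, of "\<lambda>x. 0" norm] by (auto intro: continuous_on_norm_id)
    show "AE s in lebesgue_on UNIV. norm (norm (F s)) \<le> norm (h s)"
      by (rule AE_I2) (use le in \<open>auto intro: order_trans[OF _ abs_ge_self]\<close>)
  qed
qed

lemma has_line_integral_pointwise:
  fixes F :: "complex \<Rightarrow> 'e::complex_banach"
  assumes F: "continuous_on UNIV (\<lambda>s. F (Complex a s))" and h: "h integrable_on UNIV"
    and le: "\<And>s. norm (F (Complex a s)) \<le> h s"
  shows "has_line_integral UNIV norm a F (\<i> *\<^sub>C integral UNIV (\<lambda>s. F (Complex a s)))"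
proof -
  have "has_bochner (lebesgue_on UNIV) (\<lambda>s. \<i> *\<^sub>C F (Complex a s)) (integral UNIV (\<lambda>s. \<i> *\<^sub>C F (Complex a s)))"
    by (rule has_bochner_strong(2)[OF _ continuous_dominated_norm_integrable[OF _ h]])
       (use le in \<open>auto intro!: continuous_intros F simp: norm_scaleC\<close>)
  thus ?thesis unfolding has_line_integral_def
    using integral_scaleC_right[OF continuous_dominated_integrable[OF F le h], of \<i>] by (simp add: lebesgue_on_UNIV_eq)
qed

lemma Lp_norm_cong_AE:
  assumes "strongly_measurable (interval T) f" "AE t in interval T. g t = f t"
  shows "Lp_norm p T g = Lp_norm p T f"
proof -
  have m: "strongly_measurable (interval T) g" by (rule strongly_measurable_cong_AE[OF assms])
  have "(LINT t|interval T. norm (g t) powr p) = (LINT t|interval T. norm (f t) powr p)"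
  proof (rule Bochner_Integration.integral_cong_AE)
    show "(\<lambda>t. norm (g t) powr p) \<in> borel_measurable (interval T)" using strongly_measurable_norm[OF m] by measurable
    show "(\<lambda>t. norm (f t) powr p) \<in> borel_measurable (interval T)" using strongly_measurable_norm[OF assms(1)] by measurable
    show "AE t in interval T. norm (g t) powr p = norm (f t) powr p" using assms(2) by eventually_elim simp
  qed
  thus ?thesis by (simp add: Lp_norm_def)
qed

lemma Lp_norm_bcontfun:
  fixes y :: "real \<Rightarrow>\<^sub>C 'e::complex_banach"
  assumes p: "1 < p"
  shows "Lp_norm p T (apply_bcontfun y) \<le> ((LINT t|interval T. 1) powr (1/p)) * norm y"
proof -
  have le: "norm (apply_bcontfun y t) \<le> norm y" for t using norm_bounded[of y t] .
  have c: "continuous_on {0..T} (apply_bcontfun y)" by simp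
  have "(LINT t|interval T. norm (apply_bcontfun y t) powr p) \<le> (LINT t|interval T. norm y powr p)"
  proof (rule integral_mono)
    show "integrable (interval T) (\<lambda>t. norm (apply_bcontfun y t) powr p)"
      using Lp_continuous[OF p c] by (simp add: Lp_def)
    show "integrable (interval T) (\<lambda>t. norm y powr p)" by (rule integrable_const_interval)
    show "norm (apply_bcontfun y t) powr p \<le> norm y powr p" for t
      by (rule powr_mono2) (use p le in auto)
  qed
  also have "\<dots> = (LINT t|interval T. 1) * norm y powr p"
    by (simp add: mult.commute)
  finally have "Lp_norm p T (apply_bcontfun y) \<le> ((LINT t|interval T. 1) * norm y powr p) powr (1/p)"
    unfolding Lp_norm_def by (rule powr_mono2[rotated 2]) (use p in \<open>auto intro: integral_nonneg_AE\<close>)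
  also have "\<dots> = ((LINT t|interval T. 1) powr (1/p)) * norm y"
    using p by (simp add: powr_mult powr_powr)
  finally show ?thesis .
qed

text \<open>By dominated convergence: a sequence convergent in the supremum norm is bounded and
  converges pointwise on a set of finite measure. No triangle inequality in L^p enters.\<close>

lemma Lp_norm_bcontfun_continuous:
  assumes p: "1 < p"
  shows "continuous_on UNIV (\<lambda>y :: real \<Rightarrow>\<^sub>C 'e::complex_banach. Lp_norm p T (apply_bcontfun y))"
proof (rule continuous_on_sequentiallyI)
  fix u :: "nat \<Rightarrow> real \<Rightarrow>\<^sub>C 'e" and a assume u: "u \<longlonglongrightarrow> a"
  obtain B where B: "B > 0" "\<And>n. norm (u n) \<le> B"
    using Bseq_def convergent_imp_Bseq[OF convergentI[OF u]] by (metis BseqE)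
  have pt: "(\<lambda>n. apply_bcontfun (u n) t) \<longlonglongrightarrow> apply_bcontfun a t" for t
  proof (rule metric_tendsto_imp_tendsto[OF u])
    show "\<forall>\<^sub>F n in sequentially. dist (apply_bcontfun (u n) t) (apply_bcontfun a t) \<le> dist (u n) a"
      by (rule always_eventually) (simp add: dist_bounded)
  qed
  have c: "continuous_on {0..T} (apply_bcontfun y)" for y :: "real \<Rightarrow>\<^sub>C 'e" by simp
  have i: "integrable (interval T) (\<lambda>t. norm (apply_bcontfun y t) powr p)" for y :: "real \<Rightarrow>\<^sub>C 'e"
    using Lp_continuous[OF p c] by (simp add: Lp_def)
  have "(\<lambda>n. LINT t|interval T. norm (apply_bcontfun (u n) t) powr p) \<longlonglongrightarrow> (LINT t|interval T. norm (apply_bcontfun a t) powr p)"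
  proof (rule integral_dominated_convergence[where w="\<lambda>t. B powr p"])
    show "(\<lambda>t. norm (apply_bcontfun a t) powr p) \<in> borel_measurable (interval T)" using i by blast
    show "(\<lambda>t. norm (apply_bcontfun (u n) t) powr p) \<in> borel_measurable (interval T)" for n using i by blast
    show "integrable (interval T) (\<lambda>t. B powr p)" by (rule integrable_const_interval)
    show "AE t in interval T. (\<lambda>n. norm (apply_bcontfun (u n) t) powr p) \<longlonglongrightarrow> norm (apply_bcontfun a t) powr p"
    proof (rule AE_I2)
      fix t
      have c: "continuous_on {0..} (\<lambda>x::real. x powr p)"
        by (rule continuous_on_powr'[OF continuous_on_id continuous_on_const]) (use p in auto)
      show "(\<lambda>n. norm (apply_bcontfun (u n) t) powr p) \<longlonglongrightarrow> norm (apply_bcontfun a t) powr p"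
        by (rule continuous_on_tendsto_compose[OF c tendsto_norm[OF pt]]) auto
    qed
    show "AE t in interval T. norm (norm (apply_bcontfun (u n) t) powr p) \<le> B powr p" for n
    proof (rule AE_I2)
      fix t
      have "norm (apply_bcontfun (u n) t) \<le> B" using norm_bounded[of "u n" t] B(2)[of n] by linarith
      thus "norm (norm (apply_bcontfun (u n) t) powr p) \<le> B powr p" using p by (simp add: powr_mono2)
    qed
  qed
  moreover have c2: "continuous_on {0..} (\<lambda>x::real. x powr (1/p))"
    by (rule continuous_on_powr'[OF continuous_on_id continuous_on_const]) (use p in auto)
  ultimately have "(\<lambda>n. (LINT t|interval T. norm (apply_bcontfun (u n) t) powr p) powr (1/p)) \<longlonglongrightarrow> (LINT t|interval T. norm (apply_bcontfun a t) powr p) powr (1/p)"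
    by (intro continuous_on_tendsto_compose[OF c2]) (auto intro!: integral_nonneg_AE always_eventually)
  thus "(\<lambda>n. Lp_norm p T (apply_bcontfun (u n))) \<longlonglongrightarrow> Lp_norm p T (apply_bcontfun a)" by (simp add: Lp_norm_def)
qed

instance bcontfun :: (metric_space, banach) banach ..

definition clampT :: "real \<Rightarrow> real \<Rightarrow> real" where "clampT T t = max 0 (min T t)"

text \<open>The functions on \<open>[0,T]\<close> are extended constantly, so that the Banach space of bounded continuous
  functions on the line can be mapped linearly to representatives in \<open>L\<^sup>p\<close>.\<close>

lemma Lp_line_integral_continuous:
  fixes f :: "real \<Rightarrow> real \<Rightarrow> 'e::complex_banach"
  assumes T: "T > 0" and p: "1 < p"
    and cont: "continuous_on (UNIV \<times> {0..T}) (\<lambda>(s, t). f s t)"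
    and bd: "\<And>s t. t \<in> {0..T} \<Longrightarrow> norm (f s t) \<le> h s" and h: "h integrable_on UNIV"
    and X: "\<And>s. AE t in interval T. X (Complex a s) t = f s t"
  shows "Lp_line_integral p T a X (\<lambda>t. \<i> *\<^sub>C integral UNIV (\<lambda>s. f s (clampT T t)))"
proof -
  have cl: "clampT T t \<in> {0..T}" for t using T by (auto simp: clampT_def)
  have clc: "continuous_on S (clampT T)" for S unfolding clampT_def by (intro continuous_intros)
  have fs: "continuous_on {0..T} (f s)" for s
  by (rule continuous_on_section2[OF cont]) simp
  have ft: "continuous_on UNIV (\<lambda>s. f s t)" if "t \<in> {0..T}" for t
  by (rule continuous_on_section1[OF cont that])
  define F where "F s = Bcontfun (\<lambda>t. f s (clampT T t))" for s
  have Fa: "apply_bcontfun (F s) t = f s (clampT T t)" for s t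
  proof -
    have "(\<lambda>t. f s (clampT T t)) \<in> bcontfun"
    proof (rule bcontfun_normI)
      show "continuous_on UNIV (\<lambda>t. f s (clampT T t))"
        by (rule continuous_on_compose2[OF fs clc]) (use cl in blast)
      show "norm (f s (clampT T t)) \<le> h s" for t by (rule bd[OF cl])
    qed
    thus ?thesis by (simp add: F_def Bcontfun_inverse)
  qed
  have Fn: "norm (F s) \<le> h s" for s by (rule norm_bound, unfold Fa, rule bd[OF cl])
  have Fc: "continuous_on UNIV F"
    unfolding continuous_on_iff
  proof (intro ballI allI impI)
    fix s and e :: real assume e: "e > 0"
    have "e/2 > 0" using e by simp
    \<comment> \<open>Compactness of [0,T] upgrades joint continuity to continuity of s \<mapsto> f
      s in the supremum norm.\<close>
    from continuous_on_prod_compactE[OF cont compact_Icc UNIV_I this]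
    obtain X0 where X0: "s \<in> X0" "open X0" "\<forall>x\<in>X0 \<inter> UNIV. \<forall>t\<in>{0..T}. dist (f x t) (f s t) \<le> e/2" by auto
    obtain d where d: "d > 0" "\<And>x. dist x s < d \<Longrightarrow> x \<in> X0"
      using X0(1,2) unfolding open_dist by blast
    show "\<exists>d>0. \<forall>x\<in>UNIV. dist x s < d \<longrightarrow> dist (F x) (F s) < e"
    proof (intro exI[of _ d] conjI ballI impI)
      fix x assume "dist x s < d"
      hence x: "x \<in> X0" using d by blast
      have "dist (F x) (F s) \<le> e/2" by (rule dist_bound) (use X0(3) x cl in \<open>simp add: Fa\<close>)
      thus "dist (F x) (F s) < e" using e by simp
    qed (rule d(1))
  qed
  note Fm = continuous_dominated_norm_integrable[OF Fc h Fn]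
  have Fi: "F integrable_on UNIV" by (rule continuous_dominated_integrable[OF Fc Fn h])
  let ?L = "\<lambda>y :: real \<Rightarrow>\<^sub>C 'e. (\<lambda>t. \<i> *\<^sub>C apply_bcontfun y t)"
  let ?C = "(LINT t|interval T. 1) powr (1/p)"
  have NL: "Lp_norm p T (?L y) = Lp_norm p T (apply_bcontfun y)" for y
    by (simp add: Lp_norm_def norm_scaleC)
  have LV: "?L y \<in> Lp p T" for y by (rule Lp_continuous[OF p]) (intro continuous_intros continuous_on_apply_bcontfun)
  have Lp0: "0 \<le> Lp_norm p T g" for g :: "real \<Rightarrow> 'e" by (simp add: Lp_norm_def)
  have Xc: "(\<lambda>t. \<i> *\<^sub>C X (Complex a s) t) \<in> Lp p T" for s
  proof (rule Lp_cong_AE[OF LV[of "F s"]])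
    have "AE t in interval T. t \<in> {0<..<T}" by (rule AE_I2) simp
    with X[of s] show "AE t in interval T. \<i> *\<^sub>C X (Complex a s) t = \<i> *\<^sub>C apply_bcontfun (F s) t"
      by eventually_elim (simp add: Fa clampT_def)
  qed
  have "has_bochner_in (Lp p T) (Lp_norm p T) (lebesgue_on UNIV) (\<lambda>s. \<i> *\<^sub>C X (Complex a s)) (?L (integral UNIV F))"
  proof (rule has_bochner_in_linear_image(2)[OF _ Fm, of ?L "Lp p T" "Lp_norm p T" ?C])
    show "linear ?L" by (rule linearI) (simp_all add: fun_eq_iff scaleC.add_right scaleR_fun_def scaleC.scaleR_right)
    show "continuous_on UNIV (\<lambda>y. Lp_norm p T (?L y))" unfolding NL by (rule Lp_norm_bcontfun_continuous[OF p])
    show "Lp_norm p T (?L y) \<le> ?C * norm y" for y unfolding NL by (rule Lp_norm_bcontfun[OF p])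
    show "\<i> *\<^sub>C X (Complex a s) \<in> Lp p T" for s using Xc[of s] by (simp add: scaleC_fun_def)
    show "AE s in lebesgue_on UNIV. \<forall>y. Lp_norm p T (\<i> *\<^sub>C X (Complex a s) - ?L y) = Lp_norm p T (?L (F s - y))"
    proof (rule AE_I2, rule allI)
      fix s y
      show "Lp_norm p T (\<i> *\<^sub>C X (Complex a s) - ?L y) = Lp_norm p T (?L (F s - y))"
      proof (rule Lp_norm_cong_AE)
        show "strongly_measurable (interval T) (?L (F s - y))" using LV[of "F s - y"] unfolding Lp_def by blast
        have "AE t in interval T. t \<in> {0<..<T}" by (rule AE_I2) simp
        with X[of s] show "AE t in interval T. (\<i> *\<^sub>C X (Complex a s) - ?L y) t = ?L (F s - y) t"
          by eventually_elim (simp add: Fa clampT_def scaleC_fun_def scaleC.diff_right)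
      qed
    qed
  qed (simp_all add: LV Lp0)
  moreover have "apply_bcontfun (integral UNIV F) t = integral UNIV (\<lambda>s. f s (clampT T t))" for t
  proof -
    have "bounded_linear (\<lambda>y :: real \<Rightarrow>\<^sub>C 'e. apply_bcontfun y t)"
      by (rule bounded_linear_intro[of _ 1]) (simp_all add: norm_bounded)
    from integral_linear[OF Fi this] show ?thesis by (simp add: o_def Fa)
  qed
  ultimately show ?thesis unfolding has_line_integral_def by (simp add: lebesgue_on_UNIV_eq)
qed

lemma integral_reflect_UNIV:
  fixes f :: "real \<Rightarrow> 'b::banach"
  assumes "f integrable_on UNIV" "(\<lambda>s. f (- s)) integrable_on UNIV"
  shows "integral UNIV (\<lambda>s. f (- s)) = integral UNIV f"
proof -
  have "integral {- real n..real n} (\<lambda>s. f (- s)) = integral {- real n..real n} f" for n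
    using Henstock_Kurzweil_Integration.integral_reflect_real[where f=f and a="- real n" and b="real n"] by simp
  with integral_symmetric_limit[OF assms(2)] integral_symmetric_limit[OF assms(1)] show ?thesis
    using LIMSEQ_unique by auto
qed

lemma cmod_ge_shifted:
  assumes "d > 0" "d \<le> \<bar>Re z\<bar>"
  shows "cmod z \<ge> (min d 1 / 2) * (1 + \<bar>Im z\<bar>)"
proof -
  have 1: "d \<le> cmod z" using assms abs_Re_le_cmod[of z] by linarith
  have 2: "\<bar>Im z\<bar> \<le> cmod z" by (rule abs_Im_le_cmod)
  have "min d 1 * (1 + \<bar>Im z\<bar>) = min d 1 + min d 1 * \<bar>Im z\<bar>" by (simp add: distrib_left)
  also have "\<dots> \<le> d + 1 * \<bar>Im z\<bar>" by (intro add_mono mult_right_mono) auto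
  also have "\<dots> \<le> 2 * cmod z" using 1 2 by simp
  finally show ?thesis by simp
qed

text \<open>The origin of every factor 2 pi. The pole \<mu> lies to the left of the line and \<nu>
  to the right; each fraction alone is of order 1/|s|, their difference is of order 1/s^2. The
  antiderivative is written with arctan and real logarithms, so no branch of the complex logarithm
  has to be followed.\<close>

lemma scalar_line_integral:
  assumes \<mu>: "Re \<mu> < a" and \<nu>: "a < Re \<nu>"
  shows "((\<lambda>s. 1 / (Complex a s - \<mu>) - 1 / (Complex a s - \<nu>)) has_integral complex_of_real (2 * pi)) UNIV"
proof -
  define p q y x where "p = a - Re \<mu>" and "q = Re \<nu> - a" and "y = Im \<mu>" and "x = Im \<nu>"
  have pq: "p > 0" "q > 0" using \<mu> \<nu> by (simp_all add: p_def q_def)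
  let ?f = "\<lambda>s. 1 / (Complex a s - \<mu>) - 1 / (Complex a s - \<nu>)"
  have ne: "Complex a s - \<mu> \<noteq> 0" "Complex a s - \<nu> \<noteq> 0" for s using \<mu> \<nu> by (auto simp: complex_eq_iff)
  have fc: "continuous_on S ?f" for S by (intro continuous_intros ne ballI) 
  define d1 d2 where "d1 = min p 1 / 2" and "d2 = min q 1 / 2"
  have d: "d1 > 0" "d2 > 0" using pq by (simp_all add: d1_def d2_def)
  have tr: "1 + \<bar>s\<bar> \<le> (1 + \<bar>v\<bar>) * (1 + \<bar>s - v\<bar>)" for s v :: real
  proof -
    have "1 + \<bar>s\<bar> \<le> 1 + \<bar>v\<bar> + \<bar>s - v\<bar>" by linarith
    also have "\<dots> \<le> (1 + \<bar>v\<bar>) * (1 + \<bar>s - v\<bar>)" by (simp add: algebra_simps)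
    finally show ?thesis .
  qed
  have g: "1 / cmod (Complex a s - w) \<le> (1 + \<bar>Im w\<bar>) / (min d 1 / 2) * (1 / (1 + \<bar>s\<bar>))"
    if d: "d > 0" "d \<le> \<bar>a - Re w\<bar>" for d w s
  proof -
    let ?m = "min d 1 / 2"
    have m: "?m > 0" using d by simp
    have "?m * (1 + \<bar>s\<bar>) \<le> (1 + \<bar>Im w\<bar>) * (?m * (1 + \<bar>s - Im w\<bar>))"
      using mult_left_mono[OF tr[of s "Im w"], of ?m] m by (simp only: mult_ac)
    also have "\<dots> \<le> (1 + \<bar>Im w\<bar>) * cmod (Complex a s - w)"
      using cmod_ge_shifted[of d "Complex a s - w"] d by (intro mult_left_mono) simp_all
    finally have "?m * (1 + \<bar>s\<bar>) \<le> (1 + \<bar>Im w\<bar>) * cmod (Complex a s - w)" .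
    moreover have "cmod (Complex a s - w) > 0" using d by (auto simp: complex_eq_iff)
    moreover have "1 / N \<le> Y / M * (1 / X)" if "M * X \<le> Y * N" "N > 0" "M > 0" "X > 0" for M X Y N :: real
      using that by (simp add: field_simps)
    ultimately show ?thesis using m by (simp only: zero_less_one add_pos_nonneg abs_ge_zero)
  qed
  define C where "C = cmod (\<mu> - \<nu>) * ((1 + \<bar>y\<bar>) / d1 * ((1 + \<bar>x\<bar>) / d2))"
  have fb: "norm (?f s) \<le> C * kap 1 s" for s
  proof -
    have 1: "1 / cmod (Complex a s - \<mu>) \<le> (1 + \<bar>y\<bar>) / d1 * (1 / (1 + \<bar>s\<bar>))"
      using g[of p \<mu> s] pq by (simp add: p_def y_def d1_def)
    have 2: "1 / cmod (Complex a s - \<nu>) \<le> (1 + \<bar>x\<bar>) / d2 * (1 / (1 + \<bar>s\<bar>))"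
      using g[of q \<nu> s] pq by (simp add: q_def x_def d2_def)
    have "?f s = (\<mu> - \<nu>) * (1 / (Complex a s - \<mu>) * (1 / (Complex a s - \<nu>)))" using ne[of s] by (simp add: field_simps)
    hence "norm (?f s) = cmod (\<mu> - \<nu>) * (1 / cmod (Complex a s - \<mu>) * (1 / cmod (Complex a s - \<nu>)))"
      by (simp only: norm_mult norm_divide norm_one)
    also have "\<dots> \<le> cmod (\<mu> - \<nu>) * ((1 + \<bar>y\<bar>) / d1 * (1 / (1 + \<bar>s\<bar>)) * ((1 + \<bar>x\<bar>) / d2 * (1 / (1 + \<bar>s\<bar>))))"
      by (intro mult_left_mono mult_mono 1 2) (use d in auto)
    also have "\<dots> = C * kap 1 s"
      by (simp add: C_def kap_def powr_minus powr_numeral inverse_eq_divide power2_eq_square)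
    finally show ?thesis .
  qed
  have fi: "?f integrable_on UNIV"
    by (rule continuous_dominated_integrable[OF fc fb]) (use integrable_on_cmult_left[OF kap_integrable[of 1], of C] in simp)
  let ?G = "\<lambda>s. complex_of_real (arctan ((s - y) / p) + arctan ((s - x) / q))
     + \<i> * complex_of_real ((ln (q\<^sup>2 + (s - x)\<^sup>2) - ln (p\<^sup>2 + (s - y)\<^sup>2)) / 2)"
  have pos: "p\<^sup>2 + (s - y)\<^sup>2 > 0" "q\<^sup>2 + (s - x)\<^sup>2 > 0" for s using pq by (simp_all add: add_pos_nonneg)
  have G: "(?G has_vector_derivative ?f s) (at s within S)" for s S
  proof -
    have at: "((\<lambda>s. arctan ((s - v) / r)) has_real_derivative r / (r\<^sup>2 + (s - v)\<^sup>2)) (at s within S)" if "r > 0" for r v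
    proof -
      have "((\<lambda>s. arctan ((s - v) / r)) has_real_derivative inverse (1 + ((s - v) / r)\<^sup>2) * ((1 - 0) / r)) (at s within S)"
        by (rule DERIV_chain2[OF DERIV_arctan DERIV_cdivide[OF DERIV_diff[OF DERIV_ident DERIV_const]]])
      also have "inverse (1 + ((s - v) / r)\<^sup>2) * ((1 - 0) / r) = r / (r\<^sup>2 + (s - v)\<^sup>2)"
      proof -
        have "1 + ((s - v) / r)\<^sup>2 = (r\<^sup>2 + (s - v)\<^sup>2) / r\<^sup>2" using that by (simp add: power_divide add_divide_distrib)
        thus ?thesis using that by (simp add: power2_eq_square)
      qed
      finally show ?thesis .
    qed
    have lnd: "((\<lambda>s. ln (r\<^sup>2 + (s - v)\<^sup>2)) has_real_derivative (2 * (s - v)) / (r\<^sup>2 + (s - v)\<^sup>2)) (at s within S)" if "r\<^sup>2 + (s - v)\<^sup>2 > 0" for r v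
      using that by (auto intro!: derivative_eq_intros)
    note A = DERIV_add[OF at[OF pq(1), of y] at[OF pq(2), of x]]
    note B = DERIV_cdivide[OF DERIV_diff[OF lnd[OF pos(2)] lnd[OF pos(1)]], of 2]
    have A': "((\<lambda>s. complex_of_real (arctan ((s - y) / p) + arctan ((s - x) / q))) has_vector_derivative
      complex_of_real (p / (p\<^sup>2 + (s - y)\<^sup>2) + q / (q\<^sup>2 + (s - x)\<^sup>2))) (at s within S)"
      by (rule bounded_linear.has_vector_derivative[OF bounded_linear_of_real A[unfolded has_real_derivative_iff_has_vector_derivative]])
    have B1: "((\<lambda>s. complex_of_real ((ln (q\<^sup>2 + (s - x)\<^sup>2) - ln (p\<^sup>2 + (s - y)\<^sup>2)) / 2)) has_vector_derivative
      complex_of_real ((2 * (s - x) / (q\<^sup>2 + (s - x)\<^sup>2) - 2 * (s - y) / (p\<^sup>2 + (s - y)\<^sup>2)) / 2)) (at s within S)"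
      by (rule bounded_linear.has_vector_derivative[OF bounded_linear_of_real B[unfolded has_real_derivative_iff_has_vector_derivative]])
    note B' = bounded_linear.has_vector_derivative[OF bounded_linear_mult_right[of \<i>] B1]
    have e: "complex_of_real (p / (p\<^sup>2 + (s - y)\<^sup>2) + q / (q\<^sup>2 + (s - x)\<^sup>2))
      + \<i> * complex_of_real ((2 * (s - x) / (q\<^sup>2 + (s - x)\<^sup>2) - 2 * (s - y) / (p\<^sup>2 + (s - y)\<^sup>2)) / 2) = ?f s"
    proof -
      have 1: "1 / (Complex a s - \<mu>) = Complex (p / (p\<^sup>2 + (s - y)\<^sup>2)) (- ((s - y) / (p\<^sup>2 + (s - y)\<^sup>2)))"
        by (simp add: complex_eq_iff Re_divide Im_divide p_def y_def) (metis minus_diff_eq minus_divide_left)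
      have 2: "1 / (Complex a s - \<nu>) = Complex (- (q / (q\<^sup>2 + (s - x)\<^sup>2))) (- ((s - x) / (q\<^sup>2 + (s - x)\<^sup>2)))"
      proof -
        have "(a - Re \<nu>)\<^sup>2 = q\<^sup>2" by (simp add: q_def power2_commute)
        thus ?thesis by (simp add: complex_eq_iff Re_divide Im_divide q_def x_def) (simp add: minus_divide_left)
      qed
      have 3: "(2 * u / Q - 2 * v / P) / 2 = u / Q - v / P" for u v P Q :: real by (simp add: diff_divide_distrib)
      show ?thesis unfolding 1 2 3 by (simp add: complex_eq_iff)
    qed
    show ?thesis using has_vector_derivative_add[OF A' B'] unfolding e .
  qed
  have I: "integral {- real n..real n} ?f = ?G (real n) - ?G (- real n)" for n
    by (rule integral_unique, rule fundamental_theorem_of_calculus[OF _ G]) simp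
  have at_lim: "(\<lambda>n. arctan ((real n - v) / r)) \<longlonglongrightarrow> pi / 2" "(\<lambda>n. arctan ((- real n - v) / r)) \<longlonglongrightarrow> - (pi / 2)"
    if "r > 0" for r v using that by real_asymp+
  have lnq: "(\<lambda>n. ln (q\<^sup>2 + (real n - x)\<^sup>2) - ln (p\<^sup>2 + (real n - y)\<^sup>2)) \<longlonglongrightarrow> 0"
    "(\<lambda>n. ln (q\<^sup>2 + (- real n - x)\<^sup>2) - ln (p\<^sup>2 + (- real n - y)\<^sup>2)) \<longlonglongrightarrow> 0"
    by real_asymp+
  have "(\<lambda>n. ?G (real n) - ?G (- real n)) \<longlonglongrightarrow> (complex_of_real (pi / 2 + pi / 2) + \<i> * complex_of_real (0 / 2)) - (complex_of_real (- (pi / 2) + - (pi / 2)) + \<i> * complex_of_real (0 / 2))"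
    by (intro tendsto_intros at_lim pq lnq) simp_all
  hence "(\<lambda>n. integral {- real n..real n} ?f) \<longlonglongrightarrow> complex_of_real (2 * pi)" by (simp add: I)
  from LIMSEQ_unique[OF integral_symmetric_limit[OF fi] this] fi show ?thesis
    using integrable_integral by fastforce
qed

text \<open>The resolvent identity of B, used twice, leaves three nested Volterra operators in the
  remainder. They are bounded on bounded sets of z, so \<open>vol z g t\<close> satisfies the
  quadratic estimate without any restriction on the half plane.\<close>

lemma qd_vol:
  fixes g :: "real \<Rightarrow> 'e::complex_banach"
  assumes g: "L1 T g" and t: "t \<in> {0..T}" and S: "\<And>z. z \<in> S \<Longrightarrow> cmod z \<le> r"
  shows "qd S (\<lambda>z. vol z g t)"
proof -
  define a where "a = \<bar>r\<bar>"
  have a: "- a \<le> Re z" "a \<ge> 0" if "z \<in> S" for z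
    using S[OF that] abs_Re_le_cmod[of z] by (auto simp: a_def)
  define E where "E = exp (a * T)"
  define B where "B = integral {0..T} (\<lambda>x. norm (g x))"
  have T: "T \<ge> 0" using t by auto
  have E: "E \<ge> 0" by (simp add: E_def)
  have v1: "L1 T (vol z g)" for z by (intro L1_continuous vol_continuous g)
  have v2: "L1 T (vol z (vol w g))" for z w by (intro L1_continuous vol_continuous v1)
  have b1: "norm (vol z g s) \<le> E * B" if "z \<in> S" "s \<in> {0..T}" for z s
    unfolding E_def B_def by (rule vol_norm_le[OF g that(2) a[OF that(1)]])
  have I: "integral {0..T} (\<lambda>x. norm (h x)) \<le> T * X" if "L1 T h" "\<And>s. s \<in> {0..T} \<Longrightarrow> norm (h s) \<le> X" for h :: "real \<Rightarrow> 'e" and X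
  proof -
    have "integral {0..T} (\<lambda>x. norm (h x)) \<le> integral {0..T} (\<lambda>x. X)"
      by (rule integral_le) (use that L1_integrable(2)[OF that(1)] in auto)
    thus ?thesis using T by simp
  qed
  have b2: "norm (vol w (vol z g) s) \<le> E * (T * (E * B))" if "z \<in> S" "w \<in> S" "s \<in> {0..T}" for z w s
  proof -
    have "norm (vol w (vol z g) s) \<le> E * integral {0..T} (\<lambda>x. norm (vol z g x))"
      unfolding E_def by (rule vol_norm_le[OF v1 that(3) a[OF that(2)]])
    also have "\<dots> \<le> E * (T * (E * B))" by (intro mult_left_mono I v1 b1 that E)
    finally show ?thesis .
  qed
  have b3: "norm (vol w (vol z (vol z g)) s) \<le> E * (T * (E * (T * (E * B))))" if "z \<in> S" "w \<in> S" "s \<in> {0..T}" for z w s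
  proof -
    have "norm (vol w (vol z (vol z g)) s) \<le> E * integral {0..T} (\<lambda>x. norm (vol z (vol z g) x))"
      unfolding E_def by (rule vol_norm_le[OF v2 that(3) a[OF that(2)]])
    also have "\<dots> \<le> E * (T * (E * (T * (E * B))))" by (intro mult_left_mono I v2 b2 that E)
    finally show ?thesis .
  qed
  show ?thesis
  proof (rule qdI[where D="\<lambda>z. - vol z (vol z g) t"])
    show "norm (vol z g t) \<le> E * B" if "z \<in> S" for z by (rule b1[OF that t])
    show "norm (- vol z (vol z g) t) \<le> E * (T * (E * B))" if "z \<in> S" for z using b2[OF that that t] by simp
    fix z w assume z: "z \<in> S" and w: "w \<in> S"
    have "vol w g t - vol z g t - (w - z) *\<^sub>C (- vol z (vol z g) t) = (z - w) *\<^sub>C (vol w (vol z g) t - vol z (vol z g) t)"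
      by (simp only: vol_resolvent[OF g t] scaleC.diff_right scaleC.minus_right scaleC.diff_left) simp
    also have "\<dots> = ((z - w) * (z - w)) *\<^sub>C vol w (vol z (vol z g)) t"
      by (simp only: vol_resolvent[OF v1 t] scaleC_scaleC)
    finally have "norm (vol w g t - vol z g t - (w - z) *\<^sub>C (- vol z (vol z g) t)) = (cmod (w - z))\<^sup>2 * norm (vol w (vol z (vol z g)) t)"
      by (simp only: norm_scaleC norm_mult power2_eq_square norm_minus_commute)
    also have "\<dots> \<le> (cmod (w - z))\<^sup>2 * (E * (T * (E * (T * (E * B)))))" by (intro mult_left_mono b3 z w t) simp
    finally show "norm (vol w g t - vol z g t - (w - z) *\<^sub>C (- vol z (vol z g) t)) \<le> (E * (T * (E * (T * (E * B))))) * (cmod (w - z))\<^sup>2"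
      by (simp only: mult.commute)
  qed
qed

lemma qd_uminus:
  fixes F :: "complex \<Rightarrow> 'e::complex_banach"
  assumes "qd (uminus ` S) F" shows "qd S (\<lambda>z. F (- z))"
proof -
  obtain D C where D: "\<And>z. z \<in> uminus ` S \<Longrightarrow> norm (F z) \<le> C" "\<And>z. z \<in> uminus ` S \<Longrightarrow> norm (D z) \<le> C"
    "\<And>z w. z \<in> uminus ` S \<Longrightarrow> w \<in> uminus ` S \<Longrightarrow> norm (F w - F z - (w - z) *\<^sub>C D z) \<le> C * (cmod (w - z))\<^sup>2"
    using assms unfolding qd_def by blast
  show ?thesis
  proof (rule qdI[where D="\<lambda>z. - D (- z)"])
    fix z w assume "z \<in> S" "w \<in> S"
    hence zw: "- z \<in> uminus ` S" "- w \<in> uminus ` S" by auto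
    have "(w - z) *\<^sub>C (- D (- z)) = (- w - - z) *\<^sub>C D (- z)" by (simp add: scaleC.minus_right scaleC.diff_left scaleC.minus_left)
    moreover have "cmod (- w - - z) = cmod (w - z)" using norm_minus_cancel[of "w - z"] by (simp add: norm_minus_commute)
    ultimately show "norm (F (- w) - F (- z) - (w - z) *\<^sub>C (- D (- z))) \<le> C * (cmod (w - z))\<^sup>2"
      using D(3)[OF zw] by simp
  qed (use D in auto)
qed

section \<open>Decay of the resolvents\<close>

lemma kap_shift:
  assumes "\<bar>d\<bar> \<le> 1" "e > 0" shows "kap e (x + d) \<le> 2 powr (e + 1) * kap e x"
proof -
  have "\<bar>x\<bar> \<le> \<bar>x + d\<bar> + \<bar>d\<bar>" by arith
  moreover have "1 + a \<le> 2 * (1 + b)" if "a \<le> b + f" "f \<le> 1" "0 \<le> b" for a b f :: real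
    using that by simp
  ultimately have "1 + \<bar>x\<bar> \<le> 2 * (1 + \<bar>x + d\<bar>)" using assms(1) abs_ge_zero by metis
  hence "(2 * (1 + \<bar>x + d\<bar>)) powr (- e - 1) \<le> (1 + \<bar>x\<bar>) powr (- e - 1)"
    by (rule powr_mono2'[rotated 2]) (use assms in auto)
  moreover have "(2 * (1 + \<bar>x + d\<bar>)) powr (- e - 1) = 2 powr (- e - 1) * (1 + \<bar>x + d\<bar>) powr (- e - 1)"
    by (rule powr_mult)
  ultimately have "2 powr (- e - 1) * kap e (x + d) \<le> kap e x" unfolding kap_def by (simp only:)
  hence "2 powr (e + 1) * (2 powr (- e - 1) * kap e (x + d)) \<le> 2 powr (e + 1) * kap e x" by (rule mult_left_mono) simp
  thus ?thesis by (simp add: mult.assoc[symmetric] powr_add[symmetric])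
qed

lemma kap_add_integral:
  assumes "e > 0"
  shows "((\<lambda>s. kap e (s + d)) has_integral integral UNIV (kap e)) UNIV"
  by (rule integrable_on_shift_UNIV[OF integrable_integral[OF kap_integrable[OF assms]]])

text \<open>The majorant in the inner variable s for outer variable r. The peaks at r and - r come
  from the factors l - z and l + z of the kernel, the peak at 0 from the decay of the data in l. Its
  integral does not depend on r.\<close>

definition kap3 :: "real \<Rightarrow> real \<Rightarrow> real" where
  "kap3 r s = kap (1/4) s + kap (1/4) (s - r) + kap (1/4) (s + r)"

lemma kap3_nonneg: "0 \<le> kap3 r s" by (simp add: kap3_def add_nonneg_nonneg)

lemma kap3_integral: "(kap3 r has_integral 3 * integral UNIV (kap (1/4))) UNIV"
proof -
  have e: "(1/4::real) > 0" by simp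
  from has_integral_add[OF has_integral_add[OF kap_add_integral[OF e, of 0] kap_add_integral[OF e, of "- r"]] kap_add_integral[OF e, of r]]
  show ?thesis by (simp add: kap3_def[abs_def])
qed

lemma kap_le_one: "e > 0 \<Longrightarrow> kap e s \<le> 1"
  unfolding kap_def by (simp add: powr_minus powr_diff divide_inverse[symmetric] inverse_le_1_iff) 
    (smt (verit) ge_one_powr_ge_zero inverse_le_1_iff mult_le_one powr_ge_zero divide_le_eq_1 mult_ge1_I)

lemma kap3_le: "kap3 r s \<le> 3"
  using kap_le_one[of "1/4" s] kap_le_one[of "1/4" "s - r"] kap_le_one[of "1/4" "s + r"] by (simp add: kap3_def)

lemma kap3_locally_dominated:
  obtains h where "h integrable_on UNIV" "\<And>r s. dist r r0 < 1 \<Longrightarrow> kap3 r s \<le> h s"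
proof
  have e: "(1/4::real) > 0" by simp
  have s: "(\<lambda>s. kap (1/4) (s + d)) integrable_on UNIV" for d using kap_add_integral[OF e] by blast
  show "(\<lambda>s. kap (1/4) s + 2 powr (1/4 + 1) * kap (1/4) (s + (- r0)) + 2 powr (1/4 + 1) * kap (1/4) (s + r0)) integrable_on UNIV"
    using s[of 0] by (intro integrable_add integrable_on_mult_right s) simp
  fix r s :: real assume "dist r r0 < 1"
  hence d: "\<bar>r0 - r\<bar> \<le> 1" "\<bar>r - r0\<bar> \<le> 1" by (auto simp: dist_real_def)
  have "kap (1/4) (s - r) \<le> 2 powr (1/4 + 1) * kap (1/4) (s + (- r0))"
    using kap_shift[OF d(1) e, of "s + (- r0)"] by simp
  moreover have "kap (1/4) (s + r) \<le> 2 powr (1/4 + 1) * kap (1/4) (s + r0)"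
    using kap_shift[OF d(2) e, of "s + r0"] by simp
  ultimately show "kap3 r s \<le> kap (1/4) s + 2 powr (1/4 + 1) * kap (1/4) (s + (- r0)) + 2 powr (1/4 + 1) * kap (1/4) (s + r0)"
    unfolding kap3_def by (intro add_mono order_refl)
qed

section \<open>A majorant for the kernel in two variables\<close>

lemma powr_weights_le:
  assumes "0 < x" "x \<le> Q" "0 < y" "y \<le> (Q::real)" shows "x powr (3/4) * y powr (1/4) \<le> Q"
proof -
  have "x powr (3/4) * y powr (1/4) \<le> Q powr (3/4) * Q powr (1/4)"
    by (intro mult_mono powr_mono2) (use assms in auto)
  also have "\<dots> = Q" using assms by (simp add: powr_add[symmetric])
  finally show ?thesis .
qed

text \<open>The large factor \<open>Q\<close> is split: the power 3/4 goes to \<open>R\<close> and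
  1/4 to \<open>P\<close>, so that both exponents, 7/4 and 5/4, exceed 1. The factor
  \<open>g\<close> supplies the remaining full power of \<open>R\<close>.\<close>

lemma two_variable_bound_aux:
  fixes R P Q g m :: real
  assumes "0 < R" "0 < P" "R \<le> Q" "P \<le> Q" "0 < g" "R \<le> m * g"
  shows "1 / (g * (P * Q)) \<le> m * (R powr (- 7/4) * P powr (- 5/4))"
proof -
  have Q: "Q > 0" using assms by linarith
  have "R powr (7/4) = R powr (1 + 3/4)" by simp
  also have "\<dots> = R * R powr (3/4)" unfolding powr_add using assms(1) by simp
  finally have r: "R powr (7/4) = R * R powr (3/4)" .
  have "P powr (5/4) = P powr (1 + 1/4)" by simp
  also have "\<dots> = P * P powr (1/4)" unfolding powr_add using assms(2) by simp
  finally have p: "P powr (5/4) = P * P powr (1/4)" .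
  have "R powr (7/4) * P powr (5/4) = (R * P) * (R powr (3/4) * P powr (1/4))" unfolding r p by simp
  also have "\<dots> \<le> (m * g * P) * Q"
    by (intro mult_mono powr_weights_le mult_right_mono) (use assms Q in auto)
  finally have "R powr (7/4) * P powr (5/4) \<le> m * (g * (P * Q))" by (simp add: mult_ac)
  moreover have "R powr (7/4) * P powr (5/4) > 0" "g * (P * Q) > 0" using assms Q by auto
  moreover have "1 / X \<le> m / Y" if "Y \<le> m * X" "Y > 0" "X > 0" for X Y :: real
    using divide_right_mono[OF that(1), of "X * Y"] that by simp
  ultimately have "1 / (g * (P * Q)) \<le> m / (R powr (7/4) * P powr (5/4))" by (simp only:)
  also have "\<dots> = m * (R powr (- 7/4) * P powr (- 5/4))"
  proof -
    have "x powr (- n / d) = inverse (x powr (n / d))" for x n d :: real by (simp add: powr_minus[symmetric])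
    thus ?thesis by (simp only: divide_inverse[of m] inverse_mult_distrib)
  qed
  finally show ?thesis .
qed

text \<open>\<open>P\<close> and \<open>Q\<close> are the smaller and the larger of the two factors
  1 + |s - r| and 1 + |s + r|. The larger distance is at least max |r| |s|, so \<open>Q\<close>
  dominates both \<open>R\<close> and \<open>S\<close>; its power is what makes the bound integrable
  in r as well as in s.\<close>

lemma two_variable_bound:
  "(1 / (1 + \<bar>r\<bar>) + 1 / (1 + \<bar>s\<bar>)) * (1 / ((1 + \<bar>s - r\<bar>) * (1 + \<bar>s + r\<bar>))) \<le> 3 * (kap (3/4) r * kap3 r s)"
proof -
  define R S where "R = 1 + \<bar>r\<bar>" and "S = 1 + \<bar>s\<bar>"
  obtain P Q where PQ: "P * Q = (1 + \<bar>s - r\<bar>) * (1 + \<bar>s + r\<bar>)" "P = 1 + \<bar>s - r\<bar> \<or> P = 1 + \<bar>s + r\<bar>"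
    "P \<le> Q" "R \<le> Q" "S \<le> Q" "R \<le> P + S" "P \<ge> 1"
  proof (cases "\<bar>s - r\<bar> \<le> \<bar>s + r\<bar>")
    case True
    show ?thesis
      by (rule that[of "1 + \<bar>s - r\<bar>" "1 + \<bar>s + r\<bar>"]) (use True in \<open>auto simp: R_def S_def\<close>)
  next
    case False
    show ?thesis
      by (rule that[of "1 + \<bar>s + r\<bar>" "1 + \<bar>s - r\<bar>"]) (use False in \<open>auto simp: R_def S_def\<close>)
  qed
  have pos: "R > 0" "S > 0" "P > 0" "Q > 0" using PQ by (simp_all add: R_def S_def)
  have kR: "kap (3/4) r = R powr (- 7/4)" by (simp add: kap_def R_def)
  have kS: "kap (1/4) s = S powr (- 5/4)" by (simp add: kap_def S_def)
  have kP: "P powr (- 5/4) \<le> kap (1/4) (s - r) + kap (1/4) (s + r)"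
    using PQ(2) kap_nonneg[of "1/4" "s - r"] kap_nonneg[of "1/4" "s + r"] by (auto simp: kap_def)
  have A: "1 / (R * (P * Q)) \<le> 1 * (R powr (- 7/4) * P powr (- 5/4))"
    by (rule two_variable_bound_aux) (use PQ pos in auto)
  \<comment> \<open>As R \<le> P + S, either R \<le> 2 S or R \<le> 2 P. The first case uses
    \<open>two_variable_bound_aux\<close> with S in the role of \<open>g\<close>, the second with
    the roles of S and P exchanged.\<close>
  have B: "1 / (S * (P * Q)) \<le> 2 * (R powr (- 7/4) * (S powr (- 5/4) + P powr (- 5/4)))"
  proof (cases "R \<le> 2 * S")
    case True
    have "1 / (S * (P * Q)) \<le> 2 * (R powr (- 7/4) * P powr (- 5/4))"
      by (rule two_variable_bound_aux) (use PQ pos True in auto)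
    also have "\<dots> \<le> 2 * (R powr (- 7/4) * (S powr (- 5/4) + P powr (- 5/4)))"
      by (intro mult_left_mono) auto
    finally show ?thesis .
  next
    case False
    have "1 / (P * (S * Q)) \<le> 2 * (R powr (- 7/4) * S powr (- 5/4))"
      by (rule two_variable_bound_aux) (use PQ pos False in auto)
    also have "\<dots> \<le> 2 * (R powr (- 7/4) * (S powr (- 5/4) + P powr (- 5/4)))"
      by (intro mult_left_mono) auto
    finally show ?thesis by (simp add: mult_ac)
  qed
  have "(1 / R + 1 / S) * (1 / (P * Q)) = 1 / (R * (P * Q)) + 1 / (S * (P * Q))"
    by (simp only: distrib_right times_divide_times_eq mult_1_left)
  also have "\<dots> \<le> 1 * (R powr (- 7/4) * P powr (- 5/4)) + 2 * (R powr (- 7/4) * (S powr (- 5/4) + P powr (- 5/4)))"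
    by (rule add_mono[OF A B])
  also have "\<dots> = R powr (- 7/4) * (2 * S powr (- 5/4) + 3 * P powr (- 5/4))" by (simp add: algebra_simps)
  also have "\<dots> \<le> R powr (- 7/4) * (3 * kap3 r s)"
  proof (rule mult_left_mono)
    have lin: "2 * x + 3 * y \<le> 3 * (x + a + b)" if "0 \<le> x" "y \<le> a + b" for x y a b :: real
      using that by (simp add: distrib_left)
    show "2 * S powr (- 5/4) + 3 * P powr (- 5/4) \<le> 3 * kap3 r s"
      unfolding kap3_def kS by (rule lin[OF powr_ge_zero kP])
  qed simp
  finally show ?thesis unfolding PQ(1)[symmetric] kR R_def[symmetric] S_def[symmetric] by (simp add: mult_ac)
qed

text \<open>\<open>\<rho>\<close> extracts the outer variable from the parameter: it is the
  identity, or the projection of a pair (r,t) to r when continuity in both is wanted.\<close>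

lemma integral_kap3_dominated:
  fixes F :: "'p::metric_space \<Rightarrow> real \<Rightarrow> 'b::banach"
  assumes cont: "continuous_on (P \<times> UNIV) (\<lambda>(q, s). F q s)"
    and \<rho>: "\<And>q q'. dist (\<rho> q) (\<rho> q') \<le> dist q q'"
    and bd: "\<And>q s. q \<in> P \<Longrightarrow> norm (F q s) \<le> C * (kap (3/4) (\<rho> q) * kap3 (\<rho> q) s)"
  shows "continuous_on P (\<lambda>q. integral UNIV (F q))"
    "\<And>q. q \<in> P \<Longrightarrow> F q integrable_on UNIV"
    "\<And>q. q \<in> P \<Longrightarrow> norm (integral UNIV (F q)) \<le> (\<bar>C\<bar> * (3 * integral UNIV (kap (1/4)))) * kap (3/4) (\<rho> q)"
proof -
  let ?I = "integral UNIV (kap (1/4))"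
  have bd': "norm (F q s) \<le> (\<bar>C\<bar> * kap (3/4) (\<rho> q)) * kap3 (\<rho> q) s" if "q \<in> P" for q s
  proof -
    have "C * (kap (3/4) (\<rho> q) * kap3 (\<rho> q) s) \<le> \<bar>C\<bar> * (kap (3/4) (\<rho> q) * kap3 (\<rho> q) s)"
      by (rule mult_right_mono) (simp_all add: kap3_nonneg)
    thus ?thesis using bd[OF that, of s] by (simp add: mult.assoc)
  qed
  have cs: "continuous_on UNIV (F q)" if "q \<in> P" for q
  by (rule continuous_on_section2[OF cont that])
  have K: "((\<lambda>s. (\<bar>C\<bar> * kap (3/4) r) * kap3 r s) has_integral (\<bar>C\<bar> * kap (3/4) r) * (3 * ?I)) UNIV" for r
    by (rule has_integral_mult_right[OF kap3_integral])
  show si: "F q integrable_on UNIV" if "q \<in> P" for q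
    by (rule continuous_dominated_integrable[OF cs bd']) (use K that in blast)+
  show "norm (integral UNIV (F q)) \<le> (\<bar>C\<bar> * (3 * ?I)) * kap (3/4) (\<rho> q)" if "q \<in> P" for q
  proof -
    have "norm (integral UNIV (F q)) \<le> integral UNIV (\<lambda>s. (\<bar>C\<bar> * kap (3/4) (\<rho> q)) * kap3 (\<rho> q) s)"
      by (rule integral_norm_bound_integral[OF si[OF that] _ bd'[OF that]]) (use K in blast)
    thus ?thesis unfolding integral_unique[OF K] by (simp only: mult_ac)
  qed
  show "continuous_on P (\<lambda>q. integral UNIV (F q))"
  proof (rule continuous_on_integral_dominated[OF cont])
    fix q0 assume "q0 \<in> P"
    obtain h where h: "h integrable_on UNIV" "\<And>r s. dist r (\<rho> q0) < 1 \<Longrightarrow> kap3 r s \<le> h s"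
      using kap3_locally_dominated by blast
    have "norm (F q s) \<le> \<bar>C\<bar> * h s" if q: "q \<in> P" "dist q q0 < 1" for q s
    proof -
      have d: "dist (\<rho> q) (\<rho> q0) < 1" using \<rho>[of q q0] q(2) by simp
      have "norm (F q s) \<le> \<bar>C\<bar> * (kap (3/4) (\<rho> q) * kap3 (\<rho> q) s)" using bd'[OF q(1), of s] by (simp add: mult.assoc)
      also have "\<dots> \<le> \<bar>C\<bar> * (1 * h s)"
        by (intro mult_left_mono mult_mono kap_le_one h(2) d kap3_nonneg) simp_all
      finally show ?thesis by simp
    qed
    thus "\<exists>h e. e > 0 \<and> h integrable_on UNIV \<and> (\<forall>q\<in>P. dist q q0 < e \<longrightarrow> (\<forall>s. norm (F q s) \<le> h s))"
      using integrable_on_mult_right[OF h(1), of "\<bar>C\<bar>"] by (intro exI[of _ "\<lambda>s. \<bar>C\<bar> * h s"] exI[of _ 1]) auto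
  qed
qed

text \<open>Fubini for an order of integration in which the inner integral vanishes. The orders are
  exchanged for s in \<open>{- n..n}\<close> only, where \<open>kap3\<close> is bounded and a
  majorant in r alone suffices; then n goes to infinity by dominated convergence in r.\<close>

lemma iterated_integral_zero:
  fixes \<Phi> :: "real \<Rightarrow> real \<Rightarrow> 'b::banach"
  assumes cont: "continuous_on (UNIV \<times> UNIV) (\<lambda>(s, r). \<Phi> s r)"
    and bd: "\<And>s r. norm (\<Phi> s r) \<le> C * (kap (3/4) r * kap3 r s)"
    and zero: "\<And>s. integral UNIV (\<Phi> s) = 0"
  shows "(\<lambda>r. integral UNIV (\<lambda>s. \<Phi> s r)) integrable_on UNIV"
    "integral UNIV (\<lambda>r. integral UNIV (\<lambda>s. \<Phi> s r)) = 0"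
proof -
  let ?I = "integral UNIV (kap (1/4))"
  have cont': "continuous_on (UNIV \<times> UNIV) (\<lambda>(r, s). \<Phi> s r)"
  by (rule continuous_on_swap_pair[OF cont])
  note G = integral_kap3_dominated[OF cont', of "\<lambda>r. r", OF order_refl bd]
  have gc: "continuous_on UNIV (\<lambda>r. integral UNIV (\<lambda>s. \<Phi> s r))"
    and nb: "\<And>r. norm (integral UNIV (\<lambda>s. \<Phi> s r)) \<le> (\<bar>C\<bar> * (3 * ?I)) * kap (3/4) r"
    and si: "\<And>r. (\<lambda>s. \<Phi> s r) integrable_on UNIV"
    using G by auto
  have bd': "norm (\<Phi> s r) \<le> (\<bar>C\<bar> * kap (3/4) r) * kap3 r s" for s r
  proof -
    have "C * (kap (3/4) r * kap3 r s) \<le> \<bar>C\<bar> * (kap (3/4) r * kap3 r s)"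
      by (rule mult_right_mono) (simp_all add: kap3_nonneg)
    thus ?thesis using bd[of s r] by (simp add: mult.assoc)
  qed
  have cs: "continuous_on S (\<lambda>s. \<Phi> s r)" for r S
  by (rule continuous_on_subset[OF continuous_on_section1[OF cont UNIV_I]]) simp
  have K: "((\<lambda>s. (\<bar>C\<bar> * kap (3/4) r) * kap3 r s) has_integral (\<bar>C\<bar> * kap (3/4) r) * (3 * ?I)) UNIV" for r
    by (rule has_integral_mult_right[OF kap3_integral])
  have e: "(3/4::real) > 0" by simp
  have k3: "(\<lambda>r. D * kap (3/4) r) integrable_on UNIV" for D
    by (rule integrable_on_mult_right[OF kap_integrable[OF e]])
  show "(\<lambda>r. integral UNIV (\<lambda>s. \<Phi> s r)) integrable_on UNIV" by (rule continuous_dominated_integrable[OF gc nb k3])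
  have Xn: "integral UNIV (\<lambda>r. integral {- real n..real n} (\<lambda>s. \<Phi> s r)) = 0"
    and Xc: "continuous_on UNIV (\<lambda>r. integral {- real n..real n} (\<lambda>s. \<Phi> s r))"
    and Xb: "norm (integral {- real n..real n} (\<lambda>s. \<Phi> s r)) \<le> (\<bar>C\<bar> * (3 * ?I)) * kap (3/4) r" for n r
  proof -
    have "continuous_on UNIV (\<lambda>r. integral (cbox (- real n) (real n)) (\<lambda>s. \<Phi> s r))"
      by (rule integral_continuous_on_param) (rule continuous_on_subset[OF cont'], simp)
    thus c: "continuous_on UNIV (\<lambda>r. integral {- real n..real n} (\<lambda>s. \<Phi> s r))" by simp
    show b: "norm (integral {- real n..real n} (\<lambda>s. \<Phi> s r)) \<le> (\<bar>C\<bar> * (3 * ?I)) * kap (3/4) r" for r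
    proof -
      have i: "(\<lambda>s. (\<bar>C\<bar> * kap (3/4) r) * kap3 r s) integrable_on UNIV" using K by blast
      have i': "(\<lambda>s. (\<bar>C\<bar> * kap (3/4) r) * kap3 r s) integrable_on {- real n..real n}"
        by (rule integrable_on_subinterval[OF i]) simp
      have "norm (integral {- real n..real n} (\<lambda>s. \<Phi> s r)) \<le> integral {- real n..real n} (\<lambda>s. (\<bar>C\<bar> * kap (3/4) r) * kap3 r s)"
        by (rule integral_norm_bound_integral[OF integrable_continuous_real[OF cs] i' bd'])
      also have "\<dots> \<le> integral UNIV (\<lambda>s. (\<bar>C\<bar> * kap (3/4) r) * kap3 r s)"
        by (rule integral_subset_le[OF _ i' i]) (auto simp: kap3_nonneg)
      finally show ?thesis unfolding integral_unique[OF K] by (simp only: mult_ac)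
    qed
    have "integral {- real n..real n} (\<lambda>s. integral UNIV (\<Phi> s)) = integral UNIV (\<lambda>r. integral {- real n..real n} (\<lambda>s. \<Phi> s r))"
    proof (rule integral_swap_dominated)
      show "continuous_on ({- real n..real n} \<times> UNIV) (\<lambda>(x, s). \<Phi> x s)" by (rule continuous_on_subset[OF cont]) simp
      show "norm (\<Phi> x s) \<le> (\<bar>C\<bar> * 3) * kap (3/4) s" for x s
      proof -
        have "norm (\<Phi> x s) \<le> (\<bar>C\<bar> * kap (3/4) s) * kap3 s x" by (rule bd')
        also have "\<dots> \<le> (\<bar>C\<bar> * kap (3/4) s) * 3" by (rule mult_left_mono[OF kap3_le]) simp
        finally show ?thesis by (simp add: mult_ac)
      qed
      show "(\<lambda>s. (\<bar>C\<bar> * 3) * kap (3/4) s) integrable_on UNIV" by (rule k3)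
      show "(\<lambda>r. integral {- real n..real n} (\<lambda>s. \<Phi> s r)) integrable_on UNIV"
        by (rule continuous_dominated_integrable[OF c b k3])
    qed
    thus "integral UNIV (\<lambda>r. integral {- real n..real n} (\<lambda>s. \<Phi> s r)) = 0" by (simp add: zero)
  qed
  have "(\<lambda>n. integral UNIV (\<lambda>r. integral {- real n..real n} (\<lambda>s. \<Phi> s r))) \<longlonglongrightarrow> integral UNIV (\<lambda>r. integral UNIV (\<lambda>s. \<Phi> s r))"
    by (rule dominated_convergence_continuous[OF Xc gc k3 Xb]) (rule integral_symmetric_limit[OF si])
  thus "integral UNIV (\<lambda>r. integral UNIV (\<lambda>s. \<Phi> s r)) = 0" unfolding Xn by (simp add: LIMSEQ_const_iff)
qed

lemma vol_continuous_on:
  fixes h :: "real \<Rightarrow> 'e::complex_banach"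
  assumes h: "L1 T h" and f: "continuous_on S f" and g: "continuous_on S g" "\<And>x. x \<in> S \<Longrightarrow> g x \<in> {0..T}"
  shows "continuous_on S (\<lambda>x. vol (f x) h (g x))"
proof -
  have "continuous_on S (\<lambda>x. (\<lambda>(z, t). vol z h t) (f x, g x))"
    by (rule continuous_on_compose2[OF vol_continuous2[OF h]]) (use f g in \<open>auto intro!: continuous_intros\<close>)
  thus ?thesis by simp
qed

lemma inverse_cmod_bound:
  assumes "0 < d" "d \<le> cmod l" shows "1 / cmod l \<le> (1 + 1 / d) / (1 + cmod l)"
proof -
  have "1 + cmod l \<le> (1 + 1 / d) * cmod l" using assms by (simp add: field_simps)
  moreover have "cmod l > 0" "1 + cmod l > 0" using assms by linarith+
  ultimately show ?thesis by (simp add: divide_simps mult_ac)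
qed

locale cauchy_problem = Q_operator A c for A :: "('e::complex_banach \<times> 'e) set" and c :: real +
  fixes p T :: real
  assumes p: "1 < p" and T: "T > 0"
begin

lemma Complex_in_H: "a \<le> - c \<Longrightarrow> Complex a s \<in> H" by (simp add: H_def)

text \<open>The resolvent identity bounds the change in l, linearity the change in x; the growth 1 +
  |l| does not matter along a convergent sequence.\<close>

lemma Rs_continuous2:
  assumes \<sigma>: "\<sigma> * \<sigma> = 1" shows "continuous_on (H \<times> UNIV) (\<lambda>(l, x). Rs \<sigma> l x)"
proof (rule continuous_on_sequentiallyI, clarify)
  obtain M where M: "M > 0" "\<And>l x. l \<in> H \<Longrightarrow> norm (Rs \<sigma> l x) \<le> M * (1 + cmod l) * norm x"
    using Rs_bounds \<sigma> by metis
  fix u :: "nat \<Rightarrow> complex \<times> 'e" and l x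
  assume u: "\<forall>n. u n \<in> H \<times> UNIV" and l: "l \<in> H" and lim: "u \<longlonglongrightarrow> (l, x)"
  have L: "(\<lambda>n. fst (u n)) \<longlonglongrightarrow> l" and X: "(\<lambda>n. snd (u n)) \<longlonglongrightarrow> x"
    using tendsto_fst[OF lim] tendsto_snd[OF lim] by simp_all
  have lH: "fst (u n) \<in> H" for n using u by (metis mem_Times_iff)
  have "(\<lambda>n. Rs \<sigma> (fst (u n)) (snd (u n)) - Rs \<sigma> l x) \<longlonglongrightarrow> 0"
  proof (rule Lim_null_comparison)
    let ?b = "\<lambda>n. M * (1 + cmod (fst (u n))) * norm (snd (u n) - x) + cmod (fst (u n) - l) * (M * (1 + cmod (fst (u n))) * norm (Rs \<sigma> l x))"
    have "norm (Rs \<sigma> (fst (u n)) (snd (u n)) - Rs \<sigma> l x) \<le> ?b n" for n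
    proof -
      have "Rs \<sigma> (fst (u n)) (snd (u n)) - Rs \<sigma> l x = Rs \<sigma> (fst (u n)) (snd (u n) - x) + (fst (u n) - l) *\<^sub>C Rs \<sigma> (fst (u n)) (Rs \<sigma> l x)"
        unfolding Rs_identity[OF lH l \<sigma>, symmetric] by (simp add: bounded_complex_linearD(4)[OF Rs_bcl[OF lH]])
      also have "norm \<dots> \<le> ?b n"
        by (rule norm_triangle_mono[OF M(2)[OF lH]]) (simp only: norm_scaleC, intro mult_left_mono M(2) lH norm_ge_zero)
      finally show ?thesis .
    qed
    thus "\<forall>\<^sub>F n in sequentially. norm (Rs \<sigma> (fst (u n)) (snd (u n)) - Rs \<sigma> l x) \<le> ?b n" by (rule always_eventually[OF allI])
    have "?b \<longlonglongrightarrow> M * (1 + cmod l) * norm (x - x) + cmod (l - l) * (M * (1 + cmod l) * norm (Rs \<sigma> l x))"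
      by (intro tendsto_intros L X)
    thus "?b \<longlonglongrightarrow> 0" by simp
  qed
  hence "(\<lambda>n. Rs \<sigma> (fst (u n)) (snd (u n))) \<longlonglongrightarrow> Rs \<sigma> l x" by (rule LIM_zero_cancel)
  thus "(\<lambda>n. (\<lambda>(l, x). Rs \<sigma> l x) (u n)) \<longlonglongrightarrow> Rs \<sigma> l x" by (simp add: split_def)
qed

lemma Rs_continuous_on:
  assumes \<sigma>: "\<sigma> * \<sigma> = 1" and f: "continuous_on S f" "\<And>x. x \<in> S \<Longrightarrow> f x \<in> H" and g: "continuous_on S g"
  shows "continuous_on S (\<lambda>x. Rs \<sigma> (f x) (g x))"
proof -
  have "continuous_on S (\<lambda>x. (\<lambda>(l, x). Rs \<sigma> l x) (f x, g x))"
    by (rule continuous_on_compose2[OF Rs_continuous2[OF \<sigma>]]) (use f g in \<open>auto intro!: continuous_intros\<close>)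
  thus ?thesis by simp
qed

lemma U_continuous_on: "continuous_on S g \<Longrightarrow> continuous_on S (\<lambda>x. U (g x))"
  by (rule bounded_linear.continuous_on[OF bounded_complex_linearD(1)[OF U(1)]])

lemma R2_continuous_on:
  assumes f: "continuous_on S f" "\<And>x. x \<in> S \<Longrightarrow> f x \<in> H" and g: "continuous_on S g"
  shows "continuous_on S (\<lambda>x. R2 (f x) (g x))"
proof -
  have "continuous_on S (\<lambda>x. Rs 1 (f x) (Rs (- 1) (f x) (g x)))"
    by (intro Rs_continuous_on f g) auto
  thus ?thesis by (rule continuous_on_eq) (simp add: Rs_product_same f)
qed

lemma qd_Rs:
  assumes \<sigma>: "\<sigma> * \<sigma> = 1" and v: "qd S v" and S: "\<And>z. z \<in> S \<Longrightarrow> z \<in> H" "\<And>z. z \<in> S \<Longrightarrow> cmod z \<le> r"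
  shows "qd S (\<lambda>z. Rs \<sigma> z (v z))"
proof -
  obtain M where M: "M > 0" "\<And>l x. l \<in> H \<Longrightarrow> norm (Rs \<sigma> l x) \<le> M * (1 + cmod l) * norm x"
    using Rs_bounds \<sigma> by metis
  show ?thesis
  proof (rule qd_resolvent_family[OF v Rs_bcl[OF S(1)], where K="M * (1 + r)" and \<kappa>=1])
    fix w x assume w: "w \<in> S"
    have "norm (Rs \<sigma> w x) \<le> M * (1 + cmod w) * norm x" by (rule M(2)[OF S(1)[OF w]])
    also have "\<dots> \<le> M * (1 + r) * norm x" by (intro mult_right_mono mult_left_mono) (use M S(2)[OF w] in auto)
    finally show "norm (Rs \<sigma> w x) \<le> M * (1 + r) * norm x" .
  next
    fix w z x assume "w \<in> S" "z \<in> S"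
    thus "Rs \<sigma> w x - Rs \<sigma> z x = (1 * (w - z)) *\<^sub>C Rs \<sigma> w (Rs \<sigma> z x)" using Rs_identity[OF S(1) S(1) \<sigma>] by simp
  qed
qed

lemma inverse_cmod_le: "l \<in> H \<Longrightarrow> 1 / cmod l \<le> (1 + 1 / c) / (1 + cmod l)"
  using abs_Re_le_cmod[of l] c by (intro inverse_cmod_bound) (auto simp: H_def)

text \<open>Averaging \<open>q\<close> over intervals of length \<open>(1 + |l|)\<^sup>-\<^sup>a\<close> balances its time regularity, which makes the
  average close to \<open>q\<close>, against its space regularity \<open>q \<in> L\<^sup>p(0,T;\<D>(A))\<close>, on which \<open>Rs \<sigma> l\<close> decays.\<close>

lemma Rs_decay:
  assumes \<sigma>: "\<sigma> * \<sigma> = 1" and lip: "\<And>s t. s \<in> {0..T} \<Longrightarrow> t \<in> {0..T} \<Longrightarrow> norm (q t - q s) \<le> B * \<bar>t - s\<bar>"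
    and q0: "q 0 = 0" and k: "k \<in> Lp p T" and qk: "AE t in interval T. q t = U (U (k t))"
  obtains C where "C \<ge> 0" "\<And>l t. l \<in> H \<Longrightarrow> t \<in> {0..T} \<Longrightarrow> norm (Rs \<sigma> l (q t)) \<le> C * (1 + cmod l) powr (- ((p - 1) / (2 * p)))"
proof -
  obtain M where M: "M > 0" "\<And>l x. l \<in> H \<Longrightarrow> norm (Rs \<sigma> l x) \<le> M * (1 + cmod l) * norm x"
    "\<And>l x. l \<in> H \<Longrightarrow> norm (Rs \<sigma> l (U (U x))) \<le> M / (1 + cmod l) * norm x"
    using Rs_bounds \<sigma> by metis
  have B: "B \<ge> 0" using lip[of 0 T] T order_trans[OF norm_ge_zero] by (force simp: zero_le_mult_iff)
  note k1 = Lp_imp_L1[OF p k]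
  have kp: "(\<lambda>t. norm (k t) powr p) integrable_on {a..b}" if "{a..b} \<subseteq> {0..T}" for a b
  proof (rule integrable_on_Icc_from_interval[OF _ that])
    show "(\<lambda>t. norm (k t) powr p) integrable_on {0<..<T}"
      by (rule integrable_on_lebesgue_on) (use k in \<open>auto simp: Lp_def\<close>)
  qed
  define Kp where "Kp = integral {0..T} (\<lambda>t. norm (k t) powr p)"
  have Kp0: "Kp \<ge> 0" unfolding Kp_def by (rule integral_nonneg[OF kp]) auto
  define C where "C = M * B + M * (1 + Kp)"
  have qc: "continuous_on {0..T} q"
  proof (rule continuous_onI)
    fix t e :: real assume t: "t \<in> {0..T}" and e: "e > 0"
    show "\<exists>d>0. \<forall>s\<in>{0..T}. dist s t < d \<longrightarrow> dist (q s) (q t) \<le> e"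
    proof (intro exI[of _ "e / (B + 1)"] conjI ballI impI)
      show "e / (B + 1) > 0" using e B by simp
      fix s assume s: "s \<in> {0..T}" and d: "dist s t < e / (B + 1)"
      have "norm (q s - q t) \<le> B * \<bar>s - t\<bar>" by (rule lip[OF t s])
      also have "\<dots> \<le> (B + 1) * (e / (B + 1))" by (intro mult_mono) (use B d e in \<open>auto simp: dist_real_def\<close>)
      finally show "dist (q s) (q t) \<le> e" using B by (simp add: dist_norm)
    qed
  qed
  show ?thesis
  proof (rule that[of C])
    show "C \<ge> 0" using M B Kp0 by (simp add: C_def)
    fix l t assume l: "l \<in> H" and t: "t \<in> {0..T}"
    note L = bounded_complex_linearD[OF Rs_bcl[OF l]]
    define \<Lambda> where "\<Lambda> = 1 + cmod l"
    have \<Lambda>: "\<Lambda> \<ge> 1" by (simp add: \<Lambda>_def)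
    \<comment> \<open>The averaging error is of size \<Lambda> \<delta> = \<Lambda> powr (1 - a),
      the contribution of the average of size \<Lambda> powr (a/p - 1). Both exponents are negative
      exactly for 1 < a < p, and a is the midpoint.\<close>
    define a where "a = (1 + p) / 2"
    define \<delta> where "\<delta> = \<Lambda> powr (- a)"
    have \<delta>: "\<delta> > 0" using \<Lambda> by (simp add: \<delta>_def)
    \<comment> \<open>Close to t = 0 the interval is cut off but the integral is still divided by
      \<delta>. The missing part is compensated by q(0) = 0, which makes q itself at most B \<delta>
      there.\<close>
    define t' where "t' = max 0 (t - \<delta>)"
    have t': "0 \<le> t'" "t' \<le> t" "t - t' \<le> \<delta>" "t' = 0 \<or> t - t' = \<delta>" using t \<delta> by (auto simp: t'_def max_def)
    have sub: "{t'..t} \<subseteq> {0..T}" using t t' by auto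
    have qi: "q integrable_on {t'..t}" by (rule integrable_continuous_real, rule continuous_on_subset[OF qc sub])
    define \<kappa> where "\<kappa> = (1 / \<delta>) *\<^sub>R integral {t'..t} k"
    have m: "integral {t'..t} q = U (U (integral {t'..t} k))"
    proof -
      have "integral {t'..t} q = integral {t'..t} (\<lambda>x. U (U (k x)))" by (rule integral_cong_AE_interval[OF qk sub])
      also have "\<dots> = U (U (integral {t'..t} k))"
        using integral_linear[OF L1_integrable(1)[OF k1 sub] bounded_linear_compose[OF bounded_complex_linearD(1)[OF U(1)] bounded_complex_linearD(1)[OF U(1)]]]
        by (simp add: o_def)
      finally show ?thesis .
    qed
    have UR: "U (r *\<^sub>R x) = r *\<^sub>R U x" for r x by (rule linear_simps(5)[OF bounded_complex_linearD(1)[OF U(1)]])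
    have UU\<kappa>: "U (U \<kappa>) = (1 / \<delta>) *\<^sub>R integral {t'..t} q" by (simp add: \<kappa>_def UR m)
    have near: "norm (q t - U (U \<kappa>)) \<le> B * \<delta>"
    proof -
      have I: "norm (integral {t'..t} (\<lambda>x. q t - q x)) \<le> integral {t'..t} (\<lambda>x. B * \<delta>)"
      proof (rule integral_norm_bound_integral)
        show "(\<lambda>x. q t - q x) integrable_on {t'..t}" by (rule integrable_diff[OF integrable_const_ivl qi])
        fix x assume x: "x \<in> {t'..t}"
        have "norm (q t - q x) \<le> B * \<bar>t - x\<bar>" by (rule lip) (use x t t' in auto)
        also have "\<dots> \<le> B * \<delta>" by (rule mult_left_mono) (use x t' B in auto)
        finally show "norm (q t - q x) \<le> B * \<delta>" .
      qed (rule integrable_const_ivl)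
      have J: "integral {t'..t} (\<lambda>x. q t - q x) = (t - t') *\<^sub>R q t - integral {t'..t} q"
        using integral_diff[OF integrable_const_ivl qi, of "q t"] t'(2) by simp
      have "\<delta> *\<^sub>R (q t - U (U \<kappa>)) = \<delta> *\<^sub>R q t - integral {t'..t} q"
        using \<delta> by (simp add: UU\<kappa> scaleR_diff_right)
      also have "\<dots> = integral {t'..t} (\<lambda>x. q t - q x) + (\<delta> - (t - t')) *\<^sub>R q t"
        unfolding J by (simp add: scaleR_diff_left)
      also have "norm \<dots> \<le> (t - t') * (B * \<delta>) + (\<delta> - (t - t')) * (B * \<delta>)"
      proof (rule norm_triangle_mono)
        show "norm (integral {t'..t} (\<lambda>x. q t - q x)) \<le> (t - t') * (B * \<delta>)" using I t' by (simp add: mult_ac)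
        show "norm ((\<delta> - (t - t')) *\<^sub>R q t) \<le> (\<delta> - (t - t')) * (B * \<delta>)"
        proof (cases "t' = 0")
          case True
          have "norm (q t - q 0) \<le> B * \<bar>t - 0\<bar>" by (rule lip) (use t T in auto)
          also have "\<dots> \<le> B * \<delta>" by (rule mult_left_mono) (use t' True t B in auto)
          finally have "norm (q t) \<le> B * \<delta>" by (simp add: q0)
          thus ?thesis using t'(3) by (simp add: mult_left_mono)
        qed (use t'(4) in simp)
      qed
      also have "\<dots> = \<delta> * (B * \<delta>)" by (simp add: distrib_right[symmetric])
      finally show ?thesis using \<delta> by simp
    qed
    \<comment> \<open>A pointwise inequality in place of Hoelder's: |k| is at most \<theta>, or else
      at most \<theta> powr (1-p) |k| powr p. The choice \<theta> = \<delta> powr (- 1/p) makes both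
      integrals over an interval of length \<delta> of order \<delta> \<theta>.\<close>
    define \<theta> where "\<theta> = \<delta> powr (- (1 / p))"
    have \<theta>: "\<theta> > 0" using \<delta> by (simp add: \<theta>_def)
    have young: "norm (k x) \<le> \<theta> + \<theta> powr (1 - p) * norm (k x) powr p" for x
    proof (cases "norm (k x) \<le> \<theta>")
      case True
      have "0 \<le> \<theta> powr (1 - p) * norm (k x) powr p" by simp
      with True show ?thesis by linarith
    next
      case False
      hence pos: "norm (k x) > 0" using \<theta> by linarith
      have "norm (k x) = norm (k x) powr (1 - p) * norm (k x) powr p" using pos by (simp add: powr_add[symmetric])
      also have "\<dots> \<le> \<theta> powr (1 - p) * norm (k x) powr p"
        by (intro mult_right_mono powr_mono2') (use False \<theta> p in auto)
      finally show ?thesis using \<theta> by linarith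
    qed
    have n\<kappa>: "norm \<kappa> \<le> \<theta> * (1 + Kp)"
    proof -
      have yi: "(\<lambda>x. \<theta> + \<theta> powr (1 - p) * norm (k x) powr p) integrable_on {t'..t}"
        by (intro integrable_add integrable_const_ivl integrable_on_mult_right kp sub)
      have "norm (integral {t'..t} k) \<le> integral {t'..t} (\<lambda>x. \<theta> + \<theta> powr (1 - p) * norm (k x) powr p)"
        by (rule integral_norm_bound_integral[OF L1_integrable(1)[OF k1 sub] yi young])
      also have "\<dots> = (t - t') * \<theta> + \<theta> powr (1 - p) * integral {t'..t} (\<lambda>x. norm (k x) powr p)"
        using t' by (subst integral_add[OF integrable_const_ivl integrable_on_mult_right[OF kp[OF sub]]]) simp
      also have "\<dots> \<le> \<delta> * \<theta> + \<theta> powr (1 - p) * Kp"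
      proof (intro add_mono mult_right_mono mult_left_mono)
        show "integral {t'..t} (\<lambda>x. norm (k x) powr p) \<le> Kp"
          unfolding Kp_def by (rule integral_subset_le[OF sub kp[OF sub] kp]) auto
      qed (use t' \<theta> in auto)
      also have "\<theta> powr (1 - p) = \<delta> * \<theta>"
      proof -
        have "- (1 / p) * (1 - p) = 1 + - (1 / p)" using p by (simp add: field_simps)
        hence "\<theta> powr (1 - p) = \<delta> powr (1 + - (1 / p))" by (simp only: \<theta>_def powr_powr)
        also have "\<dots> = \<delta> * \<theta>" unfolding powr_add using \<delta> by (simp add: \<theta>_def)
        finally show ?thesis .
      qed
      finally have "norm (integral {t'..t} k) \<le> \<delta> * (\<theta> * (1 + Kp))" by (simp add: algebra_simps)
      hence "(1 / \<delta>) * norm (integral {t'..t} k) \<le> (1 / \<delta>) * (\<delta> * (\<theta> * (1 + Kp)))" using \<delta> by (intro mult_left_mono) auto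
      thus ?thesis using \<delta> by (simp add: \<kappa>_def)
    qed
    define \<epsilon> where "\<epsilon> = (p - 1) / (2 * p)"
    have e1: "\<Lambda> * \<delta> \<le> \<Lambda> powr (- \<epsilon>)"
    proof -
      have "\<Lambda> * \<delta> = \<Lambda> powr (1 + - a)" unfolding powr_add using \<Lambda> by (simp add: \<delta>_def)
      also have "\<dots> \<le> \<Lambda> powr (- \<epsilon>)"
      proof (rule powr_mono[OF _ \<Lambda>])
        have "(p - 1) / (2 * p) \<le> (p - 1) / 2" using p by (intro divide_left_mono) auto
        thus "1 + - a \<le> - \<epsilon>" by (simp add: a_def \<epsilon>_def field_simps)
      qed
      finally show ?thesis .
    qed
    have e2: "\<theta> / \<Lambda> = \<Lambda> powr (- \<epsilon>)"
    proof -
      have "\<theta> = \<Lambda> powr (a / p)" by (simp add: \<theta>_def \<delta>_def powr_powr)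
      hence "\<theta> / \<Lambda> = \<Lambda> powr (a / p - 1)" unfolding powr_diff using \<Lambda> by simp
      also have "a / p - 1 = - \<epsilon>" using p by (simp add: a_def \<epsilon>_def field_simps)
      finally show ?thesis .
    qed
    have "Rs \<sigma> l (q t) = Rs \<sigma> l (q t - U (U \<kappa>)) + Rs \<sigma> l (U (U \<kappa>))" by (simp add: L)
    also have "norm \<dots> \<le> M * \<Lambda> * (B * \<delta>) + M / \<Lambda> * (\<theta> * (1 + Kp))"
    proof (rule norm_triangle_mono)
      show "norm (Rs \<sigma> l (q t - U (U \<kappa>))) \<le> M * \<Lambda> * (B * \<delta>)"
        unfolding \<Lambda>_def by (rule order_trans[OF M(2)[OF l] mult_left_mono[OF near]]) (use M in auto)
      show "norm (Rs \<sigma> l (U (U \<kappa>))) \<le> M / \<Lambda> * (\<theta> * (1 + Kp))"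
        unfolding \<Lambda>_def by (rule order_trans[OF M(3)[OF l] mult_left_mono[OF n\<kappa>]]) (use M in auto)
    qed
    also have "\<dots> = (M * B) * (\<Lambda> * \<delta>) + (M * (1 + Kp)) * (\<theta> / \<Lambda>)" by (simp add: field_simps)
    also have "\<dots> \<le> (M * B) * \<Lambda> powr (- \<epsilon>) + (M * (1 + Kp)) * \<Lambda> powr (- \<epsilon>)"
      unfolding e2 by (intro add_mono mult_left_mono e1) (use M B Kp0 in auto)
    also have "\<dots> = C * \<Lambda> powr (- \<epsilon>)" by (simp add: C_def distrib_right)
    finally show "norm (Rs \<sigma> l (q t)) \<le> C * (1 + cmod l) powr (- ((p - 1) / (2 * p)))"
      by (simp add: \<Lambda>_def \<epsilon>_def)
  qed
qed

end

section \<open>The first order problems\<close>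

text \<open>The case of the left half plane, reflected by z \<mapsto> - z.\<close>

lemma right_half_plane_integral_zero:
  fixes F :: "complex \<Rightarrow> 'e::complex_banach"
  assumes q: "\<And>r. qd {z \<in> {z. a \<le> Re z}. cmod z \<le> r} F" and e: "e > 0"
    and dec: "\<And>z. a \<le> Re z \<Longrightarrow> \<rho> \<le> cmod z \<Longrightarrow> norm (F z) \<le> C * (1 + cmod z) powr (- e - 1)"
  shows "(\<lambda>s. F (Complex a s)) integrable_on UNIV" "integral UNIV (\<lambda>s. F (Complex a s)) = 0"
proof -
  have neg: "uminus ` {z \<in> {z. Re z \<le> - a}. cmod z \<le> r} \<subseteq> {z \<in> {z. a \<le> Re z}. cmod z \<le> r}" for r by auto
  have q': "qd {z \<in> {z. Re z \<le> - a}. cmod z \<le> r} (\<lambda>z. F (- z))" for r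
    by (rule qd_uminus[OF qd_subset[OF q neg]])
  have d': "norm (F (- z)) \<le> C * (1 + cmod z) powr (- e - 1)" if "Re z \<le> - a" "\<rho> \<le> cmod z" for z
    using dec[of "- z"] that by simp
  have eq: "- Complex (- a) s = Complex a (- s)" for s by (simp add: complex_eq_iff)
  note Z = left_half_plane_integral_zero[OF q' e d', unfolded eq]
  have dec': "z \<in> {z. a \<le> Re z} \<Longrightarrow> \<rho> \<le> cmod z \<Longrightarrow> norm (F z) \<le> C * (1 + cmod z) powr (- e - 1)" for z
    using dec by simp
  obtain C' where C': "C' \<ge> 0" "\<And>z. z \<in> {z. a \<le> Re z} \<Longrightarrow> norm (F z) \<le> C' * (1 + cmod z) powr (- e - 1)"
    using decay_on_bounded_part[OF q e dec'] by metis
  show i: "(\<lambda>s. F (Complex a s)) integrable_on UNIV"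
  proof (rule line_integrable[OF qd_line_continuous[OF q] e])
    fix s show "norm (F (Complex a s)) \<le> C' * kap e s"
      using order_trans[OF C'(2) mult_left_mono[OF one_plus_cmod_powr_le_kap[OF e] C'(1)], of "Complex a s"] by simp
  qed simp
  show "integral UNIV (\<lambda>s. F (Complex a s)) = 0" using integral_reflect_UNIV[OF i Z(1)] Z(2) by simp
qed

lemma powr_minus_two: "x > 0 \<Longrightarrow> x powr (- 1 - 1) = 1 / x\<^sup>2" for x :: real
  by (simp add: powr_neg_numeral)

lemma inverse_cmod_square_bound:
  assumes "0 < d" "d \<le> cmod l" shows "1 / (cmod l)\<^sup>2 \<le> (1 + 1 / d)\<^sup>2 * (1 + cmod l) powr (- 1 - 1)"
proof -
  have "(1 / cmod l)\<^sup>2 \<le> ((1 + 1 / d) / (1 + cmod l))\<^sup>2" by (rule power_mono[OF inverse_cmod_bound[OF assms]]) simp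
  moreover have "(1 + cmod l) powr (- 1 - 1) = 1 / (1 + cmod l)\<^sup>2" by (rule powr_minus_two) (simp add: add_pos_nonneg)
  ultimately show ?thesis by (simp only: power_divide power_one times_divide_eq_right mult_1_right)
qed

text \<open>The continuous representative of \<open>B^(-1) f\<close>.\<close>

definition prim :: "(real \<Rightarrow> 'b) \<Rightarrow> real \<Rightarrow> 'b::banach" where
  "prim f t = integral {0..t} f"

lemma prim_continuous:
  fixes f :: "real \<Rightarrow> 'b::banach" assumes "L1 T f" shows "continuous_on {0..T} (prim f)"
  using integral_continuous_L1[OF assms] by (simp add: prim_def[abs_def])

lemma prim_linear:
  fixes f :: "real \<Rightarrow> 'b::banach"
  assumes "L1 T f" "t \<in> {0..T}" "bounded_linear R" shows "prim (\<lambda>x. R (f x)) t = R (prim f t)"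
proof -
  have "f integrable_on {0..t}" by (rule L1_integrable[OF assms(1)]) (use assms(2) in auto)
  from integral_linear[OF this assms(3)] show ?thesis by (simp add: prim_def o_def)
qed

lemma prim_add:
  fixes f g :: "real \<Rightarrow> 'b::banach"
  assumes "L1 T f" "L1 T g" "t \<in> {0..T}" shows "prim (\<lambda>x. f x + g x) t = prim f t + prim g t"
  unfolding prim_def by (rule integral_add) (use assms(3) in \<open>auto intro!: L1_integrable(1) assms(1,2)\<close>)

lemma prim_cong: "(\<And>x. x \<in> {0..T} \<Longrightarrow> f x = g x) \<Longrightarrow> t \<in> {0..T} \<Longrightarrow> prim f t = prim g t"
  unfolding prim_def by (rule integral_cong) simp

lemma prim_cong_AE: "AE t in interval T. f t = g t \<Longrightarrow> t \<in> {0..T} \<Longrightarrow> prim f t = prim g t"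
  unfolding prim_def by (rule integral_cong_AE_interval) auto

lemma prim_vol:
  fixes v :: "real \<Rightarrow> 'e::complex_banach"
  assumes v: "L1 T v" and t: "t \<in> {0..T}" shows "prim (vol z v) t = vol z (prim v) t"
proof -
  have "vol z (prim v) t = prim (\<lambda>x. prim v x - z *\<^sub>C vol z (prim v) x) t"
    using vol_integral[OF L1_continuous[OF prim_continuous[OF v]] t] by (simp add: prim_def)
  also have "\<dots> = prim (vol z v) t"
    by (rule prim_cong[OF _ t]) (simp add: vol_deriv[OF v, of "prim v"] prim_def)
  finally show ?thesis by simp
qed

lemma vol_commute:
  fixes g :: "real \<Rightarrow> 'e::complex_banach"
  assumes g: "L1 T g" and t: "t \<in> {0..T}" shows "vol z (vol l g) t = vol l (vol z g) t"
proof (cases "l = z")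
  case False
  have "(l - z) *\<^sub>C vol z (vol l g) t = (l - z) *\<^sub>C vol l (vol z g) t"
    using vol_resolvent[OF g t, of z l] vol_resolvent[OF g t, of l z]
    by (metis minus_diff_eq scaleC.minus_left)
  hence "(1 / (l - z)) *\<^sub>C (l - z) *\<^sub>C vol z (vol l g) t = (1 / (l - z)) *\<^sub>C (l - z) *\<^sub>C vol l (vol z g) t" by simp
  thus ?thesis using False by (simp add: scaleC_scaleC scaleC_one)
qed simp

context cauchy_problem begin

lemma Rs_commute_map:
  assumes R: "bounded_complex_linear R" and RU: "\<And>x. R (U x) = U (R x)" and R2: "\<And>x. R (R2 l x) = R2 l (R x)"
  shows "R (Rs \<sigma> l x) = Rs \<sigma> l (R x)"
  by (simp add: Rs_def Dl_def bounded_complex_linearD[OF R] RU R2)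

lemma Rs_commute:
  assumes l: "l \<in> H" and m: "m \<in> H" shows "Rs \<sigma> l (Rs \<tau> m x) = Rs \<tau> m (Rs \<sigma> l x)"
proof (rule Rs_commute_map[OF Rs_bcl[OF l] Rs_U[OF l]])
  fix x
  have "R2 m (Rs \<sigma> l x) = Rs \<sigma> l (R2 m x)"
    by (rule Rs_commute_map[OF R2_bcl[OF m] R2_U[OF m] resolvent_commute[OF sq_in(2)[OF m] sq_in(2)[OF l]]])
  thus "Rs \<sigma> l (R2 m x) = R2 m (Rs \<sigma> l x)" by simp
qed

text \<open>What remains of (\<sigma> \<i> sqrt A - z)^(-1) (B + z)^(-1) after it has been applied
  to (B + \<sigma> \<i> sqrt A) f: the sum of the two resolvents.\<close>

definition E :: "complex \<Rightarrow> complex \<Rightarrow> (real \<Rightarrow> 'e) \<Rightarrow> real \<Rightarrow> 'e" where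
  "E \<sigma> z f t = Rs \<sigma> z (f t) + vol z f t"

lemma E_cong: "t \<in> {0..T} \<Longrightarrow> (\<And>x. x \<in> {0..T} \<Longrightarrow> f x = g x) \<Longrightarrow> E \<sigma> z f t = E \<sigma> z g t"
  unfolding E_def using vol_cong[of t f g z] by simp

lemma E_L1: assumes "z \<in> H" "L1 T v" shows "L1 T (E \<sigma> z v)"
  unfolding E_def by (intro L1_add L1_linear[OF assms(2)] bounded_complex_linearD(1)[OF Rs_bcl[OF assms(1)]] L1_continuous vol_continuous assms)

lemma E_linear:
  assumes "z \<in> H" "L1 T v" "t \<in> {0..T}" "bounded_complex_linear R" "\<And>x. R (Rs \<sigma> z x) = Rs \<sigma> z (R x)"
  shows "E \<sigma> z (\<lambda>x. R (v x)) t = R (E \<sigma> z v t)"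
  using assms by (simp add: E_def vol_linear bounded_complex_linearD(3))

lemma prim_E:
  assumes z: "z \<in> H" and v: "L1 T v" and t: "t \<in> {0..T}" shows "prim (E \<sigma> z v) t = E \<sigma> z (prim v) t"
  unfolding E_def
  by (subst prim_add[OF L1_linear[OF v bounded_complex_linearD(1)[OF Rs_bcl[OF z]]] L1_continuous[OF vol_continuous[OF v]] t])
    (simp add: prim_linear[OF v t bounded_complex_linearD(1)[OF Rs_bcl[OF z]]] prim_vol[OF v t])

text \<open>The data \<open>A\<^sup>-\<^sup>1\<^sup>/\<^sup>2 B\<^sup>-\<^sup>2 v\<close> that belong to \<open>L\<^sup>p(0,T;\<D>(A\<^sup>3\<^sup>/\<^sup>2))\<close>, described by \<open>v\<close>.\<close>

definition reg :: "(real \<Rightarrow> 'e) \<Rightarrow> bool" where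
  "reg v \<longleftrightarrow> L1 T v \<and> (\<exists>k\<in>Lp p T. AE t in interval T. prim (prim v) t = U (U (k t)))"

text \<open>Makes the first order result applicable a second time: for fixed z the inner integral of
  (I) has the data \<open>E 1 z v\<close> in place of v, and these inherit the regularity because
  \<open>E \<sigma> z\<close> commutes with primitives and with \<open>U\<close>.\<close>

lemma E_reg:
  assumes v: "reg v" and z: "z \<in> H"
  shows "reg (E \<sigma> z v)" "t \<in> {0..T} \<Longrightarrow> U (prim (prim (E \<sigma> z v)) t) = E \<sigma> z (\<lambda>t. U (prim (prim v) t)) t"
proof -
  note R = Rs_bcl[OF z]
  have v1: "L1 T v" using v by (simp add: reg_def)
  note v2 = L1_continuous[OF prim_continuous[OF v1]]
  note v3 = L1_continuous[OF prim_continuous[OF v2]]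
  have pp: "prim (prim (E \<sigma> z v)) t = E \<sigma> z (prim (prim v)) t" if t: "t \<in> {0..T}" for t
  proof -
    have "prim (prim (E \<sigma> z v)) t = prim (E \<sigma> z (prim v)) t" by (rule prim_cong[OF prim_E[OF z v1] t])
    thus ?thesis by (simp add: prim_E[OF z v2 t])
  qed
  show "U (prim (prim (E \<sigma> z v)) t) = E \<sigma> z (\<lambda>t. U (prim (prim v) t)) t" if t: "t \<in> {0..T}"
    unfolding pp[OF t] by (rule E_linear[OF z v3 t U(1), symmetric]) (simp add: Rs_U[OF z])
  obtain k where k: "k \<in> Lp p T" "AE t in interval T. prim (prim v) t = U (U (k t))" using v by (auto simp: reg_def)
  note k1 = Lp_imp_L1[OF p k(1)]
  note UU = bounded_complex_linear_compose[OF U(1) U(1)]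
  have "E \<sigma> z k \<in> Lp p T" unfolding E_def
    by (intro Lp_add[OF p] Lp_linear[OF p k(1)] bounded_complex_linearD(1)[OF R] Lp_continuous[OF p] vol_continuous[OF k1])
  moreover have "AE t in interval T. prim (prim (E \<sigma> z v)) t = U (U (E \<sigma> z k t))"
    using k(2) AE_space
  proof eventually_elim
    case (elim t)
    hence t: "t \<in> {0..T}" by simp
    have "vol z (prim (prim v)) t = U (U (vol z k t))"
      using vol_cong_AE[OF k(2) t] vol_linear[OF k1 t UU] by simp
    thus ?case unfolding pp[OF t] E_def elim(1) by (simp add: Rs_U[OF z] U_simps)
  qed
  ultimately show "reg (E \<sigma> z v)" using E_L1[OF z v1] by (auto simp: reg_def)
qed

text \<open>Two derivatives in time give the expansion of (B + l)^(-1) to first order in 1/l, with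
  an explicit remainder that is O(1/|l|^2) on half planes Re l \<ge> a.\<close>

lemma vol_twice:
  assumes v: "L1 T v" and t: "t \<in> {0..T}" and l: "l \<noteq> 0"
  shows "vol l (prim (prim v)) t = (1 / l) *\<^sub>C prim (prim v) t - (1 / l\<^sup>2) *\<^sub>C (prim v t - vol l v t)"
proof -
  have 1: "vol l (prim v) t = prim (prim v) t - l *\<^sub>C vol l (prim (prim v)) t"
    by (rule vol_deriv[OF L1_continuous[OF prim_continuous[OF v]] _ t]) (simp add: prim_def)
  have 2: "vol l v t = prim v t - l *\<^sub>C vol l (prim v) t" by (rule vol_deriv[OF v _ t]) (simp add: prim_def)
  have "(1 / l\<^sup>2) *\<^sub>C (prim v t - vol l v t) = (1 / l) *\<^sub>C vol l (prim v) t"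
    using l by (simp add: 2 scaleC_scaleC power2_eq_square)
  also have "\<dots> = (1 / l) *\<^sub>C prim (prim v) t - vol l (prim (prim v)) t"
    using l by (simp add: 1 scaleC.diff_right scaleC_scaleC scaleC_one)
  finally show ?thesis by simp
qed

lemma E_continuous:
  assumes "\<sigma> * \<sigma> = 1" "a \<le> - c" "continuous_on {0..T} u"
  shows "continuous_on (UNIV \<times> {0..T}) (\<lambda>(s, t). E \<sigma> (Complex a s) u t)"
  unfolding E_def split_def
  by (intro continuous_on_add Rs_continuous_on assms(1) vol_continuous_on[OF L1_continuous[OF assms(3)]] continuous_on_Complex
      continuous_on_const continuous_on_compose2[OF assms(3)] continuous_on_snd continuous_on_fst continuous_on_id)
    (auto simp: Complex_in_H assms(2))

text \<open>With q = B^(-2) v and u = U q, the first term plus u / l equals (\<sigma> \<i> / l)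
  (\<sigma> \<i> sqrt A - l)^(-1) q, where \<open>Rs_decay\<close> supplies a power of |l| beyond
  the factor 1 / l. The second term minus u / l is O(1/|l|^2) by \<open>vol_twice\<close>. The two
  copies of u / l cancel in the sum.\<close>

lemma E_main:
  assumes \<sigma>: "\<sigma> * \<sigma> = 1" and a: "a \<le> - c" and v: "reg v"
  obtains C e where "e > 0" "\<And>s t. t \<in> {0..T} \<Longrightarrow> norm (E \<sigma> (Complex a s) (\<lambda>t. U (prim (prim v) t)) t) \<le> C * kap e s"
    "\<And>t. t \<in> {0..T} \<Longrightarrow> integral UNIV (\<lambda>s. E \<sigma> (Complex a s) (\<lambda>t. U (prim (prim v) t)) t) = (2 * pi) *\<^sub>R U (prim (prim v) t)"
proof -
  define q' q where "q' = prim v" and "q = prim q'"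
  have v1: "L1 T v" using v by (simp add: reg_def)
  note q'c = prim_continuous[OF v1, folded q'_def]
  note q'1 = L1_continuous[OF q'c]
  note qc = prim_continuous[OF q'1, folded q_def]
  note q1 = L1_continuous[OF qc]
  obtain B where B: "B > 0" "\<And>t. t \<in> {0..T} \<Longrightarrow> norm (q' t) \<le> B" by (rule continuous_bounded_Icc[OF q'c]) blast
  obtain B2 where B2: "B2 > 0" "\<And>t. t \<in> {0..T} \<Longrightarrow> norm (q t) \<le> B2" by (rule continuous_bounded_Icc[OF qc]) blast
  have lip0: "norm (q t - q s) \<le> B * (t - s)" if "s \<in> {0..T}" "t \<in> {0..T}" "s \<le> t" for s t
  proof -
    have sub: "{s..t} \<subseteq> {0..T}" "{0..t} \<subseteq> {0..T}" using that by auto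
    have "q t - q s = integral {s..t} q'"
      unfolding q_def prim_def by (rule integral_diff_Icc[OF L1_integrable(1)[OF q'1 sub(2)]]) (use that in auto)
    also have "norm \<dots> \<le> integral {s..t} (\<lambda>x. B)"
      by (rule integral_norm_bound_integral[OF L1_integrable(1)[OF q'1 sub(1)] integrable_const_ivl]) (use B(2) sub(1) in blast)
    finally show ?thesis using that by (simp add: mult.commute)
  qed
  have lip: "norm (q t - q s) \<le> B * \<bar>t - s\<bar>" if st: "s \<in> {0..T}" "t \<in> {0..T}" for s t
  proof (cases "s \<le> t")
    case True
    thus ?thesis using lip0[OF st True] by simp
  next
    case False
    thus ?thesis using lip0[OF st(2,1)] by (simp add: norm_minus_commute)
  qed
  obtain k where k: "k \<in> Lp p T" "AE t in interval T. q t = U (U (k t))" using v by (auto simp: reg_def q_def q'_def)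
  define \<epsilon> where "\<epsilon> = (p - 1) / (2 * p)"
  have \<epsilon>: "\<epsilon> > 0" "\<epsilon> \<le> 1" using p by (simp_all add: \<epsilon>_def field_simps)
  have q0: "q 0 = 0" by (simp add: q_def prim_def)
  obtain C1 where C1: "C1 \<ge> 0" "\<And>l t. l \<in> H \<Longrightarrow> t \<in> {0..T} \<Longrightarrow> norm (Rs \<sigma> l (q t)) \<le> C1 * (1 + cmod l) powr (- \<epsilon>)"
    using Rs_decay[OF \<sigma> lip q0 k] unfolding \<epsilon>_def by blast
  have c0: "l \<in> H \<Longrightarrow> c \<le> cmod l" for l using abs_Re_le_cmod[of l] by (auto simp: H_def)
  have l0: "l \<in> H \<Longrightarrow> l \<noteq> 0" for l using c0[of l] c by auto
  have P: "Rs \<sigma> l (U x) + (1 / l) *\<^sub>C U x = (\<sigma> * \<i> / l) *\<^sub>C Rs \<sigma> l x" if l: "l \<in> H" for l x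
  proof -
    have "U x = (\<sigma> * \<i>) *\<^sub>C Rs \<sigma> l x - l *\<^sub>C Rs \<sigma> l (U x)"
      using Rs_left[OF l \<sigma>, of x] by (simp add: bounded_complex_linearD[OF Rs_bcl[OF l]])
    hence "(1 / l) *\<^sub>C U x = (1 / l) *\<^sub>C ((\<sigma> * \<i>) *\<^sub>C Rs \<sigma> l x - l *\<^sub>C Rs \<sigma> l (U x))" by simp
    thus ?thesis using l0[OF l] by (simp add: scaleC.diff_right scaleC_scaleC scaleC_one)
  qed
  have abs_sigma: "cmod \<sigma> = 1"
  proof -
    have "cmod \<sigma> * cmod \<sigma> = 1" using arg_cong[OF \<sigma>, of cmod] by (simp add: norm_mult)
    thus ?thesis by (metis abs_norm_cancel abs_square_eq_1 power2_eq_square)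
  qed
  define C2 where "C2 = (1 + 1 / c) * C1"
  have C20: "C2 \<ge> 0" using C1(1) c by (simp add: C2_def)
  have Pb: "norm (Rs \<sigma> l (U (q t)) + (1 / l) *\<^sub>C U (q t)) \<le> C2 * (1 + cmod l) powr (- \<epsilon> - 1)"
    if l: "l \<in> H" and t: "t \<in> {0..T}" for l t
  proof -
    have "norm (Rs \<sigma> l (U (q t)) + (1 / l) *\<^sub>C U (q t)) = 1 / cmod l * norm (Rs \<sigma> l (q t))"
      unfolding P[OF l] by (simp add: norm_scaleC norm_mult norm_divide abs_sigma)
    also have "\<dots> \<le> (1 + 1 / c) / (1 + cmod l) * (C1 * (1 + cmod l) powr (- \<epsilon>))"
      by (intro mult_mono inverse_cmod_le l C1(2) t) (use c in auto)
    also have "\<dots> = C2 * ((1 + cmod l) powr (- \<epsilon>) / (1 + cmod l))" by (simp add: C2_def)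
    also have "(1 + cmod l) powr (- \<epsilon>) / (1 + cmod l) = (1 + cmod l) powr (- \<epsilon> - 1)"
      unfolding powr_diff by (simp add: add_nonneg_nonneg)
    finally show ?thesis .
  qed
  obtain MU where MU: "MU > 0" "\<And>x. norm (U x) \<le> MU * norm x" using Rs_bounds by metis
  define C3 where "C3 = B + exp (\<bar>a\<bar> * T) * integral {0..T} (\<lambda>x. norm (v x))"
  have C30: "C3 \<ge> 0" unfolding C3_def
    using B(1) integral_nonneg[OF L1_integrable(2)[OF v1 order_refl]] by (simp add: add_nonneg_nonneg)
  have V: "vol l (\<lambda>t. U (q t)) t = (1 / l) *\<^sub>C U (q t) - (1 / l\<^sup>2) *\<^sub>C U (q' t - vol l v t)" if "l \<noteq> 0" "t \<in> {0..T}" for l t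
    using arg_cong[OF vol_twice[OF v1 that(2,1)], of U] vol_linear[OF q1 that(2) U(1)]
    by (simp add: q'_def[symmetric] q_def[symmetric] U_simps)
  have Vb: "norm (U (q' t - vol l v t)) \<le> MU * C3" if "a \<le> Re l" "t \<in> {0..T}" for l t
  proof -
    have "norm (vol l v t) \<le> exp (\<bar>a\<bar> * T) * integral {0..T} (\<lambda>x. norm (v x))"
      by (rule vol_norm_le[OF v1 that(2)]) (use that(1) in auto)
    hence "norm (q' t - vol l v t) \<le> C3" unfolding C3_def
      using norm_triangle_ineq4[of "q' t" "vol l v t"] B(2)[OF that(2)] by linarith
    thus ?thesis using order_trans[OF MU(2) mult_left_mono] MU(1) by simp
  qed
  define C4 where "C4 = MU * C3 * (1 + 1 / c)\<^sup>2"
  have C40: "C4 \<ge> 0" using MU(1) C30 by (simp add: C4_def)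
  have Qb: "norm (vol l (\<lambda>t. U (q t)) t - (1 / l) *\<^sub>C U (q t)) \<le> C4 * (1 + cmod l) powr (- 1 - 1)"
    if l: "l \<in> H" "a \<le> Re l" and t: "t \<in> {0..T}" for l t
  proof -
    have "norm (vol l (\<lambda>t. U (q t)) t - (1 / l) *\<^sub>C U (q t)) = 1 / (cmod l)\<^sup>2 * norm (U (q' t - vol l v t))"
      unfolding V[OF l0[OF l(1)] t] by (simp add: norm_scaleC norm_divide norm_power)
    also have "\<dots> \<le> ((1 + 1 / c)\<^sup>2 * (1 + cmod l) powr (- 1 - 1)) * (MU * C3)"
      by (intro mult_mono inverse_cmod_square_bound c c0 l Vb t) simp_all
    finally show ?thesis by (simp add: C4_def mult_ac)
  qed
  define u where "u = (\<lambda>t. U (q t))"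
  have u_eq: "(\<lambda>t. U (prim (prim v) t)) = u" by (simp add: u_def q_def q'_def)
  show ?thesis
  proof (rule that[OF \<epsilon>(1), of "C2 + C4"], unfold u_eq)
    fix s t assume t: "t \<in> {0..T}"
    note l = Complex_in_H[OF a, of s]
    have "E \<sigma> (Complex a s) u t = (Rs \<sigma> (Complex a s) (U (q t)) + (1 / Complex a s) *\<^sub>C U (q t)) + (vol (Complex a s) u t - (1 / Complex a s) *\<^sub>C U (q t))"
      by (simp add: E_def u_def)
    also have "norm \<dots> \<le> C2 * (1 + cmod (Complex a s)) powr (- \<epsilon> - 1) + C4 * (1 + cmod (Complex a s)) powr (- 1 - 1)"
      unfolding u_def by (rule norm_triangle_mono[OF Pb[OF l t] Qb[OF l _ t]]) simp
    also have "\<dots> \<le> C2 * kap \<epsilon> s + C4 * kap \<epsilon> s"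
    proof (intro add_mono mult_left_mono C20 C40)
      show k: "(1 + cmod (Complex a s)) powr (- \<epsilon> - 1) \<le> kap \<epsilon> s" using one_plus_cmod_powr_le_kap[OF \<epsilon>(1), of "Complex a s"] by simp
      have "(1 + cmod (Complex a s)) powr (- 1 - 1) \<le> (1 + cmod (Complex a s)) powr (- \<epsilon> - 1)"
        by (rule powr_mono) (use \<epsilon> in auto)
      thus "(1 + cmod (Complex a s)) powr (- 1 - 1) \<le> kap \<epsilon> s" using k by linarith
    qed
    finally show "norm (E \<sigma> (Complex a s) u t) \<le> (C2 + C4) * kap \<epsilon> s" by (simp add: distrib_right)
  next
    fix t assume t: "t \<in> {0..T}"
    let ?P = "\<lambda>l. Rs \<sigma> l (u t) + (1 / (l - 0)) *\<^sub>C u t"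
    have 1: "(\<lambda>s. ?P (Complex a s)) integrable_on UNIV" "integral UNIV (\<lambda>s. ?P (Complex a s)) = 0"
    proof -
      have q: "qd {z \<in> {z. Re z \<le> a}. cmod z \<le> r} ?P" for r
      proof (intro qd_add qd_Rs[OF \<sigma> qd_const, where r=r] qd_scalar_resolvent[OF qd_const c])
        fix z assume "z \<in> {z \<in> {z. Re z \<le> a}. cmod z \<le> r}"
        thus "z \<in> H" "cmod z \<le> r" using a by (auto simp: H_def)
        thus "c \<le> cmod (z - 0)" using c0 by simp
      qed
      have d: "norm (?P z) \<le> C2 * (1 + cmod z) powr (- \<epsilon> - 1)" if "Re z \<le> a" "0 \<le> cmod z" for z
        using Pb[OF _ t, of z] that a by (simp add: H_def u_def)
      show "(\<lambda>s. ?P (Complex a s)) integrable_on UNIV" "integral UNIV (\<lambda>s. ?P (Complex a s)) = 0"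
        by (rule left_half_plane_integral_zero[OF q \<epsilon>(1) d]; assumption)+
    qed
    \<comment> \<open>The pole 0 lies to the right of the line. That suits the first term, which is
      continued to the left, but the second is continued to the right, so its comparison function
      has the pole at a - 1 on the other side. The difference of the two comparison functions then
      carries the whole value of the integral.\<close>
    define \<mu> where "\<mu> = complex_of_real (a - 1)"
    let ?X = "\<lambda>l. vol l u t - (1 / (l - \<mu>)) *\<^sub>C u t"
    have 2: "(\<lambda>s. ?X (Complex a s)) integrable_on UNIV" "integral UNIV (\<lambda>s. ?X (Complex a s)) = 0"
    proof -
      have uc: "continuous_on {0..T} u" unfolding u_def by (rule U_continuous_on[OF qc])
      have q: "qd {z \<in> {z. a \<le> Re z}. cmod z \<le> r} ?X" for r
      proof (intro qd_diff qd_vol[OF L1_continuous[OF uc] t, where r=r] qd_scalar_resolvent[OF qd_const zero_less_one])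
        fix z assume "z \<in> {z \<in> {z. a \<le> Re z}. cmod z \<le> r}"
        thus "cmod z \<le> r" "1 \<le> cmod (z - \<mu>)" using abs_Re_le_cmod[of "z - \<mu>"] by (auto simp: \<mu>_def)
      qed
      \<comment> \<open>Beyond this radius |z| \<ge> 1 and |z - \<mu>| \<ge> |z| / 2.\<close>
      define \<rho> where "\<rho> = 2 * cmod \<mu> + 1"
      define D where "D = MU * C3 + 2 * cmod \<mu> * norm (u t)"
      have D0: "D \<ge> 0" using MU(1) C30 by (simp add: D_def)
      have d: "norm (?X z) \<le> (D * (1 + 1 / 1)\<^sup>2) * (1 + cmod z) powr (- 1 - 1)" if z: "a \<le> Re z" "\<rho> \<le> cmod z" for z
      proof -
        have z1: "1 \<le> cmod z" using z(2) norm_ge_zero[of \<mu>] unfolding \<rho>_def by linarith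
        have z\<mu>: "cmod z / 2 \<le> cmod (z - \<mu>)" using z(2) norm_triangle_ineq2[of z \<mu>] norm_ge_zero[of \<mu>] unfolding \<rho>_def by linarith
        have nz: "z \<noteq> 0" "z - \<mu> \<noteq> 0" using z1 z\<mu> by auto
        have "1 / z - 1 / (z - \<mu>) = - (\<mu> / (z * (z - \<mu>)))" using nz by (simp add: divide_simps)
        moreover have "?X z = - ((1 / z\<^sup>2) *\<^sub>C U (q' t - vol z v t)) + (1 / z - 1 / (z - \<mu>)) *\<^sub>C u t"
          unfolding u_def V[OF nz(1) t] by (simp add: scaleC.diff_left)
        ultimately have "?X z = - ((1 / z\<^sup>2) *\<^sub>C U (q' t - vol z v t)) + (- (\<mu> / (z * (z - \<mu>)))) *\<^sub>C u t"
          by (simp only:)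
        also have "norm \<dots> \<le> 1 / (cmod z)\<^sup>2 * (MU * C3) + (2 * cmod \<mu> / (cmod z)\<^sup>2) * norm (u t)"
        proof (rule norm_triangle_mono)
          show "norm (- ((1 / z\<^sup>2) *\<^sub>C U (q' t - vol z v t))) \<le> 1 / (cmod z)\<^sup>2 * (MU * C3)"
            unfolding norm_minus_cancel norm_scaleC using Vb[OF z(1) t] by (simp add: norm_divide norm_power divide_right_mono)
          have "cmod \<mu> / (cmod z * cmod (z - \<mu>)) \<le> cmod \<mu> / (cmod z * (cmod z / 2))"
            by (intro divide_left_mono mult_left_mono z\<mu> mult_pos_pos) (use z1 nz in auto)
          hence "cmod (- (\<mu> / (z * (z - \<mu>)))) \<le> 2 * cmod \<mu> / (cmod z)\<^sup>2"
            by (simp add: norm_divide norm_mult power2_eq_square mult_ac)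
          thus "norm ((- (\<mu> / (z * (z - \<mu>)))) *\<^sub>C u t) \<le> (2 * cmod \<mu> / (cmod z)\<^sup>2) * norm (u t)"
            unfolding norm_scaleC by (rule mult_right_mono) simp
        qed
        also have "\<dots> = D * (1 / (cmod z)\<^sup>2)" by (simp add: D_def add_divide_distrib)
        also have "\<dots> \<le> D * ((1 + 1 / 1)\<^sup>2 * (1 + cmod z) powr (- 1 - 1))"
          by (intro mult_left_mono inverse_cmod_square_bound D0 z1) simp
        finally show ?thesis by (simp only: mult.assoc)
      qed
      show "(\<lambda>s. ?X (Complex a s)) integrable_on UNIV" "integral UNIV (\<lambda>s. ?X (Complex a s)) = 0"
        by (rule right_half_plane_integral_zero[OF q zero_less_one d]; assumption)+
    qed
    have 3: "((\<lambda>s. (1 / (Complex a s - \<mu>) - 1 / (Complex a s - 0)) *\<^sub>C u t) has_integral complex_of_real (2 * pi) *\<^sub>C u t) UNIV"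
    proof -
      have "((\<lambda>s. 1 / (Complex a s - \<mu>) - 1 / (Complex a s - 0)) has_integral complex_of_real (2 * pi)) UNIV"
        by (rule scalar_line_integral) (use a c in \<open>auto simp: \<mu>_def\<close>)
      from has_integral_linear[OF this scaleC.bounded_linear_left[of "u t"]] show ?thesis by (simp add: o_def)
    qed
    have "((\<lambda>s. ?P (Complex a s) + ?X (Complex a s) + (1 / (Complex a s - \<mu>) - 1 / (Complex a s - 0)) *\<^sub>C u t)
        has_integral 0 + 0 + complex_of_real (2 * pi) *\<^sub>C u t) UNIV"
      using 1 2 by (intro has_integral_add 3) (auto simp: has_integral_integrable_integral)
    moreover have "?P l + ?X l + (1 / (l - \<mu>) - 1 / (l - 0)) *\<^sub>C u t = E \<sigma> l u t" for l
      by (simp add: E_def scaleC.diff_left)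
    ultimately have "((\<lambda>s. E \<sigma> (Complex a s) u t) has_integral complex_of_real (2 * pi) *\<^sub>C u t) UNIV" by simp
    thus "integral UNIV (\<lambda>s. E \<sigma> (Complex a s) u t) = (2 * pi) *\<^sub>R U (prim (prim v) t)"
      using u_eq by (simp only: integral_unique scaleC_of_real fun_eq_iff)
  qed
qed

end

section \<open>The iterated integral\<close>

text \<open>One derivative in time, hence one power of 1/|l|, by \<open>vol_deriv\<close>.\<close>

lemma vol_prim_bound:
  fixes v :: "real \<Rightarrow> 'e::complex_banach"
  assumes v: "L1 T v" and a: "a \<ge> 0"
  obtains B where "B \<ge> 0" "\<And>l t. - a \<le> Re l \<Longrightarrow> l \<noteq> 0 \<Longrightarrow> t \<in> {0..T} \<Longrightarrow> norm (vol l (prim v) t) \<le> B * (1 / cmod l)"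
proof -
  obtain B1 where B1: "B1 > 0" "\<And>t. t \<in> {0..T} \<Longrightarrow> norm (prim v t) \<le> B1"
    by (rule continuous_bounded_Icc[OF prim_continuous[OF v]]) blast
  define B where "B = B1 + exp (a * T) * integral {0..T} (\<lambda>x. norm (v x))"
  show ?thesis
  proof (rule that[of B])
    show "B \<ge> 0" unfolding B_def
      using B1(1) integral_nonneg[OF L1_integrable(2)[OF v order_refl]] by (simp add: add_nonneg_nonneg)
    fix l t assume l: "- a \<le> Re l" "l \<noteq> 0" and t: "t \<in> {0..T}"
    have "l *\<^sub>C vol l (prim v) t = prim v t - vol l v t"
      using vol_deriv[OF v _ t, of "prim v" l] by (simp add: prim_def)
    hence "cmod l * norm (vol l (prim v) t) = norm (prim v t - vol l v t)" by (simp add: norm_scaleC[symmetric])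
    also have "\<dots> \<le> B" unfolding B_def
      using norm_triangle_ineq4[of "prim v t" "vol l v t"] B1(2)[OF t] vol_norm_le[OF v t l(1) a] by linarith
    finally show "norm (vol l (prim v) t) \<le> B * (1 / cmod l)" using l(2) by (simp add: field_simps)
  qed
qed

lemma square_diff_bounds:
  fixes w v :: complex
  assumes "2 * cmod v + 1 \<le> cmod w"
  shows "1 / cmod (w\<^sup>2 - v\<^sup>2) \<le> 8 * (1 + cmod w) powr (- 1 - 1)" "1 / cmod (v\<^sup>2 - w\<^sup>2) \<le> 8 * (1 + cmod w) powr (- 1 - 1)"
proof -
  have w1: "1 \<le> cmod w" "cmod v \<le> cmod w / 2" using assms norm_ge_zero[of v] by linarith+
  have "(cmod v)\<^sup>2 \<le> (cmod w / 2)\<^sup>2" by (rule power_mono[OF w1(2)]) simp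
  hence "(cmod v)\<^sup>2 \<le> (cmod w)\<^sup>2 / 4" by (simp add: power_divide)
  hence "(cmod w)\<^sup>2 / 2 \<le> (cmod w)\<^sup>2 - (cmod v)\<^sup>2" using zero_le_power2[of "cmod w"] by linarith
  also have "\<dots> \<le> cmod (w\<^sup>2 - v\<^sup>2)" using norm_triangle_ineq2[of "w\<^sup>2" "v\<^sup>2"] by (simp add: norm_power)
  finally have ge: "(cmod w)\<^sup>2 / 2 \<le> cmod (w\<^sup>2 - v\<^sup>2)" .
  have pos: "0 < (cmod w)\<^sup>2 / 2" using w1(1) by (auto intro!: zero_less_power)
  have "1 / cmod (w\<^sup>2 - v\<^sup>2) \<le> 1 / ((cmod w)\<^sup>2 / 2)"
    by (rule divide_left_mono[OF ge]) (use pos ge in \<open>auto intro!: mult_pos_pos\<close>)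
  also have "\<dots> = 2 * (1 / (cmod w)\<^sup>2)" by simp
  also have "\<dots> \<le> 2 * ((1 + 1 / 1)\<^sup>2 * (1 + cmod w) powr (- 1 - 1))"
    by (intro mult_left_mono inverse_cmod_square_bound w1) simp_all
  finally show "1 / cmod (w\<^sup>2 - v\<^sup>2) \<le> 8 * (1 + cmod w) powr (- 1 - 1)" by simp
  thus "1 / cmod (v\<^sup>2 - w\<^sup>2) \<le> 8 * (1 + cmod w) powr (- 1 - 1)" by (simp only: norm_minus_commute)
qed

context cauchy_problem begin

text \<open>Values at time t of the two integrands of (II): \<open>xint\<close> for w = A^(-1/2)
  B^(-1) v, and \<open>yint\<close> for data h of any form.\<close>

abbreviation "xint v s t \<equiv> R2 (Complex (- c) s) (vol (Complex (- c) s) (\<lambda>t. U (prim v t)) t)"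
abbreviation "yint c' h r s t \<equiv>
  Rs 1 (Complex (- c') r) (Rs (- 1) (Complex (- c) s) (vol (Complex (- c') r) (vol (Complex (- c) s) h) t))"

text \<open>The form in which the integrand y is estimated and integrated: the scalar kernel is in
  front, every resolvent of sqrt A has a factor \<open>U\<close> that makes it bounded, and the
  resolvents of B are contained in the vector x.\<close>

definition Yx :: "complex \<Rightarrow> complex \<Rightarrow> 'e \<Rightarrow> 'e" where
  "Yx z l x = (1 / (z\<^sup>2 - l\<^sup>2)) *\<^sub>C (Rs 1 z (U x) + Rs (- 1) l (U x))"

lemma Yx_diff: "z \<in> H \<Longrightarrow> l \<in> H \<Longrightarrow> Yx z l (x - y) = Yx z l x - Yx z l y"
  by (simp add: Yx_def U_simps bounded_complex_linearD(4)[OF Rs_bcl] scaleC.add_right scaleC.diff_right algebra_simps)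

text \<open>The resolvent identity of B contributes the factor 1/(l - z), and
  \<open>Rs_product\<close> the factor - 1/(z + l); together they form the kernel 1/(z^2 -
  l^2).\<close>

lemma Rs_Rs_vol_vol:
  assumes z: "z \<in> H" and l: "l \<in> H" and zl: "z \<noteq> l" and W: "L1 T W" and t: "t \<in> {0..T}"
  shows "Rs 1 z (Rs (- 1) l (vol z (vol l (\<lambda>t. U (W t))) t)) = Yx z l (vol z W t - vol l W t)"
proof -
  define y where "y = vol z (vol l (\<lambda>t. U (W t))) t"
  let ?x = "vol z W t - vol l W t"
  note UW = L1_linear[OF W bounded_complex_linearD(1)[OF U(1)]]
  have y: "U ?x = (l - z) *\<^sub>C y"
    unfolding y_def vol_resolvent[OF UW t, symmetric] by (simp add: vol_linear[OF W t U(1)] U_simps)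
  have s: "z + l \<noteq> 0"
  proof
    assume "z + l = 0"
    hence "Re z + Re l = 0" by (metis complex.sel(1) plus_complex.sel(1) zero_complex.sel(1))
    thus False using z l c by (simp add: H_def)
  qed
  have "(z + l) *\<^sub>C Rs 1 z (Rs (- 1) l (U ?x)) = - (Rs 1 z (U ?x) + Rs (- 1) l (U ?x))"
    by (rule Rs_product[OF l z]) simp
  hence "Rs 1 z (U ?x) + Rs (- 1) l (U ?x) = - ((z + l) *\<^sub>C Rs 1 z (Rs (- 1) l (U ?x)))" by simp
  also have "\<dots> = (- ((z + l) * (l - z))) *\<^sub>C Rs 1 z (Rs (- 1) l y)"
    unfolding y by (simp add: bounded_complex_linearD(2)[OF Rs_bcl] z l scaleC_scaleC scaleC.minus_left del: minus_mult_left)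
  also have "- ((z + l) * (l - z)) = z\<^sup>2 - l\<^sup>2" by (simp add: power2_eq_square algebra_simps)
  finally have "Yx z l ?x = (1 / (z\<^sup>2 - l\<^sup>2)) *\<^sub>C (z\<^sup>2 - l\<^sup>2) *\<^sub>C Rs 1 z (Rs (- 1) l y)" by (simp add: Yx_def)
  moreover have "z\<^sup>2 - l\<^sup>2 \<noteq> 0"
  proof -
    have "z\<^sup>2 - l\<^sup>2 = (z - l) * (z + l)" by (simp add: power2_eq_square algebra_simps)
    thus ?thesis using zl s by simp
  qed
  ultimately show ?thesis by (simp add: y_def scaleC_scaleC scaleC_one)
qed

lemma Yx_norm:
  obtains M where "M > 0" "\<And>z l x. z \<in> H \<Longrightarrow> l \<in> H \<Longrightarrow> norm (Yx z l x) \<le> 1 / cmod (z\<^sup>2 - l\<^sup>2) * (M * norm x)"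
    "\<And>\<sigma> l x. \<sigma> * \<sigma> = 1 \<Longrightarrow> l \<in> H \<Longrightarrow> norm (Rs \<sigma> l (U x)) \<le> M * norm x"
proof -
  obtain M where M: "M > 0" "\<And>\<sigma> l x. \<sigma> * \<sigma> = 1 \<Longrightarrow> l \<in> H \<Longrightarrow> norm (Rs \<sigma> l (U x)) \<le> M * norm x"
    using Rs_bounds by metis
  show ?thesis
  proof (rule that[of "2 * M"])
    fix z l x assume H: "z \<in> H" "l \<in> H"
    have "norm (Rs 1 z (U x) + Rs (- 1) l (U x)) \<le> M * norm x + M * norm x"
      by (intro norm_triangle_mono M(2) H) simp_all
    hence "norm (Rs 1 z (U x) + Rs (- 1) l (U x)) \<le> 2 * M * norm x" by simp
    thus "norm (Yx z l x) \<le> 1 / cmod (z\<^sup>2 - l\<^sup>2) * (2 * M * norm x)"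
      unfolding Yx_def norm_scaleC norm_divide norm_one by (rule mult_left_mono) simp
  next
    fix \<sigma> l :: complex and x :: 'e assume "\<sigma> * \<sigma> = 1" "l \<in> H"
    moreover have "0 \<le> M * norm x" using M(1) by simp
    ultimately show "norm (Rs \<sigma> l (U x)) \<le> 2 * M * norm x" using M(2)[of \<sigma> l x] by linarith
  qed (use M in simp)
qed

text \<open>Since c' > c > 0, both |z - l| and |z + l| are bounded below by multiples of 1 + |s - r|
  and 1 + |s + r|. The kernel alone is not integrable in both variables; the assumed decay of x
  supplies the missing factor for \<open>two_variable_bound\<close>.\<close>

lemma Yx_bound:
  assumes c': "c' > c" and B: "B \<ge> 0"
  obtains C where "\<And>r s x. norm x \<le> B * (1 / cmod (Complex (- c') r) + 1 / cmod (Complex (- c) s))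
    \<Longrightarrow> norm (Yx (Complex (- c') r) (Complex (- c) s) x) \<le> C * (kap (3/4) r * kap3 r s)"
proof -
  obtain M where M: "M > 0" "\<And>z l x. z \<in> H \<Longrightarrow> l \<in> H \<Longrightarrow> norm (Yx z l x) \<le> 1 / cmod (z\<^sup>2 - l\<^sup>2) * (M * norm x)"
    by (rule Yx_norm) blast
  define d1 d2 where "d1 = min (c' - c) 1 / 2" and "d2 = min (c' + c) 1 / 2"
  have d: "d1 > 0" "d2 > 0" using c' c by (auto simp: d1_def d2_def)
  define K where "K = 1 + 1 / c"
  have K: "K > 0" using c by (simp add: K_def add_pos_pos)
  show ?thesis
  proof (rule that[of "(1 / (d1 * d2)) * (M * (B * K)) * 3"])
    fix r s :: real and x :: 'e
    define z l where "z = Complex (- c') r" and "l = Complex (- c) s"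
    assume "norm x \<le> B * (1 / cmod (Complex (- c') r) + 1 / cmod (Complex (- c) s))"
    hence x: "norm x \<le> B * (1 / cmod z + 1 / cmod l)" by (simp add: z_def l_def)
    have H: "z \<in> H" "l \<in> H" using c' by (simp_all add: z_def l_def H_def)
    have iz: "1 / cmod z \<le> K * (1 / (1 + \<bar>r\<bar>))"
    proof -
      have "1 / cmod z \<le> K / (1 + cmod z)" unfolding K_def by (rule inverse_cmod_le[OF H(1)])
      also have "\<dots> \<le> K / (1 + \<bar>r\<bar>)" by (rule divide_left_mono) (use K abs_Im_le_cmod[of z] in \<open>auto simp: z_def intro!: mult_pos_pos add_pos_nonneg\<close>)
      finally show ?thesis by simp
    qed
    have il: "1 / cmod l \<le> K * (1 / (1 + \<bar>s\<bar>))"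
    proof -
      have "1 / cmod l \<le> K / (1 + cmod l)" unfolding K_def by (rule inverse_cmod_le[OF H(2)])
      also have "\<dots> \<le> K / (1 + \<bar>s\<bar>)" by (rule divide_left_mono) (use K abs_Im_le_cmod[of l] in \<open>auto simp: l_def intro!: mult_pos_pos add_pos_nonneg\<close>)
      finally show ?thesis by simp
    qed
    have nx: "norm x \<le> B * K * (1 / (1 + \<bar>r\<bar>) + 1 / (1 + \<bar>s\<bar>))"
    proof -
      have "B * (1 / cmod z + 1 / cmod l) \<le> B * (K * (1 / (1 + \<bar>r\<bar>)) + K * (1 / (1 + \<bar>s\<bar>)))"
        by (intro mult_left_mono add_mono iz il B)
      also have "\<dots> = B * K * (1 / (1 + \<bar>r\<bar>) + 1 / (1 + \<bar>s\<bar>))" by (simp only: distrib_left mult.assoc)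
      finally show ?thesis using x by linarith
    qed
    have g1: "d1 * (1 + \<bar>s - r\<bar>) \<le> cmod (l - z)"
      using cmod_ge_shifted[of "c' - c" "l - z"] c' by (simp add: d1_def z_def l_def)
    have g2: "d2 * (1 + \<bar>s + r\<bar>) \<le> cmod (l + z)"
      using cmod_ge_shifted[of "c' + c" "l + z"] c' c by (simp add: d2_def z_def l_def)
    define D where "D = (1 + \<bar>s - r\<bar>) * (1 + \<bar>s + r\<bar>)"
    have D: "D > 0" unfolding D_def by (intro mult_pos_pos) (auto intro: add_pos_nonneg)
    have "cmod (z\<^sup>2 - l\<^sup>2) = cmod (l - z) * cmod (l + z)"
      by (simp add: norm_mult[symmetric] power2_eq_square algebra_simps norm_minus_commute)
    also have "\<dots> \<ge> (d1 * (1 + \<bar>s - r\<bar>)) * (d2 * (1 + \<bar>s + r\<bar>))"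
      by (rule mult_mono[OF g1 g2]) (use d in \<open>auto intro!: mult_nonneg_nonneg\<close>)
    finally have ge: "(d1 * d2) * D \<le> cmod (z\<^sup>2 - l\<^sup>2)" by (simp add: D_def mult_ac)
    have dD: "0 < (d1 * d2) * D" using d D by simp
    have "1 / cmod (z\<^sup>2 - l\<^sup>2) \<le> 1 / ((d1 * d2) * D)"
      by (rule divide_left_mono[OF ge]) (use dD ge in \<open>auto intro!: mult_pos_pos\<close>)
    also have "\<dots> = (1 / (d1 * d2)) * (1 / D)" by simp
    finally have iD: "1 / cmod (z\<^sup>2 - l\<^sup>2) \<le> (1 / (d1 * d2)) * (1 / D)" .
    have "norm (Yx z l x) \<le> 1 / cmod (z\<^sup>2 - l\<^sup>2) * (M * norm x)" by (rule M(2)[OF H])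
    also have "\<dots> \<le> ((1 / (d1 * d2)) * (1 / D)) * (M * (B * K * (1 / (1 + \<bar>r\<bar>) + 1 / (1 + \<bar>s\<bar>))))"
      by (intro mult_mono mult_left_mono iD nx) (use M(1) dD d D in auto)
    also have "\<dots> = (1 / (d1 * d2)) * (M * (B * K)) * ((1 / (1 + \<bar>r\<bar>) + 1 / (1 + \<bar>s\<bar>)) * (1 / D))" by (simp only: mult_ac)
    also have "\<dots> \<le> (1 / (d1 * d2)) * (M * (B * K)) * (3 * (kap (3/4) r * kap3 r s))"
      unfolding D_def by (rule mult_left_mono[OF two_variable_bound]) (use d M B K in auto)
    finally show "norm (Yx (Complex (- c') r) (Complex (- c) s) x) \<le> (1 / (d1 * d2)) * (M * (B * K)) * 3 * (kap (3/4) r * kap3 r s)"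
      by (simp only: z_def l_def mult_ac)
  qed
qed

lemma Yx_continuous_on:
  assumes f: "continuous_on S f" "\<And>x. x \<in> S \<Longrightarrow> f x \<in> H" and g: "continuous_on S g" "\<And>x. x \<in> S \<Longrightarrow> g x \<in> H"
    and h: "continuous_on S h" and ne: "\<And>x. x \<in> S \<Longrightarrow> f x \<noteq> g x" "\<And>x. x \<in> S \<Longrightarrow> f x + g x \<noteq> 0"
  shows "continuous_on S (\<lambda>x. Yx (f x) (g x) (h x))"
proof -
  have "(f x)\<^sup>2 - (g x)\<^sup>2 \<noteq> 0" if "x \<in> S" for x
  proof -
    have "(f x)\<^sup>2 - (g x)\<^sup>2 = (f x - g x) * (f x + g x)" by (simp add: power2_eq_square algebra_simps)
    thus ?thesis using ne[OF that] by simp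
  qed
  thus ?thesis unfolding Yx_def
    by (intro continuous_on_scaleC continuous_on_divide continuous_on_const continuous_on_diff continuous_on_power
        continuous_on_add Rs_continuous_on U_continuous_on f g h) auto
qed

lemma lines_disjoint:
  assumes "c' > c" shows "Complex (- c') r \<noteq> Complex (- c) s" "Complex (- c') r + Complex (- c) s \<noteq> 0"
  using assms c by (auto simp: complex_eq_iff)

text \<open>Left of the line Re l = - c the only singularity of the kernel is l = z. Replacing
  \<open>Rs (- 1) l (U x)\<close> by its value y at l = z isolates it: the correction
  \<open>?F\<close> is regular there by the resolvent identity and integrates to 0. The rest is a
  scalar integral whose residue - 1/(2 z) gives the vector \<open>x'\<close>, which
  \<open>Rs_product_same\<close> identifies.\<close>

lemma integral_Yx_inner:
  assumes c': "c' > c"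
  shows "((\<lambda>s. Yx (Complex (- c') r) (Complex (- c) s) x) has_integral (2 * pi) *\<^sub>R R2 (Complex (- c') r) (U x)) UNIV"
proof -
  define z where "z = Complex (- c') r"
  have z: "z \<in> H" "Re z = - c'" using c' by (simp_all add: z_def H_def)
  obtain M where M: "M > 0" "\<And>\<sigma> l x. \<sigma> * \<sigma> = 1 \<Longrightarrow> l \<in> H \<Longrightarrow> norm (Rs \<sigma> l (U x)) \<le> M * norm x"
    using Rs_bounds by metis
  define y where "y = Rs (- 1) z (U x)"
  let ?F = "\<lambda>l. (1 / (l - (- z))) *\<^sub>C Rs (- 1) l y"
  have sum: "l + z \<noteq> 0" if "l \<in> H" for l
  proof
    assume "l + z = 0"
    hence "Re l + Re z = 0" by (metis plus_complex.sel(1) zero_complex.sel(1))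
    thus False using that z c c' by (simp add: H_def)
  qed
  have F: "?F l = - ((1 / (z\<^sup>2 - l\<^sup>2)) *\<^sub>C (Rs (- 1) l (U x) - y))" if l: "l \<in> H" "l \<noteq> z" for l
  proof -
    have "z\<^sup>2 - l\<^sup>2 = - ((l - z) * (l + z))" by (simp add: power2_eq_square algebra_simps)
    hence "1 / (z\<^sup>2 - l\<^sup>2) * (l - z) = - (1 / (l + z))" using l(2) sum[OF l(1)] by simp
    moreover have "Rs (- 1) l (U x) - y = (l - z) *\<^sub>C Rs (- 1) l y" unfolding y_def by (rule Rs_identity[OF l(1) z(1)]) simp
    ultimately show ?thesis by (simp only: scaleC_scaleC) (simp add: scaleC.minus_left)
  qed
  have q: "qd {l \<in> {l. Re l \<le> - c}. cmod l \<le> R} ?F" for R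
  proof (intro qd_scalar_resolvent qd_Rs[OF _ qd_const, where r=R])
    show "c + c' > 0" using c c' by simp
    fix l assume l: "l \<in> {l \<in> {l. Re l \<le> - c}. cmod l \<le> R}"
    show "l \<in> H" "cmod l \<le> R" using l by (auto simp: H_def)
    show "c + c' \<le> cmod (l - (- z))" using l z c c' abs_Re_le_cmod[of "l - (- z)"] by auto
  qed simp
  have d: "norm (?F l) \<le> (8 * (2 * M * norm x)) * (1 + cmod l) powr (- 1 - 1)" if l: "Re l \<le> - c" "2 * cmod z + 1 \<le> cmod l" for l
  proof -
    have "cmod z < cmod l" using l(2) norm_ge_zero[of z] by linarith
    hence lH: "l \<in> H" "l \<noteq> z" using l(1) by (auto simp: H_def)
    have "norm (Rs (- 1) l (U x) - y) \<le> M * norm x + M * norm x"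
      unfolding y_def by (rule order_trans[OF norm_triangle_ineq4 add_mono[OF M(2) M(2)]]) (simp_all add: lH z)
    hence "1 / cmod (z\<^sup>2 - l\<^sup>2) * norm (Rs (- 1) l (U x) - y) \<le> (8 * (1 + cmod l) powr (- 1 - 1)) * (2 * M * norm x)"
      by (intro mult_mono square_diff_bounds(2) l) simp_all
    thus ?thesis unfolding F[OF lH] norm_minus_cancel norm_scaleC norm_divide norm_one by (simp only: mult_ac)
  qed
  have F0: "(\<lambda>s. ?F (Complex (- c) s)) integrable_on UNIV" "integral UNIV (\<lambda>s. ?F (Complex (- c) s)) = 0"
    by (rule left_half_plane_integral_zero[OF q zero_less_one d]; assumption)+
  have 1: "((\<lambda>s. ?F (Complex (- c) s)) has_integral 0) UNIV"
    using integrable_integral[OF F0(1)] unfolding F0(2) .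
  define x' where "x' = (- (1 / (2 * z))) *\<^sub>C (Rs 1 z (U x) + y)"
  have z0: "z \<noteq> 0" using z c c' by auto
  have "((\<lambda>s. 1 / (Complex (- c) s - z) - 1 / (Complex (- c) s - (- z))) has_integral complex_of_real (2 * pi)) UNIV"
    by (rule scalar_line_integral) (use z c c' in auto)
  from has_integral_linear[OF this scaleC.bounded_linear_left[of x']]
  have 2: "((\<lambda>s. (1 / (Complex (- c) s - z) - 1 / (Complex (- c) s - (- z))) *\<^sub>C x') has_integral complex_of_real (2 * pi) *\<^sub>C x') UNIV"
    by (simp add: o_def)
  have x': "x' = R2 z (U x)"
  proof -
    have "(z + z) *\<^sub>C Rs 1 z (Rs (- 1) z (U x)) = - (Rs 1 z (U x) + y)" unfolding y_def by (rule Rs_product[OF z(1) z(1)]) simp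
    moreover have "Rs 1 z (Rs (- 1) z (U x)) = R2 z (U x)" by (rule Rs_product_same[OF z(1)]) simp
    ultimately have S: "Rs 1 z (U x) + y = - ((z + z) *\<^sub>C R2 z (U x))" by (metis minus_minus)
    have k: "- (1 / (2 * z)) * (z + z) = - 1" using z0 by simp
    show ?thesis unfolding x'_def S scaleC.minus_right scaleC_scaleC k by (simp add: scaleC.minus_left scaleC_one)
  qed
  have Y: "Yx z l x = (1 / (l - z) - 1 / (l - (- z))) *\<^sub>C x' - ?F l" if l: "l \<in> H" "l \<noteq> z" for l
  proof -
    have s: "z\<^sup>2 - l\<^sup>2 = - ((l - z) * (l + z))" by (simp add: power2_eq_square algebra_simps)
    have "(1 / (l - z) - 1 / (l - (- z))) * (- (1 / (2 * z))) = 1 / (z\<^sup>2 - l\<^sup>2)"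
      unfolding s using l(2) sum[OF l(1)] z0 by (simp add: divide_simps)
    hence "(1 / (l - z) - 1 / (l - (- z))) *\<^sub>C x' = (1 / (z\<^sup>2 - l\<^sup>2)) *\<^sub>C (Rs 1 z (U x) + y)"
      by (simp only: x'_def scaleC_scaleC)
    thus ?thesis unfolding F[OF l] Yx_def by (simp add: scaleC.add_right scaleC.diff_right)
  qed
  have "((\<lambda>s. (1 / (Complex (- c) s - z) - 1 / (Complex (- c) s - (- z))) *\<^sub>C x' - ?F (Complex (- c) s))
      has_integral complex_of_real (2 * pi) *\<^sub>C x' - 0) UNIV"
    by (rule has_integral_diff[OF 2 1])
  moreover have "(1 / (Complex (- c) s - z) - 1 / (Complex (- c) s - (- z))) *\<^sub>C x' - ?F (Complex (- c) s) = Yx z (Complex (- c) s) x" for s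
    using lines_disjoint(1)[OF c', of r s] by (intro Y[symmetric]) (auto simp: z_def H_def)
  ultimately have "((\<lambda>s. Yx z (Complex (- c) s) x) has_integral complex_of_real (2 * pi) *\<^sub>C x') UNIV" by simp
  thus ?thesis unfolding x' z_def[symmetric] by (simp only: scaleC_of_real)
qed

text \<open>As a function of z the kernel has its poles at l and - l, both to the right of Re z = -
  c' because c' > c. Closing to the left gives 0.\<close>

lemma integral_Yx_outer:
  assumes c': "c' > c"
  shows "integral UNIV (\<lambda>r. Yx (Complex (- c') r) (Complex (- c) s) y) = 0"
proof -
  define l where "l = Complex (- c) s"
  have l: "l \<in> H" "Re l = - c" by (simp_all add: l_def H_def)
  obtain M where M: "M > 0" "\<And>z l x. z \<in> H \<Longrightarrow> l \<in> H \<Longrightarrow> norm (Yx z l x) \<le> 1 / cmod (z\<^sup>2 - l\<^sup>2) * (M * norm x)"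
    by (rule Yx_norm) blast
  have q: "qd {z \<in> {z. Re z \<le> - c'}. cmod z \<le> R} (\<lambda>z. Yx z l y)" for R
  proof (rule qd_cong)
    show "qd {z \<in> {z. Re z \<le> - c'}. cmod z \<le> R} (\<lambda>z. (1 / (z - l)) *\<^sub>C ((1 / (z - (- l))) *\<^sub>C (Rs 1 z (U y) + Rs (- 1) l (U y))))"
    proof (intro qd_scalar_resolvent[where d="c' - c"] qd_add qd_const qd_Rs[OF _ qd_const, where r=R])
      fix z assume z: "z \<in> {z \<in> {z. Re z \<le> - c'}. cmod z \<le> R}"
      show "z \<in> H" "cmod z \<le> R" using z c' by (auto simp: H_def)
      show "c' - c \<le> cmod (z - l)" "c' - c \<le> cmod (z - (- l))"
        using z l c c' abs_Re_le_cmod[of "z - l"] abs_Re_le_cmod[of "z - (- l)"] by auto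
    qed (use c' in auto)
    fix z
    have "z\<^sup>2 - l\<^sup>2 = (z - l) * (z - (- l))" by (simp add: power2_eq_square algebra_simps)
    thus "Yx z l y = (1 / (z - l)) *\<^sub>C ((1 / (z - (- l))) *\<^sub>C (Rs 1 z (U y) + Rs (- 1) l (U y)))"
      by (simp add: Yx_def scaleC_scaleC)
  qed
  have d: "norm (Yx z l y) \<le> (8 * (M * norm y)) * (1 + cmod z) powr (- 1 - 1)" if z: "Re z \<le> - c'" "2 * cmod l + 1 \<le> cmod z" for z
  proof -
    have "z \<in> H" using z c' by (simp add: H_def)
    hence "norm (Yx z l y) \<le> 1 / cmod (z\<^sup>2 - l\<^sup>2) * (M * norm y)" by (rule M(2)[OF _ l(1)])
    also have "\<dots> \<le> (8 * (1 + cmod z) powr (- 1 - 1)) * (M * norm y)"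
      by (rule mult_right_mono[OF square_diff_bounds(1)[OF z(2)]]) (use M in simp)
    finally show ?thesis by (simp only: mult_ac)
  qed
  from left_half_plane_integral_zero(2)[OF q zero_less_one d] show ?thesis by (simp add: l_def)
qed

text \<open>One power of 1/|l| comes from the factor \<open>U\<close> under the resolvent of A, the
  other from the derivative in time. So the single integral in (II) converges absolutely.\<close>

lemma R2_vol_bound:
  assumes v: "L1 T v" and a: "a \<ge> 0"
  obtains C where "C \<ge> 0" "\<And>l t. l \<in> H \<Longrightarrow> - a \<le> Re l \<Longrightarrow> t \<in> {0..T} \<Longrightarrow>
    norm (R2 l (vol l (\<lambda>t. U (prim v t)) t)) \<le> C * (1 + cmod l) powr (- 1 - 1)"
proof -
  note W = L1_continuous[OF prim_continuous[OF v]]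
  obtain B where B: "B \<ge> 0" "\<And>l t. - a \<le> Re l \<Longrightarrow> l \<noteq> 0 \<Longrightarrow> t \<in> {0..T} \<Longrightarrow> norm (vol l (prim v) t) \<le> B * (1 / cmod l)"
    using vol_prim_bound[OF v a] by blast
  obtain M where M: "M > 0" "\<And>l x. l \<in> H \<Longrightarrow> cmod l * norm (R2 l (U x)) \<le> M * norm x"
    using resolvent_bounds by metis
  show ?thesis
  proof (rule that[of "M * B * (1 + 1 / c)\<^sup>2"])
    fix l t assume l: "l \<in> H" "- a \<le> Re l" and t: "t \<in> {0..T}"
    have lc: "c \<le> cmod l" using l(1) abs_Re_le_cmod[of l] by (auto simp: H_def)
    hence l0: "cmod l > 0" "l \<noteq> 0" using c by auto
    have "cmod l * norm (R2 l (U (vol l (prim v) t))) \<le> M * (B * (1 / cmod l))"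
      by (rule order_trans[OF M(2)[OF l(1)] mult_left_mono[OF B(2)[OF l(2) l0(2) t]]]) (use M in simp)
    hence "norm (R2 l (U (vol l (prim v) t))) \<le> M * B * (1 / (cmod l)\<^sup>2)"
      using l0(1) by (simp add: field_simps power2_eq_square)
    also have "\<dots> \<le> M * B * ((1 + 1 / c)\<^sup>2 * (1 + cmod l) powr (- 1 - 1))"
      by (intro mult_left_mono inverse_cmod_square_bound c lc) (use M B in simp)
    finally show "norm (R2 l (vol l (\<lambda>t. U (prim v t)) t)) \<le> M * B * (1 + 1 / c)\<^sup>2 * (1 + cmod l) powr (- 1 - 1)"
      by (simp only: vol_linear[OF W t U(1)] mult_ac)
  qed (use M B in simp)
qed

lemma R2_vol_continuous:
  assumes u: "L1 T u" and a: "a \<le> - c"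
  shows "continuous_on (UNIV \<times> {0..T}) (\<lambda>(s, t). R2 (Complex a s) (vol (Complex a s) u t))"
  unfolding split_def
  by (intro R2_continuous_on vol_continuous_on[OF u] continuous_on_Complex continuous_on_const continuous_on_snd continuous_on_fst continuous_on_id)
    (auto simp: Complex_in_H a)

text \<open>Split the vector into its part with (B + z)^(-1) and its part with (B + l)^(-1). The
  first is constant in the inner variable l and is evaluated by \<open>integral_Yx_inner\<close>;
  the second is constant in z and vanishes once the order of integration is exchanged.\<close>

lemma Yx_main:
  assumes c': "c' > c" and v: "L1 T v"
  defines "W \<equiv> prim v"
  defines "F \<equiv> \<lambda>r s t. Yx (Complex (- c') r) (Complex (- c) s) (vol (Complex (- c') r) W t - vol (Complex (- c) s) W t)"
  obtains C where "\<And>r s t. t \<in> {0..T} \<Longrightarrow> norm (F r s t) \<le> C * (kap (3/4) r * kap3 r s)"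
    "continuous_on ((UNIV \<times> {0..T}) \<times> UNIV) (\<lambda>((r, t), s). F r s t)"
    "\<And>t. t \<in> {0..T} \<Longrightarrow> integral UNIV (\<lambda>r. integral UNIV (\<lambda>s. F r s t))
       = (2 * pi) *\<^sub>R integral UNIV (\<lambda>s. R2 (Complex (- c) s) (vol (Complex (- c) s) (\<lambda>t. U (W t)) t))"
proof -
  note Wc = prim_continuous[OF v, folded W_def]
  note W1 = L1_continuous[OF Wc]
  have c0: "0 \<le> c'" using c' c by simp
  obtain B where B: "B \<ge> 0" "\<And>l t. - c' \<le> Re l \<Longrightarrow> l \<noteq> 0 \<Longrightarrow> t \<in> {0..T} \<Longrightarrow> norm (vol l W t) \<le> B * (1 / cmod l)"
    using vol_prim_bound[OF v c0] unfolding W_def by blast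
  obtain C where C: "\<And>r s x. norm x \<le> B * (1 / cmod (Complex (- c') r) + 1 / cmod (Complex (- c) s))
    \<Longrightarrow> norm (Yx (Complex (- c') r) (Complex (- c) s) x) \<le> C * (kap (3/4) r * kap3 r s)"
    by (rule Yx_bound[OF c' B(1)]) blast
  have H: "Complex (- c') r \<in> H" "Complex (- c) r \<in> H" for r using c' by (simp_all add: H_def)
  have n0: "Complex (- c') r \<noteq> 0" "Complex (- c) r \<noteq> 0" for r using c' c by (auto simp: complex_eq_iff)
  have Bz: "norm (vol (Complex (- c') r) W t) \<le> B * (1 / cmod (Complex (- c') r))"
    and Bl: "norm (vol (Complex (- c) s) W t) \<le> B * (1 / cmod (Complex (- c) s))" if "t \<in> {0..T}" for r s t
    by (rule B(2)[OF _ n0(1) that], simp) (rule B(2)[OF _ n0(2) that], use c' in simp)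
  have pB: "0 \<le> B * (1 / cmod w)" for w using B(1) by simp
  show ?thesis
  proof (rule that[of C])
    show "norm (F r s t) \<le> C * (kap (3/4) r * kap3 r s)" if "t \<in> {0..T}" for r s t
      unfolding F_def by (rule C, rule order_trans[OF norm_triangle_ineq4])
        (use Bz[OF that, of r] Bl[OF that, of s] in \<open>simp only: distrib_left\<close>)
    show "continuous_on ((UNIV \<times> {0..T}) \<times> UNIV) (\<lambda>((r, t), s). F r s t)"
      unfolding F_def split_def
      by (intro Yx_continuous_on continuous_on_diff vol_continuous_on[OF W1] continuous_on_Complex continuous_on_const
          continuous_on_snd continuous_on_fst continuous_on_id)
        (auto simp: H lines_disjoint[OF c'] simp del: complex.inject)
    fix t assume t: "t \<in> {0..T}"
    let ?u = "\<lambda>t. U (W t)"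
    let ?S = "\<lambda>z. R2 z (vol z ?u t)"
    \<comment> \<open>The decay of the vector in l alone suffices for the two variable majorant, so
      both parts of the split are integrable separately.\<close>
    define \<Phi> where "\<Phi> s r = Yx (Complex (- c') r) (Complex (- c) s) (vol (Complex (- c) s) W t)" for s r
    have \<Phi>b: "norm (\<Phi> s r) \<le> C * (kap (3/4) r * kap3 r s)" for s r
      unfolding \<Phi>_def by (rule C) (use Bl[OF t, of s] pB[of "Complex (- c') r"] in \<open>simp only: distrib_left\<close>)
    have \<Phi>c: "continuous_on (UNIV \<times> UNIV) (\<lambda>(s, r). \<Phi> s r)"
      unfolding \<Phi>_def split_def
      by (intro Yx_continuous_on continuous_on_diff vol_continuous_on[OF W1] continuous_on_Complex continuous_on_const
          continuous_on_snd continuous_on_fst continuous_on_id)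
        (use t in \<open>auto simp: H lines_disjoint[OF c'] simp del: complex.inject\<close>)
    have \<Phi>0: "integral UNIV (\<Phi> s) = 0" for s
      unfolding \<Phi>_def by (rule integral_Yx_outer[OF c'])
    note \<Phi>i = iterated_integral_zero[OF \<Phi>c \<Phi>b \<Phi>0]
    have \<Phi>s: "(\<lambda>s. \<Phi> s r) integrable_on UNIV" for r
      using integral_kap3_dominated(2)[OF continuous_on_swap_pair[OF \<Phi>c], of "\<lambda>r. r", OF order_refl \<Phi>b] by simp
    have inner: "integral UNIV (\<lambda>s. F r s t) = (2 * pi) *\<^sub>R ?S (Complex (- c') r) - integral UNIV (\<lambda>s. \<Phi> s r)" for r
    proof -
      have "(\<lambda>s. F r s t) = (\<lambda>s. Yx (Complex (- c') r) (Complex (- c) s) (vol (Complex (- c') r) W t) - \<Phi> s r)"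
        unfolding F_def \<Phi>_def by (simp add: Yx_diff H)
      thus ?thesis
        using integral_unique[OF has_integral_diff[OF integral_Yx_inner[OF c', of r "vol (Complex (- c') r) W t"] integrable_integral[OF \<Phi>s]]]
        by (simp only: vol_linear[OF W1 t U(1)])
    qed
    obtain D where D: "D \<ge> 0" "\<And>l t. l \<in> H \<Longrightarrow> - c' \<le> Re l \<Longrightarrow> t \<in> {0..T} \<Longrightarrow> norm (R2 l (vol l ?u t)) \<le> D * (1 + cmod l) powr (- 1 - 1)"
      using R2_vol_bound[OF v c0] unfolding W_def by blast
    have uc: "L1 T ?u" by (rule L1_linear[OF W1 bounded_complex_linearD(1)[OF U(1)]])
    have Si: "(\<lambda>r. ?S (Complex (- c') r)) integrable_on UNIV"
    proof (rule line_integrable[OF _ zero_less_one])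
      show "continuous_on UNIV (\<lambda>r. ?S (Complex (- c') r))"
        by (intro R2_continuous_on vol_continuous_on[OF uc] continuous_on_Complex continuous_on_const continuous_on_id) (use t H in auto)
      fix r
      have "norm (?S (Complex (- c') r)) \<le> D * (1 + cmod (Complex (- c') r)) powr (- 1 - 1)" by (rule D(2)[OF H(1) _ t]) simp
      also have "\<dots> \<le> D * kap 1 r"
        using one_plus_cmod_powr_le_kap[of 1 "Complex (- c') r"] by (intro mult_left_mono D) simp
      finally show "norm (?S (Complex (- c') r)) \<le> D * kap 1 r" .
    qed
    \<comment> \<open>The evaluated integral runs over Re z = - c', but (II) has Re z = - c. Between
      the lines the integrand is regular and decays.\<close>
    have shift: "integral UNIV (\<lambda>r. ?S (Complex (- c') r)) = integral UNIV (\<lambda>r. ?S (Complex (- c) r))"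
    proof (rule strip_shift[OF _ _ zero_less_one])
      show "- c' \<le> - c" using c' by simp
      show "qd {z \<in> {z. - c' \<le> Re z \<and> Re z \<le> - c}. cmod z \<le> R} ?S" for R
      proof (rule qd_cong)
        show "qd {z \<in> {z. - c' \<le> Re z \<and> Re z \<le> - c}. cmod z \<le> R} (\<lambda>z. Rs 1 z (Rs (- 1) z (vol z ?u t)))"
          by (intro qd_Rs[where r=R] qd_vol[OF uc t, where r=R]) (auto simp: H_def)
        fix z assume "z \<in> {z \<in> {z. - c' \<le> Re z \<and> Re z \<le> - c}. cmod z \<le> R}"
        thus "?S z = Rs 1 z (Rs (- 1) z (vol z ?u t))" by (intro Rs_product_same[symmetric]) (auto simp: H_def)
      qed
      fix z assume "- c' \<le> Re z" "Re z \<le> - c" "0 \<le> cmod z"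
      thus "norm (?S z) \<le> D * (1 + cmod z) powr (- 1 - 1)" by (intro D(2) t) (auto simp: H_def)
    qed
    have "integral UNIV (\<lambda>r. integral UNIV (\<lambda>s. F r s t)) = integral UNIV (\<lambda>r. (2 * pi) *\<^sub>R ?S (Complex (- c') r)) - 0"
      unfolding inner using integral_diff[OF integrable_cmul[OF Si, of "2 * pi"] \<Phi>i(1)] \<Phi>i(2) by simp
    also have "\<dots> = (2 * pi) *\<^sub>R integral UNIV (\<lambda>r. ?S (Complex (- c) r))" by (simp add: shift)
    finally show "integral UNIV (\<lambda>r. integral UNIV (\<lambda>s. F r s t)) = (2 * pi) *\<^sub>R integral UNIV (\<lambda>s. ?S (Complex (- c) s))" .
  qed
qed

text \<open>Assembles the L^p valued iterated integral from continuous representatives. The minus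
  sign is the product of the two factors \<i> from the parametrizations a + \<i> s and b + \<i>
  r.\<close>

lemma iterated_line_integral:
  fixes F :: "real \<Rightarrow> real \<Rightarrow> real \<Rightarrow> 'e"
  assumes c1: "\<And>r. continuous_on (UNIV \<times> {0..T}) (\<lambda>(s, t). F r s t)"
    and b1: "\<And>r. \<exists>h. h integrable_on UNIV \<and> (\<forall>s. \<forall>t\<in>{0..T}. norm (F r s t) \<le> h s)"
    and c2: "continuous_on (UNIV \<times> {0..T}) (\<lambda>(r, t). integral UNIV (\<lambda>s. F r s t))"
    and b2: "\<And>r t. t \<in> {0..T} \<Longrightarrow> norm (integral UNIV (\<lambda>s. F r s t)) \<le> h r" and h: "h integrable_on UNIV"
    and X: "\<And>r s. AE t in interval T. X (Complex a s) (Complex b r) t = F r s t"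
  obtains J where "Lp_iterated_line_integral p T a b X J"
    "\<And>t. t \<in> {0..T} \<Longrightarrow> J t = - integral UNIV (\<lambda>r. integral UNIV (\<lambda>s. F r s t))"
proof -
  define G where "G z = (\<lambda>t. \<i> *\<^sub>C integral UNIV (\<lambda>s. F (Im z) s (clampT T t)))" for z
  define J where "J t = \<i> *\<^sub>C integral UNIV (\<lambda>r. \<i> *\<^sub>C integral UNIV (\<lambda>s. F r s (clampT T t)))" for t
  have cl: "clampT T t = t" if "t \<in> {0..T}" for t using that by (simp add: clampT_def)
  have inner: "Lp_line_integral p T a (\<lambda>l. X l z) (G z)" if "Re z = b" for z
  proof -
    have z: "Complex b (Im z) = z" using that by (simp add: complex_eq_iff)
    obtain h where "h integrable_on UNIV" "\<And>s t. t \<in> {0..T} \<Longrightarrow> norm (F (Im z) s t) \<le> h s" using b1 by blast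
    from Lp_line_integral_continuous[OF T p c1 this(2,1) X[where r="Im z", unfolded z]] show ?thesis by (simp add: G_def)
  qed
  have outer: "Lp_line_integral p T b G (\<lambda>t. \<i> *\<^sub>C integral UNIV (\<lambda>r. (\<lambda>r t. \<i> *\<^sub>C integral UNIV (\<lambda>s. F r s t)) r (clampT T t)))"
  proof (rule Lp_line_integral_continuous[OF T p _ _ h])
    have "continuous_on (UNIV \<times> {0..T}) (\<lambda>x. \<i> *\<^sub>C (\<lambda>(r, t). integral UNIV (\<lambda>s. F r s t)) x)"
      by (intro continuous_on_scaleC continuous_on_const c2)
    thus "continuous_on (UNIV \<times> {0..T}) (\<lambda>(r, t). \<i> *\<^sub>C integral UNIV (\<lambda>s. F r s t))" by (simp add: split_def)
    show "norm (\<i> *\<^sub>C integral UNIV (\<lambda>s. F r s t)) \<le> h r" if "t \<in> {0..T}" for r t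
      using b2[OF that, of r] by (simp add: norm_scaleC)
    show "AE t in interval T. G (Complex b r) t = \<i> *\<^sub>C integral UNIV (\<lambda>s. F r s t)" for r
      using AE_space by eventually_elim (simp add: G_def cl)
  qed
  show ?thesis
  proof (rule that[of J])
    show "Lp_iterated_line_integral p T a b X J"
      unfolding has_iterated_line_integral_def using inner outer by (auto simp: J_def[abs_def])
    fix t assume t: "t \<in> {0..T}"
    have i: "(\<lambda>r. integral UNIV (\<lambda>s. F r s t)) integrable_on UNIV"
    by (rule continuous_dominated_integrable[OF continuous_on_section1[OF c2 t] b2[OF t] h])
    have "J t = \<i> *\<^sub>C \<i> *\<^sub>C integral UNIV (\<lambda>r. integral UNIV (\<lambda>s. F r s t))"
      unfolding J_def cl[OF t] integral_scaleC_right[OF i] ..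
    thus "J t = - integral UNIV (\<lambda>r. integral UNIV (\<lambda>s. F r s t))" by (simp add: scaleC_scaleC scaleC.minus_left scaleC_one)
  qed
qed

text \<open>The last clause expresses \<open>J\<close> at every t through the integrand only. It is
  kept for uniqueness, where the iterated integrals of (I) and (II) for the same data are
  compared.\<close>

lemma iterated_II:
  assumes c': "c' > c" and v: "L1 T v"
    and X: "\<And>z l. z \<in> H \<Longrightarrow> l \<in> H \<Longrightarrow> AE t in interval T. X l z t = Rs 1 z (Rs (- 1) l (vol z (vol l (\<lambda>t. U (prim v t))) t))"
  obtains J where "Lp_iterated_line_integral p T (- c) (- c') X J"
    "\<And>t. t \<in> {0..T} \<Longrightarrow> J t = - ((2 * pi) *\<^sub>R integral UNIV (\<lambda>s. xint v s t))"
    "\<And>t. t \<in> {0..T} \<Longrightarrow> J t = - integral UNIV (\<lambda>r. integral UNIV (\<lambda>s.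
       yint c' (\<lambda>t. U (prim v t)) r s t))"
proof -
  note W1 = L1_continuous[OF prim_continuous[OF v]]
  define F where "F r s t = Yx (Complex (- c') r) (Complex (- c) s) (vol (Complex (- c') r) (prim v) t - vol (Complex (- c) s) (prim v) t)" for r s t
  obtain C where C: "\<And>r s t. t \<in> {0..T} \<Longrightarrow> norm (F r s t) \<le> C * (kap (3/4) r * kap3 r s)"
    "continuous_on ((UNIV \<times> {0..T}) \<times> UNIV) (\<lambda>((r, t), s). F r s t)"
    "\<And>t. t \<in> {0..T} \<Longrightarrow> integral UNIV (\<lambda>r. integral UNIV (\<lambda>s. F r s t))
       = (2 * pi) *\<^sub>R integral UNIV (\<lambda>s. xint v s t)"
    unfolding F_def by (rule Yx_main[OF c' v]) blast
  have H: "Complex (- c') r \<in> H" "Complex (- c) r \<in> H" for r using c' by (simp_all add: H_def)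
  \<comment> \<open>The pair (r,t) is treated as one parameter, so that continuity of the inner
    integral in r and t jointly comes out at once.\<close>
  define F' where "F' q s = (case q of (r, t) \<Rightarrow> F r s t)" for q :: "real \<times> real" and s
  have cF': "continuous_on ((UNIV \<times> {0..T}) \<times> UNIV) (\<lambda>(q, s). F' q s)"
    using C(2) by (simp add: F'_def split_def)
  have bF': "norm (F' q s) \<le> C * (kap (3/4) (fst q) * kap3 (fst q) s)" if "q \<in> UNIV \<times> {0..T}" for q s
    using that C(1)[of "snd q" "fst q" s] by (auto simp: F'_def split_def)
  note G = integral_kap3_dominated[OF cF' dist_fst_le bF']
  show ?thesis
  proof (rule iterated_line_integral[of F])
    show "continuous_on (UNIV \<times> {0..T}) (\<lambda>(s, t). F r s t)" for r
    proof -
      have "continuous_on (UNIV \<times> {0..T}) (\<lambda>x. (\<lambda>((r, t), s). F r s t) ((r, snd x), fst x))"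
        by (rule continuous_on_compose2[OF C(2)]) (auto intro!: continuous_intros)
      thus ?thesis by (simp add: split_def)
    qed
    show "\<exists>h. h integrable_on UNIV \<and> (\<forall>s. \<forall>t\<in>{0..T}. norm (F r s t) \<le> h s)" for r
    proof (intro exI conjI allI ballI)
      show "(\<lambda>s. (C * kap (3/4) r) * kap3 r s) integrable_on UNIV"
        by (rule integrable_on_mult_right) (use kap3_integral in blast)
      show "norm (F r s t) \<le> (C * kap (3/4) r) * kap3 r s" if "t \<in> {0..T}" for s t
        using C(1)[OF that] by (simp add: mult.assoc)
    qed
    show "continuous_on (UNIV \<times> {0..T}) (\<lambda>(r, t). integral UNIV (\<lambda>s. F r s t))"
      using G(1) by (simp add: F'_def[abs_def] split_def)
    show "norm (integral UNIV (\<lambda>s. F r s t)) \<le> (\<bar>C\<bar> * (3 * integral UNIV (kap (1/4)))) * kap (3/4) r" if "t \<in> {0..T}" for r t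
      using G(3)[of "(r, t)"] that by (simp add: F'_def[abs_def])
    show "(\<lambda>r. (\<bar>C\<bar> * (3 * integral UNIV (kap (1/4)))) * kap (3/4) r) integrable_on UNIV"
      by (rule integrable_on_mult_right[OF kap_integrable]) simp
    show "AE t in interval T. X (Complex (- c) s) (Complex (- c') r) t = F r s t" for r s
      using X[OF H(1)[of r] H(2)[of s]] AE_space
    proof eventually_elim
      case (elim t)
      hence "t \<in> {0..T}" by simp
      from Rs_Rs_vol_vol[OF H lines_disjoint(1)[OF c'] W1 this] elim(1) show ?case by (simp add: F_def)
    qed
  next
    fix J assume "Lp_iterated_line_integral p T (- c) (- c') X J"
      "\<And>t. t \<in> {0..T} \<Longrightarrow> J t = - integral UNIV (\<lambda>r. integral UNIV (\<lambda>s. F r s t))"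
    moreover have "F r s t = yint c' (\<lambda>t. U (prim v t)) r s t"
      if "t \<in> {0..T}" for r s t
      unfolding F_def by (rule Rs_Rs_vol_vol[OF H lines_disjoint(1)[OF c'] W1 that, symmetric])
    ultimately show thesis using that C(3) by simp
  qed
qed

text \<open>Two applications of \<open>E_main\<close>: in the inner variable with sign -1 on the
  line - c for data that depend on z, and in the outer variable with sign 1 on the line - c'. Each
  contributes 2 pi.\<close>

lemma iterated_I:
  assumes c': "c' > c" and v: "reg v"
    and X: "\<And>z l. z \<in> H \<Longrightarrow> l \<in> H \<Longrightarrow> AE t in interval T. X l z t = E (- 1) l (E 1 z (\<lambda>t. U (prim (prim v) t))) t"
  obtains J where "Lp_iterated_line_integral p T (- c) (- c') X J"
    "\<And>t. t \<in> {0..T} \<Longrightarrow> J t = - ((4 * pi\<^sup>2) *\<^sub>R U (prim (prim v) t))"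
    "\<And>t. t \<in> {0..T} \<Longrightarrow> J t = - integral UNIV (\<lambda>r. integral UNIV (\<lambda>s.
       E (- 1) (Complex (- c) s) (E 1 (Complex (- c') r) (\<lambda>t. U (prim (prim v) t))) t))"
proof -
  define u where "u t = U (prim (prim v) t)" for t
  have v1: "L1 T v" using v by (simp add: reg_def)
  have uc: "continuous_on {0..T} u" unfolding u_def
    by (intro U_continuous_on prim_continuous L1_continuous v1)
  have c'': "- c' \<le> - c" using c' by simp
  have H: "Complex (- c') r \<in> H" "Complex (- c) r \<in> H" for r using c' by (simp_all add: H_def)
  define F where "F r s t = E (- 1) (Complex (- c) s) (E 1 (Complex (- c') r) u) t" for r s t
  \<comment> \<open>For fixed z the inner integral is a first order problem with data A^(-1/2)
    B^(-2) w.\<close>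
  define w where "w r = E 1 (Complex (- c') r) v" for r
  have w: "reg (w r)" "\<And>t. t \<in> {0..T} \<Longrightarrow> U (prim (prim (w r)) t) = E 1 (Complex (- c') r) u t" for r
    unfolding w_def u_def[abs_def] by (rule E_reg[OF v H(1)])+
  have Fw: "F r s t = E (- 1) (Complex (- c) s) (\<lambda>t. U (prim (prim (w r)) t)) t" if "t \<in> {0..T}" for r s t
    unfolding F_def by (rule E_cong[OF that]) (simp add: w(2))
  have m1: "(- 1) * (- 1) = (1 :: complex)" by simp
  have in1: "\<exists>h. h integrable_on UNIV \<and> (\<forall>s. \<forall>t\<in>{0..T}. norm (F r s t) \<le> h s)"
    and in2: "\<And>t. t \<in> {0..T} \<Longrightarrow> integral UNIV (\<lambda>s. F r s t) = (2 * pi) *\<^sub>R E 1 (Complex (- c') r) u t" for r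
  proof -
    obtain C e where e: "e > 0" "\<And>s t. t \<in> {0..T} \<Longrightarrow> norm (E (- 1) (Complex (- c) s) (\<lambda>t. U (prim (prim (w r)) t)) t) \<le> C * kap e s"
      "\<And>t. t \<in> {0..T} \<Longrightarrow> integral UNIV (\<lambda>s. E (- 1) (Complex (- c) s) (\<lambda>t. U (prim (prim (w r)) t)) t) = (2 * pi) *\<^sub>R U (prim (prim (w r)) t)"
      by (rule E_main[OF m1 order_refl w(1)]) blast
    show "\<exists>h. h integrable_on UNIV \<and> (\<forall>s. \<forall>t\<in>{0..T}. norm (F r s t) \<le> h s)"
      using e(2) Fw integrable_on_mult_right[OF kap_integrable[OF e(1)], of C] by (intro exI[of _ "\<lambda>s. C * kap e s"]) simp
    show "integral UNIV (\<lambda>s. F r s t) = (2 * pi) *\<^sub>R E 1 (Complex (- c') r) u t" if "t \<in> {0..T}" for t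
      using e(3)[OF that] by (simp add: Fw[OF that] w(2)[OF that])
  qed
  obtain C e where e: "e > 0" "\<And>s t. t \<in> {0..T} \<Longrightarrow> norm (E 1 (Complex (- c') s) u t) \<le> C * kap e s"
    "\<And>t. t \<in> {0..T} \<Longrightarrow> integral UNIV (\<lambda>s. E 1 (Complex (- c') s) u t) = (2 * pi) *\<^sub>R u t"
    unfolding u_def by (rule E_main[of 1, OF _ c'' v]) (simp, blast)
  show ?thesis
  proof (rule iterated_line_integral[of F])
    show "continuous_on (UNIV \<times> {0..T}) (\<lambda>(s, t). F r s t)" for r
    proof -
      have "continuous_on (UNIV \<times> {0..T}) (\<lambda>(s, t). E (- 1) (Complex (- c) s) (\<lambda>t. U (prim (prim (w r)) t)) t)"
        using w(1)[of r] by (intro E_continuous U_continuous_on) (auto simp: reg_def intro: prim_continuous L1_continuous)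
      thus ?thesis by (rule continuous_on_eq) (auto simp: Fw)
    qed
    show "continuous_on (UNIV \<times> {0..T}) (\<lambda>(r, t). integral UNIV (\<lambda>s. F r s t))"
    proof (rule continuous_on_eq)
      show "continuous_on (UNIV \<times> {0..T}) (\<lambda>x. (2 * pi) *\<^sub>R (\<lambda>(r, t). E 1 (Complex (- c') r) u t) x)"
        by (intro continuous_on_scaleR continuous_on_const E_continuous uc c'') simp
    qed (auto simp: in2)
    show "norm (integral UNIV (\<lambda>s. F r s t)) \<le> (2 * pi * C) * kap e r" if "t \<in> {0..T}" for r t
      using mult_left_mono[OF e(2)[OF that, of r], of "2 * pi"] by (simp add: in2[OF that] mult.assoc)
    show "(\<lambda>r. (2 * pi * C) * kap e r) integrable_on UNIV" by (rule integrable_on_mult_right[OF kap_integrable[OF e(1)]])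
    show "AE t in interval T. X (Complex (- c) s) (Complex (- c') r) t = F r s t" for r s
      using X[OF H(1)[of r] H(2)[of s]] by (simp add: F_def u_def[abs_def])
  next
    fix J assume J: "Lp_iterated_line_integral p T (- c) (- c') X J"
      "\<And>t. t \<in> {0..T} \<Longrightarrow> J t = - integral UNIV (\<lambda>r. integral UNIV (\<lambda>s. F r s t))"
    have "J t = - ((4 * pi\<^sup>2) *\<^sub>R u t)" if "t \<in> {0..T}" for t
      using J(2)[OF that] e(3)[OF that] by (simp add: in2[OF that] power2_eq_square)
    thus thesis using that J by (simp add: u_def[abs_def] F_def)
  qed (rule in1)
qed

end

section \<open>The Cauchy problem\<close>

lemma AE_interval_Icc:
  assumes "AE x in interval T. P x" "t \<in> {0..T}" shows "AE x in lebesgue_on {0..t}. P x"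
proof -
  obtain N where N: "negligible N" "\<And>x. x \<in> {0..T} - N \<Longrightarrow> P x" by (rule AE_interval_negligible[OF assms(1)]) blast
  have "AE x in lebesgue. x \<in> {0..t} \<longrightarrow> P x"
  proof (rule AE_I'[of N])
    show "N \<in> null_sets lebesgue" using N(1) by (simp add: negligible_iff_null_sets)
    show "{x \<in> space lebesgue. \<not> (x \<in> {0..t} \<longrightarrow> P x)} \<subseteq> N"
    proof
      fix x assume "x \<in> {x \<in> space lebesgue. \<not> (x \<in> {0..t} \<longrightarrow> P x)}"
      thus "x \<in> N" using N(2)[of x] assms(2) by (cases "x \<in> N") simp_all
    qed
  qed
  thus ?thesis by (subst AE_restrict_space_iff) auto
qed

lemma app_in: "(x, y) \<in> G \<Longrightarrow> (x, app G x) \<in> G"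
  unfolding app_def by (rule someI[of "\<lambda>y. (x, y) \<in> G"])

text \<open>A continuous function that vanishes almost everywhere vanishes on the open interval,
  because nonempty open sets are not negligible; then differentiate the primitive.\<close>

lemma prim_zero_AE:
  fixes d :: "real \<Rightarrow> 'b::banach"
  assumes d: "continuous_on {0..T} d" and z: "AE t in interval T. prim d t = 0" and t: "t \<in> {0<..<T}"
  shows "d t = 0"
proof -
  have pc: "continuous_on {0..T} (prim d)" by (rule prim_continuous[OF L1_continuous[OF d]])
  obtain N where N: "negligible N" "\<And>x. x \<in> {0..T} - N \<Longrightarrow> prim d x = 0" by (rule AE_interval_negligible[OF z]) blast
  let ?S = "{0<..<T} \<inter> prim d -` (- {0})"
  have "open ?S" by (rule continuous_open_preimage[OF continuous_on_subset[OF pc]]) auto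
  moreover have "negligible ?S" by (rule negligible_subset[OF N(1)]) (use N(2) in force)
  ultimately have "?S = {}" using open_not_negligible by blast
  hence zero: "prim d x = 0" if "x \<in> {0<..<T}" for x using that by blast
  have "((\<lambda>u. integral {0..u} d) has_vector_derivative d t) (at t within {0..T})"
    by (rule integral_has_vector_derivative[OF d]) (use t in auto)
  hence "(prim d has_vector_derivative d t) (at t within {0<..<T})"
    unfolding prim_def[abs_def] by (rule has_vector_derivative_within_subset) auto
  hence D: "(prim d has_vector_derivative d t) (at t)" unfolding at_within_open[OF t open_greaterThanLessThan] .
  have "((\<lambda>x. 0) has_vector_derivative d t) (at t)"
    by (rule has_vector_derivative_transform_within_open[OF D open_greaterThanLessThan t]) (simp add: zero)
  moreover have "((\<lambda>x. 0 :: 'b) has_vector_derivative 0) (at t)" by (rule has_vector_derivative_const)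
  ultimately show ?thesis by (rule vector_derivative_unique_at)
qed

lemma scaleC_constants:
  fixes x :: "'e::complex_banach"
  shows "(1 / (2 * pi * \<i>)) *\<^sub>C \<i> *\<^sub>C x = (1 / (2 * pi)) *\<^sub>R x"
    "(1 / (2 * pi * \<i>)\<^sup>2) *\<^sub>C (- ((2 * pi) *\<^sub>R x)) = (1 / (2 * pi)) *\<^sub>R x"
    "(1 / (2 * pi * \<i>)\<^sup>2) *\<^sub>C (- ((4 * pi\<^sup>2) *\<^sub>R x)) = x"
proof -
  have "(1 / (2 * complex_of_real pi * \<i>)) * \<i> = complex_of_real (1 / (2 * pi))" by simp
  thus "(1 / (2 * pi * \<i>)) *\<^sub>C \<i> *\<^sub>C x = (1 / (2 * pi)) *\<^sub>R x"
    by (simp only: scaleC_scaleC scaleC_of_real[symmetric] of_real_mult of_real_numeral)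
  have "(1 / (2 * complex_of_real pi * \<i>)\<^sup>2) * (- complex_of_real (2 * pi)) = complex_of_real (1 / (2 * pi))"
    by (simp add: power2_eq_square)
  thus "(1 / (2 * pi * \<i>)\<^sup>2) *\<^sub>C (- ((2 * pi) *\<^sub>R x)) = (1 / (2 * pi)) *\<^sub>R x"
    by (simp only: scaleC_of_real[symmetric] scaleC.minus_left[symmetric] scaleC_scaleC of_real_mult of_real_numeral)
  have "(1 / (2 * complex_of_real pi * \<i>)\<^sup>2) * (- complex_of_real (4 * pi\<^sup>2)) = 1"
    by (simp add: power2_eq_square)
  thus "(1 / (2 * pi * \<i>)\<^sup>2) *\<^sub>C (- ((4 * pi\<^sup>2) *\<^sub>R x)) = x"
    by (simp only: scaleC_of_real[symmetric] scaleC.minus_left[symmetric] scaleC_scaleC of_real_mult of_real_numeral scaleC_one)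
qed

context cauchy_problem begin

text \<open>\<open>app\<close> chooses some representative of the image, so its values are known
  only almost everywhere.\<close>

lemma app_pointwise_graph:
  assumes R: "bounded_linear R" and h: "h \<in> Lp p T"
  shows "app (pointwise p T (graph R)) h \<in> Lp p T" "AE t in interval T. app (pointwise p T (graph R)) h t = R (h t)"
proof -
  have "(h, \<lambda>t. R (h t)) \<in> pointwise p T (graph R)"
    using Lp_linear[OF p h R] h by (simp add: pointwise_def graph_eqD)
  hence "(h, app (pointwise p T (graph R)) h) \<in> pointwise p T (graph R)" by (rule app_in)
  thus "app (pointwise p T (graph R)) h \<in> Lp p T" "AE t in interval T. app (pointwise p T (graph R)) h t = R (h t)"
    by (simp_all add: pointwise_def graph_eqD)
qed

lemma shift_B_inverse_iff: "(h, f) \<in> (op_shift (B_op p T) z)\<inverse> \<longleftrightarrow> (f, \<lambda>t. h t - z *\<^sub>C f t) \<in> B_op p T"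
proof
  assume "(h, f) \<in> (op_shift (B_op p T) z)\<inverse>"
  then obtain y where y: "h = y + z *\<^sub>C f" "(f, y) \<in> B_op p T" by (auto simp: op_shift_def)
  have "(\<lambda>t. h t - z *\<^sub>C f t) = y" unfolding y(1) by (simp add: plus_fun_def scaleC_fun_def)
  thus "(f, \<lambda>t. h t - z *\<^sub>C f t) \<in> B_op p T" using y(2) by simp
next
  assume a: "(f, \<lambda>t. h t - z *\<^sub>C f t) \<in> B_op p T"
  have "h = (\<lambda>t. h t - z *\<^sub>C f t) + z *\<^sub>C f" by (simp add: plus_fun_def scaleC_fun_def)
  thus "(h, f) \<in> (op_shift (B_op p T) z)\<inverse>" unfolding op_shift_def using a by blast
qed

text \<open>Whatever solution \<open>app\<close> picks, its continuous representative
  \<open>u\<close> satisfies the Volterra equation, and \<open>vol_eqI\<close> identifies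
  it.\<close>

lemma app_shift_B:
  assumes h: "h \<in> Lp p T"
  shows "app ((op_shift (B_op p T) z)\<inverse>) h \<in> Lp p T"
    "AE t in interval T. app ((op_shift (B_op p T) z)\<inverse>) h t = vol z h t"
proof -
  note h1 = Lp_imp_L1[OF p h]
  have diff: "(\<lambda>t. h t - z *\<^sub>C f t) \<in> Lp p T" if "f \<in> Lp p T" for f
  proof -
    have "(\<lambda>t. (- z) *\<^sub>C f t) \<in> Lp p T" by (rule Lp_linear[OF p that scaleC.bounded_linear_right])
    from Lp_add[OF p h this] show ?thesis by (simp add: scaleC.minus_left)
  qed
  have vL: "vol z h \<in> Lp p T" by (rule Lp_continuous[OF p vol_continuous[OF h1]])
  have "AE t in interval T. vol z h t = integral {0..t} (\<lambda>t. h t - z *\<^sub>C vol z h t)"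
    using AE_space by eventually_elim (rule vol_integral[OF h1], simp)
  hence "(h, vol z h) \<in> (op_shift (B_op p T) z)\<inverse>"
    unfolding shift_B_inverse_iff B_op_iff[OF T p] using vL diff[OF vL] by blast
  hence "(h, app ((op_shift (B_op p T) z)\<inverse>) h) \<in> (op_shift (B_op p T) z)\<inverse>" by (rule app_in)
  then obtain f where f: "f = app ((op_shift (B_op p T) z)\<inverse>) h" "f \<in> Lp p T"
    "AE t in interval T. f t = integral {0..t} (\<lambda>t. h t - z *\<^sub>C f t)"
    unfolding shift_B_inverse_iff B_op_iff[OF T p] by blast
  define u where "u = prim (\<lambda>t. h t - z *\<^sub>C f t)"
  have fu: "AE t in interval T. f t = u t" using f(3) by (simp add: u_def prim_def)
  have uc: "continuous_on {0..T} u" unfolding u_def by (rule prim_continuous[OF Lp_imp_L1[OF p diff[OF f(2)]]])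
  have "u t = integral {0..t} (\<lambda>t. h t - z *\<^sub>C u t)" if t: "t \<in> {0..T}" for t
  proof -
    have "u t = prim (\<lambda>t. h t - z *\<^sub>C u t) t"
      unfolding u_def by (rule prim_cong_AE[OF _ t]) (use fu in \<open>eventually_elim, simp add: u_def\<close>)
    thus ?thesis by (simp add: prim_def)
  qed
  from vol_eqI[OF h1 uc this] have "u t = vol z h t" if "t \<in> {0..T}" for t using that by blast
  hence e: "u t = vol z h t" if "0 < t \<and> t < T" for t using that by simp
  have "AE t in interval T. f t = vol z h t" using fu AE_space by eventually_elim (simp add: e)
  thus "app ((op_shift (B_op p T) z)\<inverse>) h \<in> Lp p T"
    "AE t in interval T. app ((op_shift (B_op p T) z)\<inverse>) h t = vol z h t" using f by auto
qed

lemma x_op_AE: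
  assumes z: "z \<in> H" and w: "w \<in> Lp p T"
  shows "AE t in interval T. x_op p T A w z t = R2 z (vol z w t)"
  unfolding x_op_def shift_A_eq_graph[OF z]
  using app_pointwise_graph(2)[OF bounded_complex_linearD(1)[OF R2_bcl[OF z]] app_shift_B(1)[OF w, of z]] app_shift_B(2)[OF w, of z]
  by eventually_elim simp

lemma y_op_AE:
  assumes z: "z \<in> H" and l: "l \<in> H" and h: "h \<in> Lp p T"
  shows "AE t in interval T. y_op p T A h l z t = Rs 1 z (Rs (- 1) l (vol z (vol l h) t))"
proof -
  have e: "(op_shift (op_scale \<i> (op_sqrt A)) (- z))\<inverse> = graph (Rs 1 z)"
    "(op_shift (op_scale (- \<i>) (op_sqrt A)) (- l))\<inverse> = graph (Rs (- 1) l)"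
    using shift_sqrt_eq_graph[OF z, of 1] shift_sqrt_eq_graph[OF l, of "- 1"] by simp_all
  let ?b = "app ((op_shift (B_op p T) l)\<inverse>) h"
  let ?d = "app ((op_shift (B_op p T) z)\<inverse>) ?b"
  let ?e = "app (pointwise p T (graph (Rs (- 1) l))) ?d"
  note b = app_shift_B[OF h, of l]
  note d = app_shift_B[OF b(1), of z]
  note e' = app_pointwise_graph[OF bounded_complex_linearD(1)[OF Rs_bcl[OF l, of "- 1"]] d(1)]
  note f' = app_pointwise_graph[OF bounded_complex_linearD(1)[OF Rs_bcl[OF z, of 1]] e'(1)]
  show ?thesis unfolding y_op_def e
    using f'(2) e'(2) d(2) AE_space
  proof eventually_elim
    case (elim t)
    have "vol z ?b t = vol z (vol l h) t" by (rule vol_cong_AE[OF b(2)]) (use elim(4) in auto)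
    thus ?case using elim by simp
  qed
qed

lemma W0_one_D:
  assumes "w \<in> W0 1 p T A (1/2)"
  obtains v where "v \<in> Lp p T" "w \<in> Lp p T" "AE t in interval T. w t = U (prim v t)"
proof -
  obtain v w0 where v: "v \<in> Lp p T" and w0: "(v, w0) \<in> pointwise p T (graph U)" and w: "(w, w0) \<in> B_op p T"
    using assms by (auto simp: W0_def op_power_neg_half)
  have w0': "AE t in interval T. w0 t = U (v t)" using w0 by (simp add: pointwise_def graph_eqD)
  have w': "w \<in> Lp p T" "AE t in interval T. w t = prim w0 t" using w unfolding B_op_iff[OF T p] by (auto simp: prim_def)
  have "AE t in interval T. w t = U (prim v t)" using w'(2) AE_space
  proof eventually_elim
    case (elim t)
    hence t: "t \<in> {0..T}" by simp
    show ?case unfolding elim(1) prim_cong_AE[OF w0' t]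
      by (rule prim_linear[OF Lp_imp_L1[OF p v] t bounded_complex_linearD(1)[OF U(1)]])
  qed
  thus ?thesis using that v w'(1) by blast
qed

lemma W0_two_D:
  assumes "g \<in> W0 2 p T A (1/2)"
  obtains v where "v \<in> Lp p T" "g \<in> Lp p T" "AE t in interval T. g t = U (prim (prim v) t)"
proof -
  obtain w where w1: "w \<in> W0 1 p T A (1/2)" and g: "(g, w) \<in> B_op p T"
    using assms by (auto simp: W0_def numeral_2_eq_2 relcomp_Image)
  obtain v where v: "v \<in> Lp p T" and w: "AE t in interval T. w t = U (prim v t)" by (rule W0_one_D[OF w1]) blast
  have g': "g \<in> Lp p T" "AE t in interval T. g t = prim w t" using g unfolding B_op_iff[OF T p] by (auto simp: prim_def)
  have "AE t in interval T. g t = U (prim (prim v) t)" using g'(2) AE_space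
  proof eventually_elim
    case (elim t)
    hence t: "t \<in> {0..T}" by simp
    show ?case unfolding elim(1) prim_cong_AE[OF w t]
      by (rule prim_linear[OF L1_continuous[OF prim_continuous[OF Lp_imp_L1[OF p v]]] t bounded_complex_linearD(1)[OF U(1)]])
  qed
  thus ?thesis using that v g'(1) by blast
qed

text \<open>The two descriptions g = A^(-1/2) B^(-2) v and g = A^(-3/2) k are compared, and
  injectivity of \<open>U\<close> cancels one factor: B^(-2) v = A^(-1) k, which is what the decay
  estimate needs.\<close>

lemma domain_D:
  assumes "g \<in> Lp_dom p T A (3/2) \<inter> W0 2 p T A (1/2)"
  obtains v k where "v \<in> Lp p T" "reg v" "g \<in> Lp p T" "k \<in> Lp p T" "AE t in interval T. g t = U (prim (prim v) t)"
    "AE t in interval T. prim (prim v) t = U (U (k t))"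
proof -
  obtain v where v: "v \<in> Lp p T" "g \<in> Lp p T" "AE t in interval T. g t = U (prim (prim v) t)"
    using assms by (auto elim: W0_two_D)
  obtain k where k: "k \<in> Lp p T" "AE t in interval T. g t = U (U (U (k t)))"
    using assms by (auto simp: Lp_dom_def op_power_three_halves pointwise_def graph_eqD)
  have "AE t in interval T. prim (prim v) t = U (U (k t))"
    using v(3) k(2) by eventually_elim (rule U_inj, simp)
  thus ?thesis using that v k(1) Lp_imp_L1[OF p v(1)] by (auto simp: reg_def)
qed

text \<open>For \<phi> = \<open>prim \<phi>'\<close> the hypotheses say \<phi>' = B \<phi> and
  \<psi> = sqrt A \<phi>, so the data are (B + \<sigma> \<i> sqrt A) \<phi>. Passing both images
  instead of \<phi> keeps the computation among functions that are known to be integrable.\<close>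

lemma Rs_vol_first_order:
  assumes l: "l \<in> H" and \<sigma>: "\<sigma> * \<sigma> = 1" and \<phi>': "L1 T \<phi>'" and \<psi>: "L1 T \<psi>"
    and \<phi>: "AE t in interval T. prim \<phi>' t = U (\<psi> t)" and t: "t \<in> {0..T}"
  shows "Rs \<sigma> l (vol l (\<lambda>t. \<phi>' t + (\<sigma> * \<i>) *\<^sub>C \<psi> t) t) = E \<sigma> l (prim \<phi>') t"
proof -
  have v: "vol l (prim \<phi>') t = U (vol l \<psi> t)" using vol_cong_AE[OF \<phi> t] vol_linear[OF \<psi> t U(1)] by simp
  have "vol l (\<lambda>t. \<phi>' t + (\<sigma> * \<i>) *\<^sub>C \<psi> t) t = vol l \<phi>' t + (\<sigma> * \<i>) *\<^sub>C vol l \<psi> t"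
    by (simp add: vol_add[OF \<phi>' L1_scaleC_const[OF \<psi>] t] vol_scaleC[OF \<psi> t])
  also have "vol l \<phi>' t = prim \<phi>' t - l *\<^sub>C U (vol l \<psi> t)"
    unfolding v[symmetric] by (rule vol_deriv[OF \<phi>' _ t]) (simp add: prim_def)
  finally have "vol l (\<lambda>t. \<phi>' t + (\<sigma> * \<i>) *\<^sub>C \<psi> t) t = prim \<phi>' t + ((\<sigma> * \<i>) *\<^sub>C vol l \<psi> t - l *\<^sub>C U (vol l \<psi> t))" by simp
  thus ?thesis by (simp only: bounded_complex_linearD(3)[OF Rs_bcl[OF l]] Rs_left[OF l \<sigma>] E_def v)
qed

text \<open>Factor \<open>B\<^sup>2 + A = (B + \<i>\<surd>A) (B - \<i>\<surd>A)\<close> and use \<open>B - \<i>\<surd>A = (B + l) + (- \<i>\<surd>A - l)\<close>,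
  \<open>B + \<i>\<surd>A = (B + z) + (\<i>\<surd>A - z)\<close>.\<close>

lemma B2_plus_A_inverse:
  assumes v: "v \<in> Lp p T" and g: "AE t in interval T. g t = U (prim (prim v) t)"
    and h: "(g, h) \<in> B2_plus_A p T A"
  shows "h \<in> Lp p T" "z \<in> H \<Longrightarrow> l \<in> H \<Longrightarrow> t \<in> {0..T} \<Longrightarrow>
    Rs 1 z (Rs (- 1) l (vol z (vol l h) t)) = E (- 1) l (E 1 z (\<lambda>t. U (prim (prim v) t))) t"
proof -
  obtain y1 y2 g1 where y: "h = (\<lambda>t. y1 t + y2 t)" and B1: "(g, g1) \<in> B_op p T" and B2: "(g1, y1) \<in> B_op p T"
    and y2: "(g, y2) \<in> pointwise p T A"
    using h by (auto simp: B2_plus_A_def op_plus_def plus_fun_def)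
  have L: "y1 \<in> Lp p T" "y2 \<in> Lp p T" and g1: "AE t in interval T. g1 t = prim y1 t"
    and g2: "AE t in interval T. g t = prim g1 t" and gy2: "AE t in interval T. g t = U (U (y2 t))"
    using B1 B2 y2 unfolding B_op_iff[OF T p] by (auto simp: pointwise_def prim_def A_iff)
  show hL: "h \<in> Lp p T" unfolding y by (rule Lp_add[OF p L])
  note y11 = Lp_imp_L1[OF p L(1)]
  note y21 = Lp_imp_L1[OF p L(2)]
  define q' q where "q' = prim v" and "q = prim q'"
  note v1 = Lp_imp_L1[OF p v]
  note q'1 = L1_continuous[OF prim_continuous[OF v1], folded q'_def]
  note q1 = L1_continuous[OF prim_continuous[OF q'1], folded q_def]
  note Ul = bounded_complex_linearD(1)[OF U(1)]
  note y1c = prim_continuous[OF y11]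
  have Uq'c: "continuous_on {0..T} (\<lambda>t. U (q' t))" unfolding q'_def by (rule U_continuous_on[OF prim_continuous[OF v1]])
  have qy2: "AE t in interval T. q t = U (y2 t)"
    using g gy2 by eventually_elim (rule U_inj, simp add: q_def q'_def)
  \<comment> \<open>Both sides are continuous versions of B g: their primitives agree almost
    everywhere with g. One comes from the graph of B, the other from g = A^(-1/2) B^(-2) v.\<close>
  have py1: "AE t in interval T. prim y1 t = U (q' t)"
  proof -
    have "AE t in interval T. prim (\<lambda>t. prim y1 t + (- U (q' t))) t = 0"
      using g g2 AE_space
    proof eventually_elim
      case (elim t)
      hence t: "t \<in> {0..T}" by simp
      have "prim (prim y1) t = prim g1 t" by (rule prim_cong_AE[OF _ t]) (use g1 in \<open>eventually_elim, simp\<close>)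
      also have "\<dots> = prim (\<lambda>t. U (q' t)) t" using elim(1,2) prim_linear[OF q'1 t Ul] by (simp add: q'_def)
      finally show ?case
        using prim_add[OF L1_continuous[OF y1c] L1_linear[OF L1_continuous[OF Uq'c] bounded_linear_minus[OF bounded_linear_ident]] t]
          prim_linear[OF L1_continuous[OF Uq'c] t bounded_linear_minus[OF bounded_linear_ident]] by simp
    qed
    moreover have "continuous_on {0..T} (\<lambda>t. prim y1 t + (- U (q' t)))" by (intro continuous_on_add continuous_on_minus y1c Uq'c)
    ultimately have "prim y1 t + (- U (q' t)) = 0" if "t \<in> {0<..<T}" for t using prim_zero_AE that by blast
    thus ?thesis using AE_space by (auto intro: eventually_mono)
  qed
  \<comment> \<open>\<phi>' and \<psi> are B \<phi> and sqrt A \<phi> for \<phi> = (B + \<i> sqrt A)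
    g. Here sqrt A B g is q' and A g is y2, so that h = \<phi>' - \<i> \<psi>.\<close>
  define \<phi>' where "\<phi>' t = y1 t + \<i> *\<^sub>C q' t" for t
  define \<psi> where "\<psi> t = q' t + \<i> *\<^sub>C y2 t" for t
  have \<phi>'1: "L1 T \<phi>'" unfolding \<phi>'_def by (intro L1_add y11 L1_scaleC_const q'1)
  have \<psi>1: "L1 T \<psi>" unfolding \<psi>_def by (intro L1_add q'1 L1_scaleC_const y21)
  have p\<phi>': "prim \<phi>' t = prim y1 t + \<i> *\<^sub>C q t" if "t \<in> {0..T}" for t
    unfolding \<phi>'_def prim_add[OF y11 L1_scaleC_const[OF q'1] that] prim_linear[OF q'1 that scaleC.bounded_linear_right] q_def ..
  have \<phi>U: "AE t in interval T. prim \<phi>' t = U (\<psi> t)"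
    using py1 qy2 AE_space by eventually_elim (simp add: p\<phi>' \<psi>_def U_simps)
  have \<phi>2: "AE t in interval T. prim \<phi>' t = U (q' t) + (1 * \<i>) *\<^sub>C q t"
    using py1 AE_space by eventually_elim (simp add: p\<phi>')
  have h_eq: "h = (\<lambda>t. \<phi>' t + (- 1 * \<i>) *\<^sub>C \<psi> t)"
    by (simp add: y \<phi>'_def \<psi>_def fun_eq_iff scaleC.add_right scaleC.minus_left scaleC_scaleC scaleC_one)
  note \<phi>1 = L1_continuous[OF prim_continuous[OF \<phi>'1]]
  assume z: "z \<in> H" and l: "l \<in> H" and t: "t \<in> {0..T}"
  have 1: "Rs (- 1) l (vol l h x) = E (- 1) l (prim \<phi>') x" if "x \<in> {0..T}" for x
    unfolding h_eq by (rule Rs_vol_first_order[OF l _ \<phi>'1 \<psi>1 \<phi>U that]) simp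
  have 2: "Rs 1 z (vol z (prim \<phi>') x) = E 1 z (\<lambda>t. U (prim (prim v) t)) x" if x: "x \<in> {0..T}" for x
  proof -
    have pU: "prim (\<lambda>t. U (q' t)) s = U (q s)" if "s \<in> {0..T}" for s unfolding q_def by (rule prim_linear[OF q'1 that Ul])
    have "AE t in interval T. prim (\<lambda>t. U (q' t)) t = U (q t)" using AE_space by eventually_elim (simp add: pU)
    hence "Rs 1 z (vol z (\<lambda>t. U (q' t) + (1 * \<i>) *\<^sub>C q t) x) = E 1 z (prim (\<lambda>t. U (q' t))) x"
      by (intro Rs_vol_first_order[OF z _ L1_continuous[OF Uq'c] q1 _ x]) simp_all
    also have "\<dots> = E 1 z (\<lambda>t. U (prim (prim v) t)) x" by (rule E_cong[OF x]) (use pU in \<open>simp add: q_def q'_def\<close>)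
    finally show ?thesis unfolding vol_cong_AE[OF \<phi>2 x] .
  qed
  note h1 = Lp_imp_L1[OF p hL]
  note vl1 = L1_continuous[OF vol_continuous[OF h1]]
  note Rl = Rs_bcl[OF l, of "- 1"]
  \<comment> \<open>The operators in z are pulled inside the identity \<open>1\<close> for the
    factor in l, with which they commute, and then meet \<phi> = (B + \<i> sqrt A) g, where identity
    \<open>2\<close> applies.\<close>
  have "Rs (- 1) l (vol z (vol l h) t) = vol z (\<lambda>x. Rs (- 1) l (vol l h x)) t"
    by (rule vol_linear[OF vl1 t Rl, symmetric])
  also have "\<dots> = vol z (\<lambda>x. Rs (- 1) l (prim \<phi>' x) + vol l (prim \<phi>') x) t"
    by (rule vol_cong) (use t in \<open>simp add: 1 E_def\<close>)
  also have "\<dots> = Rs (- 1) l (vol z (prim \<phi>') t) + vol l (vol z (prim \<phi>')) t"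
    by (simp only: vol_add[OF L1_linear[OF \<phi>1 bounded_complex_linearD(1)[OF Rl]] L1_continuous[OF vol_continuous[OF \<phi>1]] t]
        vol_linear[OF \<phi>1 t Rl] vol_commute[OF \<phi>1 t])
  finally have "Rs 1 z (Rs (- 1) l (vol z (vol l h) t)) = Rs (- 1) l (Rs 1 z (vol z (prim \<phi>') t)) + vol l (\<lambda>x. Rs 1 z (vol z (prim \<phi>') x)) t"
    by (simp only: bounded_complex_linearD(3)[OF Rs_bcl[OF z]] Rs_commute[OF z l] vol_linear[OF L1_continuous[OF vol_continuous[OF \<phi>1]] t Rs_bcl[OF z]])
  also have "\<dots> = E (- 1) l (\<lambda>x. Rs 1 z (vol z (prim \<phi>') x)) t" by (simp add: E_def)
  also have "\<dots> = E (- 1) l (E 1 z (\<lambda>t. U (prim (prim v) t))) t" by (rule E_cong[OF t 2])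
  finally show "Rs 1 z (Rs (- 1) l (vol z (vol l h) t)) = E (- 1) l (E 1 z (\<lambda>t. U (prim (prim v) t))) t" .
qed

text \<open>Ensures that \<open>app\<close> in (I) really selects a value of B^2 + A on g and not an
  arbitrary function.\<close>

lemma B2_plus_A_Domain:
  assumes v: "v \<in> Lp p T" and gL: "g \<in> Lp p T" and k: "k \<in> Lp p T" and g: "AE t in interval T. g t = U (prim (prim v) t)"
    and gk: "AE t in interval T. prim (prim v) t = U (U (k t))"
  shows "(g, app (B2_plus_A p T A) g) \<in> B2_plus_A p T A"
proof -
  note Ul = bounded_complex_linearD(1)[OF U(1)]
  note v1 = Lp_imp_L1[OF p v]
  note v2 = L1_continuous[OF prim_continuous[OF v1]]
  have Uv: "(\<lambda>t. U (v t)) \<in> Lp p T" "(\<lambda>t. U (k t)) \<in> Lp p T" by (rule Lp_linear[OF p _ Ul], fact)+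
  have g1L: "(\<lambda>t. U (prim v t)) \<in> Lp p T" by (rule Lp_continuous[OF p U_continuous_on[OF prim_continuous[OF v1]]])
  have "(g, \<lambda>t. U (prim v t)) \<in> B_op p T"
    unfolding B_op_iff[OF T p]
  proof (intro conjI gL g1L)
    show "AE t in interval T. g t = integral {0..t} (\<lambda>t. U (prim v t))"
      using g AE_space
    proof eventually_elim
      case (elim t)
      thus ?case using prim_linear[OF v2 _ Ul, of t] by (simp add: prim_def)
    qed
  qed
  moreover have "(\<lambda>t. U (prim v t), \<lambda>t. U (v t)) \<in> B_op p T"
    unfolding B_op_iff[OF T p]
  proof (intro conjI Uv g1L)
    show "AE t in interval T. U (prim v t) = integral {0..t} (\<lambda>t. U (v t))"
      using AE_space
    proof eventually_elim
      case (elim t)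
      thus ?case using prim_linear[OF v1 _ Ul, of t] by (simp add: prim_def)
    qed
  qed
  moreover have "(g, \<lambda>t. U (k t)) \<in> pointwise p T A"
  proof -
    have "AE t in interval T. (g t, U (k t)) \<in> A" using g gk by eventually_elim (simp add: A_iff)
    thus ?thesis using gL Uv(2) by (simp add: pointwise_def)
  qed
  ultimately have "(g, (\<lambda>t. U (v t)) + (\<lambda>t. U (k t))) \<in> B2_plus_A p T A"
    unfolding B2_plus_A_def op_plus_def by blast
  thus ?thesis by (rule app_in)
qed

text \<open>Up to the factor 1/(2 pi), the solution operator of (II) on w = A^(-1/2) B^(-1) v. For
  data g = A^(-1/2) B^(-2) v it is therefore applied to \<open>prim v\<close>.\<close>

definition S :: "(real \<Rightarrow> 'e) \<Rightarrow> real \<Rightarrow> 'e" where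
  "S v t = integral UNIV (\<lambda>s. xint v s t)"

lemma S_integrand:
  assumes v: "L1 T v"
  obtains C where "\<And>s t. t \<in> {0..T} \<Longrightarrow> norm (xint v s t) \<le> C * kap 1 s"
    "continuous_on (UNIV \<times> {0..T}) (\<lambda>(s, t). xint v s t)"
    "(\<lambda>s. C * kap 1 s) integrable_on UNIV"
    "\<And>t. t \<in> {0..T} \<Longrightarrow> (\<lambda>s. xint v s t) integrable_on UNIV"
proof -
  let ?f = "\<lambda>s t. xint v s t"
  obtain C where C: "C \<ge> 0" "\<And>l t. l \<in> H \<Longrightarrow> - c \<le> Re l \<Longrightarrow> t \<in> {0..T} \<Longrightarrow>
      norm (R2 l (vol l (\<lambda>t. U (prim v t)) t)) \<le> C * (1 + cmod l) powr (- 1 - 1)"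
    using R2_vol_bound[OF v, of c] c by auto
  have b: "norm (?f s t) \<le> C * kap 1 s" if "t \<in> {0..T}" for s t
  proof -
    have "norm (?f s t) \<le> C * (1 + cmod (Complex (- c) s)) powr (- 1 - 1)" by (rule C(2)[OF _ _ that]) (simp_all add: H_def)
    also have "\<dots> \<le> C * kap 1 s"
      using one_plus_cmod_powr_le_kap[of 1 "Complex (- c) s"] by (intro mult_left_mono C) simp
    finally show ?thesis .
  qed
  have k: "(\<lambda>s. C * kap 1 s) integrable_on UNIV" by (rule integrable_on_mult_right[OF kap_integrable]) simp
  have co: "continuous_on (UNIV \<times> {0..T}) (\<lambda>(s, t). ?f s t)"
    by (rule R2_vol_continuous[OF L1_linear[OF L1_continuous[OF prim_continuous[OF v]] bounded_complex_linearD(1)[OF U(1)]] order_refl])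
  have "(\<lambda>s. ?f s t) integrable_on UNIV" if t: "t \<in> {0..T}" for t
    by (rule continuous_dominated_integrable[OF continuous_on_section1[OF co t] b[OF t] k])
  thus ?thesis using that b co k by blast
qed

lemma S_continuous:
  assumes v: "L1 T v" shows "continuous_on {0..T} (S v)"
proof -
  let ?f = "\<lambda>t s. xint v s t"
  obtain C where b: "\<And>s t. t \<in> {0..T} \<Longrightarrow> norm (?f t s) \<le> C * kap 1 s"
    and co: "continuous_on (UNIV \<times> {0..T}) (\<lambda>(s, t). ?f t s)" and k: "(\<lambda>s. C * kap 1 s) integrable_on UNIV"
    by (rule S_integrand[OF v]) blast
  note co' = continuous_on_swap_pair[OF co]
  have "continuous_on {0..T} (\<lambda>t. integral UNIV (?f t))"
    by (rule continuous_on_integral_dominated[OF co'], rule exI[of _ "\<lambda>s. C * kap 1 s"], rule exI[of _ 1]) (use b k in auto)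
  thus ?thesis by (simp add: S_def[abs_def])
qed

text \<open>The solution operator commutes with B^(-1). This is the source of f in W^{1,p}: one of
  the two time derivatives in g makes the integral converge, the other passes through it and becomes
  the derivative of f.\<close>

lemma S_prim:
  assumes v: "L1 T v" and t: "t \<in> {0..T}" shows "S (prim v) t = prim (S v) t"
proof -
  let ?f = "\<lambda>t s. xint v s t"
  let ?g = "\<lambda>t s. xint (prim v) s t"
  note v2 = L1_continuous[OF prim_continuous[OF v]]
  note Ul = bounded_complex_linearD(1)[OF U(1)]
  note u1 = L1_linear[OF v2 Ul]
  obtain C where b: "\<And>s t. t \<in> {0..T} \<Longrightarrow> norm (?f t s) \<le> C * kap 1 s"
    and co: "continuous_on (UNIV \<times> {0..T}) (\<lambda>(s, t). ?f t s)" and k: "(\<lambda>s. C * kap 1 s) integrable_on UNIV"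
    by (rule S_integrand[OF v]) blast
  obtain D where "\<And>s t. t \<in> {0..T} \<Longrightarrow> norm (?g t s) \<le> D * kap 1 s"
    and gi: "(\<lambda>s. ?g t s) integrable_on UNIV"
    by (rule S_integrand[OF v2]) (use t in blast)
  have sub: "x \<in> {0..t} \<Longrightarrow> x \<in> {0..T}" for x using t by auto
  have fg: "integral {0..t} (\<lambda>x. ?f x s) = ?g t s" for s
  proof -
    let ?l = "Complex (- c) s"
    have l: "?l \<in> H" by (simp add: H_def)
    have "prim (\<lambda>x. R2 ?l (vol ?l (\<lambda>t. U (prim v t)) x)) t = R2 ?l (prim (vol ?l (\<lambda>t. U (prim v t))) t)"
      by (rule prim_linear[OF L1_continuous[OF vol_continuous[OF u1]] t bounded_complex_linearD(1)[OF R2_bcl[OF l]]])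
    also have "prim (vol ?l (\<lambda>t. U (prim v t))) t = vol ?l (prim (\<lambda>t. U (prim v t))) t" by (rule prim_vol[OF u1 t])
    also have "\<dots> = vol ?l (\<lambda>t. U (prim (prim v) t)) t" by (rule vol_cong) (rule prim_linear[OF v2 sub Ul])
    finally show ?thesis by (simp add: prim_def)
  qed
  have "integral {0..t} (\<lambda>x. integral UNIV (?f x)) = integral UNIV (\<lambda>s. integral {0..t} (\<lambda>x. ?f x s))"
  proof (rule integral_swap_dominated[OF _ b[OF sub] k])
    show "continuous_on ({0..t} \<times> UNIV) (\<lambda>(t, s). ?f t s)"
      by (rule continuous_on_subset[OF continuous_on_swap_pair[OF co]]) (use sub in auto)
    show "(\<lambda>s. integral {0..t} (\<lambda>x. ?f x s)) integrable_on UNIV" unfolding fg by (rule gi)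
  qed
  thus ?thesis unfolding fg by (simp add: S_def[abs_def] prim_def)
qed

lemma x_line_integral:
  assumes v: "L1 T v" and wL: "w \<in> Lp p T" and w: "AE t in interval T. w t = U (prim v t)"
  obtains J where "Lp_line_integral p T (- c) (x_op p T A w) J" "\<And>t. t \<in> {0..T} \<Longrightarrow> J t = \<i> *\<^sub>C S v t"
proof -
  let ?f = "\<lambda>s t. xint v s t"
  obtain C where b: "\<And>s t. t \<in> {0..T} \<Longrightarrow> norm (?f s t) \<le> C * kap 1 s"
    and co: "continuous_on (UNIV \<times> {0..T}) (\<lambda>(s, t). ?f s t)" and k: "(\<lambda>s. C * kap 1 s) integrable_on UNIV"
    by (rule S_integrand[OF v]) blast
  have H: "Complex (- c) s \<in> H" for s by (simp add: H_def)
  have X: "AE t in interval T. x_op p T A w (Complex (- c) s) t = ?f s t" for s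
    using x_op_AE[OF H wL, of s] AE_space
  proof eventually_elim
    case (elim t)
    hence t: "t \<in> {0..T}" by simp
    show ?case unfolding elim(1) vol_cong_AE[OF w t] ..
  qed
  from Lp_line_integral_continuous[OF T p co b k X] show ?thesis
    by (rule that) (simp_all add: S_def clampT_def)
qed

lemma y_iterated_integral:
  assumes c': "c' > c" and v: "L1 T v" and wL: "w \<in> Lp p T" and w: "AE t in interval T. w t = U (prim v t)"
  obtains J where "Lp_iterated_line_integral p T (- c) (- c') (y_op p T A w) J"
    "\<And>t. t \<in> {0..T} \<Longrightarrow> J t = - ((2 * pi) *\<^sub>R S v t)"
    "\<And>t. t \<in> {0..T} \<Longrightarrow> J t = - integral UNIV (\<lambda>r. integral UNIV (\<lambda>s.
       yint c' w r s t))"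
proof -
  have e: "vol z (vol l w) t = vol z (vol l (\<lambda>t. U (prim v t))) t" if "t \<in> {0..T}" for z l t
    by (rule vol_cong) (use that in \<open>auto intro!: vol_cong_AE[OF w]\<close>)
  have "AE t in interval T. y_op p T A w l z t = Rs 1 z (Rs (- 1) l (vol z (vol l (\<lambda>t. U (prim v t))) t))"
    if "z \<in> H" "l \<in> H" for z l
    using y_op_AE[OF that wL] AE_space by eventually_elim (simp add: e)
  from iterated_II[OF c' v this] obtain J where J: "Lp_iterated_line_integral p T (- c) (- c') (y_op p T A w) J"
    "\<And>t. t \<in> {0..T} \<Longrightarrow> J t = - ((2 * pi) *\<^sub>R S v t)"
    "\<And>t. t \<in> {0..T} \<Longrightarrow> J t = - integral UNIV (\<lambda>r. integral UNIV (\<lambda>s.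
       yint c' (\<lambda>t. U (prim v t)) r s t))"
    unfolding S_def by blast
  show ?thesis by (rule that[OF J(1,2)]) (simp_all add: J(3) e)
qed

lemma part_II:
  assumes c': "c' > c" and w: "w \<in> W0 1 p T A (1/2)"
  shows "\<exists>J1 J2. Lp_line_integral p T (- c) (x_op p T A w) J1 \<and>
    Lp_iterated_line_integral p T (- c) (- c') (y_op p T A w) J2 \<and>
    (AE t in interval T. (1 / (2 * pi * \<i>)) *\<^sub>C J1 t = (1 / (2 * pi * \<i>)\<^sup>2) *\<^sub>C J2 t)"
proof -
  obtain v where v: "v \<in> Lp p T" "w \<in> Lp p T" "AE t in interval T. w t = U (prim v t)" by (rule W0_one_D[OF w])
  note v1 = Lp_imp_L1[OF p v(1)]
  obtain J1 where J1: "Lp_line_integral p T (- c) (x_op p T A w) J1" "\<And>t. t \<in> {0..T} \<Longrightarrow> J1 t = \<i> *\<^sub>C S v t"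
    by (rule x_line_integral[OF v1 v(2,3)]) blast
  obtain J2 where J2: "Lp_iterated_line_integral p T (- c) (- c') (y_op p T A w) J2"
    "\<And>t. t \<in> {0..T} \<Longrightarrow> J2 t = - ((2 * pi) *\<^sub>R S v t)"
    by (rule y_iterated_integral[OF c' v1 v(2,3)]) blast
  have "AE t in interval T. (1 / (2 * pi * \<i>)) *\<^sub>C J1 t = (1 / (2 * pi * \<i>)\<^sup>2) *\<^sub>C J2 t"
    using AE_space
  proof eventually_elim
    case (elim t)
    hence t: "t \<in> {0..T}" by simp
    show ?case unfolding J1(2)[OF t] J2(2)[OF t] scaleC_constants ..
  qed
  thus ?thesis using J1(1) J2(1) by blast
qed

lemma part_I:
  assumes c': "c' > c" and g: "g \<in> Lp_dom p T A (3/2) \<inter> W0 2 p T A (1/2)" and h: "(g, h) \<in> B2_plus_A p T A"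
  obtains J where "Lp_iterated_line_integral p T (- c) (- c') (y_op p T A h) J"
    "AE t in interval T. (1 / (2 * pi * \<i>)\<^sup>2) *\<^sub>C J t = g t"
    "\<And>t. t \<in> {0..T} \<Longrightarrow> J t = - integral UNIV (\<lambda>r. integral UNIV (\<lambda>s.
       yint c' h r s t))"
proof -
  obtain v k where v: "v \<in> Lp p T" "reg v" "AE t in interval T. g t = U (prim (prim v) t)" by (rule domain_D[OF g])
  note B = B2_plus_A_inverse[OF v(1,3) h]
  have "AE t in interval T. y_op p T A h l z t = E (- 1) l (E 1 z (\<lambda>t. U (prim (prim v) t))) t" if "z \<in> H" "l \<in> H" for z l
    using y_op_AE[OF that B(1)] AE_space by eventually_elim (simp add: B(2)[OF that])
  from iterated_I[OF c' v(2) this] obtain J where J: "Lp_iterated_line_integral p T (- c) (- c') (y_op p T A h) J"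
    "\<And>t. t \<in> {0..T} \<Longrightarrow> J t = - ((4 * pi\<^sup>2) *\<^sub>R U (prim (prim v) t))"
    "\<And>t. t \<in> {0..T} \<Longrightarrow> J t = - integral UNIV (\<lambda>r. integral UNIV (\<lambda>s.
       E (- 1) (Complex (- c) s) (E 1 (Complex (- c') r) (\<lambda>t. U (prim (prim v) t))) t))"
    by blast
  have H: "Complex (- c') r \<in> H" "Complex (- c) r \<in> H" for r using c' by (simp_all add: H_def)
  show ?thesis
  proof (rule that[OF J(1)])
    show "AE t in interval T. (1 / (2 * pi * \<i>)\<^sup>2) *\<^sub>C J t = g t"
      using v(3) AE_space
    proof eventually_elim
      case (elim t)
      hence t: "t \<in> {0..T}" by simp
      show ?case unfolding J(2)[OF t] scaleC_constants(3) elim(1) ..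
    qed
    show "J t = - integral UNIV (\<lambda>r. integral UNIV (\<lambda>s.
        yint c' h r s t))" if "t \<in> {0..T}" for t
      unfolding J(3)[OF that] B(2)[OF H that] ..
  qed
qed

lemma solution:
  assumes g: "g \<in> Lp_dom p T A (3/2) \<inter> W0 2 p T A (1/2)"
  shows "\<exists>f \<in> W1p p T.
          given_by_formula c T A g f \<and>
          (\<exists>J. Lp_line_integral p T (- c) (x_op p T A g) J \<and>
               (AE t in interval T. f t = (1 / (2 * pi * \<i>)) *\<^sub>C J t)) \<and>
          (\<forall>c'>c. \<exists>J. Lp_iterated_line_integral p T (- c) (- c') (y_op p T A g) J \<and>
               (AE t in interval T. f t = (1 / (2 * pi * \<i>)\<^sup>2) *\<^sub>C J t)) \<and>
          (\<forall>u \<in> Lp_dom p T A (3/2) \<inter> W0 2 p T A (1/2).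
               (u, g) \<in> B2_plus_A p T A \<longrightarrow> (AE t in interval T. u t = f t))"
proof -
  obtain v k where v: "v \<in> Lp p T" "g \<in> Lp p T" "AE t in interval T. g t = U (prim (prim v) t)" by (rule domain_D[OF g])
  note v1 = Lp_imp_L1[OF p v(1)]
  note v2 = L1_continuous[OF prim_continuous[OF v1]]
  define u where "u t = U (prim (prim v) t)" for t
  have uc: "continuous_on {0..T} u" unfolding u_def by (rule U_continuous_on[OF prim_continuous[OF v2]])
  note u1 = L1_continuous[OF uc]
  have gu: "AE t in interval T. g t = u t" using v(3) by (simp add: u_def)
  \<comment> \<open>g is A^(-1/2) B^(-1) applied to \<open>prim v\<close>, hence the argument of
    \<open>S\<close>.\<close>
  define f where "f t = (1 / (2 * pi)) *\<^sub>R S (prim v) t" for t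
  have W: "f \<in> W1p p T"
  proof -
    have fc: "continuous_on {0..T} f" unfolding f_def by (intro continuous_on_scaleR continuous_on_const S_continuous v2)
    have f'c: "continuous_on {0..T} (\<lambda>t. (1 / (2 * pi)) *\<^sub>R S v t)"
      by (intro continuous_on_scaleR continuous_on_const S_continuous v1)
    have "f t = integral {0..t} (\<lambda>t. (1 / (2 * pi)) *\<^sub>R S v t)" if "t \<in> {0..T}" for t
      by (simp add: f_def S_prim[OF v1 that] prim_def)
    hence "AE t in interval T. f t = integral {0..t} (\<lambda>t. (1 / (2 * pi)) *\<^sub>R S v t)"
      using AE_space by (auto intro: eventually_mono)
    hence "has_weak_derivative T f (\<lambda>t. (1 / (2 * pi)) *\<^sub>R S v t)"
      by (rule has_weak_derivative_integral[OF T L1_continuous[OF f'c]])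
    thus ?thesis using Lp_continuous[OF p fc] Lp_continuous[OF p f'c] by (auto simp: W1p_def)
  qed
  have F: "given_by_formula c T A g f"
    unfolding given_by_formula_def
  proof
    fix t assume t: "t \<in> {0..T}"
    define H' where "H' z = R2 z (vol z u t)" for z
    have "has_bochner (lebesgue_on {0..t}) (\<lambda>x. resolvent A (z\<^sup>2) (exp (z * complex_of_real (x - t)) *\<^sub>C g x)) (H' z)"
      if "Re z = - c" for z
    proof -
      have z: "z \<in> H" using that by (simp add: H_def)
      note R = bounded_complex_linearD(1)[OF R2_bcl[OF z]]
      let ?e = "\<lambda>x. exp (z * complex_of_real (x - t)) *\<^sub>C u x"
      have ec: "continuous_on {0..t} ?e"
        by (intro continuous_intros continuous_on_subset[OF uc]) (use t in auto)
      have Rc: "continuous_on {0..t} (\<lambda>x. R2 z (?e x))" by (rule bounded_linear.continuous_on[OF R ec])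
      have "has_bochner (lebesgue_on {0..t}) (\<lambda>x. R2 z (exp (z * complex_of_real (x - t)) *\<^sub>C g x)) (integral {0..t} (\<lambda>x. R2 z (?e x)))"
      proof (rule has_bochner_strong_AE[OF _ strongly_measurable_continuous_on[OF _ Rc]])
        show "integrable (lebesgue_on {0..t}) (\<lambda>x. norm (R2 z (?e x)))"
          by (rule continuous_imp_integrable_real) (intro continuous_on_norm Rc)
        show "AE x in lebesgue_on {0..t}. R2 z (exp (z * complex_of_real (x - t)) *\<^sub>C g x) = R2 z (?e x)"
          using AE_interval_Icc[OF gu t] by eventually_elim simp
      qed simp_all
      also have "integral {0..t} (\<lambda>x. R2 z (?e x)) = H' z"
        using integral_linear[OF integrable_continuous_real[OF ec] R] by (simp add: H'_def vol_def o_def)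
      finally show ?thesis .
    qed
    moreover obtain C where b: "\<And>s t. t \<in> {0..T} \<Longrightarrow> norm (xint (prim v) s t) \<le> C * kap 1 s"
      and co: "continuous_on (UNIV \<times> {0..T}) (\<lambda>(s, t). xint (prim v) s t)"
      and k: "(\<lambda>s. C * kap 1 s) integrable_on UNIV"
      by (rule S_integrand[OF v2]) blast
    have "has_line_integral UNIV norm (- c) H' (\<i> *\<^sub>C integral UNIV (\<lambda>s. H' (Complex (- c) s)))"
    proof (rule has_line_integral_pointwise[OF _ k])
      show "continuous_on UNIV (\<lambda>s. H' (Complex (- c) s))" using continuous_on_section1[OF co t] by (simp add: H'_def u_def[abs_def])
      show "norm (H' (Complex (- c) s)) \<le> C * kap 1 s" for s using b[OF t] by (simp add: H'_def u_def[abs_def])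
    qed
    moreover have "f t = (1 / (2 * pi * \<i>)) *\<^sub>C \<i> *\<^sub>C integral UNIV (\<lambda>s. H' (Complex (- c) s))"
      unfolding scaleC_constants(1) f_def S_def H'_def u_def[abs_def] ..
    ultimately show "\<exists>H J. (\<forall>z. Re z = - c \<longrightarrow> has_bochner (lebesgue_on {0..t})
         (\<lambda>x. resolvent A (z\<^sup>2) (exp (z * complex_of_real (x - t)) *\<^sub>C g x)) (H z)) \<and>
        has_line_integral UNIV norm (- c) H J \<and> f t = (1 / (2 * pi * \<i>)) *\<^sub>C J"
      by blast
  qed
  obtain J1 where J1: "Lp_line_integral p T (- c) (x_op p T A g) J1" "\<And>t. t \<in> {0..T} \<Longrightarrow> J1 t = \<i> *\<^sub>C S (prim v) t"
    by (rule x_line_integral[OF v2 v(2,3)]) blast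
  have fJ1: "AE t in interval T. f t = (1 / (2 * pi * \<i>)) *\<^sub>C J1 t"
    using AE_space
  proof eventually_elim
    case (elim t)
    hence t: "t \<in> {0..T}" by simp
    show ?case unfolding J1(2)[OF t] scaleC_constants f_def ..
  qed
  have Y: "\<exists>J. Lp_iterated_line_integral p T (- c) (- c') (y_op p T A g) J \<and>
      (AE t in interval T. f t = (1 / (2 * pi * \<i>)\<^sup>2) *\<^sub>C J t) \<and>
      (\<forall>t\<in>{0..T}. J t = - integral UNIV (\<lambda>r. integral UNIV (\<lambda>s.
        yint c' g r s t)))" if c': "c' > c" for c'
  proof -
    obtain J where J: "Lp_iterated_line_integral p T (- c) (- c') (y_op p T A g) J"
      "\<And>t. t \<in> {0..T} \<Longrightarrow> J t = - ((2 * pi) *\<^sub>R S (prim v) t)"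
      "\<And>t. t \<in> {0..T} \<Longrightarrow> J t = - integral UNIV (\<lambda>r. integral UNIV (\<lambda>s.
        yint c' g r s t))"
      by (rule y_iterated_integral[OF c' v2 v(2,3)]) blast
    have "AE t in interval T. f t = (1 / (2 * pi * \<i>)\<^sup>2) *\<^sub>C J t"
      using AE_space
    proof eventually_elim
      case (elim t)
      hence t: "t \<in> {0..T}" by simp
      show ?case unfolding J(2)[OF t] scaleC_constants f_def ..
    qed
    thus ?thesis using J(1,3) by blast
  qed
  \<comment> \<open>The constant c + 1 is one admissible c'. By (I) the function u, and by (II) the
    function f, is almost everywhere the same multiple of an iterated integral of
    \<open>yint\<close> for the data g; since both integrals are known at every t, they
    coincide.\<close>
  have uniq: "AE t in interval T. u t = f t" if u: "u \<in> Lp_dom p T A (3/2) \<inter> W0 2 p T A (1/2)" "(u, g) \<in> B2_plus_A p T A" for u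
  proof -
    have c': "c + 1 > c" by simp
    obtain J where J: "AE t in interval T. (1 / (2 * pi * \<i>)\<^sup>2) *\<^sub>C J t = u t"
      "\<And>t. t \<in> {0..T} \<Longrightarrow> J t = - integral UNIV (\<lambda>r. integral UNIV (\<lambda>s.
        yint (c + 1) g r s t))"
      by (rule part_I[OF c' u]) blast
    obtain J' where J': "AE t in interval T. f t = (1 / (2 * pi * \<i>)\<^sup>2) *\<^sub>C J' t"
      "\<And>t. t \<in> {0..T} \<Longrightarrow> J' t = - integral UNIV (\<lambda>r. integral UNIV (\<lambda>s.
        yint (c + 1) g r s t))"
      using Y[OF c'] by blast
    show ?thesis using J(1) J'(1) AE_space
    proof eventually_elim
      case (elim t)
      hence t: "t \<in> {0..T}" by simp
      show ?case using elim(1,2) unfolding J(2)[OF t] J'(2)[OF t] by simp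
    qed
  qed
  show ?thesis
    by (rule bexI[OF _ W]) (use F J1(1) fJ1 Y uniq in blast)
qed

end

theorem theorem4p1:
  fixes A :: "('e::complex_banach \<times> 'e) set" and c p T :: real
  assumes "c > 0" and "A \<in> class_Q (c\<^sup>2)" and "1 < p" and "T > 0"
  shows
    "(\<forall>g \<in> Lp_dom p T A (3/2) \<inter> W0 2 p T A (1/2).
        \<exists>f \<in> W1p p T.
          given_by_formula c T A g f \<and>
          (\<exists>J. Lp_line_integral p T (- c) (x_op p T A g) J \<and>
               (AE t in interval T. f t = (1 / (2 * pi * \<i>)) *\<^sub>C J t)) \<and>
          (\<forall>c'>c. \<exists>J. Lp_iterated_line_integral p T (- c) (- c') (y_op p T A g) J \<and>
               (AE t in interval T. f t = (1 / (2 * pi * \<i>)\<^sup>2) *\<^sub>C J t)) \<and>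
          (\<forall>u \<in> Lp_dom p T A (3/2) \<inter> W0 2 p T A (1/2).
               (u, g) \<in> B2_plus_A p T A \<longrightarrow> (AE t in interval T. u t = f t)))
     \<and>
     (\<forall>c'>c.
        (\<forall>g \<in> Lp_dom p T A (3/2) \<inter> W0 2 p T A (1/2).
           \<exists>J. Lp_iterated_line_integral p T (- c) (- c') (y_op p T A (app (B2_plus_A p T A) g)) J \<and>
               (AE t in interval T. (1 / (2 * pi * \<i>)\<^sup>2) *\<^sub>C J t = g t)) \<and>
        (\<forall>w \<in> W0 1 p T A (1/2).
           \<exists>J1 J2. Lp_line_integral p T (- c) (x_op p T A w) J1 \<and>
               Lp_iterated_line_integral p T (- c) (- c') (y_op p T A w) J2 \<and>
               (AE t in interval T.
                  (1 / (2 * pi * \<i>)) *\<^sub>C J1 t = (1 / (2 * pi * \<i>)\<^sup>2) *\<^sub>C J2 t)))"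
proof -
  interpret cauchy_problem A c p T by unfold_locales (use assms in auto)
  have I: "\<exists>J. Lp_iterated_line_integral p T (- c) (- c') (y_op p T A (app (B2_plus_A p T A) g)) J \<and>
      (AE t in interval T. (1 / (2 * pi * \<i>)\<^sup>2) *\<^sub>C J t = g t)"
    if c': "c' > c" and g: "g \<in> Lp_dom p T A (3/2) \<inter> W0 2 p T A (1/2)" for c' g
  proof -
    obtain v k where v: "v \<in> Lp p T" "g \<in> Lp p T" "k \<in> Lp p T" "AE t in interval T. g t = U (prim (prim v) t)"
      "AE t in interval T. prim (prim v) t = U (U (k t))"
      by (rule domain_D[OF g])
    show ?thesis using part_I[OF c' g B2_plus_A_Domain[OF v]] by blast
  qed
  show ?thesis
  proof (intro conjI allI impI ballI)
    fix c' assume c': "c' > c"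
    fix w assume "w \<in> W0 1 p T A (1/2)"
    from part_II[OF c' this] show "\<exists>J1 J2. Lp_line_integral p T (- c) (x_op p T A w) J1 \<and>
        Lp_iterated_line_integral p T (- c) (- c') (y_op p T A w) J2 \<and>
        (AE t in interval T. (1 / (2 * pi * \<i>)) *\<^sub>C J1 t = (1 / (2 * pi * \<i>)\<^sup>2) *\<^sub>C J2 t)" .
  qed (erule solution, erule (1) I)
qed

end
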